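(* Let $(\varepsilon_t)_{t\in\mathbb{Z}}$ be i.i.d. copies of a random variable $\varepsilon$, $Y$ measurable and $X_t=Y(\varepsilon_t,\varepsilon_{t-1},\dots)$. Fix $\tau\in(0,1)$, $p>1$, and let $l_n=(\log n)^p$, $m_n=\lfloor n/2\rfloor$, $\tilde X_t=\mathbb{E}(X_t\mid\varepsilon_t,\varepsilon_{t-1},\dots,\varepsilon_{t-l_n+1})$ and $F_{\tilde X}(x)=\mathbb{P}(\tilde X_0\le x)$. Suppose: (B) $F_X$ is Lipschitz continuous in a neighborhood of $\xi_0(\tau)$ and has a positive and continuous Lebesgue density at $\xi_0(\tau)$; (D) there is $n^*$ such that for all $n>n^*$, $F_{\tilde X}$ is Lipschitz continuous in a neighborhood of $\xi_0(\tau)$, and $\mathbb{E}|X_n-X_n'|=O(\varrho^n)$ for some $\varrho\in(0,1)$. Suppose $w$ is even and Lipschitz continuous with support $[-1,1]$, $w(0)=1$, $\lim_{x\to0}(1-w(x))/|x|^3<\infty$, and $B_n\to\infty$, $B_n=o(n^{1/4})$, $n=o(B_n^7)$. Let $\tilde\xi_n(\tau)$ be the $\tau$-th sample quantile computed from $X_1,\dots,X_{m_n-l_n}$ (a minimizer of $\sum_{t=1}^{m_n-l_n}\rho_\tau(X_t-x)$), and $$\tilde g_{n,\tau}(\lambda)=\frac{1}{2\pi m_n}\sum_{|j|<m_n}w(j/B_n)\cos(j\lambda)\sum_{t=|j|+m_n+1}^nV_t(\tau,\tilde\xi_n(\tau))V_{t-|j|}(\tau,\tilde\xi_n(\tau)).$$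 Then $$\sqrt{m_n/B_n}\,(\tilde g_{n,\tau}(\lambda)-g_\tau(\lambda))\rightsquigarrow N(0,\sigma^2(\lambda)),$$ where $\sigma^2(\lambda)=(1+h(2\lambda))g_\tau(\lambda)^2\int_{-1}^1w(x)^2dx$ and $h(\lambda)=1$ if $\lambda=2\pi k$ for some $k\in\mathbb{Z}$ and $h(\lambda)=0$ otherwise.
   Context: $(\varepsilon_t^* )$ is an independent i.i.d. copy of $(\varepsilon_t)$ and $X_t'=Y(\varepsilon_t,\dots,\varepsilon_1,\varepsilon_0^*,\varepsilon_{-1}^*,\dots)$. $F_X(x)=\mathbb{P}(X_0\le x)$, $\xi_0(\tau)=\inf\{x:F_X(x)\ge\tau\}$. $\rho_\tau(x)=x(\tau-1\{x<0\})$. $V_t(\tau,\xi)=\tau-1\{X_t<\xi\}$, $V_t(\tau)=V_t(\tau,\xi_0(\tau))$, $r_\tau(j)=\mathbb{E}V_0(\tau)V_j(\tau)$, $g_\tau(\lambda)=\frac{1}{2\pi}\sum_{j\in\mathbb{Z}}r_\tau(j)\cos(j\lambda)$. $\rightsquigarrow$ denotes convergence in distribution as $n\to\infty$. *)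

theory Defs
  imports "HOL-Probability.Probability" "HOL-Library.Landau_Symbols"
begin

definition Xproc :: "(int \<Rightarrow> 'a \<Rightarrow> 'e) \<Rightarrow> ((nat \<Rightarrow> 'e) \<Rightarrow> real) \<Rightarrow> int \<Rightarrow> 'a \<Rightarrow> real" where
  "Xproc eps Y t = (\<lambda>\<omega>. Y (\<lambda>k::nat. eps (t - int k) \<omega>))"

definition rho :: "real \<Rightarrow> real \<Rightarrow> real" where
  "rho \<tau> x = x * (\<tau> - (if x < 0 then 1 else 0))"

definition Vt :: "(int \<Rightarrow> 'a \<Rightarrow> real) \<Rightarrow> real \<Rightarrow> int \<Rightarrow> real \<Rightarrow> 'a \<Rightarrow> real" where
  "Vt X \<tau> t \<xi> \<omega> = \<tau> - (if X t \<omega> < \<xi> then 1 else 0)"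

definition cdfX :: "'a measure \<Rightarrow> ('a \<Rightarrow> real) \<Rightarrow> real \<Rightarrow> real" where
  "cdfX M Z x = measure M {\<omega> \<in> space M. Z \<omega> \<le> x}"

definition quant0 :: "'a measure \<Rightarrow> ('a \<Rightarrow> real) \<Rightarrow> real \<Rightarrow> real" where
  "quant0 M Z \<tau> = Inf {x. cdfX M Z x \<ge> \<tau>}"

definition rtau :: "'a measure \<Rightarrow> (int \<Rightarrow> 'a \<Rightarrow> real) \<Rightarrow> real \<Rightarrow> int \<Rightarrow> real" where
  "rtau M X \<tau> j = (\<integral>\<omega>. Vt X \<tau> 0 (quant0 M (X 0) \<tau>) \<omega> * Vt X \<tau> j (quant0 M (X 0) \<tau>) \<omega> \<partial>M)"

definition gtau :: "'a measure \<Rightarrow> (int \<Rightarrow> 'a \<Rightarrow> real) \<Rightarrow> real \<Rightarrow> real \<Rightarrow> real" where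
  "gtau M X \<tau> lam = 1 / (2 * pi) * infsum (\<lambda>j::int. rtau M X \<tau> j * cos (real_of_int j * lam)) UNIV"

text \<open>Coupling distance E|X_n - X_n'| where X_n' = Y(eps_n,...,eps_1,eps*_0,eps*_{-1},...),
  expressed through the law D of eps_0: u k plays eps_(n-k), v k plays eps*_(n-k).\<close>
definition coupling_dist :: "'e measure \<Rightarrow> ((nat \<Rightarrow> 'e) \<Rightarrow> real) \<Rightarrow> nat \<Rightarrow> real" where
  "coupling_dist D Y n =
     (\<integral>uv. \<bar>Y (fst uv) - Y (\<lambda>k. if k < n then fst uv k else snd uv k)\<bar>
        \<partial>(PiM UNIV (\<lambda>_::nat. D) \<Otimes>\<^sub>M PiM UNIV (\<lambda>_::nat. D)))"

definition ln_len :: "real \<Rightarrow> nat \<Rightarrow> nat" where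
  "ln_len p n = nat \<lfloor>(ln (real n)) powr p\<rfloor>"

definition mn :: "nat \<Rightarrow> nat" where
  "mn n = n div 2"

definition gen_sigma :: "'a measure \<Rightarrow> 'e measure \<Rightarrow> (int \<Rightarrow> 'a \<Rightarrow> 'e) \<Rightarrow> int set \<Rightarrow> 'a measure" where
  "gen_sigma M E eps S = sigma (space M) {eps s -` A \<inter> space M | s A. s \<in> S \<and> A \<in> sets E}"

definition Xtilde :: "'a measure \<Rightarrow> 'e measure \<Rightarrow> (int \<Rightarrow> 'a \<Rightarrow> 'e) \<Rightarrow> (int \<Rightarrow> 'a \<Rightarrow> real) \<Rightarrow> nat \<Rightarrow> int \<Rightarrow> 'a \<Rightarrow> real" where
  "Xtilde M E eps X l t = real_cond_exp M (gen_sigma M E eps {t - int l + 1 .. t}) (X t)"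

definition gtilde :: "(int \<Rightarrow> 'a \<Rightarrow> real) \<Rightarrow> real \<Rightarrow> (real \<Rightarrow> real) \<Rightarrow> (nat \<Rightarrow> real)
    \<Rightarrow> (nat \<Rightarrow> 'a \<Rightarrow> real) \<Rightarrow> nat \<Rightarrow> real \<Rightarrow> 'a \<Rightarrow> real" where
  "gtilde X \<tau> w B xi n lam \<omega> =
     (let m = int (mn n) in
      1 / (2 * pi * real (mn n)) *
      (\<Sum>j\<in>{-(m - 1) .. m - 1}. w (real_of_int j / B n) * cos (real_of_int j * lam) *
         (\<Sum>t\<in>{\<bar>j\<bar> + m + 1 .. int n}.
             Vt X \<tau> t (xi n \<omega>) \<omega> * Vt X \<tau> (t - \<bar>j\<bar>) (xi n \<omega>) \<omega>)))"

definition hfun :: "real \<Rightarrow> real" where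
  "hfun lam = (if \<exists>k::int. lam = 2 * pi * real_of_int k then 1 else 0)"

definition normal_measure :: "real \<Rightarrow> real \<Rightarrow> real measure" where
  "normal_measure \<mu> s2 =
     (if s2 = 0 then return borel \<mu> else density lborel (normal_density \<mu> (sqrt s2)))"

end

(*
  Replacing the innovations older than l by one fixed, well chosen continuation gives an
  l-dependent copy of X whose indicator processes differ from the original ones only with
  geometrically small probability; with l a tiny power of n this error is negligible throughout.

  The plug-in quantile is removed uniformly: the sample quantile is within n^(-9/20) of the true one
  with high probability, and on a grid of mesh n^(-13/20) the quadratic form in the indicators moves
  by o(sqrt(m B)), by second moment bounds for the bilinear form and monotonicity of the indicators
  between grid points.

  At the true quantile, products with lag below 2l have variance O(m l^3) and contribute only the mean,
  whose bias is controlled by the cubic flatness of w at 0 and n = o(B^7).  The sum over the remaining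
  lags is cut into independent blocks of length n^(3/8), separated by gaps of order B; its
  characteristic function factorizes, and a third order expansion with a fourth moment
  bound gives the normal limit.  Riemann sums of w^2 and of w^2 cos(2 j lam) yield the
  variance, and the second kind survives only if sin lam = 0, which is the factor 1 + h(2 lam).
*)

theory Submission
  imports Defs "HOL-Real_Asymp.Real_Asymp"
begin

section \<open>Bounded functions of independent sigma-algebras\<close>

text \<open>The obstacle is that indicators are discontinuous in the quantile argument, so nothing
  can be expanded in \<open>xi\<close>. Two facts replace an expansion. An increment of an indicator
  takes values in -1, 0, 1, so its variance is at most its L1 norm, which is of the order of the
  change of argument. And near the true quantile both factors of a product have small mean, so
  outside the small lags a shift of the argument changes the mean of the quadratic form only to
  second order. The cutoff \<open>2 l\<close> for the lags is what makes covariances of products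
  factor: for nearby times the current pair and the lagged pair use disjoint innovations, for
  distant times a centred factor stands alone. Hence the large lags have variance of order
  \<open>m B\<close>, up to powers of \<open>l\<close>, and not \<open>m B^2\<close>. The truncation
  length serves two opposing ends: \<open>\<theta> ^ lag n\<close> has to beat every power of
  \<open>n\<close>, while powers of \<open>lag n\<close> must disappear in the margins between other
  exponents; a tiny power of \<open>n\<close> does both. All blocks share one exact variance, which
  is evaluated by dominated convergence of double sums over the integers.\<close>

locale indep_fields = prob_space M for M :: "'a measure" +
  fixes F :: "int set \<Rightarrow> 'a measure"
  assumes space_F: "space (F S) = space M"
    and sets_F: "sets (F S) \<subseteq> sets M"
    and mono_F: "S \<subseteq> T \<Longrightarrow> sets (F S) \<subseteq> sets (F T)"
    and indep_F: "S \<inter> T = {} \<Longrightarrow> indep_set (sets (F S)) (sets (F T))"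
begin

text \<open>\<open>F S\<close> stands for what the innovations with index in \<open>S\<close>
  determine. Boundedness belongs to the predicate so that integrability of products and powers of
  any order reduces to closure rules followed by \<open>bm_integrable\<close>, usually with
  \<open>S = UNIV\<close>.\<close>

definition bm :: "int set \<Rightarrow> ('a \<Rightarrow> 'b::real_normed_vector) \<Rightarrow> bool" where
  "bm S f \<longleftrightarrow> f \<in> borel_measurable (F S) \<and> (\<exists>K. \<forall>\<omega>\<in>space M. norm (f \<omega>) \<le> K)"

lemma measurable_F_M: "f \<in> borel_measurable (F S) \<Longrightarrow> f \<in> borel_measurable M"
  by (rule measurable_mono[THEN subsetD, rotated -1, of f "F S" borel])
     (use sets_F space_F in auto)

lemma bmI: "f \<in> borel_measurable (F S) \<Longrightarrow> (\<And>\<omega>. \<omega> \<in> space M \<Longrightarrow> norm (f \<omega>) \<le> K) \<Longrightarrow> bm S f"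
  by (auto simp: bm_def)

lemma bm_mono: "bm S f \<Longrightarrow> S \<subseteq> T \<Longrightarrow> bm T f"
  using measurable_mono[of borel borel "F S" "F T"] mono_F[of S T] space_F
  by (auto simp: bm_def)

lemma bm_measurable: "bm S f \<Longrightarrow> f \<in> borel_measurable M"
  by (auto simp: bm_def measurable_F_M)

lemma bm_integrable:
  fixes f :: "'a \<Rightarrow> 'b::{banach, second_countable_topology}"
  assumes "bm S f" shows "integrable M f"
proof -
  obtain K where "\<And>\<omega>. \<omega> \<in> space M \<Longrightarrow> norm (f \<omega>) \<le> K" using assms by (auto simp: bm_def)
  then show ?thesis
    by (intro integrable_const_bound[of _ K] bm_measurable[OF assms]) auto
qed

lemma bm_const: "bm S (\<lambda>_. c)"
  by (auto simp: bm_def)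

lemma bm_add:
  fixes f g :: "'a \<Rightarrow> 'b::{real_normed_vector, second_countable_topology}"
  assumes "bm S f" "bm S g" shows "bm S (\<lambda>\<omega>. f \<omega> + g \<omega>)"
proof -
  obtain K L where KL: "\<And>\<omega>. \<omega> \<in> space M \<Longrightarrow> norm (f \<omega>) \<le> K" "\<And>\<omega>. \<omega> \<in> space M \<Longrightarrow> norm (g \<omega>) \<le> L"
    using assms by (auto simp: bm_def)
  show ?thesis
  proof (rule bmI[of _ _ "K + L"])
    show "(\<lambda>\<omega>. f \<omega> + g \<omega>) \<in> borel_measurable (F S)"
      using assms by (intro borel_measurable_add) (auto simp: bm_def)
    show "norm (f \<omega> + g \<omega>) \<le> K + L" if "\<omega> \<in> space M" for \<omega>
      using norm_triangle_ineq[of "f \<omega>" "g \<omega>"] KL[OF that] by linarith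
  qed
qed

lemma bm_mult:
  fixes f g :: "'a \<Rightarrow> 'b::{real_normed_algebra, second_countable_topology}"
  assumes "bm S f" "bm S g" shows "bm S (\<lambda>\<omega>. f \<omega> * g \<omega>)"
proof -
  obtain K L where KL: "\<And>\<omega>. \<omega> \<in> space M \<Longrightarrow> norm (f \<omega>) \<le> K" "\<And>\<omega>. \<omega> \<in> space M \<Longrightarrow> norm (g \<omega>) \<le> L"
    using assms by (auto simp: bm_def)
  have "norm (f \<omega> * g \<omega>) \<le> K * L" if "\<omega> \<in> space M" for \<omega>
    using order_trans[OF norm_mult_ineq[of "f \<omega>" "g \<omega>"] mult_mono[OF KL(1)[OF that] KL(2)[OF that]]]
      order_trans[OF norm_ge_zero KL(1)[OF that]] by simp
  moreover have "(\<lambda>\<omega>. f \<omega> * g \<omega>) \<in> borel_measurable (F S)"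
    using assms by (intro borel_measurable_times) (auto simp: bm_def)
  ultimately show ?thesis by (intro bmI[of _ _ "K * L"])
qed

lemma bm_cmult:
  fixes f :: "'a \<Rightarrow> real" shows "bm S f \<Longrightarrow> bm S (\<lambda>\<omega>. c * f \<omega>)"
  by (intro bm_mult bm_const)

lemma bm_diff:
  fixes f g :: "'a \<Rightarrow> real" assumes "bm S f" "bm S g" shows "bm S (\<lambda>\<omega>. f \<omega> - g \<omega>)"
  using bm_add[OF assms(1) bm_cmult[OF assms(2), of "-1"]] by simp

lemma bm_sum:
  fixes f :: "'i \<Rightarrow> 'a \<Rightarrow> real"
  assumes "\<And>i. i \<in> I \<Longrightarrow> bm S (f i)" shows "bm S (\<lambda>\<omega>. \<Sum>i\<in>I. f i \<omega>)"
  using assms by (induction I rule: infinite_finite_induct) (auto intro: bm_const bm_add)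

lemma bm_power:
  fixes f :: "'a \<Rightarrow> real" assumes "bm S f" shows "bm S (\<lambda>\<omega>. f \<omega> ^ k)"
  using assms by (induction k) (auto intro: bm_const bm_mult)

lemma bm_abs:
  fixes f :: "'a \<Rightarrow> real" assumes "bm S f" shows "bm S (\<lambda>\<omega>. \<bar>f \<omega>\<bar>)"
  using assms borel_measurable_abs[of f "F S"] by (simp add: bm_def)

text \<open>The sigma-algebras generated by \<open>f\<close> and \<open>g\<close> lie inside
  \<open>F S\<close> and \<open>F T\<close>, so independence passes from sets to functions. From
  here on independence is a matter of comparing index sets.\<close>

lemma bm_indep:
  fixes f g :: "'a \<Rightarrow> 'b::{real_normed_field, banach, second_countable_topology}"
  assumes f: "bm S f" and g: "bm T g" and d: "S \<inter> T = {}"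
  shows "expectation (\<lambda>\<omega>. f \<omega> * g \<omega>) = expectation f * expectation g"
proof -
  have *: "sigma_sets (space M) {h -` A \<inter> space M |A. A \<in> sets borel} \<subseteq> sets (F R)"
    if "h \<in> borel_measurable (F R)" for R and h :: "'a \<Rightarrow> 'b"
  proof -
    have "{h -` A \<inter> space M |A. A \<in> sets borel} \<subseteq> sets (F R)"
    proof (rule subsetI, elim CollectE exE conjE)
      fix x A assume "x = h -` A \<inter> space M" "A \<in> sets borel"
      then show "x \<in> sets (F R)" using measurable_sets[OF that, of A] by (simp add: space_F)
    qed
    from sets.sigma_sets_subset[OF this] show ?thesis by (simp add: space_F)
  qed
  have "indep_var borel f borel g"
    unfolding indep_var_eq
  proof (intro conjI bm_measurable[OF f] bm_measurable[OF g])
    have "f \<in> borel_measurable (F S)" "g \<in> borel_measurable (F T)" using f g by (auto simp: bm_def)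
    from *[OF this(1)] *[OF this(2)]
    show "indep_set (sigma_sets (space M) {f -` A \<inter> space M |A. A \<in> sets borel})
        (sigma_sets (space M) {g -` A \<inter> space M |A. A \<in> sets borel})"
      using indep_F[OF d] unfolding indep_set_def by (rule_tac indep_sets_mono_sets) (auto split: bool.splits)
  qed
  then show ?thesis
    by (intro indep_var_lebesgue_integral bm_integrable[OF f] bm_integrable[OF g])
qed

text \<open>After expanding the square, each \<open>t\<close> keeps at most \<open>2 G\<close>
  partners, and each remaining expectation is at most \<open>K\<close> because a product is bounded
  by the mean of the two squares.\<close>

lemma orth_sum_second_moment:
  fixes y :: "int \<Rightarrow> 'a \<Rightarrow> real" and G :: int and K :: real
  assumes I: "finite I" and G: "G \<ge> 1" and K: "K \<ge> 0"
    and int: "\<And>t s. t \<in> I \<Longrightarrow> s \<in> I \<Longrightarrow> integrable M (\<lambda>\<omega>. y t \<omega> * y s \<omega>)"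
    and orth: "\<And>t s. t \<in> I \<Longrightarrow> s \<in> I \<Longrightarrow> \<bar>t - s\<bar> \<ge> G \<Longrightarrow> expectation (\<lambda>\<omega>. y t \<omega> * y s \<omega>) = 0"
    and bd: "\<And>t. t \<in> I \<Longrightarrow> expectation (\<lambda>\<omega>. (y t \<omega>)\<^sup>2) \<le> K"
  shows "expectation (\<lambda>\<omega>. (\<Sum>t\<in>I. y t \<omega>)\<^sup>2) \<le> 2 * real_of_int G * real (card I) * K"
proof -
  have cs: "expectation (\<lambda>\<omega>. y t \<omega> * y s \<omega>) \<le> K" if "t \<in> I" "s \<in> I" for t s
  proof -
    have "expectation (\<lambda>\<omega>. y t \<omega> * y s \<omega>) \<le> expectation (\<lambda>\<omega>. ((y t \<omega>)\<^sup>2 + (y s \<omega>)\<^sup>2) / 2)"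
    proof (intro integral_mono)
      show "integrable M (\<lambda>\<omega>. ((y t \<omega>)\<^sup>2 + (y s \<omega>)\<^sup>2) / 2)"
        using int[OF that(1,1)] int[OF that(2,2)] by (simp add: power2_eq_square)
      show "y t \<omega> * y s \<omega> \<le> ((y t \<omega>)\<^sup>2 + (y s \<omega>)\<^sup>2) / 2" for \<omega>
        using sum_squares_bound[of "y t \<omega>" "y s \<omega>"] by simp
    qed (use int that in auto)
    also have "\<dots> = (expectation (\<lambda>\<omega>. (y t \<omega>)\<^sup>2) + expectation (\<lambda>\<omega>. (y s \<omega>)\<^sup>2)) / 2"
      using int[OF that(1,1)] int[OF that(2,2)] by (simp add: power2_eq_square)
    also have "\<dots> \<le> K" using bd[OF that(1)] bd[OF that(2)] by simp
    finally show ?thesis .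
  qed
  have "expectation (\<lambda>\<omega>. (\<Sum>t\<in>I. y t \<omega>)\<^sup>2) = (\<Sum>t\<in>I. \<Sum>s\<in>I. expectation (\<lambda>\<omega>. y t \<omega> * y s \<omega>))"
    unfolding power2_eq_square sum_product using int by (simp add: Bochner_Integration.integral_sum)
  also have "\<dots> \<le> (\<Sum>t\<in>I. \<Sum>s\<in>I. if s \<in> {t - G<..<t + G} then K else 0)"
    using cs orth by (intro sum_mono) auto
  also have "\<dots> = (\<Sum>t\<in>I. card (I \<inter> {t - G<..<t + G}) * K)"
    using I by (simp add: sum.If_cases Int_def)
  also have "\<dots> \<le> (\<Sum>t\<in>I. 2 * real_of_int G * K)"
  proof (intro sum_mono mult_right_mono K)
    fix t
    have "card (I \<inter> {t - G<..<t + G}) \<le> card {t - G<..<t + G}" by (intro card_mono) auto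
    then have "int (card (I \<inter> {t - G<..<t + G})) \<le> 2 * G" using G by simp
    then show "real (card (I \<inter> {t - G<..<t + G})) \<le> 2 * real_of_int G" by linarith
  qed
  finally show ?thesis by (simp add: mult_ac)
qed

text \<open>Spacing \<open>G\<close> makes the newest term independent of the sum \<open>S\<close>
  of the earlier ones. In the fourth power, terms linear in the new variable or in \<open>S\<close>
  vanish, which leaves \<open>E S^4 + 6 E S^2 E y^2 + E y^4\<close>; the bound closes because
  \<open>3 k^2 + 6 k + 1 \<le> 3 (k + 1)^2\<close>. The middle term is the reason for carrying the
  second moment through the induction.\<close>

lemma sep_fourth:
  fixes y :: "int \<Rightarrow> 'a \<Rightarrow> real" and G :: int and K :: real
  assumes K: "K \<ge> 0" and I: "finite I"
    and sep: "\<And>t s. t \<in> I \<Longrightarrow> s \<in> I \<Longrightarrow> t < s \<Longrightarrow> s - t \<ge> G"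
    and y: "\<And>t. bm {t - G<..t} (y t)"
    and y0: "\<And>t. t \<in> I \<Longrightarrow> expectation (y t) = 0"
    and y2: "\<And>t. t \<in> I \<Longrightarrow> expectation (\<lambda>\<omega>. y t \<omega> ^ 2) \<le> K"
    and y4: "\<And>t. t \<in> I \<Longrightarrow> expectation (\<lambda>\<omega>. y t \<omega> ^ 4) \<le> K\<^sup>2"
  shows "expectation (\<lambda>\<omega>. (\<Sum>t\<in>I. y t \<omega>) ^ 2) \<le> card I * K \<and>
    expectation (\<lambda>\<omega>. (\<Sum>t\<in>I. y t \<omega>) ^ 4) \<le> 3 * (real (card I))\<^sup>2 * K\<^sup>2"
  using I sep y0 y2 y4
proof (induction I rule: finite_linorder_max_induct)
  case empty
  then show ?case by simp
next
  case (insert b A)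
  define S where "S = (\<lambda>\<omega>. \<Sum>t\<in>A. y t \<omega>)"
  have bS: "bm {..b - G} S"
    unfolding S_def
  proof (intro bm_sum)
    fix t assume t: "t \<in> A"
    then show "bm {..b - G} (y t)"
      using insert.hyps insert.prems(1)[of t b] by (intro bm_mono[OF y[of t]]) auto
  qed
  have IH: "expectation (\<lambda>\<omega>. S \<omega> ^ 2) \<le> card A * K" "expectation (\<lambda>\<omega>. S \<omega> ^ 4) \<le> 3 * (real (card A))\<^sup>2 * K\<^sup>2"
    using insert.IH insert.prems by (auto simp: S_def)
  have d: "{..b - G} \<inter> {b - G<..b} = {}" by auto
  have prod: "expectation (\<lambda>\<omega>. S \<omega> ^ i * y b \<omega> ^ j) = expectation (\<lambda>\<omega>. S \<omega> ^ i) * expectation (\<lambda>\<omega>. y b \<omega> ^ j)" for i j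
    by (intro bm_indep[OF bm_power[OF bS] bm_power[OF y] d])
  have int: "integrable M (\<lambda>\<omega>. S \<omega> ^ i * y b \<omega> ^ j)" for i j
    by (intro bm_integrable[of UNIV] bm_mult bm_power) (auto intro: bm_mono[OF bS] bm_mono[OF y])
  note int0 = int[of _ 0, simplified] int[of 0, simplified] int[of 1 1, simplified]
    int[of 1 3, simplified] int[of 3 1, simplified] int[of 2 2]
  have y1: "expectation (y b) = 0" using insert.prems by simp
  have cI: "card (insert b A) = card A + 1" using insert.hyps by (subst card_insert_disjoint) auto
  have S: "(\<Sum>t\<in>insert b A. y t \<omega>) = S \<omega> + y b \<omega>" for \<omega>
    using insert.hyps by (subst sum.insert) (auto simp: S_def)
  have "expectation (\<lambda>\<omega>. (S \<omega> + y b \<omega>)\<^sup>2) = expectation (\<lambda>\<omega>. S \<omega> ^ 2 + 2 * (S \<omega> ^ 1 * y b \<omega> ^ 1) + y b \<omega> ^ 2)"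
    by (intro Bochner_Integration.integral_cong) (auto simp: power2_eq_square algebra_simps)
  also have "\<dots> = expectation (\<lambda>\<omega>. S \<omega> ^ 2) + 2 * (expectation (\<lambda>\<omega>. S \<omega>) * expectation (y b)) + expectation (\<lambda>\<omega>. y b \<omega> ^ 2)"
    using int0 prod[of 1 1] by simp
  also have "\<dots> \<le> card (insert b A) * K"
    using IH(1) y1 insert.prems(3)[of b] cI by (auto simp: algebra_simps)
  finally have 1: "expectation (\<lambda>\<omega>. (S \<omega> + y b \<omega>)\<^sup>2) \<le> card (insert b A) * K" .
  have "expectation (\<lambda>\<omega>. (S \<omega> + y b \<omega>) ^ 4) = expectation (\<lambda>\<omega>. S \<omega> ^ 4 + 4 * (S \<omega> ^ 3 * y b \<omega> ^ 1) +
      6 * (S \<omega> ^ 2 * y b \<omega> ^ 2) + 4 * (S \<omega> ^ 1 * y b \<omega> ^ 3) + y b \<omega> ^ 4)"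
    by (intro Bochner_Integration.integral_cong) (auto simp: eval_nat_numeral algebra_simps)
  also have "\<dots> = expectation (\<lambda>\<omega>. S \<omega> ^ 4) + 4 * (expectation (\<lambda>\<omega>. S \<omega> ^ 3) * expectation (y b)) +
     6 * (expectation (\<lambda>\<omega>. S \<omega> ^ 2) * expectation (\<lambda>\<omega>. y b \<omega> ^ 2)) +
     4 * (expectation (\<lambda>\<omega>. S \<omega>) * expectation (\<lambda>\<omega>. y b \<omega> ^ 3)) + expectation (\<lambda>\<omega>. y b \<omega> ^ 4)"
    using int0 prod[of 3 1] prod[of 2 2] prod[of 1 3] by simp
  also have "expectation S = 0"
    unfolding S_def using insert.prems(2) by (subst Bochner_Integration.integral_sum) (auto intro: bm_integrable[OF y])
  also have "expectation (\<lambda>\<omega>. S \<omega> ^ 2) * expectation (\<lambda>\<omega>. y b \<omega> ^ 2) \<le> (card A * K) * K"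
    using IH(1) insert.prems(3)[of b] K by (intro mult_mono) (auto intro!: integral_nonneg)
  finally have "expectation (\<lambda>\<omega>. (S \<omega> + y b \<omega>) ^ 4) \<le> 3 * (real (card A))\<^sup>2 * K\<^sup>2 + 6 * (card A * K * K) + K\<^sup>2"
    using IH(2) y1 insert.prems(4)[of b] by auto
  also have "\<dots> \<le> 3 * (real (card (insert b A)))\<^sup>2 * K\<^sup>2"
    unfolding cI by (simp add: power2_eq_square algebra_simps)
  finally show ?case unfolding S using 1 by auto
qed

text \<open>Cauchy-Schwarz, applied twice.\<close>

lemma sum_power4_le:
  fixes R :: "'i \<Rightarrow> real"
  shows "(\<Sum>i\<in>I. R i) ^ 4 \<le> (real (card I)) ^ 3 * (\<Sum>i\<in>I. R i ^ 4)"
proof -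
  have "(\<Sum>i\<in>I. R i) ^ 4 = ((\<Sum>i\<in>I. R i)\<^sup>2)\<^sup>2" by simp
  also have "\<dots> \<le> (card I * (\<Sum>i\<in>I. (R i)\<^sup>2))\<^sup>2"
    using sum_squared_le_sum_of_squares[of R I] by (cases "finite I") (auto simp del: power_mult_numeral intro!: power_mono simp: mult_ac)
  also have "\<dots> = (card I)\<^sup>2 * (\<Sum>i\<in>I. (R i)\<^sup>2)\<^sup>2" by (simp add: power_mult_distrib)
  also have "\<dots> \<le> (card I)\<^sup>2 * (card I * (\<Sum>i\<in>I. ((R i)\<^sup>2)\<^sup>2))"
    using sum_squared_le_sum_of_squares[of "\<lambda>i. (R i)\<^sup>2" I]
    by (cases "finite I", intro mult_left_mono) (simp_all add: mult_ac)
  also have "\<dots> = (real (card I)) ^ 3 * (\<Sum>i\<in>I. R i ^ 4)" by (simp add: eval_nat_numeral mult_ac)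
  finally show ?thesis .
qed

text \<open>Indices in one residue class modulo \<open>G\<close> are at least \<open>G\<close>
  apart, so \<open>sep_fourth\<close> applies to each class; \<open>sum_power4_le\<close> recombines
  the \<open>G\<close> classes. The result has the order of the square of the variance, as for
  independent terms, up to powers of \<open>G\<close>.\<close>

lemma dep_sum_fourth:
  fixes y :: "int \<Rightarrow> 'a \<Rightarrow> real" and G u :: int and p :: nat and K :: real
  assumes K: "K \<ge> 0" and G: "G \<ge> 1" and I: "I \<subseteq> {u..<u + int p}"
    and y: "\<And>t. bm {t - G<..t} (y t)"
    and y0: "\<And>t. t \<in> I \<Longrightarrow> expectation (y t) = 0"
    and y2: "\<And>t. t \<in> I \<Longrightarrow> expectation (\<lambda>\<omega>. y t \<omega> ^ 2) \<le> K"
    and y4: "\<And>t. t \<in> I \<Longrightarrow> expectation (\<lambda>\<omega>. y t \<omega> ^ 4) \<le> K\<^sup>2"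
  shows "expectation (\<lambda>\<omega>. (\<Sum>t\<in>I. y t \<omega>) ^ 4) \<le> 3 * (real_of_int G)\<^sup>2 * (real p + 2 * real_of_int G)\<^sup>2 * K\<^sup>2"
proof -
  define J where "J = (\<lambda>r. {t\<in>I. t mod G = r})"
  have fI: "finite I" using I by (rule finite_subset) auto
  have dec: "(\<Sum>t\<in>I. y t \<omega>) = (\<Sum>r\<in>{0..<G}. \<Sum>t\<in>J r. y t \<omega>)" for \<omega>
    unfolding J_def using G fI by (intro sum.group[symmetric]) auto
  have int: "integrable M (\<lambda>\<omega>. (\<Sum>t\<in>A. y t \<omega>) ^ 4)" for A
    by (intro bm_integrable[of UNIV] bm_power bm_sum bm_mono[OF y]) auto
  \<comment> \<open>\<open>t div G\<close> is injective on a residue class and maps it into an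
    interval; the incomplete periods at the two ends cost the extra \<open>2 G\<close>.\<close>
  have card: "real (card (J r)) * real_of_int G \<le> real p + 2 * real_of_int G" for r
  proof -
    have inj: "inj_on (\<lambda>t. t div G) (J r)"
    proof (rule inj_onI)
      fix t s assume "t \<in> J r" "s \<in> J r" "t div G = s div G"
      then show "t = s" using div_mult_mod_eq[of t G] div_mult_mod_eq[of s G] by (simp add: J_def)
    qed
    have "(\<lambda>t. t div G) ` J r \<subseteq> {u div G..(u + int p) div G}"
      using I G by (auto simp: J_def intro!: zdiv_mono1 dest!: subsetD)
    then have "card ((\<lambda>t. t div G) ` J r) \<le> card {u div G..(u + int p) div G}"
      by (intro card_mono) auto
    then have "card (J r) \<le> card {u div G..(u + int p) div G}"
      using card_image[OF inj] by simp
    also have "\<dots> = nat ((u + int p) div G - u div G + 1)" by simp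
    finally have "card (J r) \<le> nat ((u + int p) div G - u div G + 1)" .
    moreover have "u div G \<le> (u + int p) div G" using G by (intro zdiv_mono1) auto
    ultimately have "int (card (J r)) \<le> (u + int p) div G - u div G + 1"
      by linarith
    then have "int (card (J r)) * G \<le> ((u + int p) div G - u div G + 1) * G"
      using G by (intro mult_right_mono) auto
    also have "\<dots> = ((u + int p) div G) * G - (u div G) * G + G"
      by (simp add: algebra_simps)
    finally have "int (card (J r)) * G \<le> ((u + int p) div G) * G - (u div G) * G + G" .
    also have "\<dots> \<le> (u + int p) - (u - G) + G"
      using G pos_mod_bound[of G u] pos_mod_sign[of G "u + int p"]
        div_mult_mod_eq[of u G] div_mult_mod_eq[of "u + int p" G] by linarith
    finally have "int (card (J r)) * G \<le> int p + 2 * G" by simp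
    then have "real_of_int (int (card (J r)) * G) \<le> real_of_int (int p + 2 * G)" by (simp only: of_int_le_iff)
    then show ?thesis by simp
  qed
  have "expectation (\<lambda>\<omega>. (\<Sum>t\<in>I. y t \<omega>) ^ 4) \<le> expectation (\<lambda>\<omega>. (real (card {0..<G})) ^ 3 * (\<Sum>r\<in>{0..<G}. (\<Sum>t\<in>J r. y t \<omega>) ^ 4))"
    by (intro integral_mono int Bochner_Integration.integrable_sum integrable_mult_right)
       (unfold dec, rule sum_power4_le)
  also have "\<dots> = (real_of_int G) ^ 3 * (\<Sum>r\<in>{0..<G}. expectation (\<lambda>\<omega>. (\<Sum>t\<in>J r. y t \<omega>) ^ 4))"
    using int G by (simp add: Bochner_Integration.integral_sum)
  also have "\<dots> \<le> (real_of_int G) ^ 3 * (\<Sum>r\<in>{0..<G}. 3 * (real (card (J r)))\<^sup>2 * K\<^sup>2)"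
  proof (intro mult_left_mono sum_mono)
    fix r assume "r \<in> {0..<G}"
    have "G dvd s - t" if "t \<in> J r" "s \<in> J r" for s t
      using that by (auto simp: J_def mod_eq_dvd_iff)
    then have "s - t \<ge> G" if "t \<in> J r" "s \<in> J r" "t < s" for s t
      using that by (intro zdvd_imp_le) auto
    then show "expectation (\<lambda>\<omega>. (\<Sum>t\<in>J r. y t \<omega>) ^ 4) \<le> 3 * (real (card (J r)))\<^sup>2 * K\<^sup>2"
      using fI y0 y2 y4 by (intro sep_fourth[where G=G, THEN conjunct2] K y) (auto simp: J_def)
  qed (use G in auto)
  also have "\<dots> = real_of_int G * (\<Sum>r\<in>{0..<G}. 3 * (real (card (J r)) * real_of_int G)\<^sup>2 * K\<^sup>2)"
    by (simp add: sum_distrib_left power_mult_distrib eval_nat_numeral mult_ac)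
  also have "\<dots> \<le> real_of_int G * (\<Sum>r\<in>{0..<G}. 3 * (real p + 2 * real_of_int G)\<^sup>2 * K\<^sup>2)"
    using card G by (intro mult_left_mono sum_mono mult_right_mono power_mono) auto
  also have "\<dots> = 3 * (real_of_int G)\<^sup>2 * (real p + 2 * real_of_int G)\<^sup>2 * K\<^sup>2"
    using G by (simp add: power2_eq_square mult_ac)
  finally show ?thesis .
qed

end

section \<open>Products of an l-dependent process with a lagged linear form\<close>

context indep_fields
begin

text \<open>The window has exactly \<open>l\<close> indices, so values at times that differ by
  \<open>l\<close> or more are independent.\<close>

definition lproc :: "int \<Rightarrow> (int \<Rightarrow> 'a \<Rightarrow> real) \<Rightarrow> bool" where
  "lproc l A \<longleftrightarrow> (\<forall>t. bm {t - l<..t} (A t))"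

lemma lprocD: "lproc l A \<Longrightarrow> {t - l<..t} \<subseteq> S \<Longrightarrow> bm S (A t)"
  unfolding lproc_def by (blast intro: bm_mono)

lemma lproc_integrable: "lproc l A \<Longrightarrow> integrable M (A t)"
  by (rule bm_integrable[OF lprocD[of _ _ _ UNIV]]) auto

lemma lproc_cov_zero:
  assumes A: "lproc l A" and D: "lproc l D" and z: "expectation (A t) = 0 \<or> expectation (D s) = 0"
    and ts: "l \<le> \<bar>t - s\<bar>"
  shows "expectation (\<lambda>\<omega>. A t \<omega> * D s \<omega>) = 0"
proof -
  have "{t - l<..t} \<inter> {s - l<..s} = {}" using ts by auto
  from bm_indep[OF lprocD[OF A order_refl] lprocD[OF D order_refl] this] z show ?thesis by auto
qed

lemma second_moment_nonneg: "0 \<le> expectation (\<lambda>\<omega>. (f \<omega> :: real)\<^sup>2)"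
  by (intro integral_nonneg_AE) auto

lemma lin_second_moment:
  fixes \<beta> :: "int \<Rightarrow> real" and C \<kappa> :: real
  assumes D: "lproc l D" and D0: "\<And>t. expectation (D t) = 0"
    and D2: "\<And>t. expectation (\<lambda>\<omega>. (D t \<omega>)\<^sup>2) \<le> \<kappa>" and J: "finite J"
    and C: "\<And>j. \<bar>\<beta> j\<bar> \<le> C" and l: "l \<ge> 1"
  shows "expectation (\<lambda>\<omega>. (\<Sum>j\<in>J. \<beta> j * D (t - j) \<omega>)\<^sup>2) \<le> 2 * real_of_int l * real (card J) * (C\<^sup>2 * \<kappa>)"
proof (rule orth_sum_second_moment[OF J l])
  have \<kappa>: "0 \<le> \<kappa>" using D2[of 0] second_moment_nonneg[of "D 0"] by linarith
  then show "0 \<le> C\<^sup>2 * \<kappa>" by simp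
  fix i j
  show "integrable M (\<lambda>\<omega>. \<beta> i * D (t - i) \<omega> * (\<beta> j * D (t - j) \<omega>))"
    by (intro bm_integrable[of UNIV] bm_mult bm_const lprocD[OF D]) auto
  have "expectation (\<lambda>\<omega>. \<beta> i * D (t - i) \<omega> * (\<beta> j * D (t - j) \<omega>)) =
      expectation (\<lambda>\<omega>. (\<beta> i * \<beta> j) * (D (t - i) \<omega> * D (t - j) \<omega>))"
    by (simp add: mult_ac)
  also have "\<dots> = \<beta> i * \<beta> j * expectation (\<lambda>\<omega>. D (t - i) \<omega> * D (t - j) \<omega>)" by simp
  also assume "l \<le> \<bar>i - j\<bar>"
  then have "expectation (\<lambda>\<omega>. D (t - i) \<omega> * D (t - j) \<omega>) = 0"
    by (intro lproc_cov_zero[OF D D]) (auto simp: D0)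
  finally show "expectation (\<lambda>\<omega>. \<beta> i * D (t - i) \<omega> * (\<beta> j * D (t - j) \<omega>)) = 0" by simp
next
  fix i
  have "0 \<le> \<kappa>" using D2[of 0] second_moment_nonneg[of "D 0"] by linarith
  have "expectation (\<lambda>\<omega>. (\<beta> i * D (t - i) \<omega>)\<^sup>2) = (\<beta> i)\<^sup>2 * expectation (\<lambda>\<omega>. (D (t - i) \<omega>)\<^sup>2)"
    by (simp add: power_mult_distrib)
  also have "\<dots> \<le> C\<^sup>2 * \<kappa>"
    using D2 C[of i] \<open>0 \<le> \<kappa>\<close>
    by (intro mult_mono) (auto simp: abs_le_square_iff[symmetric] intro!: integral_nonneg_AE)
  finally show "expectation (\<lambda>\<omega>. (\<beta> i * D (t - i) \<omega>)\<^sup>2) \<le> C\<^sup>2 * \<kappa>" .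
qed

text \<open>If the times differ by \<open>l\<close> or more, the later \<open>A\<close> is
  independent of all other factors and both sides vanish. If they differ by less, the two
  \<open>A\<close> use innovations after \<open>min t s - l\<close>, whereas the two
  \<open>W\<close> stop at \<open>max t s - L\<close>, which is earlier because \<open>L\<close> is
  at least \<open>2 l\<close>. No case is left in which current and lagged factors interact.\<close>

lemma eta_covariance:
  fixes \<beta> :: "int \<Rightarrow> int \<Rightarrow> real" and l L b :: int
  assumes A: "lproc l A" and D: "lproc l D" and A0: "\<And>t. expectation (A t) = 0"
    and l: "l \<ge> 1" "2 * l \<le> L"
  defines "W \<equiv> \<lambda>t \<omega>. \<Sum>j\<in>{L..b}. \<beta> t j * D (t - j) \<omega>"
  shows "expectation (\<lambda>\<omega>. (A t \<omega> * W t \<omega>) * (A s \<omega> * W s \<omega>)) =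
    expectation (\<lambda>\<omega>. A t \<omega> * A s \<omega>) * expectation (\<lambda>\<omega>. W t \<omega> * W s \<omega>)"
proof -
  have W: "bm S (W t)" if "{..t - L} \<subseteq> S" for t S
    unfolding W_def using that by (intro bm_sum bm_mult bm_const lprocD[OF D]) auto
  have far: "expectation (\<lambda>\<omega>. (A t \<omega> * W t \<omega>) * (A s \<omega> * W s \<omega>)) =
    expectation (\<lambda>\<omega>. A t \<omega> * A s \<omega>) * expectation (\<lambda>\<omega>. W t \<omega> * W s \<omega>)" if "l \<le> t - s" for t s
  proof -
    have b: "bm {..t - l} (\<lambda>\<omega>. W t \<omega> * (A s \<omega> * W s \<omega>))"
      using that l by (intro bm_mult W lprocD[OF A]) auto
    have "expectation (\<lambda>\<omega>. A t \<omega> * (W t \<omega> * (A s \<omega> * W s \<omega>))) = 0"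
      using A0 by (subst bm_indep[OF lprocD[OF A order_refl] b]) auto
    moreover have "expectation (\<lambda>\<omega>. A t \<omega> * A s \<omega>) = 0"
      using that by (intro lproc_cov_zero[OF A A]) (auto simp: A0)
    ultimately show ?thesis by (simp add: mult.assoc)
  qed
  consider "l \<le> t - s" | "l \<le> s - t" | "\<bar>t - s\<bar> < l" by linarith
  then show ?thesis
  proof cases
    case 1
    then show ?thesis by (rule far)
  next
    case 2
    from far[OF 2] show ?thesis by (simp add: mult_ac)
  next
    case 3
    have "expectation (\<lambda>\<omega>. (A t \<omega> * A s \<omega>) * (W t \<omega> * W s \<omega>)) =
      expectation (\<lambda>\<omega>. A t \<omega> * A s \<omega>) * expectation (\<lambda>\<omega>. W t \<omega> * W s \<omega>)"
    proof (rule bm_indep)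
      show "bm {min t s - l<..} (\<lambda>\<omega>. A t \<omega> * A s \<omega>)"
        by (intro bm_mult lprocD[OF A]) auto
      show "bm {..max t s - L} (\<lambda>\<omega>. W t \<omega> * W s \<omega>)"
        by (intro bm_mult W) auto
      show "{min t s - l<..} \<inter> {..max t s - L} = {}" using 3 l by auto
    qed
    then show ?thesis by (simp add: mult_ac)
  qed
qed

text \<open>By \<open>eta_covariance\<close> the summands are orthogonal at distance
  \<open>l\<close>, and each has second moment \<open>E A^2 E W^2\<close>. Since
  \<open>E W^2\<close> is itself linear in \<open>b\<close>, the total is linear in
  \<open>b\<close>; a bound on the products lag by lag would give \<open>b^2\<close>.\<close>

lemma large_lags_second_moment:
  fixes \<beta> :: "int \<Rightarrow> int \<Rightarrow> real" and C \<kappa>1 \<kappa>2 :: real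
  assumes A: "lproc l A" and D: "lproc l D"
    and A0: "\<And>t. expectation (A t) = 0" and D0: "\<And>t. expectation (D t) = 0"
    and A2: "\<And>t. expectation (\<lambda>\<omega>. (A t \<omega>)\<^sup>2) \<le> \<kappa>1" and D2: "\<And>t. expectation (\<lambda>\<omega>. (D t \<omega>)\<^sup>2) \<le> \<kappa>2"
    and l: "l \<ge> 1" "2 * l \<le> L" and b: "b \<ge> 0"
    and C: "\<And>t j. \<bar>\<beta> t j\<bar> \<le> C" and I: "finite I"
  shows "expectation (\<lambda>\<omega>. (\<Sum>t\<in>I. A t \<omega> * (\<Sum>j\<in>{L..b}. \<beta> t j * D (t - j) \<omega>))\<^sup>2)
    \<le> 2 * real_of_int l * real (card I) * (\<kappa>1 * (2 * real_of_int l * (real_of_int b + 1) * (C\<^sup>2 * \<kappa>2)))"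
proof -
  define W where "W = (\<lambda>t \<omega>. \<Sum>j\<in>{L..b}. \<beta> t j * D (t - j) \<omega>)"
  have cov: "expectation (\<lambda>\<omega>. (A t \<omega> * W t \<omega>) * (A s \<omega> * W s \<omega>)) =
    expectation (\<lambda>\<omega>. A t \<omega> * A s \<omega>) * expectation (\<lambda>\<omega>. W t \<omega> * W s \<omega>)" for t s
    unfolding W_def by (rule eta_covariance[OF A D A0 l])
  have k1: "0 \<le> \<kappa>1" using A2[of 0] second_moment_nonneg[of "A 0"] by linarith
  have k2: "0 \<le> \<kappa>2" using D2[of 0] second_moment_nonneg[of "D 0"] by linarith
  have W2: "expectation (\<lambda>\<omega>. (W t \<omega>)\<^sup>2) \<le> 2 * real_of_int l * (real_of_int b + 1) * (C\<^sup>2 * \<kappa>2)" for t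
  proof -
    have "expectation (\<lambda>\<omega>. (W t \<omega>)\<^sup>2) \<le> 2 * real_of_int l * real (card {L..b}) * (C\<^sup>2 * \<kappa>2)"
      unfolding W_def by (intro lin_second_moment[OF D D0 D2 _ C l(1)]) auto
    also have "\<dots> \<le> 2 * real_of_int l * (real_of_int b + 1) * (C\<^sup>2 * \<kappa>2)"
      using l k2 b by (intro mult_right_mono mult_left_mono) auto
    finally show ?thesis .
  qed
  have "expectation (\<lambda>\<omega>. (\<Sum>t\<in>I. A t \<omega> * W t \<omega>)\<^sup>2)
    \<le> 2 * real_of_int l * real (card I) * (\<kappa>1 * (2 * real_of_int l * (real_of_int b + 1) * (C\<^sup>2 * \<kappa>2)))"
  proof (rule orth_sum_second_moment[OF I l(1)])
    show "0 \<le> \<kappa>1 * (2 * real_of_int l * (real_of_int b + 1) * (C\<^sup>2 * \<kappa>2))" using k1 k2 l b by simp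
    fix t s
    show "integrable M (\<lambda>\<omega>. A t \<omega> * W t \<omega> * (A s \<omega> * W s \<omega>))"
      unfolding W_def by (intro bm_integrable[of UNIV] bm_mult bm_sum bm_const lprocD[OF A] lprocD[OF D]) auto
    assume "l \<le> \<bar>t - s\<bar>"
    then show "expectation (\<lambda>\<omega>. A t \<omega> * W t \<omega> * (A s \<omega> * W s \<omega>)) = 0"
      unfolding cov using lproc_cov_zero[OF A A] A0 by simp
  next
    fix t
    have "expectation (\<lambda>\<omega>. (A t \<omega> * W t \<omega>)\<^sup>2) = expectation (\<lambda>\<omega>. (A t \<omega>)\<^sup>2) * expectation (\<lambda>\<omega>. (W t \<omega>)\<^sup>2)"
      using cov[of t t] by (simp add: power2_eq_square)
    also have "\<dots> \<le> \<kappa>1 * (2 * real_of_int l * (real_of_int b + 1) * (C\<^sup>2 * \<kappa>2))"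
      using A2 W2 k1 by (intro mult_mono) (auto intro: second_moment_nonneg)
    finally show "expectation (\<lambda>\<omega>. (A t \<omega> * W t \<omega>)\<^sup>2) \<le> \<kappa>1 * (2 * real_of_int l * (real_of_int b + 1) * (C\<^sup>2 * \<kappa>2))" .
  qed
  then show ?thesis by (simp add: W_def)
qed

lemma bm_centered_sum_second_moment:
  fixes y :: "int \<Rightarrow> 'a \<Rightarrow> real" and G :: int and K :: real
  assumes y: "\<And>t. bm {t - G<..t} (y t)" and I: "finite I" and G: "G \<ge> 1"
    and y2: "\<And>t. t \<in> I \<Longrightarrow> expectation (\<lambda>\<omega>. (y t \<omega>)\<^sup>2) \<le> K"
  shows "expectation (\<lambda>\<omega>. (\<Sum>t\<in>I. y t \<omega> - expectation (y t))\<^sup>2) \<le> 2 * real_of_int G * real (card I) * K"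
proof (cases "I = {}")
  case False
  then have K: "0 \<le> K" using y2 second_moment_nonneg order_trans by blast
  have int: "integrable M (y t)" "integrable M (\<lambda>\<omega>. (y t \<omega>)\<^sup>2)" for t
    by (intro bm_integrable[of UNIV] bm_power bm_mono[OF y], simp)+
  show ?thesis
  proof (rule orth_sum_second_moment[OF I G K])
    fix t s assume "G \<le> \<bar>t - s\<bar>"
    then have "{t - G<..t} \<inter> {s - G<..s} = {}" by auto
    then have "expectation (\<lambda>\<omega>. (y t \<omega> - expectation (y t)) * (y s \<omega> - expectation (y s))) =
      expectation (\<lambda>\<omega>. y t \<omega> - expectation (y t)) * expectation (\<lambda>\<omega>. y s \<omega> - expectation (y s))"
      by (intro bm_indep[of "{t - G<..t}" _ "{s - G<..s}"] bm_diff bm_const y)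
    then show "expectation (\<lambda>\<omega>. (y t \<omega> - expectation (y t)) * (y s \<omega> - expectation (y s))) = 0"
      using int by (simp add: prob_space)
  next
    show "integrable M (\<lambda>\<omega>. (y t \<omega> - expectation (y t)) * (y s \<omega> - expectation (y s)))" for t s
      by (intro bm_integrable[of UNIV] bm_mult bm_diff bm_const bm_mono[OF y]) auto
    fix t assume "t \<in> I"
    have "expectation (\<lambda>\<omega>. (y t \<omega> - expectation (y t))\<^sup>2) = expectation (\<lambda>\<omega>. (y t \<omega>)\<^sup>2) - (expectation (y t))\<^sup>2"
      using int by (intro variance_eq) auto
    also have "\<dots> \<le> K" using y2[OF \<open>t \<in> I\<close>] by (smt (verit) zero_le_power2)
    finally show "expectation (\<lambda>\<omega>. (y t \<omega> - expectation (y t))\<^sup>2) \<le> K" .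
  qed
qed simp

text \<open>For lags below \<open>L\<close> no factorization is available. The sum over lags is
  treated as one variable with window \<open>L + l\<close> and estimated by Cauchy-Schwarz; the
  cubic cost in \<open>L\<close> is affordable because \<open>L\<close> will be a multiple of
  \<open>l\<close>.\<close>

lemma small_lags_second_moment:
  fixes \<beta> :: "int \<Rightarrow> int \<Rightarrow> real" and C \<kappa> :: real
  assumes A: "lproc l A" and D: "lproc l D"
    and AD: "\<And>t s. expectation (\<lambda>\<omega>. (A t \<omega> * D s \<omega>)\<^sup>2) \<le> \<kappa>"
    and l: "l \<ge> 1" and L: "L \<ge> 0" and C: "\<And>t j. \<bar>\<beta> t j\<bar> \<le> C" and I: "finite I"
  shows "expectation (\<lambda>\<omega>. ((\<Sum>t\<in>I. \<Sum>j\<in>{0..<L}. \<beta> t j * (A t \<omega> * D (t - j) \<omega>))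
      - (\<Sum>t\<in>I. \<Sum>j\<in>{0..<L}. \<beta> t j * expectation (\<lambda>\<omega>. A t \<omega> * D (t - j) \<omega>)))\<^sup>2)
    \<le> 2 * real_of_int (L + l) * real (card I) * ((real_of_int L)\<^sup>2 * C\<^sup>2 * \<kappa>)"
proof -
  define y where "y = (\<lambda>t \<omega>. \<Sum>j\<in>{0..<L}. \<beta> t j * (A t \<omega> * D (t - j) \<omega>))"
  have bAD: "bm S (\<lambda>\<omega>. A t \<omega> * D s \<omega>)" if "{t - l<..t} \<subseteq> S" "{s - l<..s} \<subseteq> S" for t s S
    using that by (intro bm_mult lprocD[OF A] lprocD[OF D])
  have k: "0 \<le> \<kappa>" using AD[of 0 0] second_moment_nonneg[of "\<lambda>\<omega>. A 0 \<omega> * D 0 \<omega>"] by linarith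
  have y: "bm {t - (L + l)<..t} (y t)" for t
    unfolding y_def by (intro bm_sum bm_cmult bAD) (use L in auto)
  have Ey: "expectation (y t) = (\<Sum>j\<in>{0..<L}. \<beta> t j * expectation (\<lambda>\<omega>. A t \<omega> * D (t - j) \<omega>))" for t
    unfolding y_def by (subst Bochner_Integration.integral_sum) (auto intro: bm_integrable[OF bAD[of _ UNIV]])
  have intq: "integrable M (\<lambda>\<omega>. (\<beta> t j * (A t \<omega> * D (t - j) \<omega>))\<^sup>2)" for t j
    by (intro bm_integrable[of UNIV] bm_power bm_cmult bAD) auto
  have "expectation (\<lambda>\<omega>. (y t \<omega>)\<^sup>2) \<le> (real_of_int L)\<^sup>2 * C\<^sup>2 * \<kappa>" for t
  proof -
    have "expectation (\<lambda>\<omega>. (y t \<omega>)\<^sup>2) \<le> expectation (\<lambda>\<omega>. card {0..<L} * (\<Sum>j\<in>{0..<L}. (\<beta> t j * (A t \<omega> * D (t - j) \<omega>))\<^sup>2))"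
    proof (intro integral_mono)
      show "integrable M (\<lambda>\<omega>. (y t \<omega>)\<^sup>2)"
        by (intro bm_integrable[of UNIV] bm_power bm_mono[OF y]) auto
      show "integrable M (\<lambda>\<omega>. card {0..<L} * (\<Sum>j\<in>{0..<L}. (\<beta> t j * (A t \<omega> * D (t - j) \<omega>))\<^sup>2))"
        using intq by (intro integrable_mult_right Bochner_Integration.integrable_sum)
      show "(y t \<omega>)\<^sup>2 \<le> card {0..<L} * (\<Sum>j\<in>{0..<L}. (\<beta> t j * (A t \<omega> * D (t - j) \<omega>))\<^sup>2)" for \<omega>
        unfolding y_def using sum_squared_le_sum_of_squares[of "\<lambda>j. \<beta> t j * (A t \<omega> * D (t - j) \<omega>)" "{0..<L}"]
        by (simp add: mult_ac)
    qed
    also have "\<dots> = real_of_int L * (\<Sum>j\<in>{0..<L}. (\<beta> t j)\<^sup>2 * expectation (\<lambda>\<omega>. (A t \<omega> * D (t - j) \<omega>)\<^sup>2))"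
      using intq L by (simp add: Bochner_Integration.integral_sum power_mult_distrib[of "\<beta> _ _"])
    also have "\<dots> \<le> real_of_int L * (\<Sum>j\<in>{0..<L}. C\<^sup>2 * \<kappa>)"
      using L k AD C by (intro mult_left_mono sum_mono mult_mono)
        (auto intro: second_moment_nonneg order_trans[OF C] simp: abs_le_square_iff[symmetric])
    also have "\<dots> = (real_of_int L)\<^sup>2 * C\<^sup>2 * \<kappa>" using L by (simp add: power2_eq_square)
    finally show ?thesis .
  qed
  from bm_centered_sum_second_moment[OF y I _ this] L l
  have "expectation (\<lambda>\<omega>. (\<Sum>t\<in>I. y t \<omega> - expectation (y t))\<^sup>2) \<le> 2 * real_of_int (L + l) * real (card I) * ((real_of_int L)\<^sup>2 * C\<^sup>2 * \<kappa>)"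
    by simp
  then show ?thesis unfolding Ey sum_subtractf by (simp add: y_def)
qed

end

section \<open>Second moments of bilinear forms\<close>

lemma sum5_squared_le:
  fixes a b c d e :: real
  shows "(a + b + c + d + e)\<^sup>2 \<le> 5 * (a\<^sup>2 + b\<^sup>2 + c\<^sup>2 + d\<^sup>2 + e\<^sup>2)"
proof -
  have "0 \<le> (a - b)\<^sup>2 + (a - c)\<^sup>2 + (a - d)\<^sup>2 + (a - e)\<^sup>2 + (b - c)\<^sup>2 + (b - d)\<^sup>2 + (b - e)\<^sup>2
    + (c - d)\<^sup>2 + (c - e)\<^sup>2 + (d - e)\<^sup>2"
    by (intro add_nonneg_nonneg zero_le_power2)
  then show ?thesis by (simp add: power2_eq_square algebra_simps)
qed

context indep_fields
begin

text \<open>\<open>D\<close> plays the role of a small increment of indicators and \<open>A\<close>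
  that of a merely bounded factor. As \<open>|D| \<le> 1\<close>, the square of \<open>D\<close> is
  at most \<open>|D|\<close>, so the L1 bound \<open>\<kappa>\<close> also bounds the variance. The
  factors 4 come from \<open>|Ac| \<le> 2\<close>.\<close>

lemma centered_cross_moments:
  fixes A D :: "'a \<Rightarrow> real" and \<kappa> :: real
  assumes A: "bm UNIV A" and D: "bm UNIV D"
    and A1: "\<And>\<omega>. \<omega> \<in> space M \<Longrightarrow> \<bar>A \<omega>\<bar> \<le> 1" and D1: "\<And>\<omega>. \<omega> \<in> space M \<Longrightarrow> \<bar>D \<omega>\<bar> \<le> 1"
    and \<kappa>: "expectation (\<lambda>\<omega>. \<bar>D \<omega>\<bar>) \<le> \<kappa>"
  defines "Ac \<equiv> \<lambda>\<omega>. A \<omega> - expectation A" and "Dc \<equiv> \<lambda>\<omega>. D \<omega> - expectation D"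
  shows "expectation (\<lambda>\<omega>. (Dc \<omega>)\<^sup>2) \<le> \<kappa>"
    and "expectation (\<lambda>\<omega>. (Ac \<omega> * Dc \<omega>)\<^sup>2) \<le> 4 * \<kappa>"
    and "\<bar>expectation (\<lambda>\<omega>. Ac \<omega> * Dc \<omega>)\<bar> \<le> 4 * \<kappa>"
    and "expectation (\<lambda>\<omega>. (Ac \<omega>)\<^sup>2) \<le> 1"
proof -
  have A1': "expectation (\<lambda>\<omega>. \<bar>A \<omega>\<bar>) \<le> 1"
    using A1 by (intro integral_le_const bm_integrable[OF bm_abs[OF A]] AE_I2) auto
  then have EA: "\<bar>expectation A\<bar> \<le> 1" using integral_abs_bound[of M A] by linarith
  have Ac2: "\<bar>Ac \<omega>\<bar> \<le> 2" if "\<omega> \<in> space M" for \<omega>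
    using A1[OF that] EA by (auto simp: Ac_def)
  have bA: "bm UNIV Ac" and bD: "bm UNIV Dc" unfolding Ac_def Dc_def by (intro bm_diff A D bm_const)+
  have var: "expectation (\<lambda>\<omega>. (X \<omega> - expectation X)\<^sup>2) \<le> expectation (\<lambda>\<omega>. \<bar>X \<omega>\<bar>)"
    if X: "bm UNIV X" and X1: "\<And>\<omega>. \<omega> \<in> space M \<Longrightarrow> \<bar>X \<omega>\<bar> \<le> 1" for X :: "'a \<Rightarrow> real"
  proof -
    have "expectation (\<lambda>\<omega>. (X \<omega> - expectation X)\<^sup>2) = expectation (\<lambda>\<omega>. (X \<omega>)\<^sup>2) - (expectation X)\<^sup>2"
      by (intro variance_eq bm_integrable[OF X] bm_integrable[OF bm_power[OF X]])
    also have "\<dots> \<le> expectation (\<lambda>\<omega>. (X \<omega>)\<^sup>2)" by simp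
    also have "\<dots> \<le> expectation (\<lambda>\<omega>. \<bar>X \<omega>\<bar>)"
    proof (intro integral_mono_AE bm_integrable[OF bm_power[OF X]] bm_integrable[OF bm_abs[OF X]] AE_I2)
      fix \<omega> assume "\<omega> \<in> space M"
      from mult_left_mono[OF X1[OF this], of "\<bar>X \<omega>\<bar>"] show "(X \<omega>)\<^sup>2 \<le> \<bar>X \<omega>\<bar>"
        by (simp add: power2_eq_square)
    qed
    finally show ?thesis .
  qed
  show D2: "expectation (\<lambda>\<omega>. (Dc \<omega>)\<^sup>2) \<le> \<kappa>"
    using var[OF D D1] \<kappa> by (simp add: Dc_def)
  show "expectation (\<lambda>\<omega>. (Ac \<omega>)\<^sup>2) \<le> 1"
    using A1' var[OF A A1] by (simp add: Ac_def)
  have "expectation (\<lambda>\<omega>. (Ac \<omega> * Dc \<omega>)\<^sup>2) \<le> expectation (\<lambda>\<omega>. 4 * (Dc \<omega>)\<^sup>2)"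
  proof (intro integral_mono_AE bm_integrable[of UNIV] bm_power bm_mult bA bD bm_const AE_I2)
    fix \<omega> assume "\<omega> \<in> space M"
    from power_mono[OF Ac2[OF this], of 2] show "(Ac \<omega> * Dc \<omega>)\<^sup>2 \<le> 4 * (Dc \<omega>)\<^sup>2"
      by (simp add: power_mult_distrib mult_right_mono)
  qed
  then show "expectation (\<lambda>\<omega>. (Ac \<omega> * Dc \<omega>)\<^sup>2) \<le> 4 * \<kappa>" using D2 by simp
  have "\<bar>expectation (\<lambda>\<omega>. Ac \<omega> * Dc \<omega>)\<bar> \<le> expectation (\<lambda>\<omega>. \<bar>Ac \<omega> * Dc \<omega>\<bar>)"
    by (rule integral_abs_bound)
  also have "\<dots> \<le> expectation (\<lambda>\<omega>. 2 * (\<bar>D \<omega>\<bar> + \<bar>expectation D\<bar>))"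
  proof (intro integral_mono_AE bm_integrable[of UNIV] bm_abs bm_mult bA bD bm_const AE_I2 bm_add D)
    fix \<omega> assume "\<omega> \<in> space M"
    from Ac2[OF this] show "\<bar>Ac \<omega> * Dc \<omega>\<bar> \<le> 2 * (\<bar>D \<omega>\<bar> + \<bar>expectation D\<bar>)"
      unfolding abs_mult by (intro mult_mono) (auto simp: Dc_def)
  qed
  also have "\<dots> = 2 * (expectation (\<lambda>\<omega>. \<bar>D \<omega>\<bar>) + \<bar>expectation D\<bar>)"
    using bm_integrable[OF bm_abs[OF D]] by (simp add: prob_space)
  also have "\<dots> \<le> 4 * \<kappa>" using \<kappa> order_trans[OF integral_abs_bound \<kappa>] by (smt (verit))
  finally show "\<bar>expectation (\<lambda>\<omega>. Ac \<omega> * Dc \<omega>)\<bar> \<le> 4 * \<kappa>" .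
qed

text \<open>Writing each factor as mean plus centred part gives a centred form, split at lag
  \<open>2 l\<close>, two mixed linear forms and a product of means. The four summands of the bound
  belong to large lags, small lags, both mixed forms together, and the product of means. The number
  \<open>e\<close> is the mean of the centred small-lag part, the one mean that
  \<open>\<alpha>\<close> does not control; it is left existential and bounded separately.\<close>

lemma bilinear_second_moment:
  fixes \<beta> :: "int \<Rightarrow> int \<Rightarrow> real" and C \<kappa> \<alpha> :: real and l b :: int
  assumes A: "lproc l A" and D: "lproc l D"
    and A1: "\<And>t \<omega>. \<omega> \<in> space M \<Longrightarrow> \<bar>A t \<omega>\<bar> \<le> 1" and D1: "\<And>t \<omega>. \<omega> \<in> space M \<Longrightarrow> \<bar>D t \<omega>\<bar> \<le> 1"
    and EA: "\<And>t. \<bar>expectation (A t)\<bar> \<le> \<alpha>" and ED: "\<And>t. \<bar>expectation (D t)\<bar> \<le> \<alpha>"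
    and \<kappa>: "(\<forall>t. expectation (\<lambda>\<omega>. \<bar>A t \<omega>\<bar>) \<le> \<kappa>) \<or> (\<forall>t. expectation (\<lambda>\<omega>. \<bar>D t \<omega>\<bar>) \<le> \<kappa>)"
    and l: "l \<ge> 1" "2 * l \<le> b" and C: "\<And>t j. \<bar>\<beta> t j\<bar> \<le> C" and I: "finite I"
  shows "\<exists>e. \<bar>e\<bar> \<le> real (card I) * (2 * real_of_int l) * C * (4 * \<kappa>) \<and>
    expectation (\<lambda>\<omega>. ((\<Sum>t\<in>I. \<Sum>j\<in>{0..b}. \<beta> t j * (A t \<omega> * D (t - j) \<omega>)) - e)\<^sup>2) \<le>
      5 * C\<^sup>2 * real (card I) * (8 * (real_of_int l)\<^sup>2 * real_of_int b * \<kappa> + 96 * (real_of_int l)^3 * \<kappa>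
        + 24 * real_of_int l * (real_of_int b)\<^sup>2 * \<alpha>\<^sup>2 + 4 * real (card I) * (real_of_int b)\<^sup>2 * \<alpha>^4)"
proof -
  define a where "a = (\<lambda>t. expectation (A t))"
  define d where "d = (\<lambda>t. expectation (D t))"
  define Ac where "Ac = (\<lambda>t \<omega>. A t \<omega> - a t)"
  define Dc where "Dc = (\<lambda>t \<omega>. D t \<omega> - d t)"
  have bA: "bm UNIV (A t)" and bD: "bm UNIV (D t)" for t
    by (auto intro: lprocD[OF A] lprocD[OF D])
  have C0: "0 \<le> C" using C[of 0 0] by linarith
  have \<alpha>0: "0 \<le> \<alpha>" using EA[of 0] by linarith
  have \<kappa>0: "0 \<le> \<kappa>"
  proof -
    have "0 \<le> expectation (\<lambda>\<omega>. \<bar>A 0 \<omega>\<bar>)" "0 \<le> expectation (\<lambda>\<omega>. \<bar>D 0 \<omega>\<bar>)" by simp_all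
    then show ?thesis using \<kappa> order_trans by blast
  qed
  \<comment> \<open>Whichever process is small in L1 receives the variance bound
    \<open>\<kappa>\<close> and the other one receives 1, so that the rest of the argument is
    symmetric and uses only the product \<open>k1 * k2\<close>.\<close>
  obtain k1 k2 where k12: "k1 * k2 = \<kappa>" and k1: "\<And>t. expectation (\<lambda>\<omega>. (Ac t \<omega>)\<^sup>2) \<le> k1"
    and k2: "\<And>t. expectation (\<lambda>\<omega>. (Dc t \<omega>)\<^sup>2) \<le> k2"
    and AD2: "\<And>t s. expectation (\<lambda>\<omega>. (Ac t \<omega> * Dc s \<omega>)\<^sup>2) \<le> 4 * \<kappa>"
    and AD: "\<And>t s. \<bar>expectation (\<lambda>\<omega>. Ac t \<omega> * Dc s \<omega>)\<bar> \<le> 4 * \<kappa>"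
    and A2: "\<And>t. expectation (\<lambda>\<omega>. (Ac t \<omega>)\<^sup>2) \<le> 1" and D2: "\<And>t. expectation (\<lambda>\<omega>. (Dc t \<omega>)\<^sup>2) \<le> 1"
  proof -
    have one: "expectation (\<lambda>\<omega>. \<bar>X \<omega>\<bar>) \<le> 1"
      if "bm UNIV X" "\<And>\<omega>. \<omega> \<in> space M \<Longrightarrow> \<bar>X \<omega>\<bar> \<le> 1" for X :: "'a \<Rightarrow> real"
      using that(2) by (intro integral_le_const bm_integrable[OF bm_abs[OF that(1)]] AE_I2) auto
    have cA: "expectation (\<lambda>\<omega>. (Ac t \<omega>)\<^sup>2) \<le> 1" for t
      using centered_cross_moments(4)[OF bA bA A1 A1 order_refl] by (simp add: Ac_def a_def)
    have cD: "expectation (\<lambda>\<omega>. (Dc t \<omega>)\<^sup>2) \<le> 1" for t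
      using centered_cross_moments(4)[OF bD bD D1 D1 order_refl] by (simp add: Dc_def d_def)
    from \<kappa> show ?thesis
    proof
      assume *: "\<forall>t. expectation (\<lambda>\<omega>. \<bar>A t \<omega>\<bar>) \<le> \<kappa>"
      show ?thesis
        using centered_cross_moments[OF bD bA D1 A1 *[rule_format]] cA cD
        by (intro that[of \<kappa> 1]) (simp_all add: Ac_def Dc_def a_def d_def mult.commute)
    next
      assume *: "\<forall>t. expectation (\<lambda>\<omega>. \<bar>D t \<omega>\<bar>) \<le> \<kappa>"
      show ?thesis
        using centered_cross_moments[OF bA bD A1 D1 *[rule_format]] cA cD
        by (intro that[of 1 \<kappa>]) (simp_all add: Ac_def Dc_def a_def d_def)
    qed
  qed
  have pA: "lproc l Ac" and pD: "lproc l Dc"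
    unfolding lproc_def Ac_def Dc_def by (auto intro!: bm_diff bm_const lprocD[OF A] lprocD[OF D])
  have A0: "expectation (Ac t) = 0" and D0: "expectation (Dc t) = 0" for t
    using bm_integrable[OF bA] bm_integrable[OF bD] by (simp_all add: Ac_def Dc_def a_def d_def prob_space)
  define N where "N = real (card I)"
  define L where "L = real_of_int l"
  define b' where "b' = real_of_int b"
  have L1: "1 \<le> L" "2 * L \<le> b'" using l by (simp_all add: L_def b'_def)
  have cb: "real (card {0..b}) \<le> 2 * b'" using L1 by (simp add: b'_def)
  \<comment> \<open>\<open>f1\<close> and \<open>f2\<close> are the centred form at large and small
    lags, \<open>f3\<close> and \<open>f4\<close> the mixed forms, \<open>f5\<close> the
    deterministic part.\<close>
  define f1 where "f1 = (\<lambda>\<omega>. \<Sum>t\<in>I. Ac t \<omega> * (\<Sum>j\<in>{2*l..b}. \<beta> t j * Dc (t - j) \<omega>))"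
  define e where "e = (\<Sum>t\<in>I. \<Sum>j\<in>{0..<2*l}. \<beta> t j * expectation (\<lambda>\<omega>. Ac t \<omega> * Dc (t - j) \<omega>))"
  define f2 where "f2 = (\<lambda>\<omega>. (\<Sum>t\<in>I. \<Sum>j\<in>{0..<2*l}. \<beta> t j * (Ac t \<omega> * Dc (t - j) \<omega>)) - e)"
  define f3 where "f3 = (\<lambda>\<omega>. \<Sum>t\<in>I. a t * (\<Sum>j\<in>{0..b}. \<beta> t j * Dc (t - j) \<omega>))"
  define f4 where "f4 = (\<lambda>\<omega>. \<Sum>t\<in>I. (\<Sum>j\<in>{0..b}. \<beta> t j * d (t - j)) * Ac t \<omega>)"
  define f5 where "f5 = (\<Sum>t\<in>I. \<Sum>j\<in>{0..b}. \<beta> t j * (a t * d (t - j)))"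
  have split: "(\<Sum>j\<in>{0..b}. g j) = (\<Sum>j\<in>{0..<2*l}. g j) + (\<Sum>j\<in>{2*l..b}. g j)" for g :: "int \<Rightarrow> real"
    using l by (subst sum.union_disjoint[symmetric]) (auto intro!: sum.cong)
  have dec: "(\<Sum>t\<in>I. \<Sum>j\<in>{0..b}. \<beta> t j * (A t \<omega> * D (t - j) \<omega>)) - e = f1 \<omega> + f2 \<omega> + f3 \<omega> + f4 \<omega> + f5" for \<omega>
  proof -
    have "(\<Sum>j\<in>{0..b}. \<beta> t j * (A t \<omega> * D (t - j) \<omega>)) =
      (\<Sum>j\<in>{0..b}. \<beta> t j * (Ac t \<omega> * Dc (t - j) \<omega>)) + a t * (\<Sum>j\<in>{0..b}. \<beta> t j * Dc (t - j) \<omega>)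
      + (\<Sum>j\<in>{0..b}. \<beta> t j * d (t - j)) * Ac t \<omega> + (\<Sum>j\<in>{0..b}. \<beta> t j * (a t * d (t - j)))" for t
      unfolding sum_distrib_left sum_distrib_right sum.distrib[symmetric]
      by (intro sum.cong) (auto simp: Ac_def Dc_def algebra_simps)
    moreover have "(\<Sum>j\<in>{0..b}. \<beta> t j * (Ac t \<omega> * Dc (t - j) \<omega>)) = Ac t \<omega> * (\<Sum>j\<in>{2*l..b}. \<beta> t j * Dc (t - j) \<omega>)
       + (\<Sum>j\<in>{0..<2*l}. \<beta> t j * (Ac t \<omega> * Dc (t - j) \<omega>))" for t
      unfolding split by (simp add: sum_distrib_left mult_ac)
    ultimately show ?thesis
      by (simp add: f1_def f2_def f3_def f4_def f5_def sum.distrib)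
  qed
  have e: "\<bar>e\<bar> \<le> N * (2 * L) * C * (4 * \<kappa>)"
  proof -
    have "\<bar>e\<bar> \<le> (\<Sum>t\<in>I. \<Sum>j\<in>{0..<2*l}. C * (4 * \<kappa>))"
      unfolding e_def using C AD C0
      by (intro order_trans[OF sum_abs] sum_mono) (auto simp: abs_mult intro!: mult_mono)
    also have "\<dots> = N * (2 * L) * C * (4 * \<kappa>)" using l by (simp add: N_def L_def)
    finally show ?thesis .
  qed
  have m1: "expectation (\<lambda>\<omega>. (f1 \<omega>)\<^sup>2) \<le> C\<^sup>2 * N * (8 * L\<^sup>2 * b' * \<kappa>)"
  proof -
    have "expectation (\<lambda>\<omega>. (f1 \<omega>)\<^sup>2) \<le> 2 * L * N * (k1 * (2 * L * (b' + 1) * (C\<^sup>2 * k2)))"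
      using large_lags_second_moment[OF pA pD A0 D0 k1 k2 l(1) order_refl _ C I, of b] l
      by (simp add: f1_def L_def N_def b'_def)
    also have "\<dots> = 4 * L\<^sup>2 * N * C\<^sup>2 * \<kappa> * (b' + 1)" by (simp add: k12[symmetric] power2_eq_square)
    also have "\<dots> \<le> 4 * L\<^sup>2 * N * C\<^sup>2 * \<kappa> * (2 * b')"
      using L1 \<kappa>0 by (intro mult_left_mono mult_nonneg_nonneg) (auto simp: N_def)
    finally show ?thesis by (simp add: mult_ac)
  qed
  have m2: "expectation (\<lambda>\<omega>. (f2 \<omega>)\<^sup>2) \<le> C\<^sup>2 * N * (96 * L^3 * \<kappa>)"
  proof -
    have "expectation (\<lambda>\<omega>. (f2 \<omega>)\<^sup>2) \<le> 2 * real_of_int (2 * l + l) * N * ((real_of_int (2 * l))\<^sup>2 * C\<^sup>2 * (4 * \<kappa>))"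
      using small_lags_second_moment[OF pA pD AD2 l(1) _ C I, of "2 * l"] l
      by (simp add: f2_def e_def N_def)
    also have "\<dots> = C\<^sup>2 * N * (96 * L^3 * \<kappa>)" by (simp add: L_def power2_eq_square power3_eq_cube)
    finally show ?thesis .
  qed
  have m3: "expectation (\<lambda>\<omega>. (f3 \<omega>)\<^sup>2) \<le> C\<^sup>2 * N * (16 * L * b'\<^sup>2 * \<alpha>\<^sup>2)"
  proof -
    define y where "y = (\<lambda>t \<omega>. a t * (\<Sum>j\<in>{0..b}. \<beta> t j * Dc (t - j) \<omega>))"
    have y: "bm {t - (b + l)<..t} (y t)" for t
      unfolding y_def by (intro bm_cmult bm_sum lprocD[OF pD]) auto
    have y0: "expectation (y t) = 0" for t
      unfolding y_def using lproc_integrable[OF pD] by (simp add: Bochner_Integration.integral_sum D0)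
    have "expectation (\<lambda>\<omega>. (y t \<omega>)\<^sup>2) \<le> \<alpha>\<^sup>2 * (2 * L * (2 * b') * (C\<^sup>2 * 1))" for t
    proof -
      have lin: "expectation (\<lambda>\<omega>. (\<Sum>j\<in>{0..b}. \<beta> t j * Dc (t - j) \<omega>)\<^sup>2) \<le> 2 * L * real (card {0..b}) * (C\<^sup>2 * 1)"
        unfolding L_def
        by (rule lin_second_moment[where \<beta>="\<beta> t", OF pD D0 D2 finite_atLeastAtMost_int C l(1)])
      have "expectation (\<lambda>\<omega>. (y t \<omega>)\<^sup>2) = (a t)\<^sup>2 * expectation (\<lambda>\<omega>. (\<Sum>j\<in>{0..b}. \<beta> t j * Dc (t - j) \<omega>)\<^sup>2)"
        by (simp add: y_def power_mult_distrib)
      also have "\<dots> \<le> \<alpha>\<^sup>2 * (2 * L * real (card {0..b}) * (C\<^sup>2 * 1))"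
        using EA[of t] \<alpha>0 lin second_moment_nonneg
        by (intro mult_mono) (auto simp del: card_atLeastAtMost_int simp: a_def abs_le_square_iff[symmetric])
      also have "\<dots> \<le> \<alpha>\<^sup>2 * (2 * L * (2 * b') * (C\<^sup>2 * 1))"
        using cb L1 by (intro mult_left_mono mult_right_mono) auto
      finally show ?thesis .
    qed
    from bm_centered_sum_second_moment[OF y I _ this, unfolded y0] l
    have "expectation (\<lambda>\<omega>. (f3 \<omega>)\<^sup>2) \<le> 2 * real_of_int (b + l) * N * (\<alpha>\<^sup>2 * (2 * L * (2 * b') * C\<^sup>2))"
      by (simp add: y0 f3_def y_def N_def)
    also have "\<dots> \<le> 2 * (2 * b') * N * (\<alpha>\<^sup>2 * (2 * L * (2 * b') * C\<^sup>2))"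
      using L1 by (intro mult_left_mono mult_right_mono) (auto simp: N_def L_def b'_def)
    also have "\<dots> = C\<^sup>2 * N * (16 * L * b'\<^sup>2 * \<alpha>\<^sup>2)" by (simp add: power2_eq_square)
    finally show ?thesis .
  qed
  have bd: "\<bar>\<Sum>j\<in>{0..b}. \<beta> t j * d (t - j)\<bar> \<le> 2 * b' * C * \<alpha>" for t
  proof -
    have "\<bar>\<Sum>j\<in>{0..b}. \<beta> t j * d (t - j)\<bar> \<le> (\<Sum>j\<in>{0..b}. C * \<alpha>)"
      using C ED C0 by (intro order_trans[OF sum_abs] sum_mono) (auto simp: abs_mult d_def intro!: mult_mono)
    also have "\<dots> = card {0..b} * (C * \<alpha>)" by simp
    also have "\<dots> \<le> 2 * b' * (C * \<alpha>)" using C0 \<alpha>0 by (intro mult_right_mono cb) auto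
    finally show ?thesis by simp
  qed
  have m4: "expectation (\<lambda>\<omega>. (f4 \<omega>)\<^sup>2) \<le> C\<^sup>2 * N * (8 * L * b'\<^sup>2 * \<alpha>\<^sup>2)"
  proof -
    define y where "y = (\<lambda>t \<omega>. (\<Sum>j\<in>{0..b}. \<beta> t j * d (t - j)) * Ac t \<omega>)"
    have y: "bm {t - l<..t} (y t)" for t
      unfolding y_def by (intro bm_cmult lprocD[OF pA]) auto
    have y0: "expectation (y t) = 0" for t
      unfolding y_def by (simp add: A0)
    have "expectation (\<lambda>\<omega>. (y t \<omega>)\<^sup>2) \<le> (2 * b' * C * \<alpha>)\<^sup>2 * 1" for t
    proof -
      have "expectation (\<lambda>\<omega>. (y t \<omega>)\<^sup>2) = (\<Sum>j\<in>{0..b}. \<beta> t j * d (t - j))\<^sup>2 * expectation (\<lambda>\<omega>. (Ac t \<omega>)\<^sup>2)"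
        by (simp add: y_def power_mult_distrib)
      also have "\<dots> \<le> (2 * b' * C * \<alpha>)\<^sup>2 * 1"
        using bd[of t] A2 second_moment_nonneg C0 L1 \<alpha>0
        by (intro mult_mono) (auto simp: abs_le_square_iff[symmetric])
      finally show ?thesis .
    qed
    from bm_centered_sum_second_moment[OF y I _ this, unfolded y0] l
    have "expectation (\<lambda>\<omega>. (f4 \<omega>)\<^sup>2) \<le> 2 * L * N * (2 * b' * C * \<alpha>)\<^sup>2"
      by (simp add: y0 f4_def y_def N_def L_def)
    also have "\<dots> = C\<^sup>2 * N * (8 * L * b'\<^sup>2 * \<alpha>\<^sup>2)" by (simp add: power2_eq_square)
    finally show ?thesis .
  qed
  have m5: "f5\<^sup>2 \<le> C\<^sup>2 * N * (4 * N * b'\<^sup>2 * \<alpha>^4)"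
  proof -
    have "\<bar>f5\<bar> \<le> (\<Sum>t\<in>I. \<alpha> * (2 * b' * C * \<alpha>))"
      unfolding f5_def
    proof (rule order_trans[OF sum_abs], rule sum_mono)
      fix t
      have "\<bar>\<Sum>j\<in>{0..b}. \<beta> t j * (a t * d (t - j))\<bar> = \<bar>a t\<bar> * \<bar>\<Sum>j\<in>{0..b}. \<beta> t j * d (t - j)\<bar>"
        by (simp add: abs_mult[symmetric] sum_distrib_left mult_ac)
      also have "\<dots> \<le> \<alpha> * (2 * b' * C * \<alpha>)"
        using EA bd \<alpha>0 by (intro mult_mono) (auto simp: a_def)
      finally show "\<bar>\<Sum>j\<in>{0..b}. \<beta> t j * (a t * d (t - j))\<bar> \<le> \<alpha> * (2 * b' * C * \<alpha>)" .
    qed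
    also have "\<dots> = N * (2 * b' * C * \<alpha>\<^sup>2)" by (simp add: N_def power2_eq_square)
    finally have "f5\<^sup>2 \<le> (N * (2 * b' * C * \<alpha>\<^sup>2))\<^sup>2" by (simp add: abs_le_square_iff[symmetric])
    then show ?thesis by (simp add: power_mult_distrib power2_eq_square eval_nat_numeral mult_ac)
  qed
  have bf: "bm UNIV f1" "bm UNIV f2" "bm UNIV f3" "bm UNIV f4"
    unfolding f1_def f2_def f3_def f4_def
    by (intro bm_sum bm_mult bm_diff bm_const lprocD[OF pA] lprocD[OF pD]; simp)+
  have "expectation (\<lambda>\<omega>. ((\<Sum>t\<in>I. \<Sum>j\<in>{0..b}. \<beta> t j * (A t \<omega> * D (t - j) \<omega>)) - e)\<^sup>2)
      \<le> expectation (\<lambda>\<omega>. 5 * ((f1 \<omega>)\<^sup>2 + (f2 \<omega>)\<^sup>2 + (f3 \<omega>)\<^sup>2 + (f4 \<omega>)\<^sup>2 + f5\<^sup>2))"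
    unfolding dec
    by (intro integral_mono sum5_squared_le bm_integrable[of UNIV] bm_power bm_add bm_mult bm_const bf)
  also have "\<dots> = 5 * (expectation (\<lambda>\<omega>. (f1 \<omega>)\<^sup>2) + expectation (\<lambda>\<omega>. (f2 \<omega>)\<^sup>2)
      + expectation (\<lambda>\<omega>. (f3 \<omega>)\<^sup>2) + expectation (\<lambda>\<omega>. (f4 \<omega>)\<^sup>2) + f5\<^sup>2)"
    using bf[THEN bm_power, THEN bm_integrable, of 2] by (simp add: prob_space)
  also have "\<dots> \<le> 5 * (C\<^sup>2 * N * (8 * L\<^sup>2 * b' * \<kappa>) + C\<^sup>2 * N * (96 * L^3 * \<kappa>) + C\<^sup>2 * N * (16 * L * b'\<^sup>2 * \<alpha>\<^sup>2)
      + C\<^sup>2 * N * (8 * L * b'\<^sup>2 * \<alpha>\<^sup>2) + C\<^sup>2 * N * (4 * N * b'\<^sup>2 * \<alpha>^4))"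
    using m1 m2 m3 m4 m5 by (intro mult_left_mono add_mono) auto
  also have "\<dots> = 5 * C\<^sup>2 * N * (8 * L\<^sup>2 * b' * \<kappa> + 96 * L^3 * \<kappa> + 24 * L * b'\<^sup>2 * \<alpha>\<^sup>2 + 4 * N * b'\<^sup>2 * \<alpha>^4)"
    by (simp add: algebra_simps)
  finally show ?thesis using e unfolding N_def L_def b'_def by auto
qed

end

section \<open>Characteristic functions of sums of independent blocks\<close>

text \<open>Expanding \<open>(e |x| - x^2)^2 / e\<close> shows it. The third absolute moment in the
  Taylor remainder is thereby traded for second and fourth moments, with a free parameter
  \<open>e\<close>.\<close>

lemma cube_le_young: "\<bar>x::real\<bar> ^ 3 \<le> (e * x\<^sup>2 + x ^ 4 / e) / 2" if "e > 0"
proof -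
  have "0 \<le> (e * \<bar>x\<bar> - x\<^sup>2)\<^sup>2 / e" using that by simp
  also have "\<dots> = e * x\<^sup>2 - 2 * \<bar>x\<bar> ^ 3 + x ^ 4 / e"
    using that by (simp add: field_simps power2_eq_square power3_eq_cube eval_nat_numeral)
  finally show ?thesis by simp
qed

lemma exp_minus_approx: "\<bar>exp (- y) - (1 - y)\<bar> \<le> y\<^sup>2 / 2" if "0 \<le> (y::real)"
proof -
  have 1: "1 - y \<le> exp (- y)" using exp_ge_add_one_self[of "-y"] by simp
  have "\<forall>x. 0 \<le> x \<and> x \<le> y \<longrightarrow> (\<exists>y. ((\<lambda>x. 1 - x + x\<^sup>2 / 2 - exp (- x)) has_real_derivative y) (at x) \<and> 0 \<le> y)"
  proof safe
    fix x :: real assume "0 \<le> x"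
    have "((\<lambda>x. 1 - x + x\<^sup>2 / 2 - exp (- x)) has_real_derivative (- 1 + x + exp (- x))) (at x)"
      by (auto intro!: derivative_eq_intros)
    moreover have "0 \<le> - 1 + x + exp (- x)" using exp_ge_add_one_self[of "-x"] by simp
    ultimately show "\<exists>y. ((\<lambda>x. 1 - x + x\<^sup>2 / 2 - exp (- x)) has_real_derivative y) (at x) \<and> 0 \<le> y" by blast
  qed
  then have "(\<lambda>x. 1 - x + x\<^sup>2 / 2 - exp (- x)) 0 \<le> (\<lambda>x. 1 - x + x\<^sup>2 / 2 - exp (- x)) y"
    using DERIV_nonneg_imp_nondecreasing[OF that] by blast
  then show ?thesis using 1 by simp
qed

context indep_fields
begin

lemma bm_iexp: "bm S (T :: 'a \<Rightarrow> real) \<Longrightarrow> bm S (\<lambda>\<omega>. iexp (u * T \<omega>))"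
  by (rule bmI[of _ _ 1]) (auto simp: bm_def)

lemma bm_prod:
  fixes f :: "nat \<Rightarrow> 'a \<Rightarrow> complex"
  assumes "\<And>i. i < k \<Longrightarrow> bm S (f i)" shows "bm S (\<lambda>\<omega>. \<Prod>i<k. f i \<omega>)"
  using assms by (induction k) (auto intro!: bm_const bm_mult)

lemma expectation_prod_disjoint:
  fixes f :: "nat \<Rightarrow> 'a \<Rightarrow> complex"
  assumes "\<And>i. i < k \<Longrightarrow> bm (S i) (f i)" and "\<And>i j. i < j \<Longrightarrow> j < k \<Longrightarrow> S i \<inter> S j = {}"
  shows "expectation (\<lambda>\<omega>. \<Prod>i<k. f i \<omega>) = (\<Prod>i<k. expectation (f i))"
  using assms
proof (induction k)
  case 0
  then show ?case by (simp add: prob_space)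
next
  case (Suc k)
  have "bm (\<Union>i<k. S i) (\<lambda>\<omega>. \<Prod>i<k. f i \<omega>)"
  proof (rule bm_prod)
    fix i assume "i < k"
    then show "bm (\<Union>i<k. S i) (f i)" by (intro bm_mono[OF Suc.prems(1)[of i]]) auto
  qed
  moreover have "(\<Union>i<k. S i) \<inter> S k = {}" using Suc.prems(2) by auto
  ultimately have "expectation (\<lambda>\<omega>. (\<Prod>i<k. f i \<omega>) * f k \<omega>) = expectation (\<lambda>\<omega>. \<Prod>i<k. f i \<omega>) * expectation (f k)"
    using Suc.prems(1) by (intro bm_indep[of "\<Union>i<k. S i" _ "S k"]) auto
  then show ?case using Suc by simp
qed

text \<open>The characteristic function is compared with \<open>1 - u^2 v / 2\<close> by Taylor
  expansion, with the cubic remainder estimated by \<open>cube_le_young\<close>, and this polynomial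
  with the exponential. The second comparison costs \<open>v^2\<close>, which is at most
  \<open>E T^4\<close> because the variance of \<open>T^2\<close> is nonnegative.\<close>

lemma char_block_approx:
  fixes T :: "'a \<Rightarrow> real" and v e u :: real
  assumes T: "bm S T" and T0: "expectation T = 0" and T2: "expectation (\<lambda>\<omega>. (T \<omega>)\<^sup>2) = v"
    and e: "e > 0"
  shows "norm (expectation (\<lambda>\<omega>. iexp (u * T \<omega>)) - of_real (exp (- (u\<^sup>2 * v / 2))))
    \<le> \<bar>u\<bar> ^ 3 * (e * v + expectation (\<lambda>\<omega>. T \<omega> ^ 4) / e) / 12 + u ^ 4 * expectation (\<lambda>\<omega>. T \<omega> ^ 4) / 8"
proof -
  define q where "q = expectation (\<lambda>\<omega>. T \<omega> ^ 4)"
  have v: "0 \<le> v" unfolding T2[symmetric] by (intro integral_nonneg_AE) auto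
  have vq: "v\<^sup>2 \<le> q"
  proof -
    have "0 \<le> expectation (\<lambda>\<omega>. ((T \<omega>)\<^sup>2 - v)\<^sup>2)" by (intro integral_nonneg_AE) auto
    also have "\<dots> = expectation (\<lambda>\<omega>. T \<omega> ^ 4 - 2 * v * (T \<omega>)\<^sup>2 + v\<^sup>2)"
      by (simp add: power2_eq_square algebra_simps eval_nat_numeral)
    also have "\<dots> = q - 2 * v * v + v\<^sup>2"
      using bm_integrable[OF bm_power[OF T, of 4]] bm_integrable[OF bm_power[OF T, of 2]]
      by (simp add: q_def T2 prob_space)
    finally show ?thesis by (simp add: power2_eq_square)
  qed
  have int: "integrable M T" "integrable M (\<lambda>\<omega>. (T \<omega>)\<^sup>2)" "integrable M (\<lambda>\<omega>. T \<omega> ^ 4)"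
    by (auto intro: bm_integrable[OF T] bm_integrable[OF bm_power[OF T]])
  have bc: "bm S (\<lambda>\<omega>. complex_of_real (g \<omega>))" if "bm S g" for g
    using that by (auto simp: bm_def)
  have "expectation (\<lambda>\<omega>. iexp (u * T \<omega>)) - of_real (1 - u\<^sup>2 * v / 2) =
      expectation (\<lambda>\<omega>. iexp (u * T \<omega>) - (1 + \<i> * (u * T \<omega>) - (u * T \<omega>)\<^sup>2 / 2))"
  proof -
    have "expectation (\<lambda>\<omega>. 1 + \<i> * (u * T \<omega>) - complex_of_real ((u * T \<omega>)\<^sup>2 / 2)) = of_real (1 - u\<^sup>2 * v / 2)"
      using int T0 T2 by (simp add: prob_space power_mult_distrib del: of_real_divide of_real_power)
    moreover have "integrable M (\<lambda>\<omega>. 1 + \<i> * (u * T \<omega>) - complex_of_real ((u * T \<omega>)\<^sup>2 / 2))"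
      using int by (simp add: power_mult_distrib del: of_real_divide of_real_power)
    moreover have "integrable M (\<lambda>\<omega>. iexp (u * T \<omega>))" by (intro bm_integrable[OF bm_iexp[OF T]])
    ultimately show ?thesis by simp
  qed
  also have "norm \<dots> \<le> expectation (\<lambda>\<omega>. norm (iexp (u * T \<omega>) - (1 + \<i> * (u * T \<omega>) - (u * T \<omega>)\<^sup>2 / 2)))"
    by (rule integral_norm_bound)
  also have "\<dots> \<le> expectation (\<lambda>\<omega>. \<bar>u\<bar>^3 * (e * (T \<omega>)\<^sup>2 + T \<omega> ^ 4 / e) / 12)"
  proof (rule integral_mono)
    have "integrable M (\<lambda>\<omega>. iexp (u * T \<omega>))" by (intro bm_integrable[OF bm_iexp[OF T]])
    moreover have "integrable M (\<lambda>\<omega>. 1 + \<i> * (u * T \<omega>) - complex_of_real ((u * T \<omega>)\<^sup>2 / 2))"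
      using int by (simp add: power_mult_distrib del: of_real_divide of_real_power)
    ultimately show "integrable M (\<lambda>\<omega>. norm (iexp (u * T \<omega>) - (1 + \<i> * (u * T \<omega>) - (u * T \<omega>)\<^sup>2 / 2)))"
      by (intro integrable_norm) simp
    show "integrable M (\<lambda>\<omega>. \<bar>u\<bar>^3 * (e * (T \<omega>)\<^sup>2 + T \<omega> ^ 4 / e) / 12)" using int by simp
    fix \<omega>
    have "norm (iexp (u * T \<omega>) - (1 + \<i> * (u * T \<omega>) - (u * T \<omega>)\<^sup>2 / 2)) \<le> \<bar>u * T \<omega>\<bar> ^ 3 / 6"
      using iexp_approx1[of "u * T \<omega>" 2] by (simp add: numeral_eq_Suc power2_eq_square algebra_simps)
    also have "\<dots> = \<bar>u\<bar>^3 * \<bar>T \<omega>\<bar>^3 / 6" by (simp add: abs_mult power_mult_distrib)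
    also have "\<dots> \<le> \<bar>u\<bar>^3 * ((e * (T \<omega>)\<^sup>2 + T \<omega> ^ 4 / e) / 2) / 6"
      by (intro divide_right_mono mult_left_mono cube_le_young e) auto
    finally show "norm (iexp (u * T \<omega>) - (1 + \<i> * (u * T \<omega>) - (u * T \<omega>)\<^sup>2 / 2)) \<le> \<bar>u\<bar>^3 * (e * (T \<omega>)\<^sup>2 + T \<omega> ^ 4 / e) / 12"
      by simp
  qed
  also have "\<dots> = \<bar>u\<bar> ^ 3 * (e * v + q / e) / 12" using int by (simp add: T2 q_def)
  finally have 1: "norm (expectation (\<lambda>\<omega>. iexp (u * T \<omega>)) - of_real (1 - u\<^sup>2 * v / 2)) \<le> \<bar>u\<bar> ^ 3 * (e * v + q / e) / 12" .
  have "norm (complex_of_real (1 - u\<^sup>2 * v / 2) - of_real (exp (- (u\<^sup>2 * v / 2)))) = \<bar>exp (- (u\<^sup>2 * v / 2)) - (1 - u\<^sup>2 * v / 2)\<bar>"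
    unfolding of_real_diff[symmetric] norm_of_real by (rule abs_minus_commute)
  also have "\<dots> \<le> (u\<^sup>2 * v / 2)\<^sup>2 / 2" using v by (intro exp_minus_approx) simp
  also have "\<dots> = u ^ 4 * v\<^sup>2 / 8" by (simp add: power_mult_distrib power_divide)
  also have "\<dots> \<le> u ^ 4 * q / 8" using vq by (intro divide_right_mono mult_left_mono) auto
  finally have 2: "norm (complex_of_real (1 - u\<^sup>2 * v / 2) - of_real (exp (- (u\<^sup>2 * v / 2)))) \<le> u ^ 4 * q / 8" .
  have "norm (expectation (\<lambda>\<omega>. iexp (u * T \<omega>)) - of_real (exp (- (u\<^sup>2 * v / 2)))) \<le>
      norm (expectation (\<lambda>\<omega>. iexp (u * T \<omega>)) - of_real (1 - u\<^sup>2 * v / 2)) +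
      norm (complex_of_real (1 - u\<^sup>2 * v / 2) - of_real (exp (- (u\<^sup>2 * v / 2))))"
    by (rule order_trans[OF _ norm_triangle_ineq]) (simp only: diff_add_cancel add_diff_eq)
  then show ?thesis unfolding q_def[symmetric] using 1 2 by linarith
qed

text \<open>Independence turns the characteristic function into a product, and products of numbers
  in the unit disc differ by at most the sum of the differences of their factors. Only the total
  variance \<open>k v\<close> and a bound \<open>d\<close> on the total of the fourth moments enter,
  so this is a quantitative Lyapunov theorem.\<close>

lemma char_block_sum_approx:
  fixes T :: "nat \<Rightarrow> 'a \<Rightarrow> real" and v q d u :: real
  assumes T: "\<And>i. i < k \<Longrightarrow> bm (S i) (T i)" and disj: "\<And>i j. i < j \<Longrightarrow> j < k \<Longrightarrow> S i \<inter> S j = {}"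
    and T0: "\<And>i. i < k \<Longrightarrow> expectation (T i) = 0" and T2: "\<And>i. i < k \<Longrightarrow> expectation (\<lambda>\<omega>. (T i \<omega>)\<^sup>2) = v"
    and T4: "\<And>i. i < k \<Longrightarrow> expectation (\<lambda>\<omega>. T i \<omega> ^ 4) \<le> q" and d: "d > 0" "k * q \<le> d"
  shows "norm (expectation (\<lambda>\<omega>. iexp (u * (\<Sum>i<k. T i \<omega>))) - of_real (exp (- (u\<^sup>2 * (k * v) / 2))))
    \<le> \<bar>u\<bar> ^ 3 * sqrt d * (k * v + 1) / 12 + u ^ 4 * d / 8"
proof -
  \<comment> \<open>This choice balances the two parts of the cubic remainder: \<open>e\<close> and
    \<open>d / e\<close> both equal \<open>sqrt d\<close>.\<close>
  define e where "e = sqrt d"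
  have e: "e > 0" "d / e = e" using d by (auto simp: e_def real_div_sqrt)
  have "expectation (\<lambda>\<omega>. iexp (u * (\<Sum>i<k. T i \<omega>))) = expectation (\<lambda>\<omega>. \<Prod>i<k. iexp (u * T i \<omega>))"
    by (simp add: sum_distrib_left exp_sum[symmetric])
  also have "\<dots> = (\<Prod>i<k. expectation (\<lambda>\<omega>. iexp (u * T i \<omega>)))"
    using T disj by (intro expectation_prod_disjoint[of _ S] bm_iexp) auto
  finally have prod: "expectation (\<lambda>\<omega>. iexp (u * (\<Sum>i<k. T i \<omega>))) = (\<Prod>i<k. expectation (\<lambda>\<omega>. iexp (u * T i \<omega>)))" .
  have ex: "complex_of_real (exp (- (u\<^sup>2 * (k * v) / 2))) = (\<Prod>i<k. of_real (exp (- (u\<^sup>2 * v / 2))))"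
    by (simp add: exp_of_nat_mult[symmetric] mult_ac flip: of_real_power)
  show ?thesis
  proof (cases "k = 0")
    case True
    then show ?thesis using d by (simp add: prob_space)
  next
    case False
    then have v: "0 \<le> v" using T2[of 0] second_moment_nonneg[of "T 0"] by simp
    have "norm ((\<Prod>i<k. expectation (\<lambda>\<omega>. iexp (u * T i \<omega>))) - (\<Prod>i<k. complex_of_real (exp (- (u\<^sup>2 * v / 2)))))
      \<le> (\<Sum>i<k. norm (expectation (\<lambda>\<omega>. iexp (u * T i \<omega>)) - complex_of_real (exp (- (u\<^sup>2 * v / 2)))))"
    proof (rule norm_prod_diff)
      fix i assume "i \<in> {..<k}"
      have "norm (expectation (\<lambda>\<omega>. iexp (u * T i \<omega>))) \<le> expectation (\<lambda>\<omega>. norm (iexp (u * T i \<omega>)))"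
        by (rule integral_norm_bound)
      then show "norm (expectation (\<lambda>\<omega>. iexp (u * T i \<omega>))) \<le> 1" by (simp add: prob_space)
      show "norm (complex_of_real (exp (- (u\<^sup>2 * v / 2)))) \<le> 1" using v by simp
    qed
    also have "\<dots> \<le> (\<Sum>i<k. \<bar>u\<bar> ^ 3 * (e * v + q / e) / 12 + u ^ 4 * q / 8)"
    proof (rule sum_mono)
      fix i assume "i \<in> {..<k}"
      then have i: "i < k" by simp
      have "norm (expectation (\<lambda>\<omega>. iexp (u * T i \<omega>)) - complex_of_real (exp (- (u\<^sup>2 * v / 2)))) \<le>
        \<bar>u\<bar> ^ 3 * (e * v + expectation (\<lambda>\<omega>. T i \<omega> ^ 4) / e) / 12 + u ^ 4 * expectation (\<lambda>\<omega>. T i \<omega> ^ 4) / 8"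
        by (rule char_block_approx[OF T[OF i] T0[OF i] T2[OF i] e(1)])
      also have "\<dots> \<le> \<bar>u\<bar> ^ 3 * (e * v + q / e) / 12 + u ^ 4 * q / 8"
        using T4[OF i] e by (intro add_mono divide_right_mono mult_left_mono) auto
      finally show "norm (expectation (\<lambda>\<omega>. iexp (u * T i \<omega>)) - complex_of_real (exp (- (u\<^sup>2 * v / 2)))) \<le>
        \<bar>u\<bar> ^ 3 * (e * v + q / e) / 12 + u ^ 4 * q / 8" .
    qed
    also have "\<dots> = \<bar>u\<bar> ^ 3 * (e * (k * v) + (k * q) / e) / 12 + u ^ 4 * (k * q) / 8"
      by (simp add: field_simps)
    also have "\<dots> \<le> \<bar>u\<bar> ^ 3 * (e * (k * v) + d / e) / 12 + u ^ 4 * d / 8"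
      using d(2) e by (intro add_mono divide_right_mono mult_left_mono) auto
    also have "\<dots> = \<bar>u\<bar> ^ 3 * sqrt d * (k * v + 1) / 12 + u ^ 4 * d / 8"
      unfolding e(2) by (simp add: e_def algebra_simps)
    finally show ?thesis unfolding prod ex .
  qed
qed

end

section \<open>Moments of a block of large-lag products\<close>

text \<open>Substituting \<open>e = k + x\<close> moves the dependence on \<open>x\<close> from the
  range of the finitely supported \<open>c\<close> into a membership test, so that sums for
  different \<open>x\<close> run over one common set \<open>R\<close> and can be
  interchanged.\<close>

lemma sum_shift_support:
  fixes c g :: "int \<Rightarrow> real"
  assumes "finite J" "finite R" "\<And>x. x \<notin> R \<Longrightarrow> c x = 0"
  shows "(\<Sum>k\<in>J. g k * c (k + x)) = (\<Sum>e\<in>R. (if e - x \<in> J then g (e - x) else 0) * c e)"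
proof -
  have "(\<Sum>k\<in>J. g k * c (k + x)) = (\<Sum>k\<in>{k\<in>J. k + x \<in> R}. g k * c (k + x))"
    using assms by (intro sum.mono_neutral_right) auto
  also have "\<dots> = (\<Sum>e\<in>{e\<in>R. e - x \<in> J}. g (e - x) * c e)"
    by (rule sum.reindex_bij_witness[of _ "\<lambda>e. e - x" "\<lambda>k. k + x"]) auto
  also have "\<dots> = (\<Sum>e\<in>R. (if e - x \<in> J then g (e - x) else 0) * c e)"
    using assms(2) by (intro sum.mono_neutral_cong_left) auto
  finally show ?thesis .
qed

definition autocorr :: "(int \<Rightarrow> real) \<Rightarrow> int set \<Rightarrow> int \<Rightarrow> real" where
  "autocorr \<alpha> J d = (\<Sum>j\<in>J. if j - d \<in> J then \<alpha> j * \<alpha> (j - d) else 0)"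

text \<open>The variance of a block of length \<open>K\<close>. \<open>K - |u|\<close> counts the
  ordered pairs of times with difference \<open>u\<close>, \<open>c u\<close> is the autocovariance
  of the current factor, and the inner sum is that of the lagged linear form: the convolution of
  \<open>c\<close> with the autocorrelation of the weights. In this shape limits can be taken term
  by term.\<close>

definition block_var :: "(int \<Rightarrow> real) \<Rightarrow> (int \<Rightarrow> real) \<Rightarrow> int \<Rightarrow> int set \<Rightarrow> int \<Rightarrow> real" where
  "block_var c \<alpha> l J K = (\<Sum>u\<in>{-l<..<l}. (real_of_int (K - \<bar>u\<bar>)) * c u *
     (\<Sum>e\<in>{-l<..<l}. c e * autocorr \<alpha> J (u - e)))"

context indep_fields
begin

text \<open>By \<open>eta_covariance\<close> the products \<open>Z t * W t\<close> have
  autocovariance \<open>c * \<gamma>\<close>, where \<open>\<gamma>\<close> is the autocovariance of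
  \<open>W\<close>. The value is exact and does not depend on the starting point \<open>a\<close>,
  which gives all blocks a common variance.\<close>

lemma block_second_moment:
  fixes \<alpha> c :: "int \<Rightarrow> real" and l b a K :: int
  assumes Z: "lproc l Z" and Z0: "\<And>t. expectation (Z t) = 0"
    and c: "\<And>t s. expectation (\<lambda>\<omega>. Z t \<omega> * Z s \<omega>) = c (t - s)"
    and l: "l \<ge> 1" and K: "l \<le> K"
  defines "W \<equiv> \<lambda>t \<omega>. \<Sum>j\<in>{2*l..b}. \<alpha> j * Z (t - j) \<omega>"
  shows "expectation (\<lambda>\<omega>. (\<Sum>t\<in>{a+1..a+K}. Z t \<omega> * W t \<omega>)\<^sup>2) = block_var c \<alpha> l {2*l..b} K"
proof -
  define R where "R = {-l<..<l}"
  define J where "J = {2*l..b}"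
  define I where "I = {a+1..a+K}"
  have fin: "finite R" "finite J" "finite I" by (auto simp: R_def J_def I_def)
  have cR: "c x = 0" if "x \<notin> R" for x
    using lproc_cov_zero[OF Z Z, of x 0] Z0 c[of x 0] that by (auto simp: R_def)
  have csym: "c (- x) = c x" for x
    using c[of 0 x] c[of x 0] by (simp add: mult.commute)
  define \<gamma> where "\<gamma> = (\<lambda>u. \<Sum>j\<in>J. \<Sum>k\<in>J. \<alpha> j * \<alpha> k * c (u - j + k))"
  have gam: "\<gamma> u = (\<Sum>e\<in>R. c e * autocorr \<alpha> J (u - e))" for u
  proof -
    have "\<gamma> u = (\<Sum>j\<in>J. \<alpha> j * (\<Sum>k\<in>J. \<alpha> k * c (k + (u - j))))"
      unfolding \<gamma>_def by (simp add: sum_distrib_left mult.assoc algebra_simps)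
    also have "\<dots> = (\<Sum>j\<in>J. \<alpha> j * (\<Sum>e\<in>R. (if e - (u - j) \<in> J then \<alpha> (e - (u - j)) else 0) * c e))"
      using fin cR by (simp add: sum_shift_support)
    also have "\<dots> = (\<Sum>e\<in>R. c e * autocorr \<alpha> J (u - e))"
      unfolding autocorr_def sum_distrib_left
      by (subst sum.swap) (intro sum.cong refl, auto simp: algebra_simps)
    finally show ?thesis .
  qed
  have WW: "expectation (\<lambda>\<omega>. W t \<omega> * W s \<omega>) = \<gamma> (t - s)" for t s
  proof -
    have int: "integrable M (\<lambda>\<omega>. \<alpha> i * Z (t - i) \<omega> * (\<alpha> j * Z (s - j) \<omega>))" for i j
      by (intro bm_integrable[of UNIV] bm_mult bm_const lprocD[OF Z]) auto
    have "expectation (\<lambda>\<omega>. W t \<omega> * W s \<omega>) =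
        (\<Sum>i\<in>J. \<Sum>j\<in>J. expectation (\<lambda>\<omega>. (\<alpha> i * Z (t - i) \<omega>) * (\<alpha> j * Z (s - j) \<omega>)))"
      unfolding W_def J_def sum_product using int by (simp add: Bochner_Integration.integral_sum)
    also have "\<dots> = (\<Sum>i\<in>J. \<Sum>j\<in>J. \<alpha> i * \<alpha> j * expectation (\<lambda>\<omega>. Z (t - i) \<omega> * Z (s - j) \<omega>))"
      by (intro sum.cong refl) (subst integral_mult_right_zero[symmetric], simp add: mult_ac)
    also have "\<dots> = \<gamma> (t - s)" unfolding \<gamma>_def c by (simp add: algebra_simps)
    finally show ?thesis .
  qed
  define h where "h = (\<lambda>u. c u * \<gamma> u)"
  have hR: "h (- x) = 0" if "x \<notin> R" for x using cR[of "-x"] that by (auto simp: h_def R_def)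
  have eta: "expectation (\<lambda>\<omega>. (Z t \<omega> * W t \<omega>) * (Z s \<omega> * W s \<omega>)) = h (t - s)" for t s
    using eta_covariance[where \<beta>="\<lambda>_. \<alpha>", OF Z Z Z0 l order_refl, of t b s] unfolding c WW[symmetric] h_def
    by (simp add: W_def)
  have bW: "bm UNIV (W t)" for t unfolding W_def by (intro bm_sum bm_cmult lprocD[OF Z]) auto
  have int: "integrable M (\<lambda>\<omega>. (Z t \<omega> * W t \<omega>) * (Z s \<omega> * W s \<omega>))" for t s
    by (intro bm_integrable[of UNIV] bm_mult bW lprocD[OF Z]) auto
  have "expectation (\<lambda>\<omega>. (\<Sum>t\<in>I. Z t \<omega> * W t \<omega>)\<^sup>2) = (\<Sum>t\<in>I. \<Sum>s\<in>I. expectation (\<lambda>\<omega>. (Z t \<omega> * W t \<omega>) * (Z s \<omega> * W s \<omega>)))"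
    unfolding power2_eq_square sum_product using int by (simp add: Bochner_Integration.integral_sum)
  also have "\<dots> = (\<Sum>t\<in>I. \<Sum>s\<in>I. 1 * (\<lambda>y. h (- y)) (s + (- t)))"
    unfolding eta by simp
  also have "\<dots> = (\<Sum>t\<in>I. \<Sum>e\<in>R. (if e - (- t) \<in> I then 1 else 0) * h (- e))"
    using fin hR by (intro sum.cong refl sum_shift_support) auto
  also have "\<dots> = (\<Sum>e\<in>R. (\<Sum>t\<in>I. if e + t \<in> I then 1 else 0) * h (- e))"
    by (subst sum.swap) (simp add: sum_distrib_right)
  also have "\<dots> = (\<Sum>e\<in>R. real_of_int (K - \<bar>e\<bar>) * h (- e))"
  proof (intro sum.cong refl arg_cong2[where f="(*)"])
    fix e assume e: "e \<in> R"
    have "(\<Sum>t\<in>I. if e + t \<in> I then 1 else (0::real)) = card {t\<in>I. e + t \<in> I}"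
      using fin by (simp add: sum.If_cases Int_def)
    \<comment> \<open>The interval and its shift overlap in \<open>K - |e|\<close> points;
      \<open>l \<le> K\<close> keeps this count nonnegative for every \<open>e\<close> in
      \<open>R\<close>.\<close>
    also have "{t\<in>I. e + t \<in> I} = {max (a+1) (a+1-e)..min (a+K) (a+K-e)}" by (auto simp: I_def)
    also have "real (card \<dots>) = real_of_int (K - \<bar>e\<bar>)" using e K by (auto simp: R_def)
    finally show "(\<Sum>t\<in>I. if e + t \<in> I then 1 else 0) = real_of_int (K - \<bar>e\<bar>)" .
  qed
  also have "\<dots> = (\<Sum>e\<in>R. real_of_int (K - \<bar>e\<bar>) * h e)"
    by (rule sum.reindex_bij_witness[of _ uminus uminus]) (auto simp: R_def)
  also have "\<dots> = block_var c \<alpha> l {2*l..b} K"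
    unfolding block_var_def h_def gam R_def[symmetric] J_def[symmetric] by (simp add: mult.assoc)
  finally show ?thesis by (simp add: I_def)
qed

text \<open>\<open>dep_sum_fourth\<close> is used twice: for \<open>W t\<close>, a sum of terms with
  window \<open>l\<close>, and then for the sum of the \<open>Z t * W t\<close>, whose window is
  \<open>b + l\<close>. In between, moments of \<open>Z t * W t\<close> factor because the lags
  start at \<open>2 l\<close>. The last claim locates the innovations of a block and later yields
  independence of blocks.\<close>

lemma block_fourth_moment:
  fixes \<alpha> :: "int \<Rightarrow> real" and l b a :: int and P :: nat and C :: real
  assumes Z: "lproc l Z" and Z0: "\<And>t. expectation (Z t) = 0"
    and Z1: "\<And>t \<omega>. \<omega> \<in> space M \<Longrightarrow> \<bar>Z t \<omega>\<bar> \<le> 1"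
    and \<alpha>: "\<And>j. \<bar>\<alpha> j\<bar> \<le> C" and l: "l \<ge> 1" "2 * l \<le> b" and I: "I \<subseteq> {a..<a + int P}"
  defines "W \<equiv> \<lambda>t \<omega>. \<Sum>j\<in>{2*l..b}. \<alpha> j * Z (t - j) \<omega>"
  shows "expectation (\<lambda>\<omega>. (\<Sum>t\<in>I. Z t \<omega> * W t \<omega>)^4) \<le>
    3 * (real_of_int (b + l))\<^sup>2 * (real P + 2 * real_of_int (b + l))\<^sup>2 * (2 * real_of_int l * real_of_int (b + 1 + 2 * l) * C\<^sup>2)\<^sup>2"
    and "expectation (\<lambda>\<omega>. \<Sum>t\<in>I. Z t \<omega> * W t \<omega>) = 0"
    and "{a - b - l..<a + int P} \<subseteq> S \<Longrightarrow> bm S (\<lambda>\<omega>. \<Sum>t\<in>I. Z t \<omega> * W t \<omega>)"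
proof -
  have bZ: "bm UNIV (Z t)" for t by (rule lprocD[OF Z]) auto
  have bW: "bm {t - b - l<..t - 2 * l} (W t)" for t
    unfolding W_def by (intro bm_sum bm_cmult lprocD[OF Z]) auto
  have pow: "expectation (\<lambda>\<omega>. Z t \<omega> ^ i * W t \<omega> ^ i) = expectation (\<lambda>\<omega>. Z t \<omega> ^ i) * expectation (\<lambda>\<omega>. W t \<omega> ^ i)" for t i
    using l by (intro bm_indep[OF bm_power[OF lprocD[OF Z order_refl]] bm_power[OF bW]]) auto
  have Zp: "expectation (\<lambda>\<omega>. Z t \<omega> ^ i) \<le> 1" for t i
  proof (intro integral_le_const bm_integrable[OF bm_power[OF bZ]] AE_I2)
    fix \<omega> assume "\<omega> \<in> space M"
    have "Z t \<omega> ^ i \<le> \<bar>Z t \<omega>\<bar> ^ i" by (metis abs_ge_self power_abs)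
    also have "\<dots> \<le> 1" using Z1[OF \<open>\<omega> \<in> space M\<close>] by (intro power_le_one) auto
    finally show "Z t \<omega> ^ i \<le> 1" .
  qed
  \<comment> \<open>Chosen so that one number serves both moments of \<open>W\<close>, as
    \<open>dep_sum_fourth\<close> demands bounds \<open>K\<close> and \<open>K^2\<close>: its square
    is the fourth moment bound with the factor 3 enlarged to 4.\<close>
  define \<kappa> where "\<kappa> = 2 * real_of_int l * real_of_int (b + 1 + 2 * l) * C\<^sup>2"
  have \<kappa>: "0 \<le> \<kappa>" using l by (simp add: \<kappa>_def)
  have W2: "expectation (\<lambda>\<omega>. W t \<omega> ^ 2) \<le> \<kappa>" for t
  proof -
    have "expectation (\<lambda>\<omega>. W t \<omega> ^ 2) \<le> 2 * real_of_int l * real (card {2*l..b}) * (C\<^sup>2 * 1)"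
      unfolding W_def by (rule lin_second_moment[OF Z Z0 Zp finite_atLeastAtMost_int \<alpha> l(1)])
    also have "\<dots> \<le> 2 * real_of_int l * real_of_int (b + 1 + 2 * l) * (C\<^sup>2 * 1)"
      using l by (intro mult_right_mono mult_left_mono) auto
    finally show ?thesis by (simp add: \<kappa>_def)
  qed
  have W4: "expectation (\<lambda>\<omega>. W t \<omega> ^ 4) \<le> \<kappa>\<^sup>2" for t
  proof -
    define y where "y = (\<lambda>s \<omega>. \<alpha> (t - s) * Z s \<omega>)"
    have W: "W t \<omega> = (\<Sum>s\<in>{t - b..t - 2*l}. y s \<omega>)" for \<omega>
      unfolding W_def y_def by (rule sum.reindex_bij_witness[of _ "\<lambda>s. t - s" "\<lambda>s. t - s"]) auto
    have y1: "\<bar>y s \<omega>\<bar> \<le> C" if "\<omega> \<in> space M" for s \<omega>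
      using mult_mono[OF \<alpha>[of "t - s"] Z1[OF that, of s]] \<alpha>[of 0] by (simp add: y_def abs_mult)
    have by': "bm {s - l<..s} (y s)" for s
      unfolding y_def by (intro bm_cmult lprocD[OF Z order_refl])
    have yp: "expectation (\<lambda>\<omega>. y s \<omega> ^ i) \<le> C ^ i" for s i
    proof (intro integral_le_const bm_integrable[OF bm_power[OF by']] AE_I2)
      fix \<omega> assume "\<omega> \<in> space M"
      have "y s \<omega> ^ i \<le> \<bar>y s \<omega>\<bar> ^ i" by (metis abs_ge_self power_abs)
      also have "\<dots> \<le> C ^ i" using y1[OF \<open>\<omega> \<in> space M\<close>] by (intro power_mono) auto
      finally show "y s \<omega> ^ i \<le> C ^ i" .
    qed
    have "expectation (\<lambda>\<omega>. (\<Sum>s\<in>{t - b..t - 2*l}. y s \<omega>) ^ 4)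
      \<le> 3 * (real_of_int l)\<^sup>2 * (real (nat (b + 1)) + 2 * real_of_int l)\<^sup>2 * (C\<^sup>2)\<^sup>2"
    proof (rule dep_sum_fourth[where u="t - b"])
      show "expectation (\<lambda>\<omega>. y s \<omega> ^ 4) \<le> (C\<^sup>2)\<^sup>2" for s using yp[of s 4] by simp
      show "expectation (y s) = 0" for s by (simp add: y_def Z0)
    qed (use l by' yp in auto)
    also have "\<dots> \<le> 4 * (real_of_int l)\<^sup>2 * (real (nat (b + 1)) + 2 * real_of_int l)\<^sup>2 * (C\<^sup>2)\<^sup>2"
      by (intro mult_right_mono) auto
    also have "\<dots> = \<kappa>\<^sup>2"
      using l by (simp add: \<kappa>_def power_mult_distrib)
    finally show ?thesis unfolding W .
  qed
  have by': "bm {t - (b + l)<..t} (\<lambda>\<omega>. Z t \<omega> * W t \<omega>)" for t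
    using l by (intro bm_mult lprocD[OF Z] bm_mono[OF bW]) auto
  have y0: "expectation (\<lambda>\<omega>. Z t \<omega> * W t \<omega>) = 0" for t
    using pow[of t 1] Z0 by simp
  have yp: "expectation (\<lambda>\<omega>. (Z t \<omega> * W t \<omega>) ^ i) \<le> q"
    if "expectation (\<lambda>\<omega>. W t \<omega> ^ i) \<le> q" "even i" for t i q
  proof -
    have "expectation (\<lambda>\<omega>. (Z t \<omega> * W t \<omega>) ^ i) = expectation (\<lambda>\<omega>. Z t \<omega> ^ i) * expectation (\<lambda>\<omega>. W t \<omega> ^ i)"
      unfolding power_mult_distrib pow ..
    also have "\<dots> \<le> 1 * q"
      using that Zp by (intro mult_mono) (auto intro!: integral_nonneg_AE simp: zero_le_even_power)
    finally show ?thesis by simp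
  qed
  show "expectation (\<lambda>\<omega>. (\<Sum>t\<in>I. Z t \<omega> * W t \<omega>)^4) \<le>
    3 * (real_of_int (b + l))\<^sup>2 * (real P + 2 * real_of_int (b + l))\<^sup>2 * (2 * real_of_int l * real_of_int (b + 1 + 2 * l) * C\<^sup>2)\<^sup>2"
    unfolding \<kappa>_def[symmetric]
    using l I by (intro dep_sum_fourth[OF \<kappa> _ I by' y0 yp[OF W2] yp[OF W4]]) auto
  show "expectation (\<lambda>\<omega>. \<Sum>t\<in>I. Z t \<omega> * W t \<omega>) = 0"
    using y0 by (subst Bochner_Integration.integral_sum) (auto intro: bm_integrable[OF by'])
  show "bm S (\<lambda>\<omega>. \<Sum>t\<in>I. Z t \<omega> * W t \<omega>)" if "{a - b - l..<a + int P} \<subseteq> S"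
  proof (rule bm_sum)
    fix t assume "t \<in> I"
    then have "{t - (b + l)<..t} \<subseteq> S" using I that by fastforce
    then show "bm S (\<lambda>\<omega>. Z t \<omega> * W t \<omega>)" by (rule bm_mono[OF by'])
  qed
qed

end

section \<open>Riemann sums of the lag window\<close>

text \<open>Dominated convergence for series over the integers, obtained by reading them as
  integrals over the counting measure. Since the domination holds only eventually, the sequence is
  shifted by \<open>n0\<close>.\<close>

lemma int_tannery:
  fixes f :: "nat \<Rightarrow> int \<Rightarrow> real"
  assumes w: "w summable_on UNIV"
    and bd: "eventually (\<lambda>n. \<forall>u. \<bar>f n u\<bar> \<le> w u) sequentially"
    and lim: "\<And>u. (\<lambda>n. f n u) \<longlonglongrightarrow> g u"
  shows "(\<lambda>n. infsum (f n) UNIV) \<longlonglongrightarrow> infsum g UNIV"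
proof -
  obtain n0 where n0: "\<And>n u. n \<ge> n0 \<Longrightarrow> \<bar>f n u\<bar> \<le> w u"
    using bd by (auto simp: eventually_sequentially)
  have w0: "0 \<le> w u" for u using n0[OF order_refl, of u] by linarith
  have wi: "integrable (count_space UNIV) w"
    using w w0 by (subst abs_summable_on_def[symmetric], subst abs_summable_equivalent[symmetric]) simp
  have gb: "\<bar>g u\<bar> \<le> w u" for u
    by (rule tendsto_upperbound[OF tendsto_rabs[OF lim]]) (auto simp: eventually_sequentially intro!: exI[of _ n0] n0)
  have eq: "infsum h UNIV = integral\<^sup>L (count_space UNIV) h" if "\<And>u. \<bar>h u\<bar> \<le> w u" for h :: "int \<Rightarrow> real"
  proof -
    have "integrable (count_space UNIV) h"
      by (rule Bochner_Integration.integrable_bound[OF wi]) (auto intro!: AE_I2 order_trans[OF that])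
    then have "Infinite_Set_Sum.abs_summable_on h UNIV" by (simp add: abs_summable_on_def)
    from infsetsum_infsum[OF this] show ?thesis by (simp add: infsetsum_def)
  qed
  have "(\<lambda>n. integral\<^sup>L (count_space UNIV) (f (n + n0))) \<longlonglongrightarrow> integral\<^sup>L (count_space UNIV) g"
    by (rule integral_dominated_convergence[OF _ _ wi])
       (auto intro!: AE_I2 n0 LIMSEQ_ignore_initial_segment[OF lim])
  then have "(\<lambda>n. infsum (f (n + n0)) UNIV) \<longlonglongrightarrow> infsum g UNIV"
    using eq[of g] gb eq[of "f (_ + n0)"] n0 by simp
  then show ?thesis by (rule LIMSEQ_offset)
qed

lemma geometric_int_summable:
  fixes \<theta> :: real
  assumes "0 \<le> \<theta>" "\<theta> < 1"
  shows "(\<lambda>u::int. C * \<theta> ^ nat \<bar>u\<bar>) summable_on UNIV"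
proof -
  have nat: "(\<lambda>n::nat. \<theta> ^ n) summable_on UNIV"
    using assms by (intro norm_summable_imp_summable_on) (simp add: summable_geometric)
  have "(\<lambda>u::int. \<theta> ^ nat \<bar>u\<bar>) summable_on range int"
    using nat by (subst summable_on_reindex) (auto simp: o_def)
  moreover have "(\<lambda>u::int. \<theta> ^ nat \<bar>u\<bar>) summable_on range (\<lambda>n. - int n)"
    using nat by (subst summable_on_reindex) (auto simp: o_def inj_def)
  ultimately have "(\<lambda>u::int. \<theta> ^ nat \<bar>u\<bar>) summable_on (range int \<union> range (\<lambda>n. - int n))"
    by (rule summable_on_union)
  moreover have "range int \<union> range (\<lambda>n. - int n) = UNIV"
    by (auto simp: image_iff) (metis int_cases2)
  ultimately show ?thesis by (intro summable_on_cmult_right) simp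
qed

lemma riemann_sum_lipschitz:
  fixes f :: "real \<Rightarrow> real"
  assumes f: "K-lipschitz_on UNIV f" and B: "B > 0"
  shows "\<bar>(\<Sum>j<n. f (real j / B)) / B - integral {0..real n / B} f\<bar> \<le> real n * K / B\<^sup>2"
proof (induction n)
  case (Suc n)
  define a where "a = real n / B"
  have a: "0 \<le> a" "real (Suc n) / B = a + 1 / B" using B by (auto simp: a_def field_simps)
  have cont: "continuous_on S f" for S using lipschitz_on_continuous_on[OF f] continuous_on_subset by blast
  have int: "f integrable_on {x..y}" for x y by (intro integrable_continuous_real cont)
  have "integral {a..a + 1/B} (\<lambda>x. f a - f x) = f a / B - integral {a..a+1/B} f"
    using B by (subst Henstock_Kurzweil_Integration.integral_diff[OF _ int]) auto
  moreover have "norm (integral {a..a + 1/B} (\<lambda>x. f a - f x)) \<le> (K / B) * (a + 1/B - a)"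
  proof (rule integral_bound)
    fix t assume t: "t \<in> {a..a + 1/B}"
    have "norm (f a - f t) \<le> K * dist a t" using lipschitz_onD[OF f, of a t] by (simp add: dist_norm)
    also have "\<dots> \<le> K * (1 / B)"
      using t lipschitz_on_nonneg[OF f] by (intro mult_left_mono) (auto simp: dist_real_def)
    finally show "norm (f a - f t) \<le> K / B" by simp
  qed (use B in \<open>auto intro!: continuous_intros cont\<close>)
  ultimately have 1: "\<bar>f a / B - integral {a..a+1/B} f\<bar> \<le> K / B\<^sup>2" by (simp add: power2_eq_square)
  have "integral {0..a} f + integral {a..a+1/B} f = integral {0..a+1/B} f"
    using a B by (intro Henstock_Kurzweil_Integration.integral_combine int) auto
  moreover have "(\<Sum>j<Suc n. f (real j / B)) / B = (\<Sum>j<n. f (real j / B)) / B + f a / B"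
    by (simp add: a_def add_divide_distrib)
  moreover have "real (Suc n) * K / B\<^sup>2 = real n * K / B\<^sup>2 + K / B\<^sup>2"
    by (simp add: add_divide_distrib[symmetric] algebra_simps)
  ultimately show ?case using Suc 1 unfolding a(2) a_def[symmetric] by linarith
qed simp

text \<open>Summation by parts: \<open>2 sin x cos ((2 j - d) x)\<close> is a telescoping difference
  of the bounded \<open>s j\<close>, and the increments of the sampled \<open>f\<close> are at most
  \<open>K / B\<close>. Keeping the factor \<open>2 sin x\<close> on the left avoids a division
  where it vanishes.\<close>

lemma oscillating_sum_lipschitz:
  fixes f :: "real \<Rightarrow> real"
  assumes f: "K-lipschitz_on UNIV f" and B: "B > 0" and C: "\<And>x. \<bar>f x\<bar> \<le> C"
  shows "\<bar>(\<Sum>j<n. f (real j / B) * cos ((2 * real j - d) * x)) * (2 * sin x)\<bar> \<le> 2 * C + real n * K / B"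
proof -
  define s where "s = (\<lambda>j::nat. sin ((2 * real j - 1 - d) * x))"
  have K: "0 \<le> K" using lipschitz_on_nonneg[OF f] .
  have id: "2 * sin x * cos ((2 * real j - d) * x) = s (Suc j) - s j" for j
  proof -
    have "s (Suc j) = sin ((2 * real j - d) * x + x)" "s j = sin ((2 * real j - d) * x - x)"
      by (auto simp: s_def algebra_simps)
    then show ?thesis by (simp add: sin_add sin_diff)
  qed
  have eq: "(\<Sum>j<n. f (real j / B) * cos ((2 * real j - d) * x)) * (2 * sin x) =
     f (real n / B) * s n - f 0 * s 0 - (\<Sum>j<n. (f (real (Suc j) / B) - f (real j / B)) * s (Suc j))" for n
  proof (induction n)
    case (Suc n)
    have "f (real n / B) * cos ((2 * real n - d) * x) * (2 * sin x) = f (real n / B) * (s (Suc n) - s n)"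
      unfolding id[symmetric] by simp
    with Suc show ?case by (simp add: algebra_simps)
  qed simp
  have s1: "\<bar>s j\<bar> \<le> 1" for j by (simp add: s_def)
  have "\<bar>\<Sum>j<n. (f (real (Suc j) / B) - f (real j / B)) * s (Suc j)\<bar> \<le> (\<Sum>j<n. K / B * 1)"
  proof (rule order_trans[OF sum_abs], rule sum_mono)
    fix j
    have "\<bar>f (real (Suc j) / B) - f (real j / B)\<bar> \<le> K * dist (real (Suc j) / B) (real j / B)"
      using lipschitz_onD[OF f, of "real (Suc j) / B" "real j / B"] by (simp add: dist_real_def)
    also have "dist (real (Suc j) / B) (real j / B) = 1 / B"
      using B by (simp add: dist_real_def diff_divide_distrib[symmetric])
    finally show "\<bar>(f (real (Suc j) / B) - f (real j / B)) * s (Suc j)\<bar> \<le> K / B * 1"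
      unfolding abs_mult using s1 K B by (intro mult_mono) auto
  qed
  moreover have "\<bar>f (real n / B) * s n\<bar> \<le> C * 1" "\<bar>f 0 * s 0\<bar> \<le> C * 1"
    unfolding abs_mult using C s1 by (intro mult_mono; force intro: order_trans[OF abs_ge_zero C])+
  ultimately show ?thesis unfolding eq by simp
qed

lemma sum_int_atLeastAtMost_nat: "(\<Sum>j\<in>{0..b::int}. g j) = (\<Sum>j<nat (b + 1). g (int j))"
  by (rule sum.reindex_bij_witness[of _ int nat]) auto

lemma hfun_twice: "hfun (2 * x) = (if sin x = 0 then 1 else 0)"
proof -
  have "(\<exists>k::int. 2 * x = 2 * pi * real_of_int k) \<longleftrightarrow> sin x = 0"
    by (simp add: sin_zero_iff_int2 mult.commute mult.left_commute)
  then show ?thesis by (simp add: hfun_def)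
qed

lemma cos_twice_shift: 
  assumes "sin x = 0" shows "cos ((2 * real_of_int j - d) * x) = cos (d * x)"
proof -
  obtain k :: int where k: "x = of_int k * pi" using assms by (auto simp: sin_zero_iff_int2)
  have "cos ((2 * real_of_int j - d) * x) = cos (- (d * x) + 2 * pi * of_int (j * k))"
    unfolding k by (simp add: algebra_simps)
  also have "\<dots> = cos (- (d * x))" by (simp only: cos_add cos_int_2pin sin_int_2pin mult_1_right mult_zero_right diff_zero)
  finally show ?thesis by simp
qed

locale lag_window =
  fixes w :: "real \<Rightarrow> real" and Lw Cw :: real
  assumes w_lipschitz: "Lw-lipschitz_on UNIV w"
    and w_bound: "\<And>x. \<bar>w x\<bar> \<le> Cw"
    and w_outside: "\<And>x. \<bar>x\<bar> \<ge> 1 \<Longrightarrow> w x = 0"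
begin

lemma Cw_nonneg: "0 \<le> Cw" using w_bound[of 0] by linarith

lemma Lw_nonneg: "0 \<le> Lw" using lipschitz_on_nonneg[OF w_lipschitz] .

lemma w_lip: "\<bar>w x - w y\<bar> \<le> Lw * \<bar>x - y\<bar>"
  using lipschitz_onD[OF w_lipschitz, of x y] by (simp add: dist_real_def)

lemma w2_lipschitz: "(2 * Cw * Lw)-lipschitz_on UNIV (\<lambda>x. (w x)\<^sup>2)"
proof (rule lipschitz_onI)
  fix x y
  have "(w x)\<^sup>2 - (w y)\<^sup>2 = (w x + w y) * (w x - w y)" by (simp add: power2_eq_square algebra_simps)
  then have "\<bar>(w x)\<^sup>2 - (w y)\<^sup>2\<bar> = \<bar>w x + w y\<bar> * \<bar>w x - w y\<bar>" by (simp add: abs_mult)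
  also have "\<dots> \<le> (2 * Cw) * (Lw * \<bar>x - y\<bar>)"
    using w_bound[of x] w_bound[of y] w_lip[of x y] Cw_nonneg by (intro mult_mono) auto
  finally show "dist ((w x)\<^sup>2) ((w y)\<^sup>2) \<le> 2 * Cw * Lw * dist x y" by (simp add: dist_real_def)
qed (use Cw_nonneg Lw_nonneg in auto)

lemma w2_bound: "\<bar>(w x)\<^sup>2\<bar> \<le> Cw\<^sup>2"
  using w_bound[of x] by (simp add: abs_le_square_iff[symmetric])

lemma integral_w2_beyond: assumes "y \<ge> 1" shows "integral {0..y} (\<lambda>x. (w x)\<^sup>2) = integral {0..1} (\<lambda>x. (w x)\<^sup>2)"
proof -
  have cont: "continuous_on S (\<lambda>x. (w x)\<^sup>2)" for S
    using lipschitz_on_continuous_on[OF w2_lipschitz] continuous_on_subset by blast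
  have "integral {0..1} (\<lambda>x. (w x)\<^sup>2) + integral {1..y} (\<lambda>x. (w x)\<^sup>2) = integral {0..y} (\<lambda>x. (w x)\<^sup>2)"
    using assms by (intro Henstock_Kurzweil_Integration.integral_combine integrable_continuous_real cont) auto
  moreover have "integral {1..y} (\<lambda>x. (w x)\<^sup>2) = integral {1..y} (\<lambda>x. 0)"
    by (intro integral_cong) (simp add: w_outside)
  ultimately show ?thesis by simp
qed

definition wcos :: "real \<Rightarrow> real \<Rightarrow> int \<Rightarrow> real" where
  "wcos B x j = 2 * w (real_of_int j / B) * cos (real_of_int j * x)"

lemma wcos_bound: "\<bar>wcos B x j\<bar> \<le> 2 * Cw"
  using mult_mono[OF w_bound[of "real_of_int j / B"] abs_cos_le_one[of "real_of_int j * x"]] Cw_nonneg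
  by (simp add: wcos_def abs_mult)

text \<open>Two replacements are made: \<open>w ((j - d) / B)\<close> becomes
  \<open>w (j / B)\<close>, at Lipschitz cost \<open>|d| / B\<close> for each lag, and the
  restriction of \<open>j\<close> and \<open>j - d\<close> to \<open>{2*l..b}\<close> is dropped,
  which matters only near the two ends.\<close>

lemma autocorr_wcos_approx:
  fixes l b d :: int
  assumes B: "B > 0" and l: "0 \<le> l" and b: "0 \<le> b"
  shows "\<bar>autocorr (wcos B x) {2*l..b} d -
      (\<Sum>j\<in>{0..b}. 4 * (w (real_of_int j / B))\<^sup>2 * (cos (real_of_int j * x) * cos (real_of_int (j - d) * x)))\<bar>
    \<le> (real_of_int b + 1) * (4 * Cw * Lw * \<bar>real_of_int d\<bar> / B) + (2 * real_of_int l + 2 * \<bar>real_of_int d\<bar>) * (4 * Cw\<^sup>2)"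
proof -
  define J where "J = {2*l..b}"
  define g where "g = (\<lambda>j. if j \<in> J \<and> j - d \<in> J then wcos B x j * wcos B x (j - d) else 0)"
  define h where "h = (\<lambda>j. 4 * (w (real_of_int j / B))\<^sup>2 * (cos (real_of_int j * x) * cos (real_of_int (j - d) * x)))"
  \<comment> \<open>Contains every \<open>j\<close> in \<open>{0..b}\<close> for which
    \<open>j\<close> or \<open>j - d\<close> falls outside \<open>J\<close>, whatever the sign of
    \<open>d\<close>.\<close>
  define E where "E = {0..<2 * l + \<bar>d\<bar>} \<union> {b - \<bar>d\<bar><..b}"
  have "autocorr (wcos B x) J d = (\<Sum>j\<in>J. g j)"
    unfolding autocorr_def g_def by (intro sum.cong) auto
  also have "\<dots> = (\<Sum>j\<in>{0..b}. g j)"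
    using l by (intro sum.mono_neutral_left) (auto simp: J_def g_def)
  finally have eq: "autocorr (wcos B x) J d - (\<Sum>j\<in>{0..b}. h j) = (\<Sum>j\<in>{0..b}. g j - h j)" by (simp add: sum_subtractf)
  have pt: "\<bar>g j - h j\<bar> \<le> 4 * Cw * Lw * \<bar>real_of_int d\<bar> / B + (if j \<in> E then 4 * Cw\<^sup>2 else 0)" if "j \<in> {0..b}" for j
  proof (cases "j \<in> J \<and> j - d \<in> J")
    case True
    have "g j - h j = 4 * (w (real_of_int j / B) * (w (real_of_int (j - d) / B) - w (real_of_int j / B)) *
      (cos (real_of_int j * x) * cos (real_of_int (j - d) * x)))"
      using True by (simp add: g_def h_def wcos_def power2_eq_square algebra_simps)
    also have "\<bar>\<dots>\<bar> = 4 * (\<bar>w (real_of_int j / B)\<bar> * \<bar>w (real_of_int (j - d) / B) - w (real_of_int j / B)\<bar> *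
      (\<bar>cos (real_of_int j * x)\<bar> * \<bar>cos (real_of_int (j - d) * x)\<bar>))" by (simp add: abs_mult)
    also have "\<dots> \<le> 4 * (Cw * (Lw * \<bar>real_of_int (j - d) / B - real_of_int j / B\<bar>) * (1 * 1))"
      using Cw_nonneg Lw_nonneg by (intro mult_left_mono mult_mono w_bound w_lip abs_cos_le_one) auto
    also have "\<bar>real_of_int (j - d) / B - real_of_int j / B\<bar> = \<bar>real_of_int d\<bar> / B"
      using B by (simp add: diff_divide_distrib[symmetric])
    finally have "\<bar>g j - h j\<bar> \<le> 4 * Cw * Lw * \<bar>real_of_int d\<bar> / B" by simp
    then show ?thesis using Cw_nonneg by (auto intro: order_trans)
  next
    case False
    then have jE: "j \<in> E" using that l by (auto simp: E_def J_def)
    have "\<bar>h j\<bar> = 4 * (\<bar>(w (real_of_int j / B))\<^sup>2\<bar> * (\<bar>cos (real_of_int j * x)\<bar> * \<bar>cos (real_of_int (j - d) * x)\<bar>))"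
      by (simp add: h_def abs_mult)
    also have "\<dots> \<le> 4 * (Cw\<^sup>2 * (1 * 1))"
      using Cw_nonneg by (intro mult_left_mono mult_mono w2_bound abs_cos_le_one) auto
    finally have "\<bar>h j\<bar> \<le> 4 * Cw\<^sup>2" by simp
    moreover have "g j = 0" using False by (auto simp: g_def)
    moreover have "0 \<le> 4 * Cw * Lw * \<bar>real_of_int d\<bar> / B" using Cw_nonneg Lw_nonneg B by simp
    ultimately show ?thesis using jE by simp
  qed
  have "\<bar>\<Sum>j\<in>{0..b}. g j - h j\<bar> \<le> (\<Sum>j\<in>{0..b}. 4 * Cw * Lw * \<bar>real_of_int d\<bar> / B + (if j \<in> E then 4 * Cw\<^sup>2 else 0))"
    by (rule order_trans[OF sum_abs], rule sum_mono, rule pt)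
  also have "\<dots> = (real_of_int b + 1) * (4 * Cw * Lw * \<bar>real_of_int d\<bar> / B) + real (card ({0..b} \<inter> E)) * (4 * Cw\<^sup>2)"
    using b by (simp add: sum.distrib sum.If_cases)
  also have "\<dots> \<le> (real_of_int b + 1) * (4 * Cw * Lw * \<bar>real_of_int d\<bar> / B) + (2 * real_of_int l + 2 * \<bar>real_of_int d\<bar>) * (4 * Cw\<^sup>2)"
  proof (intro add_left_mono mult_right_mono)
    have "card ({0..b} \<inter> E) \<le> card E" by (intro card_mono) (auto simp: E_def)
    also have "\<dots> \<le> card {0..<2 * l + \<bar>d\<bar>} + card {b - \<bar>d\<bar><..b}" unfolding E_def by (rule card_Un_le)
    finally have "int (card ({0..b} \<inter> E)) \<le> 2 * l + 2 * \<bar>d\<bar>" using l by simp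
    then show "real (card ({0..b} \<inter> E)) \<le> 2 * real_of_int l + 2 * \<bar>real_of_int d\<bar>" by linarith
  qed simp
  finally have "\<bar>autocorr (wcos B x) J d - (\<Sum>j\<in>{0..b}. h j)\<bar> \<le>
    (real_of_int b + 1) * (4 * Cw * Lw * \<bar>real_of_int d\<bar> / B) + (2 * real_of_int l + 2 * \<bar>real_of_int d\<bar>) * (4 * Cw\<^sup>2)"
    unfolding eq .
  then show ?thesis by (simp only: J_def h_def)
qed

text \<open>\<open>2 cos (j x) cos ((j - d) x) = cos (d x) + cos ((2 j - d) x)\<close>. The first
  term produces a Riemann sum of \<open>w^2\<close>. The second averages out unless
  \<open>sin x = 0\<close>, and in that case it equals \<open>cos (d x)\<close> and doubles the
  limit.\<close>

lemma autocorr_wcos_limit: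
  fixes B :: "nat \<Rightarrow> real" and l :: "nat \<Rightarrow> int"
  assumes B: "filterlim B at_top sequentially" and l: "\<And>n. 0 \<le> l n" and lB: "(\<lambda>n. real_of_int (l n) / B n) \<longlonglongrightarrow> 0"
  shows "(\<lambda>n. autocorr (wcos (B n) x) {2 * l n..\<lfloor>B n\<rfloor>} d / B n) \<longlonglongrightarrow>
    2 * (1 + hfun (2 * x)) * integral {0..1} (\<lambda>x. (w x)\<^sup>2) * cos (real_of_int d * x)"
proof -
  define I0 where "I0 = integral {0..1} (\<lambda>x. (w x)\<^sup>2)"
  \<comment> \<open>With \<open>\<lfloor>B n\<rfloor> + 1\<close> terms the grid reaches at least
    the argument 1, so the Riemann sum covers the whole support of \<open>w\<close> on the positive
    side.\<close>
  define N where "N = (\<lambda>n. nat (\<lfloor>B n\<rfloor> + 1))"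
  define f where "f = (\<lambda>x. (w x)\<^sup>2)"
  define K where "K = 2 * Cw * Lw"
  have evB: "eventually (\<lambda>n. B n \<ge> 1) sequentially" using B by (auto simp: filterlim_at_top)
  have N: "B n \<le> real (N n)" "real (N n) \<le> 2 * B n" "real_of_int \<lfloor>B n\<rfloor> + 1 = real (N n)" if "B n \<ge> 1" for n
    using that unfolding N_def by linarith+
  have B0: "(\<lambda>n. c / B n) \<longlonglongrightarrow> 0" for c :: real
    by (rule real_tendsto_divide_at_top[OF tendsto_const B])
  have lim1: "(\<lambda>n. (\<Sum>j<N n. f (real j / B n)) / B n) \<longlonglongrightarrow> I0"
  proof (rule Lim_transform[OF tendsto_const[of I0]], rule Lim_null_comparison)
    show "eventually (\<lambda>n. norm ((\<Sum>j<N n. f (real j / B n)) / B n - I0) \<le> 2 * K / B n) sequentially"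
      using evB
    proof eventually_elim
      case (elim n)
      have "integral {0..real (N n) / B n} f = I0"
        unfolding I0_def f_def using N[OF elim] elim by (intro integral_w2_beyond) simp
      then have "norm ((\<Sum>j<N n. f (real j / B n)) / B n - I0) \<le> real (N n) * K / (B n)\<^sup>2"
        using riemann_sum_lipschitz[OF w2_lipschitz, of "B n" "N n"] elim by (simp add: f_def K_def)
      also have "\<dots> \<le> (2 * B n) * K / (B n)\<^sup>2"
        using N[OF elim] Cw_nonneg Lw_nonneg by (intro divide_right_mono mult_right_mono) (auto simp: K_def)
      finally show ?case using elim by (simp add: power2_eq_square)
    qed
  qed (rule B0)
  have lim2: "(\<lambda>n. (\<Sum>j<N n. f (real j / B n) * cos ((2 * real j - real_of_int d) * x)) / B n) \<longlonglongrightarrow> hfun (2 * x) * I0 * cos (real_of_int d * x)"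
  proof (cases "sin x = 0")
    case True
    have "cos ((2 * real j - real_of_int d) * x) = cos (real_of_int d * x)" for j
      using cos_twice_shift[OF True, of "int j" "real_of_int d"] by simp
    then show ?thesis using tendsto_mult_right[OF lim1, of "cos (real_of_int d * x)"] True
      by (simp add: hfun_twice sum_distrib_right[symmetric])
  next
    case False
    have "(\<lambda>n. (\<Sum>j<N n. f (real j / B n) * cos ((2 * real j - real_of_int d) * x)) / B n) \<longlonglongrightarrow> 0"
    proof (rule Lim_null_comparison)
      show "eventually (\<lambda>n. norm ((\<Sum>j<N n. f (real j / B n) * cos ((2 * real j - real_of_int d) * x)) / B n)
          \<le> ((2 * Cw\<^sup>2 + 2 * K) / \<bar>2 * sin x\<bar>) / B n) sequentially"
        using evB
      proof eventually_elim
        case (elim n)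
        define S where "S = (\<Sum>j<N n. f (real j / B n) * cos ((2 * real j - real_of_int d) * x))"
        have "\<bar>S * (2 * sin x)\<bar> \<le> 2 * Cw\<^sup>2 + real (N n) * K / B n"
          unfolding S_def using oscillating_sum_lipschitz[OF w2_lipschitz _ w2_bound] elim by (simp add: f_def K_def)
        also have "real (N n) * K / B n \<le> 2 * B n * K / B n"
          using N[OF elim] Cw_nonneg Lw_nonneg elim by (intro divide_right_mono mult_right_mono) (auto simp: K_def)
        finally have "\<bar>S\<bar> * \<bar>2 * sin x\<bar> \<le> 2 * Cw\<^sup>2 + 2 * K" using elim by (simp add: abs_mult)
        then have "\<bar>S\<bar> \<le> (2 * Cw\<^sup>2 + 2 * K) / \<bar>2 * sin x\<bar>" using False by (simp add: pos_le_divide_eq)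
        then have "\<bar>S\<bar> / B n \<le> ((2 * Cw\<^sup>2 + 2 * K) / \<bar>2 * sin x\<bar>) / B n"
          using elim by (intro divide_right_mono) auto
        then show ?case using elim unfolding S_def[symmetric] by simp
      qed
    qed (rule B0)
    then show ?thesis using False by (simp add: hfun_twice)
  qed
  have "(\<lambda>n. autocorr (wcos (B n) x) {2 * l n..\<lfloor>B n\<rfloor>} d / B n -
      (2 * cos (real_of_int d * x) * ((\<Sum>j<N n. f (real j / B n)) / B n) +
       2 * ((\<Sum>j<N n. f (real j / B n) * cos ((2 * real j - real_of_int d) * x)) / B n))) \<longlonglongrightarrow> 0"
  proof (rule Lim_null_comparison)
    show "eventually (\<lambda>n. norm (autocorr (wcos (B n) x) {2 * l n..\<lfloor>B n\<rfloor>} d / B n -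
      (2 * cos (real_of_int d * x) * ((\<Sum>j<N n. f (real j / B n)) / B n) +
       2 * ((\<Sum>j<N n. f (real j / B n) * cos ((2 * real j - real_of_int d) * x)) / B n))) \<le>
       8 * Cw * Lw * \<bar>real_of_int d\<bar> / B n + 8 * Cw\<^sup>2 * (real_of_int (l n) / B n) + 8 * Cw\<^sup>2 * \<bar>real_of_int d\<bar> / B n) sequentially"
      using evB
    proof eventually_elim
      case (elim n)
      define A where "A = autocorr (wcos (B n) x) {2 * l n..\<lfloor>B n\<rfloor>} d"
      define H where "H = (\<Sum>j\<in>{0..\<lfloor>B n\<rfloor>}. 4 * (w (real_of_int j / B n))\<^sup>2 * (cos (real_of_int j * x) * cos (real_of_int (j - d) * x)))"
      have "H = (\<Sum>j<N n. 4 * (w (real j / B n))\<^sup>2 * (cos (real j * x) * cos ((real j - real_of_int d) * x)))"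
        unfolding H_def N_def by (subst sum_int_atLeastAtMost_nat) simp
      also have "\<dots> = (\<Sum>j<N n. 2 * cos (real_of_int d * x) * f (real j / B n) +
          2 * (f (real j / B n) * cos ((2 * real j - real_of_int d) * x)))"
      proof (intro sum.cong refl)
        fix j :: nat
        have "2 * (cos (real j * x) * cos ((real j - real_of_int d) * x)) = cos (real_of_int d * x) + cos ((2 * real j - real_of_int d) * x)"
          by (simp add: cos_times_cos algebra_simps)
        then show "4 * (w (real j / B n))\<^sup>2 * (cos (real j * x) * cos ((real j - real_of_int d) * x)) =
            2 * cos (real_of_int d * x) * f (real j / B n) + 2 * (f (real j / B n) * cos ((2 * real j - real_of_int d) * x))"
          unfolding f_def by algebra
      qed
      finally have H: "H / B n = 2 * cos (real_of_int d * x) * ((\<Sum>j<N n. f (real j / B n)) / B n) +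
       2 * ((\<Sum>j<N n. f (real j / B n) * cos ((2 * real j - real_of_int d) * x)) / B n)"
        by (simp add: sum.distrib sum_distrib_left add_divide_distrib)
      have "\<bar>A - H\<bar> \<le> (real_of_int \<lfloor>B n\<rfloor> + 1) * (4 * Cw * Lw * \<bar>real_of_int d\<bar> / B n) + (2 * real_of_int (l n) + 2 * \<bar>real_of_int d\<bar>) * (4 * Cw\<^sup>2)"
        unfolding A_def H_def using elim l by (intro autocorr_wcos_approx) auto
      also have "\<dots> \<le> (2 * B n) * (4 * Cw * Lw * \<bar>real_of_int d\<bar> / B n) + (2 * real_of_int (l n) + 2 * \<bar>real_of_int d\<bar>) * (4 * Cw\<^sup>2)"
        using N[OF elim] Cw_nonneg Lw_nonneg elim by (intro add_right_mono mult_right_mono) auto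
      finally have "\<bar>A - H\<bar> / B n \<le> ((2 * B n) * (4 * Cw * Lw * \<bar>real_of_int d\<bar> / B n) + (2 * real_of_int (l n) + 2 * \<bar>real_of_int d\<bar>) * (4 * Cw\<^sup>2)) / B n"
        using elim by (intro divide_right_mono) auto
      also have "\<dots> = 8 * Cw * Lw * \<bar>real_of_int d\<bar> / B n + 8 * Cw\<^sup>2 * (real_of_int (l n) / B n) + 8 * Cw\<^sup>2 * \<bar>real_of_int d\<bar> / B n"
        using elim by (simp add: field_simps)
      finally show ?case unfolding H[symmetric] A_def[symmetric] using elim by (simp add: diff_divide_distrib[symmetric] abs_divide)
    qed
    show "(\<lambda>n. 8 * Cw * Lw * \<bar>real_of_int d\<bar> / B n + 8 * Cw\<^sup>2 * (real_of_int (l n) / B n) + 8 * Cw\<^sup>2 * \<bar>real_of_int d\<bar> / B n) \<longlonglongrightarrow> 0"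
      using tendsto_add[OF tendsto_add[OF B0 tendsto_mult_left[OF lB]] B0] by simp
  qed
  from tendsto_add[OF this tendsto_add[OF tendsto_mult_left[OF lim1, of "2 * cos (real_of_int d * x)"] tendsto_mult_left[OF lim2, of 2]]]
  have "(\<lambda>n. autocorr (wcos (B n) x) {2 * l n..\<lfloor>B n\<rfloor>} d / B n) \<longlonglongrightarrow>
    0 + (2 * cos (real_of_int d * x) * I0 + 2 * (hfun (2 * x) * I0 * cos (real_of_int d * x)))"
    by (simp only: diff_add_cancel)
  then show ?thesis by (simp add: I0_def algebra_simps)
qed


lemma autocorr_wcos_bound:
  assumes B: "B \<ge> 1" and l: "0 \<le> l"
  shows "\<bar>autocorr (wcos B x) {2*l..\<lfloor>B\<rfloor>} d / B\<bar> \<le> 8 * Cw\<^sup>2"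
proof -
  have "\<bar>autocorr (wcos B x) {2*l..\<lfloor>B\<rfloor>} d\<bar> \<le> (\<Sum>j\<in>{2*l..\<lfloor>B\<rfloor>}. 4 * Cw\<^sup>2)"
    unfolding autocorr_def
  proof (rule order_trans[OF sum_abs], rule sum_mono)
    fix j
    show "\<bar>if j - d \<in> {2*l..\<lfloor>B\<rfloor>} then wcos B x j * wcos B x (j - d) else 0\<bar> \<le> 4 * Cw\<^sup>2"
      using mult_mono[OF wcos_bound[of B x j] wcos_bound[of B x "j - d"]] Cw_nonneg
      by (simp add: abs_mult power2_eq_square)
  qed
  also have "\<dots> = real (card {2*l..\<lfloor>B\<rfloor>}) * (4 * Cw\<^sup>2)" by simp
  also have "\<dots> \<le> (2 * B) * (4 * Cw\<^sup>2)"
  proof (intro mult_right_mono)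
    have "real (card {2*l..\<lfloor>B\<rfloor>}) = real (nat (\<lfloor>B\<rfloor> + 1 - 2 * l))" by simp
    then show "real (card {2*l..\<lfloor>B\<rfloor>}) \<le> 2 * B" using l B by linarith
  qed simp
  finally have "\<bar>autocorr (wcos B x) {2*l..\<lfloor>B\<rfloor>} d\<bar> / B \<le> (2 * B) * (4 * Cw\<^sup>2) / B"
    using B by (intro divide_right_mono) auto
  then show ?thesis using B by (simp add: abs_divide)
qed

text \<open>\<open>int_tannery\<close> is applied to the inner sum and then to the outer one. The
  geometric decay of \<open>c n\<close>, uniform in \<open>n\<close>, together with
  \<open>autocorr_wcos_bound\<close> provides the dominating functions.\<close>

lemma block_var_limit:
  fixes B :: "nat \<Rightarrow> real" and l K :: "nat \<Rightarrow> int" and c :: "nat \<Rightarrow> int \<Rightarrow> real" and r :: "int \<Rightarrow> real" and C \<theta> :: real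
  assumes B: "filterlim B at_top sequentially" and lB: "(\<lambda>n. real_of_int (l n) / B n) \<longlonglongrightarrow> 0"
    and l: "filterlim l at_top sequentially" "\<And>n. 0 \<le> l n" and lK: "eventually (\<lambda>n. l n \<le> K n) sequentially"
    and c: "\<And>u. (\<lambda>n. c n u) \<longlonglongrightarrow> r u" and cb: "\<And>n u. \<bar>c n u\<bar> \<le> C * \<theta> ^ nat \<bar>u\<bar>"
    and \<theta>: "0 \<le> \<theta>" "\<theta> < 1" and r: "\<And>u. r (- u) = r u"
  shows "(\<lambda>n. block_var (c n) (wcos (B n) x) (l n) {2 * l n..\<lfloor>B n\<rfloor>} (K n) / (real_of_int (K n) * B n)) \<longlonglongrightarrow>
    2 * (1 + hfun (2 * x)) * integral {0..1} (\<lambda>x. (w x)\<^sup>2) * (infsum (\<lambda>u. r u * cos (real_of_int u * x)) UNIV)\<^sup>2"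
proof -
  define a0 where "a0 = 2 * (1 + hfun (2 * x)) * integral {0..1} (\<lambda>x. (w x)\<^sup>2)"
  define R where "R = infsum (\<lambda>u. r u * cos (real_of_int u * x)) UNIV"
  define ac where "ac = (\<lambda>n d. autocorr (wcos (B n) x) {2 * l n..\<lfloor>B n\<rfloor>} d / B n)"
  \<comment> \<open>The finite sums are extended by zero to all integers; for fixed \<open>u\<close>
    and \<open>e\<close> the cutoff is eventually inactive because \<open>l n\<close> tends to
    infinity.\<close>
  define fi where "fi = (\<lambda>n u e. if e \<in> {-l n<..<l n} then c n e * ac n (u - e) else 0)"
  define fo where "fo = (\<lambda>n u. if u \<in> {-l n<..<l n} then real_of_int (K n - \<bar>u\<bar>) / real_of_int (K n) * c n u * infsum (fi n u) UNIV else 0)"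
  define S where "S = infsum (\<lambda>u::int. C * \<theta> ^ nat \<bar>u\<bar>) UNIV"
  have sumg: "(\<lambda>u::int. C * \<theta> ^ nat \<bar>u\<bar>) summable_on UNIV" for C by (rule geometric_int_summable[OF \<theta>])
  have C0: "0 \<le> C" using cb[of 0 0] by auto
  have evB: "eventually (\<lambda>n. B n \<ge> 1) sequentially" using B by (auto simp: filterlim_at_top)
  have evl: "eventually (\<lambda>n. u \<in> {-l n<..<l n}) sequentially" for u
  proof -
    have "eventually (\<lambda>n. \<bar>u\<bar> + 1 \<le> l n) sequentially" using l(1) by (auto simp: filterlim_at_top)
    then show ?thesis by eventually_elim auto
  qed
  have rb: "\<bar>r u\<bar> \<le> C * \<theta> ^ nat \<bar>u\<bar>" for u
    by (rule tendsto_upperbound[OF tendsto_rabs[OF c]]) (use cb in auto)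
  have rs: "(\<lambda>u. r u * g u) summable_on UNIV" if "\<And>u. \<bar>g u\<bar> \<le> 1" for g
  proof (rule abs_summable_summable[OF summable_on_comparison_test[OF sumg[of C]]])
    show "norm (r u * g u) \<le> C * \<theta> ^ nat \<bar>u\<bar>" for u
      using mult_mono[OF rb[of u] that[of u]] C0 \<theta> by (simp add: abs_mult)
  qed simp
  have acb: "\<bar>ac n d\<bar> \<le> 8 * Cw\<^sup>2" if "B n \<ge> 1" for n d
    unfolding ac_def by (rule autocorr_wcos_bound[OF that l(2)])
  have fib: "\<bar>fi n u e\<bar> \<le> (8 * Cw\<^sup>2 * C) * \<theta> ^ nat \<bar>e\<bar>" if "B n \<ge> 1" for n u e
    using mult_mono[OF cb[of n e] acb[OF that, of "u - e"]] C0 \<theta> by (auto simp: fi_def abs_mult mult_ac)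
  have aclim: "(\<lambda>n. ac n d) \<longlonglongrightarrow> a0 * cos (real_of_int d * x)" for d
    unfolding ac_def a0_def by (rule autocorr_wcos_limit[OF B l(2) lB])
  have filim: "(\<lambda>n. fi n u e) \<longlonglongrightarrow> r e * (a0 * cos (real_of_int (u - e) * x))" for u e
  proof (rule Lim_transform_eventually[OF tendsto_mult[OF c aclim]])
    show "eventually (\<lambda>n. c n e * ac n (u - e) = fi n u e) sequentially"
      using evl[of e] by eventually_elim (simp add: fi_def)
  qed
  \<comment> \<open>In \<open>cos ((u - e) x)\<close> the sine part of the addition formula is odd
    in \<open>e\<close> and \<open>r\<close> is even; this is why the limit is a square of the
    cosine series.\<close>
  have sin0: "infsum (\<lambda>e. r e * sin (real_of_int e * x)) UNIV = 0"
  proof -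
    have "infsum (\<lambda>e. r e * sin (real_of_int e * x)) UNIV = infsum (\<lambda>e. - (r e * sin (real_of_int e * x))) UNIV"
      by (rule infsum_reindex_bij_witness[of _ uminus uminus]) (auto simp: r)
    then show ?thesis by (simp add: infsum_uminus)
  qed
  have inner: "(\<lambda>n. infsum (fi n u) UNIV) \<longlonglongrightarrow> a0 * R * cos (real_of_int u * x)" for u
  proof -
    have "(\<lambda>n. infsum (fi n u) UNIV) \<longlonglongrightarrow> infsum (\<lambda>e. r e * (a0 * cos (real_of_int (u - e) * x))) UNIV"
      by (rule int_tannery[OF sumg[of "8 * Cw\<^sup>2 * C"] _ filim]) (rule eventually_mono[OF evB], blast intro: fib)
    also have "(\<lambda>e. r e * (a0 * cos (real_of_int (u - e) * x))) =
      (\<lambda>e. (a0 * cos (real_of_int u * x)) * (r e * cos (real_of_int e * x)) + (a0 * sin (real_of_int u * x)) * (r e * sin (real_of_int e * x)))"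
      by (simp add: left_diff_distrib cos_diff algebra_simps)
    also have "infsum \<dots> UNIV = (a0 * cos (real_of_int u * x)) * R + (a0 * sin (real_of_int u * x)) * 0"
      unfolding R_def sin0[symmetric] by (subst infsum_add) (auto intro!: summable_on_cmult_right rs simp: infsum_cmult_right')
    finally show ?thesis by (simp add: mult_ac)
  qed
  have infb: "\<bar>infsum (fi n u) UNIV\<bar> \<le> 8 * Cw\<^sup>2 * S" if "B n \<ge> 1" for n u
  proof -
    have fs: "(\<lambda>e. \<bar>fi n u e\<bar>) summable_on UNIV"
      by (rule summable_on_comparison_test[OF sumg]) (use fib[OF that] in auto)
    then have "\<bar>infsum (fi n u) UNIV\<bar> \<le> infsum (\<lambda>e. \<bar>fi n u e\<bar>) UNIV"
      using norm_infsum_bound[of "fi n u" UNIV] by simp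
    also have "\<dots> \<le> infsum (\<lambda>e. (8 * Cw\<^sup>2 * C) * \<theta> ^ nat \<bar>e\<bar>) UNIV"
      by (intro infsum_mono fs sumg fib that)
    also have "\<dots> = 8 * Cw\<^sup>2 * S" unfolding S_def infsum_cmult_right'[symmetric] by (simp add: mult_ac)
    finally show ?thesis .
  qed
  have S0: "0 \<le> S" unfolding S_def using C0 \<theta> by (intro infsum_nonneg) auto
  have folim: "(\<lambda>n. fo n u) \<longlonglongrightarrow> r u * (a0 * R * cos (real_of_int u * x))" for u
  proof (rule Lim_transform_eventually)
    have Kt: "filterlim (\<lambda>n. real_of_int (K n)) at_top sequentially"
      by (rule filterlim_compose[OF filterlim_real_of_int_at_top], rule filterlim_at_top_mono[OF l(1) lK])
    have "(\<lambda>n. 1 - real_of_int \<bar>u\<bar> / real_of_int (K n)) \<longlonglongrightarrow> 1 - 0"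
      by (intro tendsto_diff tendsto_const real_tendsto_divide_at_top[OF tendsto_const Kt])
    from tendsto_mult[OF tendsto_mult[OF this c] inner]
    show "(\<lambda>n. (1 - real_of_int \<bar>u\<bar> / real_of_int (K n)) * c n u * infsum (fi n u) UNIV) \<longlonglongrightarrow> r u * (a0 * R * cos (real_of_int u * x))"
      by simp
    have "eventually (\<lambda>n. K n > 0) sequentially"
      using lK evl[of 0] by eventually_elim auto
    then show "eventually (\<lambda>n. (1 - real_of_int \<bar>u\<bar> / real_of_int (K n)) * c n u * infsum (fi n u) UNIV = fo n u) sequentially"
      using evl[of u] by eventually_elim (simp add: fo_def diff_divide_distrib)
  qed
  have "(\<lambda>n. infsum (fo n) UNIV) \<longlonglongrightarrow> infsum (\<lambda>u. r u * (a0 * R * cos (real_of_int u * x))) UNIV"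
  proof (rule int_tannery[OF sumg _ folim])
    show "eventually (\<lambda>n. \<forall>u. \<bar>fo n u\<bar> \<le> (8 * Cw\<^sup>2 * S * C) * \<theta> ^ nat \<bar>u\<bar>) sequentially"
      using evB lK
    proof eventually_elim
      case (elim n)
      show ?case
      proof
        fix u
        show "\<bar>fo n u\<bar> \<le> (8 * Cw\<^sup>2 * S * C) * \<theta> ^ nat \<bar>u\<bar>"
        proof (cases "u \<in> {-l n<..<l n}")
          case True
          have "\<bar>real_of_int (K n - \<bar>u\<bar>) / real_of_int (K n)\<bar> \<le> 1" using True elim by auto
          then have "\<bar>real_of_int (K n - \<bar>u\<bar>) / real_of_int (K n)\<bar> * \<bar>c n u\<bar> * \<bar>infsum (fi n u) UNIV\<bar> \<le>
              1 * (C * \<theta> ^ nat \<bar>u\<bar>) * (8 * Cw\<^sup>2 * S)"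
            using C0 \<theta> by (intro mult_mono infb elim cb) auto
          then show ?thesis using True by (simp add: fo_def abs_mult mult_ac)
        next
          case False
          then show ?thesis using C0 \<theta> S0 by (auto simp: fo_def)
        qed
      qed
    qed
  qed
  also have "(\<lambda>u. r u * (a0 * R * cos (real_of_int u * x))) = (\<lambda>u. (a0 * R) * (r u * cos (real_of_int u * x)))"
    by (simp add: mult_ac)
  also have "infsum \<dots> UNIV = a0 * R\<^sup>2" by (simp add: infsum_cmult_right' R_def power2_eq_square)
  finally have lim: "(\<lambda>n. infsum (fo n) UNIV) \<longlonglongrightarrow> a0 * R\<^sup>2" .
  have "infsum (fo n) UNIV = block_var (c n) (wcos (B n) x) (l n) {2 * l n..\<lfloor>B n\<rfloor>} (K n) / (real_of_int (K n) * B n)" for n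
  proof -
    have "infsum (fi n u) UNIV = infsum (\<lambda>e. c n e * ac n (u - e)) {-l n<..<l n}" for u
      by (rule infsum_cong_neutral) (auto simp: fi_def)
    moreover have "infsum (fo n) UNIV = infsum (\<lambda>u. real_of_int (K n - \<bar>u\<bar>) / real_of_int (K n) * c n u * infsum (fi n u) UNIV) {-l n<..<l n}"
      by (rule infsum_cong_neutral) (auto simp: fo_def)
    ultimately have "infsum (fo n) UNIV = (\<Sum>u\<in>{-l n<..<l n}. real_of_int (K n - \<bar>u\<bar>) / real_of_int (K n) * c n u * (\<Sum>e\<in>{-l n<..<l n}. c n e * ac n (u - e)))"
      by simp
    also have "\<dots> = block_var (c n) (wcos (B n) x) (l n) {2 * l n..\<lfloor>B n\<rfloor>} (K n) / (real_of_int (K n) * B n)"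
      unfolding block_var_def ac_def by (simp add: sum_divide_distrib sum_distrib_left mult_ac)
    finally show ?thesis .
  qed
  then show ?thesis using lim by (simp add: a0_def R_def)
qed

end

section \<open>Functionals of an i.i.d. sequence\<close>

locale iid_functional = prob_space M for M :: "'a measure" +
  fixes E :: "'e measure" and eps :: "int \<Rightarrow> 'a \<Rightarrow> 'e" and Y :: "(nat \<Rightarrow> 'e) \<Rightarrow> real"
  assumes eps_meas: "\<And>t. eps t \<in> measurable M E"
    and eps_indep: "indep_vars (\<lambda>_. E) eps UNIV"
    and eps_ident: "\<And>t. distr M E (eps t) = distr M E (eps 0)"
    and Y_meas: "Y \<in> borel_measurable (PiM UNIV (\<lambda>_::nat. E))"
begin

abbreviation "law \<equiv> distr M E (eps 0)"
abbreviation "seqlaw \<equiv> PiM UNIV (\<lambda>_::nat. law)"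
abbreviation "F \<equiv> gen_sigma M E eps"

definition past :: "int \<Rightarrow> 'a \<Rightarrow> nat \<Rightarrow> 'e" where
  "past t \<omega> k = eps (t - int k) \<omega>"

sublocale law: prob_space law
  by (rule prob_space_distr[OF eps_meas])

lemma gen_sigma_generators: "{eps s -` A \<inter> space M | s A. s \<in> S \<and> A \<in> sets E} \<subseteq> Pow (space M)"
  by auto

lemma space_gen_sigma [simp]: "space (F S) = space M"
  unfolding gen_sigma_def by (rule space_measure_of[OF gen_sigma_generators])

lemma sets_gen_sigma: "sets (F S) = sigma_sets (space M) {eps s -` A \<inter> space M | s A. s \<in> S \<and> A \<in> sets E}"
  unfolding gen_sigma_def by (rule sets_measure_of[OF gen_sigma_generators])

lemma eps_gen_sigma: "s \<in> S \<Longrightarrow> eps s \<in> measurable (F S) E"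
  using measurable_space[OF eps_meas] by (intro measurableI) (auto simp: sets_gen_sigma intro!: sigma_sets.Basic)

text \<open>For one index the events form a class stable under intersection, so independence of the
  family lifts to the sigma-algebras generated by two disjoint groups of indices.\<close>

sublocale indep_fields M F
proof unfold_locales
  show "space (F S) = space M" for S by simp
  show "sets (F S) \<subseteq> sets M" for S
    unfolding sets_gen_sigma by (intro sets.sigma_sets_subset) (auto intro: measurable_sets[OF eps_meas])
  show "sets (F S) \<subseteq> sets (F T)" if "S \<subseteq> T" for S T
    unfolding sets_gen_sigma using that by (intro sigma_sets_mono') auto
  show "indep_set (sets (F S)) (sets (F T))" if "S \<inter> T = {}" for S T
  proof -
    define G where "G = (\<lambda>i. {eps i -` A \<inter> space M | A. A \<in> sets E})"
    have "indep_sets G (\<Union>b\<in>UNIV. case_bool S T b)"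
      using eps_indep unfolding indep_vars_def2 G_def by (auto intro: indep_sets_mono_index[rotated])
    then have "indep_sets (\<lambda>b. sigma_sets (space M) (\<Union>i\<in>case_bool S T b. G i)) UNIV"
    proof (rule indep_sets_collect_sigma)
      show "Int_stable (G i)" for i
      proof (rule Int_stableI)
        fix a b assume "a \<in> G i" "b \<in> G i"
        then obtain A B where "a = eps i -` A \<inter> space M" "b = eps i -` B \<inter> space M" "A \<in> sets E" "B \<in> sets E"
          by (auto simp: G_def)
        then have "a \<inter> b = eps i -` (A \<inter> B) \<inter> space M" "A \<inter> B \<in> sets E" by auto
        then show "a \<inter> b \<in> G i" unfolding G_def by blast
      qed
      show "disjoint_family_on (case_bool S T) UNIV"
        using that by (auto simp: disjoint_family_on_def split: bool.splits)
    qed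
    moreover have "sigma_sets (space M) (\<Union>i\<in>case_bool S T b. G i) = case_bool (sets (F S)) (sets (F T)) b" for b
      unfolding sets_gen_sigma G_def by (cases b) (auto intro!: arg_cong[where f="sigma_sets _"])
    ultimately show ?thesis unfolding indep_set_def by (simp cong: indep_sets_cong)
  qed
qed

lemma eps_law: "distr M (PiM UNIV (\<lambda>_::int. E)) (\<lambda>\<omega> i. eps i \<omega>) = PiM UNIV (\<lambda>_. law)"
proof -
  have "(\<lambda>i. distr M E (eps i)) = (\<lambda>_. law)" by (rule ext) (rule eps_ident)
  then show ?thesis
    using indep_vars_iff_distr_eq_PiM[where I=UNIV and M'="\<lambda>_. E" and X=eps] eps_indep eps_meas
    by (simp add: restrict_UNIV)
qed

text \<open>An injective selection from an i.i.d. family has the same product law. It covers both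
  the time-reversed \<open>past\<close> and translations of the time axis.\<close>

lemma eps_reindex_law:
  fixes g :: "'i \<Rightarrow> int"
  assumes "inj g"
  shows "distr M (PiM UNIV (\<lambda>_. E)) (\<lambda>\<omega> i. eps (g i) \<omega>) = PiM UNIV (\<lambda>_. law)"
proof -
  have "distr (PiM UNIV (\<lambda>_::int. law)) (PiM UNIV (\<lambda>_. law)) (\<lambda>\<omega> i. \<omega> (g i)) = PiM UNIV (\<lambda>_. law)"
    using distr_PiM_reindex[of UNIV "\<lambda>_::int. law" g UNIV] assms law.prob_space_axioms by (simp add: restrict_UNIV)
  then have "PiM UNIV (\<lambda>_. law) = distr (distr M (PiM UNIV (\<lambda>_::int. E)) (\<lambda>\<omega> i. eps i \<omega>)) (PiM UNIV (\<lambda>_. law)) (\<lambda>\<omega> i. \<omega> (g i))"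
    unfolding eps_law by simp
  also have "\<dots> = distr (distr M (PiM UNIV (\<lambda>_::int. E)) (\<lambda>\<omega> i. eps i \<omega>)) (PiM UNIV (\<lambda>_. E)) (\<lambda>\<omega> i. \<omega> (g i))"
    by (intro distr_cong refl sets_PiM_cong) auto
  also have "\<dots> = distr M (PiM UNIV (\<lambda>_. E)) ((\<lambda>\<omega> i. \<omega> (g i)) \<circ> (\<lambda>\<omega> i. eps i \<omega>))"
    by (intro distr_distr measurable_PiM_single') (auto simp: space_PiM intro: eps_meas measurable_space[OF eps_meas])
  finally show ?thesis by (simp add: o_def)
qed

lemma past_measurable: "past t \<in> measurable M (PiM UNIV (\<lambda>_. E))"
  unfolding past_def[abs_def]
  by (intro measurable_PiM_single') (auto intro: eps_meas measurable_space[OF eps_meas])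

lemma past_law: "distr M (PiM UNIV (\<lambda>_::nat. E)) (past t) = seqlaw"
  unfolding past_def[abs_def] by (rule eps_reindex_law) (auto simp: inj_def)

lemma sets_seqlaw: "sets seqlaw = sets (PiM UNIV (\<lambda>_::nat. E))"
  by (intro sets_PiM_cong) auto

text \<open>Both factors are read from one functional \<open>H\<close> of the two-sided sequence,
  whose law is invariant under translation.\<close>

lemma stationary_pair:
  fixes \<phi> \<psi> :: "(nat \<Rightarrow> 'e) \<Rightarrow> real"
  assumes [measurable]: "\<phi> \<in> borel_measurable (PiM UNIV (\<lambda>_. E))" "\<psi> \<in> borel_measurable (PiM UNIV (\<lambda>_. E))"
  shows "expectation (\<lambda>\<omega>. \<phi> (past (t + u) \<omega>) * \<psi> (past (s + u) \<omega>)) = expectation (\<lambda>\<omega>. \<phi> (past t \<omega>) * \<psi> (past s \<omega>))"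
proof -
  define H where "H = (\<lambda>e :: int \<Rightarrow> 'e. \<phi> (\<lambda>k. e (t - int k)) * \<psi> (\<lambda>k. e (s - int k)))"
  have comp: "(\<lambda>e k. e (t - int k)) \<in> measurable (PiM UNIV (\<lambda>_::int. E)) (PiM UNIV (\<lambda>_::nat. E))" for t
    by (intro measurable_PiM_single') (auto simp: space_PiM)
  have H: "H \<in> borel_measurable (PiM UNIV (\<lambda>_::int. E))"
    unfolding H_def using measurable_compose[OF comp assms(1)] measurable_compose[OF comp assms(2)] by measurable
  have sh: "(\<lambda>\<omega> i. eps (i + u) \<omega>) \<in> measurable M (PiM UNIV (\<lambda>_::int. E))" for u
    by (intro measurable_PiM_single') (auto intro: eps_meas measurable_space[OF eps_meas])
  have "expectation (\<lambda>\<omega>. H (\<lambda>i. eps (i + u) \<omega>)) = integral\<^sup>L (distr M (PiM UNIV (\<lambda>_::int. E)) (\<lambda>\<omega> i. eps (i + u) \<omega>)) H" for u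
    by (rule integral_distr[symmetric, OF sh H])
  also have "\<dots> u = integral\<^sup>L (PiM UNIV (\<lambda>_. law)) H" for u
    by (subst eps_reindex_law) (auto simp: inj_def)
  finally have *: "expectation (\<lambda>\<omega>. H (\<lambda>i. eps (i + u) \<omega>)) = integral\<^sup>L (PiM UNIV (\<lambda>_. law)) H" for u .
  show ?thesis using *[of u] *[of 0] by (simp add: H_def past_def[abs_def] algebra_simps)
qed


text \<open>Coordinate \<open>k\<close> is the innovation of age \<open>k\<close>, so the
  \<open>n\<close> newest come from \<open>u\<close> and the older ones from \<open>v\<close>. With
  an independent \<open>v\<close> this is the argument of the coupled variable in
  \<open>coupling_dist\<close>.\<close>

definition mix :: "nat \<Rightarrow> (nat \<Rightarrow> 'e) \<Rightarrow> (nat \<Rightarrow> 'e) \<Rightarrow> nat \<Rightarrow> 'e" where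
  "mix n u v = (\<lambda>k. if k < n then u k else v k)"

lemma mix_measurable: "(\<lambda>uv. mix n (fst uv) (snd uv)) \<in> measurable (seqlaw \<Otimes>\<^sub>M seqlaw) seqlaw"
proof (rule measurable_PiM_single')
  fix i :: nat
  show "(\<lambda>uv. mix n (fst uv) (snd uv) i) \<in> measurable (seqlaw \<Otimes>\<^sub>M seqlaw) law"
    unfolding mix_def by (cases "i < n") simp_all
qed (auto simp: mix_def space_pair_measure space_PiM PiE_iff)

lemma mix_measurable1:
  assumes "v \<in> space seqlaw"
  shows "(\<lambda>u. mix n u v) \<in> measurable (PiM UNIV (\<lambda>_. E)) (PiM UNIV (\<lambda>_. E))"
proof (rule measurable_PiM_single')
  fix i :: nat
  show "(\<lambda>u. mix n u v i) \<in> measurable (PiM UNIV (\<lambda>_. E)) E"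
    unfolding mix_def using assms by (cases "i < n") (auto simp: space_PiM PiE_iff)
qed (use assms in \<open>auto simp: mix_def space_PiM PiE_iff\<close>)

lemma mix_law: "distr (seqlaw \<Otimes>\<^sub>M seqlaw) seqlaw (\<lambda>uv. mix n (fst uv) (snd uv)) = seqlaw"
proof (rule measure_eqI_PiM_infinite[symmetric])
  interpret S: prob_space seqlaw by (intro prob_space_PiM law.prob_space_axioms)
  interpret SS: pair_prob_space seqlaw seqlaw ..
  show "finite_measure seqlaw" by unfold_locales
  fix A :: "nat \<Rightarrow> 'e set" and J :: "nat set"
  assume J: "finite J" and A: "\<And>i. i \<in> J \<Longrightarrow> A i \<in> sets law"
  define emb where "emb = (\<lambda>J. prod_emb UNIV (\<lambda>_::nat. law) J (Pi\<^sub>E J A))"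
  have ms: "emb K \<in> sets seqlaw" if "K \<subseteq> J" for K
    unfolding emb_def using that J A by (intro sets_PiM_I) (auto intro: finite_subset)
  have em: "emeasure seqlaw (emb K) = (\<Prod>i\<in>K. emeasure law (A i))" if "K \<subseteq> J" for K
    unfolding emb_def using that J A by (intro emeasure_PiM_emb law.prob_space_axioms) (auto intro: finite_subset)
  have "emeasure (distr (seqlaw \<Otimes>\<^sub>M seqlaw) seqlaw (\<lambda>uv. mix n (fst uv) (snd uv))) (emb J) =
      emeasure (seqlaw \<Otimes>\<^sub>M seqlaw) ((\<lambda>uv. mix n (fst uv) (snd uv)) -` emb J \<inter> space (seqlaw \<Otimes>\<^sub>M seqlaw))"
    by (rule emeasure_distr[OF mix_measurable ms]) simp
  also have "(\<lambda>uv. mix n (fst uv) (snd uv)) -` emb J \<inter> space (seqlaw \<Otimes>\<^sub>M seqlaw) =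
      emb (J \<inter> {..<n}) \<times> emb (J - {..<n})"
    by (auto simp: emb_def prod_emb_def mix_def space_pair_measure space_PiM PiE_iff restrict_def extensional_def split: if_splits)
  also have "emeasure (seqlaw \<Otimes>\<^sub>M seqlaw) \<dots> = emeasure seqlaw (emb (J \<inter> {..<n})) * emeasure seqlaw (emb (J - {..<n}))"
    by (rule S.emeasure_pair_measure_Times) (auto intro: ms)
  also have "\<dots> = (\<Prod>i\<in>J \<inter> {..<n}. emeasure law (A i)) * (\<Prod>i\<in>J - {..<n}. emeasure law (A i))"
    by (simp add: em)
  also have "\<dots> = (\<Prod>i\<in>J. emeasure law (A i))"
    using J by (subst prod.union_disjoint[symmetric]) (auto intro!: prod.cong)
  also have "\<dots> = emeasure seqlaw (emb J)" by (simp add: em)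
  finally show "emeasure seqlaw (prod_emb UNIV (\<lambda>_. law) J (Pi\<^sub>E J A)) =
      emeasure (distr (seqlaw \<Otimes>\<^sub>M seqlaw) seqlaw (\<lambda>uv. mix n (fst uv) (snd uv))) (prod_emb UNIV (\<lambda>_. law) J (Pi\<^sub>E J A))"
    by (simp add: emb_def)
qed simp_all

text \<open>If the inner integral exceeded \<open>coupling_dist law Y n\<close> for almost every
  \<open>v\<close>, integrating over \<open>v\<close> would make this number larger than itself.
  Integrability of \<open>Y\<close> justifies Fubini and excludes, up to a null set, continuations
  for which the inner integral is undefined; \<open>mix_law\<close> gives the integrability of the
  mixed term.\<close>

lemma continuation_exists:
  assumes X_int: "integrable M (Xproc eps Y 0)"
  shows "\<exists>v\<in>space seqlaw. integrable seqlaw (\<lambda>u. \<bar>Y u - Y (mix n u v)\<bar>) \<and>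
    (\<integral>u. \<bar>Y u - Y (mix n u v)\<bar> \<partial>seqlaw) \<le> coupling_dist law Y n"
proof (rule ccontr)
  assume neg: "\<not> ?thesis"
  interpret S: prob_space seqlaw by (intro prob_space_PiM law.prob_space_axioms)
  interpret SS: pair_prob_space seqlaw seqlaw ..
  have Ym: "Y \<in> borel_measurable seqlaw" using Y_meas measurable_cong_sets[OF sets_seqlaw refl] by blast
  have "integrable M (\<lambda>\<omega>. Y (past 0 \<omega>))"
    using X_int by (simp add: Xproc_def past_def[abs_def])
  then have "integrable (distr M (PiM UNIV (\<lambda>_::nat. E)) (past 0)) Y"
    by (subst integrable_distr_eq[OF past_measurable Y_meas])
  then have Yint: "integrable seqlaw Y" unfolding past_law .
  have "distr (seqlaw \<Otimes>\<^sub>M seqlaw) seqlaw fst = seqlaw"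
    using S.distr_pair_fst[of seqlaw] by (simp add: S.emeasure_space_1 scale_measure_1)
  then have i1: "integrable (seqlaw \<Otimes>\<^sub>M seqlaw) (\<lambda>uv. Y (fst uv))"
    using Yint integrable_distr_eq[OF measurable_fst, of Y seqlaw seqlaw] Ym by simp
  have i2: "integrable (seqlaw \<Otimes>\<^sub>M seqlaw) (\<lambda>uv. Y (mix n (fst uv) (snd uv)))"
    using Yint integrable_distr_eq[OF mix_measurable Ym, of n] unfolding mix_law by simp
  define f where "f = (\<lambda>u v. \<bar>Y u - Y (mix n u v)\<bar>)"
  have i: "integrable (seqlaw \<Otimes>\<^sub>M seqlaw) (case_prod f)"
    using integrable_abs[OF Bochner_Integration.integrable_diff[OF i1 i2]] by (simp add: f_def case_prod_beta')
  have c: "coupling_dist law Y n = integral\<^sup>L (seqlaw \<Otimes>\<^sub>M seqlaw) (case_prod f)"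
    by (simp add: coupling_dist_def f_def case_prod_beta' mix_def)
  have "AE v in seqlaw. integrable seqlaw (\<lambda>u. f u v)"
    using SS.AE_integrable_snd[OF i] .
  then have "AE v in seqlaw. coupling_dist law Y n < (\<integral>u. f u v \<partial>seqlaw)"
    using AE_space by eventually_elim (use neg in \<open>force simp: f_def not_le\<close>)
  then have "coupling_dist law Y n < (\<integral>v. (\<integral>u. f u v \<partial>seqlaw) \<partial>seqlaw)"
    using SS.integrable_snd[OF i] by (intro S.expectation_greater)
  also have "\<dots> = coupling_dist law Y n" unfolding c using SS.integral_snd[OF i] .
  finally show False by simp
qed

end

section \<open>Truncated innovations and indicator processes\<close>

locale quantile_process = iid_functional M E eps Y
  for M :: "'a measure" and E :: "'e measure" and eps :: "int \<Rightarrow> 'a \<Rightarrow> 'e" and Y :: "(nat \<Rightarrow> 'e) \<Rightarrow> real" +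
  fixes \<tau> :: real
  assumes X_int: "integrable M (Xproc eps Y 0)"
    and tau: "0 < \<tau>" "\<tau> < 1"
    and B_lip: "\<exists>\<delta>>0. \<exists>L. L-lipschitz_on (cball (quant0 M (Xproc eps Y 0) \<tau>) \<delta>) (cdfX M (Xproc eps Y 0))"
    and B_dens: "\<exists>f \<delta>. \<delta> > 0 \<and> isCont f (quant0 M (Xproc eps Y 0) \<tau>) \<and> f (quant0 M (Xproc eps Y 0) \<tau>) > 0 \<and>
        (\<forall>x\<in>cball (quant0 M (Xproc eps Y 0) \<tau>) \<delta>. f x \<ge> 0) \<and>
        (\<forall>a b. quant0 M (Xproc eps Y 0) \<tau> - \<delta> \<le> a \<longrightarrow> a \<le> b \<longrightarrow> b \<le> quant0 M (Xproc eps Y 0) \<tau> + \<delta> \<longrightarrow>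
           set_integrable lborel {a..b} f \<and>
           cdfX M (Xproc eps Y 0) b - cdfX M (Xproc eps Y 0) a = (LINT x:{a..b}|lborel. f x))"
    and D_coup: "\<exists>rr. 0 < rr \<and> rr < 1 \<and>
        (\<lambda>n. coupling_dist (distr M E (eps 0)) Y n) \<in> O(\<lambda>n. rr ^ n)"
begin

abbreviation "X \<equiv> Xproc eps Y"
abbreviation "\<xi>0 \<equiv> quant0 M (X 0) \<tau>"
abbreviation "cdf0 \<equiv> cdfX M (X 0)"

text \<open>The law of the independent copy is integrated out in the coupling distance, so by averaging some fixed
  continuation does at least as well.\<close>
definition cont :: "nat \<Rightarrow> nat \<Rightarrow> 'e" where
  "cont n = (SOME v. v \<in> space seqlaw \<and> integrable seqlaw (\<lambda>u. \<bar>Y u - Y (mix n u v)\<bar>) \<and>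
    (\<integral>u. \<bar>Y u - Y (mix n u v)\<bar> \<partial>seqlaw) \<le> coupling_dist law Y n)"

lemma cont:
  "cont n \<in> space seqlaw" "integrable seqlaw (\<lambda>u. \<bar>Y u - Y (mix n u (cont n))\<bar>)"
  "(\<integral>u. \<bar>Y u - Y (mix n u (cont n))\<bar> \<partial>seqlaw) \<le> coupling_dist law Y n"
  using someI_ex[OF continuation_exists[OF X_int, of n, unfolded Bex_def]] unfolding cont_def by auto

text \<open>The fixed tail leaves no auxiliary randomness: the copy lives on \<open>M\<close> itself
  and is a function of the \<open>l\<close> newest innovations, hence measurable for
  \<open>F {t - int l<..t}\<close>.\<close>

definition Xl :: "nat \<Rightarrow> int \<Rightarrow> 'a \<Rightarrow> real" where
  "Xl l t \<omega> = Y (mix l (past t \<omega>) (cont l))"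

lemma X_past: "X t \<omega> = Y (past t \<omega>)"
  by (simp add: Xproc_def past_def[abs_def])

lemma Y_mix_measurable: "(\<lambda>u. Y (mix l u (cont l))) \<in> borel_measurable (PiM UNIV (\<lambda>_. E))"
  by (rule measurable_compose[OF mix_measurable1[OF cont(1)] Y_meas])

lemma Xl_F_measurable: "Xl l t \<in> borel_measurable (F {t - int l<..t})"
  unfolding Xl_def[abs_def]
proof (rule measurable_compose[OF _ Y_meas], rule measurable_PiM_single')
  fix k :: nat
  show "(\<lambda>\<omega>. mix l (past t \<omega>) (cont l) k) \<in> measurable (F {t - int l<..t}) E"
    using cont(1)[of l] by (cases "k < l") (auto simp: mix_def past_def space_PiM PiE_iff intro!: eps_gen_sigma)
qed (use cont(1)[of l] measurable_space[OF eps_meas] in \<open>auto simp: mix_def past_def space_PiM PiE_iff\<close>)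

lemma X_F_measurable: "X t \<in> borel_measurable (F {..t})"
  unfolding X_past[abs_def]
proof (rule measurable_compose[OF _ Y_meas], rule measurable_PiM_single')
  show "(\<lambda>\<omega>. past t \<omega> k) \<in> measurable (F {..t}) E" for k
    unfolding past_def by (intro eps_gen_sigma) auto
qed (use measurable_space[OF eps_meas] in \<open>auto simp: past_def\<close>)

lemma X_measurable: "X t \<in> borel_measurable M"
  by (rule measurable_F_M[OF X_F_measurable])

lemma Xl_measurable: "Xl l t \<in> borel_measurable M"
  by (rule measurable_F_M[OF Xl_F_measurable])

lemma Xl_close:
  "integrable M (\<lambda>\<omega>. \<bar>X t \<omega> - Xl l t \<omega>\<bar>)" "expectation (\<lambda>\<omega>. \<bar>X t \<omega> - Xl l t \<omega>\<bar>) \<le> coupling_dist law Y l"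
proof -
  define g where "g = (\<lambda>u. \<bar>Y u - Y (mix l u (cont l))\<bar>)"
  have g: "g \<in> borel_measurable (PiM UNIV (\<lambda>_. E))" 
    unfolding g_def using Y_meas Y_mix_measurable by measurable
  have eq: "(\<lambda>\<omega>. \<bar>X t \<omega> - Xl l t \<omega>\<bar>) = (\<lambda>\<omega>. g (past t \<omega>))" by (simp add: g_def X_past Xl_def)
  show "integrable M (\<lambda>\<omega>. \<bar>X t \<omega> - Xl l t \<omega>\<bar>)"
    unfolding eq using integrable_distr_eq[OF past_measurable g, of t] cont(2)[of l] unfolding past_law by (simp add: g_def)
  show "expectation (\<lambda>\<omega>. \<bar>X t \<omega> - Xl l t \<omega>\<bar>) \<le> coupling_dist law Y l"
    unfolding eq using integral_distr[OF past_measurable g, of t] cont(3)[of l] unfolding past_law by (simp add: g_def)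
qed

text \<open>The Landau bound holds only from some index on; the finitely many earlier terms are
  absorbed by adding their ratios to the constant.\<close>

lemma coupling_geometric: "\<exists>C rr. 0 \<le> C \<and> 0 < rr \<and> rr < 1 \<and> (\<forall>l. coupling_dist law Y l \<le> C * rr ^ l)"
proof -
  obtain rr where rr: "0 < rr" "rr < 1" "(\<lambda>n. coupling_dist law Y n) \<in> O(\<lambda>n. rr ^ n)" using D_coup by auto
  from landau_o.bigE[OF rr(3)] obtain c where c: "c > 0" "eventually (\<lambda>n. norm (coupling_dist law Y n) \<le> c * norm (rr ^ n)) at_top" by auto
  then obtain N where N: "\<And>n. n \<ge> N \<Longrightarrow> \<bar>coupling_dist law Y n\<bar> \<le> c * rr ^ n"
    using rr by (auto simp: eventually_at_top_linorder)
  define C where "C = c + (\<Sum>n<N. \<bar>coupling_dist law Y n\<bar> / rr ^ n)"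
  have Cc: "c \<le> C" unfolding C_def using rr by (simp add: sum_nonneg)
  have "coupling_dist law Y l \<le> C * rr ^ l" for l
  proof (cases "l < N")
    case True
    have "\<bar>coupling_dist law Y l\<bar> / rr ^ l \<le> (\<Sum>n<N. \<bar>coupling_dist law Y n\<bar> / rr ^ n)"
      using rr True by (intro member_le_sum) auto
    then have "\<bar>coupling_dist law Y l\<bar> / rr ^ l \<le> C" using c by (simp add: C_def)
    then show ?thesis using rr by (simp add: pos_divide_le_eq)
  next
    case False
    then have "\<bar>coupling_dist law Y l\<bar> \<le> c * rr ^ l" using N by simp
    also have "\<dots> \<le> C * rr ^ l" using Cc rr by (intro mult_right_mono) auto
    finally show ?thesis by simp
  qed
  then show ?thesis using rr c Cc by (intro exI[of _ C] exI[of _ rr]) auto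
qed

lemma stationary_single:
  assumes "\<phi> \<in> borel_measurable (PiM UNIV (\<lambda>_. E))"
  shows "expectation (\<lambda>\<omega>. \<phi> (past t \<omega>) :: real) = expectation (\<lambda>\<omega>. \<phi> (past 0 \<omega>))"
  using stationary_pair[OF assms, of "\<lambda>_. 1" 0 t 0] by simp

lemma prob_X_le: "prob {\<omega>\<in>space M. X t \<omega> \<le> x} = cdf0 x"
proof -
  have m: "(\<lambda>u. indicator {y. y \<le> x} (Y u) :: real) \<in> borel_measurable (PiM UNIV (\<lambda>_. E))"
    using Y_meas by measurable
  have ind: "expectation (\<lambda>\<omega>. indicator S (X t \<omega>) :: real) = prob {\<omega>\<in>space M. X t \<omega> \<in> S}" if "S \<in> sets borel" for S t
  proof -
    have "expectation (\<lambda>\<omega>. indicator S (X t \<omega>) :: real) = expectation (indicator {\<omega>\<in>space M. X t \<omega> \<in> S})"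
      by (intro Bochner_Integration.integral_cong) (auto simp: indicator_def)
    moreover have "{\<omega>\<in>space M. X t \<omega> \<in> S} \<inter> space M = {\<omega>\<in>space M. X t \<omega> \<in> S}" by auto
    ultimately show ?thesis by simp
  qed
  show ?thesis
    using stationary_single[OF m, of t] ind[of "{y. y \<le> x}"] by (simp add: X_past[symmetric] cdfX_def)
qed

lemma cdf0_cdf: "cdf0 x = cdf (distr M borel (X 0)) x"
  unfolding cdfX_def cdf_def using X_measurable[of 0] by (subst measure_distr) (auto intro!: arg_cong[where f=prob])

lemma cdf0_mono: "x \<le> y \<Longrightarrow> cdf0 x \<le> cdf0 y"
  unfolding cdfX_def using X_measurable[of 0] by (intro finite_measure_mono) auto

text \<open>The distribution function is at least \<open>\<tau>\<close> to the right of the infimum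
  and at most \<open>\<tau>\<close> to the left of it; Lipschitz continuity there forces
  equality.\<close>

lemma cdf0_quantile: "cdf0 \<xi>0 = \<tau>"
proof -
  interpret R: real_distribution "distr M borel (X 0)" by (rule real_distribution_distr[OF X_measurable])
  define S where "S = {x. cdf0 x \<ge> \<tau>}"
  have xi: "\<xi>0 = Inf S" by (simp add: quant0_def S_def)
  have "eventually (\<lambda>x. cdf0 x > \<tau>) at_top"
    unfolding cdf0_cdf using R.cdf_lim_at_top_prob tau by (intro order_tendstoD) auto
  then have ne: "S \<noteq> {}" by (auto simp: S_def eventually_at_top_linorder intro: less_imp_le)
  have "eventually (\<lambda>x. cdf0 x < \<tau>) at_bot"
    unfolding cdf0_cdf using R.cdf_lim_at_bot tau by (intro order_tendstoD) auto
  then obtain y where "cdf0 y < \<tau>" by (auto simp: eventually_at_bot_linorder)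
  have bdd: "bdd_below S"
  proof (rule bdd_belowI[of _ y], rule ccontr)
    fix x assume "x \<in> S" "\<not> y \<le> x"
    then show False using \<open>cdf0 y < \<tau>\<close> cdf0_mono[of x y] by (simp add: S_def)
  qed
  obtain \<delta> L where \<delta>: "\<delta> > 0" "L-lipschitz_on (cball \<xi>0 \<delta>) cdf0" using B_lip by auto
  have cont: "isCont cdf0 \<xi>0"
    by (rule continuous_on_interior[OF lipschitz_on_continuous_on[OF \<delta>(2)]]) (simp add: \<delta>(1))
  have 1: "cdf0 x \<ge> \<tau>" if "x > \<xi>0" for x
  proof -
    have "Inf S < x" using that xi by simp
    then obtain s where "s \<in> S" "s < x" using cInf_less_iff[OF ne bdd] by blast
    then show ?thesis using cdf0_mono[of s x] by (auto simp: S_def)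
  qed
  have 2: "cdf0 x \<le> \<tau>" if "x < \<xi>0" for x
  proof (rule ccontr)
    assume "\<not> cdf0 x \<le> \<tau>"
    then have "x \<in> S" by (simp add: S_def)
    then show False using cInf_lower[OF _ bdd, of x] that xi by simp
  qed
  have lim: "(cdf0 \<longlongrightarrow> cdf0 \<xi>0) (at_right \<xi>0)" "(cdf0 \<longlongrightarrow> cdf0 \<xi>0) (at_left \<xi>0)"
    using cont unfolding isCont_def filterlim_at_split by auto
  have "\<tau> \<le> cdf0 \<xi>0"
  proof (rule tendsto_lowerbound[OF lim(1)])
    show "eventually (\<lambda>x. \<tau> \<le> cdf0 x) (at_right \<xi>0)"
      by (rule eventually_at_rightI[of _ "\<xi>0 + 1"]) (use 1 in auto)
  qed simp
  moreover have "cdf0 \<xi>0 \<le> \<tau>"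
  proof (rule tendsto_upperbound[OF lim(2)])
    show "eventually (\<lambda>x. cdf0 x \<le> \<tau>) (at_left \<xi>0)"
      by (rule eventually_at_leftI[of "\<xi>0 - 1"]) (use 2 in auto)
  qed simp
  ultimately show ?thesis by simp
qed

text \<open>By continuity the density stays above half its value at the quantile, which gives the
  linear growth with \<open>c = f \<xi>0 / 2\<close>. Continuity of the distribution function
  excludes atoms, so strict and weak inequalities have the same probability; \<open>V\<close> uses
  the strict one.\<close>

lemma cdf0_local:
  "\<exists>\<delta> L c. 0 < \<delta> \<and> 0 \<le> L \<and> 0 < c \<and>
    (\<forall>x y. \<bar>x - \<xi>0\<bar> \<le> \<delta> \<longrightarrow> \<bar>y - \<xi>0\<bar> \<le> \<delta> \<longrightarrow> \<bar>cdf0 x - cdf0 y\<bar> \<le> L * \<bar>x - y\<bar>) \<and>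
    (\<forall>h. 0 \<le> h \<longrightarrow> h \<le> \<delta> \<longrightarrow> \<tau> + c * h \<le> cdf0 (\<xi>0 + h) \<and> cdf0 (\<xi>0 - h) \<le> \<tau> - c * h) \<and>
    (\<forall>x t. \<bar>x - \<xi>0\<bar> < \<delta> \<longrightarrow> prob {\<omega>\<in>space M. X t \<omega> < x} = cdf0 x)"
proof -
  obtain \<delta>1 L where \<delta>1: "\<delta>1 > 0" "L-lipschitz_on (cball \<xi>0 \<delta>1) cdf0" using B_lip by auto
  obtain f \<delta>2 where f: "\<delta>2 > 0" "isCont f \<xi>0" "f \<xi>0 > 0"
    "\<And>a b. \<xi>0 - \<delta>2 \<le> a \<Longrightarrow> a \<le> b \<Longrightarrow> b \<le> \<xi>0 + \<delta>2 \<Longrightarrow> set_integrable lborel {a..b} f"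
    "\<And>a b. \<xi>0 - \<delta>2 \<le> a \<Longrightarrow> a \<le> b \<Longrightarrow> b \<le> \<xi>0 + \<delta>2 \<Longrightarrow> cdf0 b - cdf0 a = (LINT x:{a..b}|lborel. f x)"
    using B_dens by blast
  obtain \<delta>3 where \<delta>3: "\<delta>3 > 0" "\<And>x. \<bar>x - \<xi>0\<bar> < \<delta>3 \<Longrightarrow> \<bar>f x - f \<xi>0\<bar> < f \<xi>0 / 2"
    using f(2)[unfolded continuous_at_eps_delta, rule_format, of "f \<xi>0 / 2"] f(3) by (auto simp: dist_real_def)
  define c where "c = f \<xi>0 / 2"
  define \<delta> where "\<delta> = min \<delta>1 (min \<delta>2 (\<delta>3 / 2))"
  have \<delta>: "0 < \<delta>" "\<delta> \<le> \<delta>1" "\<delta> \<le> \<delta>2" "\<delta> < \<delta>3" using \<delta>1 f \<delta>3 by (auto simp: \<delta>_def)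
  have low: "c * (b - a) \<le> cdf0 b - cdf0 a" if "\<xi>0 - \<delta> \<le> a" "a \<le> b" "b \<le> \<xi>0 + \<delta>" for a b
  proof -
    have int: "set_integrable lborel {a..b} f" using that \<delta> by (intro f(4)) auto
    have "c * (b - a) = (LINT x:{a..b}|lborel. c)" using that by (simp add: set_lebesgue_integral_def)
    also have "\<dots> \<le> (LINT x:{a..b}|lborel. f x)"
    proof (rule set_integral_mono[OF _ int])
      show "set_integrable lborel {a..b} (\<lambda>x. c)"
        unfolding set_integrable_def by (intro integrable_scaleR_left integrable_real_indicator) (simp_all add: emeasure_lborel_Icc_eq)
      fix x assume "x \<in> {a..b}"
      then have "\<bar>x - \<xi>0\<bar> < \<delta>3" using that \<delta> by auto
      from \<delta>3(2)[OF this] show "c \<le> f x" unfolding c_def by linarith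
    qed
    also have "\<dots> = cdf0 b - cdf0 a" using that \<delta> by (intro f(5)[symmetric]) auto
    finally show ?thesis .
  qed
  have lip: "\<bar>cdf0 x - cdf0 y\<bar> \<le> L * \<bar>x - y\<bar>" if "\<bar>x - \<xi>0\<bar> \<le> \<delta>" "\<bar>y - \<xi>0\<bar> \<le> \<delta>" for x y
    using lipschitz_onD[OF \<delta>1(2), of x y] that \<delta> by (simp add: dist_real_def abs_minus_commute)
  have less: "prob {\<omega>\<in>space M. X t \<omega> < x} = cdf0 x" if "\<bar>x - \<xi>0\<bar> < \<delta>" for x t
  proof (rule antisym)
    show "prob {\<omega>\<in>space M. X t \<omega> < x} \<le> cdf0 x"
      unfolding prob_X_le[of t, symmetric] using X_measurable by (intro finite_measure_mono) auto
    have cont: "isCont cdf0 x"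
      using continuous_on_interior[OF lipschitz_on_continuous_on[OF \<delta>1(2)], of x] that \<delta> by (auto simp: dist_real_def)
    then have "(cdf0 \<longlongrightarrow> cdf0 x) (at_left x)"
      unfolding isCont_def filterlim_at_split by auto
    then show "cdf0 x \<le> prob {\<omega>\<in>space M. X t \<omega> < x}"
    proof (rule tendsto_upperbound)
      show "eventually (\<lambda>y. cdf0 y \<le> prob {\<omega>\<in>space M. X t \<omega> < x}) (at_left x)"
      proof (rule eventually_at_leftI[of "x - 1"])
        fix y assume "y \<in> {x - 1<..<x}"
        then show "cdf0 y \<le> prob {\<omega>\<in>space M. X t \<omega> < x}"
          unfolding prob_X_le[of t, symmetric] using X_measurable by (intro finite_measure_mono) auto
      qed simp
    qed simp
  qed
  show ?thesis
  proof (rule exI[of _ \<delta>], rule exI[of _ L], rule exI[of _ c], intro conjI allI impI)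
    show "0 \<le> L" using lipschitz_on_nonneg[OF \<delta>1(2)] .
    show "0 < c" using f by (simp add: c_def)
    fix h assume "0 \<le> h" "h \<le> \<delta>"
    then show "\<tau> + c * h \<le> cdf0 (\<xi>0 + h)" "cdf0 (\<xi>0 - h) \<le> \<tau> - c * h"
      using low[of \<xi>0 "\<xi>0 + h"] low[of "\<xi>0 - h" \<xi>0] \<delta> cdf0_quantile by auto
  qed (use \<delta> lip less in auto)
qed

text \<open>If the two indicators differ, then \<open>X\<close> and its copy are at least
  \<open>\<eta>\<close> apart or \<open>X\<close> is close to \<open>x\<close>. Markov bounds the
  first event by a multiple of \<open>rr ^ l / \<eta>\<close>, the Lipschitz condition bounds the
  second by a multiple of \<open>\<eta>\<close>. Balancing gives
  \<open>\<eta> = sqrt rr ^ l\<close>, hence the rate \<open>\<theta> = sqrt rr\<close>.\<close>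

lemma mismatch_geometric:
  "\<exists>C \<theta> \<delta>. 0 \<le> C \<and> 0 < \<theta> \<and> \<theta> < 1 \<and> 0 < \<delta> \<and>
    (\<forall>l t x. \<bar>x - \<xi>0\<bar> \<le> \<delta> \<longrightarrow> prob {\<omega>\<in>space M. (X t \<omega> < x) \<noteq> (Xl l t \<omega> < x)} \<le> C * \<theta> ^ l)"
proof -
  obtain \<delta> L where \<delta>: "0 < \<delta>" "0 \<le> L"
    and lip: "\<And>x y. \<bar>x - \<xi>0\<bar> \<le> \<delta> \<Longrightarrow> \<bar>y - \<xi>0\<bar> \<le> \<delta> \<Longrightarrow> \<bar>cdf0 x - cdf0 y\<bar> \<le> L * \<bar>x - y\<bar>"
    using cdf0_local by blast
  obtain C rr where C: "0 \<le> C" "0 < rr" "rr < 1" "\<And>l. coupling_dist law Y l \<le> C * rr ^ l"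
    using coupling_geometric by blast
  define \<theta> where "\<theta> = sqrt rr"
  have \<theta>: "0 < \<theta>" "\<theta> < 1" "\<theta> * \<theta> = rr" using C by (auto simp: \<theta>_def real_sqrt_lt_1_iff)
  note [measurable] = X_measurable Xl_measurable
  have "prob {\<omega>\<in>space M. (X t \<omega> < x) \<noteq> (Xl l t \<omega> < x)} \<le> (C + 3 * L + 4 / \<delta>) * \<theta> ^ l"
    if x: "\<bar>x - \<xi>0\<bar> \<le> \<delta> / 2" for l t x
  proof (cases "4 * \<theta> ^ l \<le> \<delta>")
    case True
    define \<eta> where "\<eta> = \<theta> ^ l"
    have \<eta>: "0 < \<eta>" "4 * \<eta> \<le> \<delta>" using \<theta> True by (auto simp: \<eta>_def)
    have "prob {\<omega>\<in>space M. (X t \<omega> < x) \<noteq> (Xl l t \<omega> < x)} \<le>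
        prob ({\<omega>\<in>space M. \<bar>X t \<omega> - Xl l t \<omega>\<bar> \<ge> \<eta>} \<union> ({\<omega>\<in>space M. X t \<omega> \<le> x + \<eta>} - {\<omega>\<in>space M. X t \<omega> \<le> x - 2 * \<eta>}))"
      using \<eta> by (intro finite_measure_mono) auto
    also have "\<dots> \<le> prob {\<omega>\<in>space M. \<bar>X t \<omega> - Xl l t \<omega>\<bar> \<ge> \<eta>} +
        prob ({\<omega>\<in>space M. X t \<omega> \<le> x + \<eta>} - {\<omega>\<in>space M. X t \<omega> \<le> x - 2 * \<eta>})"
      by (intro measure_Un_le) auto
    finally have 1: "prob {\<omega>\<in>space M. (X t \<omega> < x) \<noteq> (Xl l t \<omega> < x)} \<le> prob {\<omega>\<in>space M. \<bar>X t \<omega> - Xl l t \<omega>\<bar> \<ge> \<eta>} +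
        prob ({\<omega>\<in>space M. X t \<omega> \<le> x + \<eta>} - {\<omega>\<in>space M. X t \<omega> \<le> x - 2 * \<eta>})" .
    have "prob {\<omega>\<in>space M. \<bar>X t \<omega> - Xl l t \<omega>\<bar> \<ge> \<eta>} \<le> expectation (\<lambda>\<omega>. \<bar>X t \<omega> - Xl l t \<omega>\<bar>) / \<eta>"
      by (rule integral_Markov_inequality_measure[OF Xl_close(1), of "{}"]) (use \<eta> in auto)
    also have "\<dots> \<le> C * rr ^ l / \<eta>"
      using order_trans[OF Xl_close(2) C(4)] \<eta> by (intro divide_right_mono) auto
    also have "\<dots> = C * \<eta>"
    proof -
      have "rr ^ l = \<theta> ^ l * \<theta> ^ l" by (simp add: \<theta>(3)[symmetric] power_mult_distrib)
      then show ?thesis using \<theta> by (simp add: \<eta>_def)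
    qed
    finally have 2: "prob {\<omega>\<in>space M. \<bar>X t \<omega> - Xl l t \<omega>\<bar> \<ge> \<eta>} \<le> C * \<eta>" .
    have "prob ({\<omega>\<in>space M. X t \<omega> \<le> x + \<eta>} - {\<omega>\<in>space M. X t \<omega> \<le> x - 2 * \<eta>}) = cdf0 (x + \<eta>) - cdf0 (x - 2 * \<eta>)"
      unfolding prob_X_le[of t, symmetric] using \<eta> by (intro finite_measure_Diff) auto
    also have "\<dots> \<le> L * \<bar>(x + \<eta>) - (x - 2 * \<eta>)\<bar>"
    proof -
      have "\<bar>x + \<eta> - \<xi>0\<bar> \<le> \<delta>" "\<bar>x - 2 * \<eta> - \<xi>0\<bar> \<le> \<delta>" using x \<eta> by linarith+
      from lip[OF this] show ?thesis by linarith
    qed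
    also have "\<dots> = 3 * L * \<eta>" using \<eta> by simp
    finally have 3: "prob ({\<omega>\<in>space M. X t \<omega> \<le> x + \<eta>} - {\<omega>\<in>space M. X t \<omega> \<le> x - 2 * \<eta>}) \<le> 3 * L * \<eta>" .
    have "0 \<le> 4 / \<delta> * \<eta>" using \<eta> \<delta> by simp
    then show ?thesis using 1 2 3 unfolding \<eta>_def[symmetric] distrib_right by linarith
  next
    case False
    \<comment> \<open>Here \<open>\<eta>\<close> is too large for the Lipschitz neighbourhood. The
      trivial bound is enough and accounts for the summand \<open>4 / \<delta>\<close> of the
      constant.\<close>
    have "prob {\<omega>\<in>space M. (X t \<omega> < x) \<noteq> (Xl l t \<omega> < x)} \<le> 1" by simp
    also have "1 \<le> (4 / \<delta>) * \<theta> ^ l" using False \<delta> by (simp add: field_simps)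
    also have "\<dots> \<le> (C + 3 * L + 4 / \<delta>) * \<theta> ^ l" using C \<delta> \<theta> by (intro mult_right_mono) auto
    finally show ?thesis .
  qed
  then show ?thesis using C \<delta> \<theta> by (intro exI[of _ "C + 3 * L + 4 / \<delta>"] exI[of _ \<theta>] exI[of _ "\<delta> / 2"]) auto
qed

end

text \<open>The constants become parameters, so that all later estimates refer to the same
  \<open>C\<close>, \<open>\<theta>\<close> and neighbourhood.\<close>

locale quantile_process_const = quantile_process M E eps Y \<tau>
  for M :: "'a measure" and E :: "'e measure" and eps :: "int \<Rightarrow> 'a \<Rightarrow> 'e" and Y :: "(nat \<Rightarrow> 'e) \<Rightarrow> real" and \<tau> :: real +
  fixes C \<theta> \<delta>0 L c :: real
  assumes params: "0 \<le> C" "0 < \<theta>" "\<theta> < 1" "0 < \<delta>0" "0 \<le> L" "0 < c"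
    and mismatch: "\<And>l t x. \<bar>x - \<xi>0\<bar> \<le> \<delta>0 \<Longrightarrow> prob {\<omega>\<in>space M. (X t \<omega> < x) \<noteq> (Xl l t \<omega> < x)} \<le> C * \<theta> ^ l"
    and cdf_lip: "\<And>x y. \<bar>x - \<xi>0\<bar> \<le> \<delta>0 \<Longrightarrow> \<bar>y - \<xi>0\<bar> \<le> \<delta>0 \<Longrightarrow> \<bar>cdf0 x - cdf0 y\<bar> \<le> L * \<bar>x - y\<bar>"
    and cdf_growth: "\<And>h. 0 \<le> h \<Longrightarrow> h \<le> \<delta>0 \<Longrightarrow> \<tau> + c * h \<le> cdf0 (\<xi>0 + h) \<and> cdf0 (\<xi>0 - h) \<le> \<tau> - c * h"
    and prob_less: "\<And>x t. \<bar>x - \<xi>0\<bar> \<le> \<delta>0 \<Longrightarrow> prob {\<omega>\<in>space M. X t \<omega> < x} = cdf0 x"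

lemma (in quantile_process) constants_exist:
  "\<exists>C \<theta> \<delta>0 L c. quantile_process_const M E eps Y \<tau> C \<theta> \<delta>0 L c"
proof -
  obtain \<delta>1 L c where 1: "0 < \<delta>1" "0 \<le> L" "0 < c"
    "\<And>x y. \<bar>x - \<xi>0\<bar> \<le> \<delta>1 \<Longrightarrow> \<bar>y - \<xi>0\<bar> \<le> \<delta>1 \<Longrightarrow> \<bar>cdf0 x - cdf0 y\<bar> \<le> L * \<bar>x - y\<bar>"
    "\<And>h. 0 \<le> h \<Longrightarrow> h \<le> \<delta>1 \<Longrightarrow> \<tau> + c * h \<le> cdf0 (\<xi>0 + h) \<and> cdf0 (\<xi>0 - h) \<le> \<tau> - c * h"
    "\<And>x t. \<bar>x - \<xi>0\<bar> < \<delta>1 \<Longrightarrow> prob {\<omega>\<in>space M. X t \<omega> < x} = cdf0 x"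
    using cdf0_local by blast
  obtain C \<theta> \<delta>2 where 2: "0 \<le> C" "0 < \<theta>" "\<theta> < 1" "0 < \<delta>2"
    "\<And>l t x. \<bar>x - \<xi>0\<bar> \<le> \<delta>2 \<Longrightarrow> prob {\<omega>\<in>space M. (X t \<omega> < x) \<noteq> (Xl l t \<omega> < x)} \<le> C * \<theta> ^ l"
    using mismatch_geometric by blast
  \<comment> \<open>Half of \<open>\<delta>1\<close>, because absence of atoms was obtained only in
    the open neighbourhood.\<close>
  define \<delta>0 where "\<delta>0 = min (\<delta>1 / 2) \<delta>2"
  have \<delta>0: "0 < \<delta>0" "\<delta>0 < \<delta>1" "\<delta>0 \<le> \<delta>2" using 1 2 by (auto simp: \<delta>0_def)
  have "quantile_process_const M E eps Y \<tau> C \<theta> \<delta>0 L c"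
    by unfold_locales (use 1 2 \<delta>0 in auto)
  then show ?thesis by blast
qed

section \<open>Indicator processes and their autocovariances\<close>

context quantile_process_const
begin

definition V :: "real \<Rightarrow> int \<Rightarrow> 'a \<Rightarrow> real" where "V x t \<omega> = Vt X \<tau> t x \<omega>"
definition U :: "nat \<Rightarrow> real \<Rightarrow> int \<Rightarrow> 'a \<Rightarrow> real" where "U l x t \<omega> = Vt (Xl l) \<tau> t x \<omega>"
text \<open>The mean of \<open>U\<close> at the quantile is only of order
  \<open>\<theta> ^ l\<close>. Exact centring is what the covariance factorization and the block
  moments require.\<close>

definition Z :: "nat \<Rightarrow> int \<Rightarrow> 'a \<Rightarrow> real" where "Z l t \<omega> = U l \<xi>0 t \<omega> - expectation (U l \<xi>0 t)"
definition r :: "int \<Rightarrow> real" where "r = rtau M X \<tau>"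
definition cov :: "nat \<Rightarrow> int \<Rightarrow> real" where "cov l u = expectation (\<lambda>\<omega>. Z l u \<omega> * Z l 0 \<omega>)"

lemma Vt_bound: "\<bar>Vt W \<tau> t x \<omega>\<bar> \<le> 1"
  using tau by (auto simp: Vt_def)

lemma V_bound: "\<bar>V x t \<omega>\<bar> \<le> 1" and U_bound: "\<bar>U l x t \<omega>\<bar> \<le> 1"
  by (simp_all add: V_def U_def Vt_bound)

lemma U_lproc: "lproc (int l) (U l x)"
  unfolding lproc_def
proof
  fix t
  note [measurable] = Xl_F_measurable[of l t]
  show "bm {t - int l<..t} (U l x t)"
    by (rule bmI[of _ _ 1]) (use U_bound in \<open>auto simp: U_def[abs_def] Vt_def\<close>)
qed

lemma V_bm: "bm {..t} (V x t)"
proof -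
  note [measurable] = X_F_measurable[of t]
  show ?thesis by (rule bmI[of _ _ 1]) (use V_bound in \<open>auto simp: V_def[abs_def] Vt_def\<close>)
qed

lemma U_bm: "bm UNIV (U l x t)"
  by (rule lprocD[OF U_lproc]) simp

lemma V_bm': "bm UNIV (V x t)"
  by (rule bm_mono[OF V_bm]) simp

lemma expectation_V: "\<bar>x - \<xi>0\<bar> \<le> \<delta>0 \<Longrightarrow> expectation (V x t) = \<tau> - cdf0 x"
proof -
  assume x: "\<bar>x - \<xi>0\<bar> \<le> \<delta>0"
  note [measurable] = X_measurable
  have "expectation (V x t) = expectation (\<lambda>\<omega>. \<tau> - indicator {\<omega>\<in>space M. X t \<omega> < x} \<omega>)"
    by (intro Bochner_Integration.integral_cong) (auto simp: V_def Vt_def indicator_def)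
  also have "\<dots> = \<tau> - prob {\<omega>\<in>space M. X t \<omega> < x}"
    by (subst Bochner_Integration.integral_diff)
       (auto simp: prob_space emeasure_eq_measure intro!: arg_cong[where f=prob])
  finally show ?thesis using prob_less[OF x] by simp
qed

lemma UV_diff: 
  assumes x: "\<bar>x - \<xi>0\<bar> \<le> \<delta>0" 
  shows "expectation (\<lambda>\<omega>. \<bar>U l x t \<omega> - V x t \<omega>\<bar>) \<le> C * \<theta> ^ l"
proof -
  note [measurable] = X_measurable Xl_measurable
  have "expectation (\<lambda>\<omega>. \<bar>U l x t \<omega> - V x t \<omega>\<bar>) = expectation (indicator {\<omega>\<in>space M. (X t \<omega> < x) \<noteq> (Xl l t \<omega> < x)})"
    by (intro Bochner_Integration.integral_cong) (auto simp: V_def U_def Vt_def indicator_def)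
  also have "\<dots> = prob {\<omega>\<in>space M. (X t \<omega> < x) \<noteq> (Xl l t \<omega> < x)}"
    by (simp add: Int_def conj_commute cong: conj_cong)
  finally show ?thesis using mismatch[OF x] by simp
qed

lemma expectation_UV: 
  assumes x: "\<bar>x - \<xi>0\<bar> \<le> \<delta>0" 
  shows "\<bar>expectation (U l x t) - (\<tau> - cdf0 x)\<bar> \<le> C * \<theta> ^ l"
proof -
  have "\<bar>expectation (\<lambda>\<omega>. U l x t \<omega> - V x t \<omega>)\<bar> \<le> expectation (\<lambda>\<omega>. \<bar>U l x t \<omega> - V x t \<omega>\<bar>)"
    by (rule integral_abs_bound)
  then show ?thesis
    using UV_diff[OF x, of l t] bm_integrable[OF U_bm] bm_integrable[OF V_bm'] expectation_V[OF x] by simp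
qed

lemma \<xi>0_close: "\<bar>\<xi>0 - \<xi>0\<bar> \<le> \<delta>0"
  using params by simp

lemma expectation_U: 
  assumes x: "\<bar>x - \<xi>0\<bar> \<le> \<delta>0" 
  shows "\<bar>expectation (U l x t)\<bar> \<le> L * \<bar>x - \<xi>0\<bar> + C * \<theta> ^ l"
  using expectation_UV[OF x, of l t] cdf_lip[OF x \<xi>0_close] cdf0_quantile by linarith

lemma expectation_U0: "\<bar>expectation (U l \<xi>0 t)\<bar> \<le> C * \<theta> ^ l"
  using expectation_U[OF \<xi>0_close, of l t] by simp

text \<open>\<open>U\<close> is monotone in its argument, so the absolute increment integrates to a
  difference of means. Those differ from increments of the distribution function by the mismatch
  error at each of the two points.\<close>

lemma U_increment: 
  assumes x: "\<bar>x - \<xi>0\<bar> \<le> \<delta>0" and y: "\<bar>y - \<xi>0\<bar> \<le> \<delta>0"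
  shows "expectation (\<lambda>\<omega>. \<bar>U l x t \<omega> - U l y t \<omega>\<bar>) \<le> L * \<bar>x - y\<bar> + 2 * (C * \<theta> ^ l)"
proof -
  have *: "expectation (\<lambda>\<omega>. \<bar>U l x t \<omega> - U l y t \<omega>\<bar>) \<le> L * \<bar>x - y\<bar> + 2 * (C * \<theta> ^ l)"
    if x: "\<bar>x - \<xi>0\<bar> \<le> \<delta>0" and y: "\<bar>y - \<xi>0\<bar> \<le> \<delta>0" and "x \<le> y" for x y
  proof -
    have "expectation (\<lambda>\<omega>. \<bar>U l x t \<omega> - U l y t \<omega>\<bar>) = expectation (\<lambda>\<omega>. U l x t \<omega> - U l y t \<omega>)"
      using \<open>x \<le> y\<close> by (intro Bochner_Integration.integral_cong) (auto simp: U_def Vt_def)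
    also have "\<dots> = expectation (U l x t) - expectation (U l y t)"
      using bm_integrable[OF U_bm] by simp
    also have "\<dots> \<le> L * \<bar>x - y\<bar> + 2 * (C * \<theta> ^ l)"
      using expectation_UV[OF x, of l t] expectation_UV[OF y, of l t] cdf_lip[OF x y] by linarith
    finally show ?thesis .
  qed
  show ?thesis
  proof (cases "x \<le> y")
    case False
    then show ?thesis using *[OF y x] by (simp add: abs_minus_commute)
  qed (rule *[OF x y])
qed

lemma Z_lproc: "lproc (int l) (Z l)"
  unfolding lproc_def Z_def[abs_def] by (intro allI bm_diff bm_const lprocD[OF U_lproc]) auto

lemma Z_bm: "bm UNIV (Z l t)"
  by (rule lprocD[OF Z_lproc]) simp

lemma expectation_Z: "expectation (Z l t) = 0"
  unfolding Z_def[abs_def] using bm_integrable[OF U_bm] by (simp add: prob_space)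

text \<open>The variable and its mean both lie in \<open>[\<tau> - 1, \<tau>]\<close>, an interval
  of length 1.\<close>

lemma Z_bound: "\<bar>Z l t \<omega>\<bar> \<le> 1"
proof -
  have U: "\<tau> - 1 \<le> U l \<xi>0 t \<omega>" "U l \<xi>0 t \<omega> \<le> \<tau>" for \<omega> by (auto simp: U_def Vt_def)
  have "\<tau> - 1 \<le> expectation (U l \<xi>0 t)" "expectation (U l \<xi>0 t) \<le> \<tau>"
    using U by (auto intro!: integral_ge_const integral_le_const bm_integrable[OF U_bm])
  then show ?thesis using U[of \<omega>] by (simp add: Z_def abs_le_iff)
qed

lemma U_past: "U l x t \<omega> = \<tau> - (if Y (mix l (past t \<omega>) (local.cont l)) < x then 1 else 0)"
  by (simp add: U_def Vt_def Xl_def)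

lemma cov_stationary: "expectation (\<lambda>\<omega>. Z l t \<omega> * Z l s \<omega>) = cov l (t - s)"
proof -
  define \<phi> where "\<phi> = (\<lambda>u. \<tau> - (if Y (mix l u (local.cont l)) < \<xi>0 then 1 else 0))"
  have m: "\<phi> \<in> borel_measurable (PiM UNIV (\<lambda>_. E))"
    unfolding \<phi>_def using Y_mix_measurable[of l] by measurable
  have Uphi: "U l \<xi>0 t = (\<lambda>\<omega>. \<phi> (past t \<omega>))" for t by (rule ext) (simp add: U_past \<phi>_def)
  have EU: "expectation (U l \<xi>0 t) = expectation (U l \<xi>0 0)" for t
    unfolding Uphi by (rule stationary_single[OF m])
  define \<mu> where "\<mu> = expectation (U l \<xi>0 0)"
  have m': "(\<lambda>u. \<phi> u - \<mu>) \<in> borel_measurable (PiM UNIV (\<lambda>_. E))" using m by measurable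
  have Zphi: "Z l t \<omega> = \<phi> (past t \<omega>) - \<mu>" for t \<omega>
    unfolding Z_def EU[of t] \<mu>_def[symmetric] by (simp add: Uphi)
  show ?thesis unfolding Zphi cov_def
    using stationary_pair[OF m' m', of "t - s" s 0] by simp
qed

lemma V_stationary: "expectation (\<lambda>\<omega>. V \<xi>0 t \<omega> * V \<xi>0 s \<omega>) = r (t - s)"
proof -
  define \<phi> where "\<phi> = (\<lambda>u. \<tau> - (if Y u < \<xi>0 then 1 else 0))"
  have m: "\<phi> \<in> borel_measurable (PiM UNIV (\<lambda>_. E))"
    unfolding \<phi>_def using Y_meas by measurable
  have Vphi: "V \<xi>0 t \<omega> = \<phi> (past t \<omega>)" for t \<omega> by (simp add: V_def Vt_def X_past \<phi>_def)
  have "expectation (\<lambda>\<omega>. V \<xi>0 t \<omega> * V \<xi>0 s \<omega>) = expectation (\<lambda>\<omega>. V \<xi>0 (t - s) \<omega> * V \<xi>0 0 \<omega>)"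
    unfolding Vphi using stationary_pair[OF m m, of "t - s" s 0] by simp
  also have "\<dots> = r (t - s)"
    unfolding r_def rtau_def V_def by (simp add: mult.commute)
  finally show ?thesis .
qed

lemma r_sym: "r (- u) = r u"
  using V_stationary[of 0 u] V_stationary[of u 0] by (simp add: mult.commute)

lemma prod_diff_le: "\<bar>a * b - a' * b'\<bar> \<le> \<bar>a - a'\<bar> + \<bar>b - b'\<bar>"
  if "\<bar>b\<bar> \<le> 1" "\<bar>a'\<bar> \<le> 1" for a b a' b' :: real
proof -
  have "a * b - a' * b' = (a - a') * b + a' * (b - b')" by (simp add: algebra_simps)
  then have "\<bar>a * b - a' * b'\<bar> \<le> \<bar>a - a'\<bar> * \<bar>b\<bar> + \<bar>a'\<bar> * \<bar>b - b'\<bar>"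
    using abs_triangle_ineq[of "(a - a') * b" "a' * (b - b')"] by (simp add: abs_mult)
  also have "\<dots> \<le> \<bar>a - a'\<bar> * 1 + 1 * \<bar>b - b'\<bar>" using that by (intro add_mono mult_mono) auto
  finally show ?thesis by simp
qed

lemma cov_r: "\<bar>cov l u - r u\<bar> \<le> (2 * C + C\<^sup>2) * \<theta> ^ l"
proof -
  have iU: "integrable M (\<lambda>\<omega>. U l \<xi>0 u \<omega> * U l \<xi>0 0 \<omega>)" and iV: "integrable M (\<lambda>\<omega>. V \<xi>0 u \<omega> * V \<xi>0 0 \<omega>)"
    by (intro bm_integrable[of UNIV] bm_mult U_bm V_bm')+
  have "cov l u = expectation (\<lambda>\<omega>. U l \<xi>0 u \<omega> * U l \<xi>0 0 \<omega>) - expectation (U l \<xi>0 u) * expectation (U l \<xi>0 0)"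
    unfolding cov_def Z_def using bm_integrable[OF U_bm] iU
    by (simp add: left_diff_distrib right_diff_distrib prob_space)
  moreover have "\<bar>expectation (\<lambda>\<omega>. U l \<xi>0 u \<omega> * U l \<xi>0 0 \<omega>) - r u\<bar> \<le> 2 * (C * \<theta> ^ l)"
  proof -
    have "expectation (\<lambda>\<omega>. U l \<xi>0 u \<omega> * U l \<xi>0 0 \<omega>) - r u = expectation (\<lambda>\<omega>. U l \<xi>0 u \<omega> * U l \<xi>0 0 \<omega> - V \<xi>0 u \<omega> * V \<xi>0 0 \<omega>)"
      using iU iV V_stationary[of u 0] by simp
    then have "\<bar>expectation (\<lambda>\<omega>. U l \<xi>0 u \<omega> * U l \<xi>0 0 \<omega>) - r u\<bar> \<le> expectation (\<lambda>\<omega>. \<bar>U l \<xi>0 u \<omega> * U l \<xi>0 0 \<omega> - V \<xi>0 u \<omega> * V \<xi>0 0 \<omega>\<bar>)"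
      by (simp only: integral_abs_bound)
    also have "\<dots> \<le> expectation (\<lambda>\<omega>. \<bar>U l \<xi>0 u \<omega> - V \<xi>0 u \<omega>\<bar> + \<bar>U l \<xi>0 0 \<omega> - V \<xi>0 0 \<omega>\<bar>)"
      by (intro integral_mono bm_integrable[of UNIV] bm_abs bm_add bm_diff bm_mult U_bm V_bm' prod_diff_le U_bound V_bound)
    also have "\<dots> = expectation (\<lambda>\<omega>. \<bar>U l \<xi>0 u \<omega> - V \<xi>0 u \<omega>\<bar>) + expectation (\<lambda>\<omega>. \<bar>U l \<xi>0 0 \<omega> - V \<xi>0 0 \<omega>\<bar>)"
      by (intro Bochner_Integration.integral_add bm_integrable[of UNIV] bm_abs bm_diff U_bm V_bm')
    also have "\<dots> \<le> 2 * (C * \<theta> ^ l)" using UV_diff[OF \<xi>0_close, of l u] UV_diff[OF \<xi>0_close, of l 0] by simp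
    finally show ?thesis .
  qed
  moreover have "\<bar>expectation (U l \<xi>0 u) * expectation (U l \<xi>0 0)\<bar> \<le> C\<^sup>2 * \<theta> ^ l"
  proof -
    have "\<bar>expectation (U l \<xi>0 u) * expectation (U l \<xi>0 0)\<bar> \<le> (C * \<theta> ^ l) * (C * \<theta> ^ l)"
      unfolding abs_mult using params by (intro mult_mono expectation_U0) auto
    also have "\<dots> = C\<^sup>2 * \<theta> ^ l * \<theta> ^ l" by (simp add: power2_eq_square)
    also have "\<dots> \<le> C\<^sup>2 * \<theta> ^ l * 1" using params by (intro mult_left_mono power_le_one) auto
    finally show ?thesis by simp
  qed
  ultimately show ?thesis unfolding distrib_right by linarith
qed

text \<open>The truncation length is chosen equal to the lag: \<open>U n\<close> at time
  \<open>n\<close> uses innovations 1 to \<open>n\<close> only and is independent of the centred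
  \<open>V\<close> at time 0, so the covariance is just the mismatch error.\<close>

lemma r_bound: "\<bar>r u\<bar> \<le> C * \<theta> ^ nat \<bar>u\<bar>"
proof -
  have *: "\<bar>r (int n)\<bar> \<le> C * \<theta> ^ n" for n
  proof -
    have d: "{int n - int n<..int n} \<inter> {..0} = {}" by auto
    have "expectation (\<lambda>\<omega>. U n \<xi>0 (int n) \<omega> * V \<xi>0 0 \<omega>) = 0"
      using bm_indep[OF lprocD[OF U_lproc[of n \<xi>0] order_refl] V_bm d, of \<xi>0] expectation_V[OF \<xi>0_close, of 0] cdf0_quantile by simp
    moreover have "integrable M (\<lambda>\<omega>. U n \<xi>0 (int n) \<omega> * V \<xi>0 0 \<omega>)" "integrable M (\<lambda>\<omega>. V \<xi>0 (int n) \<omega> * V \<xi>0 0 \<omega>)"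
      by (intro bm_integrable[of UNIV] bm_mult U_bm V_bm')+
    ultimately have "r (int n) = - expectation (\<lambda>\<omega>. (U n \<xi>0 (int n) \<omega> - V \<xi>0 (int n) \<omega>) * V \<xi>0 0 \<omega>)"
      using V_stationary[of "int n" 0] by (simp add: left_diff_distrib)
    then have "\<bar>r (int n)\<bar> \<le> expectation (\<lambda>\<omega>. \<bar>(U n \<xi>0 (int n) \<omega> - V \<xi>0 (int n) \<omega>) * V \<xi>0 0 \<omega>\<bar>)"
      using integral_abs_bound by simp
    also have "\<dots> \<le> expectation (\<lambda>\<omega>. \<bar>U n \<xi>0 (int n) \<omega> - V \<xi>0 (int n) \<omega>\<bar>)"
    proof (intro integral_mono bm_integrable[of UNIV] bm_abs bm_mult bm_diff U_bm V_bm')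
      fix \<omega>
      show "\<bar>(U n \<xi>0 (int n) \<omega> - V \<xi>0 (int n) \<omega>) * V \<xi>0 0 \<omega>\<bar> \<le> \<bar>U n \<xi>0 (int n) \<omega> - V \<xi>0 (int n) \<omega>\<bar>"
        unfolding abs_mult using V_bound[of \<xi>0 0 \<omega>] by (intro mult_left_le) auto
    qed
    also have "\<dots> \<le> C * \<theta> ^ n" by (rule UV_diff[OF \<xi>0_close])
    finally show ?thesis .
  qed
  show ?thesis
  proof (cases "u \<ge> 0")
    case True
    then show ?thesis using *[of "nat u"] by simp
  next
    case False
    then show ?thesis using *[of "nat (- u)"] r_sym[of u] by simp
  qed
qed

lemma cov_far: "int l \<le> \<bar>u\<bar> \<Longrightarrow> cov l u = 0"
  unfolding cov_def by (rule lproc_cov_zero[OF Z_lproc Z_lproc]) (auto simp: expectation_Z)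

text \<open>Beyond lag \<open>l\<close> the covariance is zero, and below it the truncation error
  \<open>\<theta> ^ l\<close> is smaller than \<open>\<theta> ^ nat \<bar>u\<bar>\<close>. The bound
  is therefore uniform in \<open>l\<close>, as domination in \<open>block_var_limit\<close>
  needs.\<close>

lemma cov_bound: "\<bar>cov l u\<bar> \<le> (3 * C + C\<^sup>2) * \<theta> ^ nat \<bar>u\<bar>"
proof (cases "int l \<le> \<bar>u\<bar>")
  case True
  then show ?thesis using cov_far params by simp
next
  case False
  then have "\<theta> ^ l \<le> \<theta> ^ nat \<bar>u\<bar>" using params by (intro power_decreasing) auto
  then have "(2 * C + C\<^sup>2) * \<theta> ^ l \<le> (2 * C + C\<^sup>2) * \<theta> ^ nat \<bar>u\<bar>" using params by (intro mult_left_mono) auto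
  then have "\<bar>cov l u\<bar> \<le> C * \<theta> ^ nat \<bar>u\<bar> + (2 * C + C\<^sup>2) * \<theta> ^ nat \<bar>u\<bar>" using cov_r[of l u] r_bound[of u] by linarith
  then show ?thesis by (simp add: algebra_simps)
qed

end

section \<open>Localization of the sample quantile\<close>

text \<open>The objective is convex in \<open>x\<close>, and minus the sum of
  \<open>\<tau> - 1{X t < y}\<close> is a subgradient of it at \<open>y\<close>. A minimizer on one
  side of \<open>y\<close> determines the sign of that sum.\<close>

lemma rho_minimizer_le:
  fixes T :: "'i set" and \<tau> :: real
  assumes T: "finite T" and min: "\<And>x. (\<Sum>t\<in>T. rho \<tau> (X t - x0)) \<le> (\<Sum>t\<in>T. rho \<tau> (X t - x))"
    and tau: "0 < \<tau>" "\<tau> < 1"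
  shows "y < x0 \<Longrightarrow> 0 \<le> (\<Sum>t\<in>T. \<tau> - (if X t < y then 1 else 0))"
    and "x0 < y \<Longrightarrow> (\<Sum>t\<in>T. \<tau> - (if X t < y then 1 else 0)) \<le> 0"
proof -
  assume y: "y < x0"
  have "(\<Sum>t\<in>T. rho \<tau> (X t - x0) - rho \<tau> (X t - y)) \<ge> (\<Sum>t\<in>T. (x0 - y) * ((if X t < y then 1 else 0) - \<tau>))"
  proof (rule sum_mono)
    fix t
    \<comment> \<open>\<open>rho\<close> is the maximum of two lines, with slopes
      \<open>\<tau>\<close> and \<open>\<tau> - 1\<close>; for negative arguments the second lies
      above the first.\<close>
    have "\<tau> * (X t - x0) \<ge> \<tau> * (X t - x0) \<and> (X t - x0) * (\<tau> - 1) \<ge> \<tau> * (X t - x0) \<or> X t \<ge> x0"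
      using tau by (auto simp: algebra_simps)
    then show "(x0 - y) * ((if X t < y then 1 else 0) - \<tau>) \<le> rho \<tau> (X t - x0) - rho \<tau> (X t - y)"
      using y tau by (auto simp: rho_def algebra_simps)
  qed
  moreover have "(\<Sum>t\<in>T. rho \<tau> (X t - x0) - rho \<tau> (X t - y)) \<le> 0" using min[of y] by (simp add: sum_subtractf)
  ultimately have "(x0 - y) * (\<Sum>t\<in>T. (if X t < y then 1 else 0) - \<tau>) \<le> 0" by (simp add: sum_distrib_left)
  then have "(\<Sum>t\<in>T. (if X t < y then 1 else 0) - \<tau>) \<le> 0" using y by (simp add: mult_le_0_iff)
  then show "0 \<le> (\<Sum>t\<in>T. \<tau> - (if X t < y then 1 else 0))" by (simp add: sum_subtractf)
next
  assume y: "x0 < y"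
  have "(\<Sum>t\<in>T. rho \<tau> (X t - x0) - rho \<tau> (X t - y)) \<ge> (\<Sum>t\<in>T. (y - x0) * (\<tau> - (if X t < y then 1 else 0)))"
  proof (rule sum_mono)
    fix t
    show "(y - x0) * (\<tau> - (if X t < y then 1 else 0)) \<le> rho \<tau> (X t - x0) - rho \<tau> (X t - y)"
      using y tau by (auto simp: rho_def algebra_simps)
  qed
  moreover have "(\<Sum>t\<in>T. rho \<tau> (X t - x0) - rho \<tau> (X t - y)) \<le> 0" using min[of y] by (simp add: sum_subtractf)
  ultimately have "(y - x0) * (\<Sum>t\<in>T. \<tau> - (if X t < y then 1 else 0)) \<le> 0" by (simp add: sum_distrib_left)
  then show "(\<Sum>t\<in>T. \<tau> - (if X t < y then 1 else 0)) \<le> 0" using y by (simp add: mult_le_0_iff)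
qed

lemma (in prob_space) chebyshev_second_moment:
  fixes f :: "'a \<Rightarrow> real"
  assumes f: "f \<in> borel_measurable M" and f2: "integrable M (\<lambda>\<omega>. (f \<omega>)\<^sup>2)"
    and K: "expectation (\<lambda>\<omega>. (f \<omega>)\<^sup>2) \<le> K" and e: "e > 0"
  shows "prob {\<omega>\<in>space M. \<bar>f \<omega>\<bar> \<ge> e} \<le> K / e\<^sup>2"
proof -
  have "{\<omega>\<in>space M. \<bar>f \<omega>\<bar> \<ge> e} = {\<omega>\<in>space M. (f \<omega>)\<^sup>2 \<ge> e\<^sup>2}"
    using e by (auto simp: abs_le_square_iff[symmetric])
  also have "prob \<dots> \<le> expectation (\<lambda>\<omega>. (f \<omega>)\<^sup>2) / e\<^sup>2"
    by (rule integral_Markov_inequality_measure[OF f2, of "{}"]) (use e in auto)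
  also have "\<dots> \<le> K / e\<^sup>2" using K by (intro divide_right_mono) auto
  finally show ?thesis .
qed

context quantile_process_const
begin

text \<open>Outside this event the indicators of \<open>X\<close> may be exchanged for those of the
  l-dependent copy at all times and all listed arguments at once.\<close>

lemma mismatch_union:
  assumes T: "finite T" and S: "finite S" "\<And>x. x \<in> S \<Longrightarrow> \<bar>x - \<xi>0\<bar> \<le> \<delta>0"
  shows "prob {\<omega>\<in>space M. \<exists>t\<in>T. \<exists>x\<in>S. V x t \<omega> \<noteq> U l x t \<omega>} \<le> real (card T) * real (card S) * (C * \<theta> ^ l)"
proof -
  note [measurable] = X_measurable Xl_measurable
  have "{\<omega>\<in>space M. \<exists>t\<in>T. \<exists>x\<in>S. V x t \<omega> \<noteq> U l x t \<omega>} =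
    (\<Union>(t,x)\<in>T \<times> S. {\<omega>\<in>space M. (X t \<omega> < x) \<noteq> (Xl l t \<omega> < x)})"
    by (auto simp: V_def U_def Vt_def split: if_splits)
  also have "prob \<dots> \<le> (\<Sum>(t,x)\<in>T \<times> S. prob {\<omega>\<in>space M. (X t \<omega> < x) \<noteq> (Xl l t \<omega> < x)})"
  proof (rule order_trans[OF finite_measure_subadditive_finite])
    show "(\<lambda>(t,x). {\<omega>\<in>space M. (X t \<omega> < x) \<noteq> (Xl l t \<omega> < x)}) ` (T \<times> S) \<subseteq> events"
    proof (rule image_subsetI)
      fix z
      show "(\<lambda>(t,x). {\<omega>\<in>space M. (X t \<omega> < x) \<noteq> (Xl l t \<omega> < x)}) z \<in> events"
        by (cases z) (simp only: prod.case, measurable)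
    qed
  qed (use T S(1) in \<open>auto simp: case_prod_beta'\<close>)
  also have "\<dots> \<le> (\<Sum>(t,x)\<in>T \<times> S. C * \<theta> ^ l)"
    using mismatch S(2) by (intro sum_mono) auto
  also have "\<dots> = real (card T) * real (card S) * (C * \<theta> ^ l)"
    using T S by (simp add: case_prod_beta' card_cartesian_product)
  finally show ?thesis .
qed

lemma centered_U_sum_second_moment:
  assumes T: "finite T" and l: "l \<ge> 1"
  shows "expectation (\<lambda>\<omega>. (\<Sum>t\<in>T. U l x t \<omega> - expectation (U l x t))\<^sup>2) \<le> 2 * real l * real (card T) * 1"
proof -
  have bU: "bm {t - int l<..t} (U l x t)" for t x by (rule lprocD[OF U_lproc order_refl])
  have "expectation (\<lambda>\<omega>. (U l x t \<omega>)\<^sup>2) \<le> 1" for t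
    using U_bound by (intro integral_le_const bm_integrable[OF bm_power[OF U_bm]] AE_I2) (simp add: abs_square_le_1)
  from bm_centered_sum_second_moment[where G="int l", OF bU T _ this] l
  show ?thesis by simp
qed

text \<open>A difference of two indicators of half-lines has square equal to its absolute value in
  either order, so the L1 bound \<open>K\<close> is also a second moment bound.\<close>

lemma centered_U_increment_second_moment:
  assumes T: "finite T" and l: "l \<ge> 1"
    and K: "\<And>t. expectation (\<lambda>\<omega>. \<bar>U l x t \<omega> - U l y t \<omega>\<bar>) \<le> K"
  shows "expectation (\<lambda>\<omega>. (\<Sum>t\<in>T. (U l x t \<omega> - U l y t \<omega>) - expectation (\<lambda>\<omega>. U l x t \<omega> - U l y t \<omega>))\<^sup>2)
      \<le> 2 * real l * real (card T) * K"
proof -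
  have bU: "bm {t - int l<..t} (U l x t)" for t x by (rule lprocD[OF U_lproc order_refl])
  have "expectation (\<lambda>\<omega>. (U l x t \<omega> - U l y t \<omega>)\<^sup>2) \<le> K" for t
  proof -
    have "(\<lambda>\<omega>. (U l x t \<omega> - U l y t \<omega>)\<^sup>2) = (\<lambda>\<omega>. \<bar>U l x t \<omega> - U l y t \<omega>\<bar>)"
      by (rule ext) (auto simp: U_def Vt_def)
    then show ?thesis using K[of t] by simp
  qed
  from bm_centered_sum_second_moment[where G="int l", OF bm_diff[OF bU bU] T _ this] l
  show ?thesis by simp
qed

text \<open>A minimizer beyond \<open>\<xi>0 + d\<close> makes the sum of indicators at
  \<open>\<xi>0 + d\<close> nonnegative, although its mean is at most minus
  \<open>N c d / 2\<close>: growth of the distribution function gives \<open>c d\<close> and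
  \<open>small\<close> lets truncation use up half of it. The deviation is caught by Chebyshev; the
  left side is symmetric.\<close>

lemma quantile_localization:
  fixes xi :: "'a \<Rightarrow> real" and T :: "int set"
  assumes T: "finite T" "T \<noteq> {}" and xi: "xi \<in> borel_measurable M"
    and min: "\<And>\<omega> x. \<omega> \<in> space M \<Longrightarrow> (\<Sum>t\<in>T. rho \<tau> (X t \<omega> - xi \<omega>)) \<le> (\<Sum>t\<in>T. rho \<tau> (X t \<omega> - x))"
    and d: "0 < d" "d \<le> \<delta>0" and l: "l \<ge> 1" and small: "2 * (C * \<theta> ^ l) \<le> c * d"
  shows "prob {\<omega>\<in>space M. d < \<bar>xi \<omega> - \<xi>0\<bar>} \<le>
    real (card T) * 2 * (C * \<theta> ^ l) + 16 * real l / (real (card T) * (c * d)\<^sup>2)"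
proof -
  define N where "N = real (card T)"
  have N: "N > 0" using T by (simp add: N_def card_gt_0_iff)
  define S where "S = {\<xi>0 - d, \<xi>0 + d}"
  define h where "h = (\<lambda>x \<omega>. \<Sum>t\<in>T. U l x t \<omega> - expectation (U l x t))"
  define e where "e = N * (c * d / 2)"
  have e: "e > 0" using N d params by (simp add: e_def)
  define A where "A = {\<omega>\<in>space M. \<exists>t\<in>T. \<exists>x\<in>S. V x t \<omega> \<noteq> U l x t \<omega>}"
  define H where "H = (\<lambda>x. {\<omega>\<in>space M. e \<le> \<bar>h x \<omega>\<bar>})"
  note [measurable] = X_measurable Xl_measurable xi bm_measurable[OF U_bm] bm_measurable[OF V_bm']
  have hm: "h x \<in> borel_measurable M" for x unfolding h_def by measurable
  have ms: "A \<in> events" "H x \<in> events" for x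
    unfolding A_def H_def S_def using T hm by measurable
  have sub: "{\<omega>\<in>space M. d < \<bar>xi \<omega> - \<xi>0\<bar>} \<subseteq> A \<union> (H (\<xi>0 - d) \<union> H (\<xi>0 + d))"
  proof
    fix \<omega> assume "\<omega> \<in> {\<omega>\<in>space M. d < \<bar>xi \<omega> - \<xi>0\<bar>}"
    then have \<omega>: "\<omega> \<in> space M" and far: "d < \<bar>xi \<omega> - \<xi>0\<bar>" by auto
    note mono = rho_minimizer_le[OF T(1) min[OF \<omega>] tau]
    show "\<omega> \<in> A \<union> (H (\<xi>0 - d) \<union> H (\<xi>0 + d))"
    proof (cases "\<omega> \<in> A")
      case False
      have UV: "(\<Sum>t\<in>T. V x t \<omega>) = (\<Sum>t\<in>T. U l x t \<omega>)" if "x \<in> S" for x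
        using False \<omega> that by (intro sum.cong) (auto simp: A_def)
      consider "\<xi>0 + d < xi \<omega>" | "xi \<omega> < \<xi>0 - d" using far by linarith
      then show ?thesis
      proof cases
        case 1
        have "0 \<le> (\<Sum>t\<in>T. U l (\<xi>0 + d) t \<omega>)"
          using mono(1)[OF 1] UV[of "\<xi>0 + d"] by (simp add: S_def V_def Vt_def)
        moreover have "(\<Sum>t\<in>T. expectation (U l (\<xi>0 + d) t)) \<le> (\<Sum>t\<in>T. - (c * d / 2))"
        proof (rule sum_mono)
          fix t
          have "\<bar>\<xi>0 + d - \<xi>0\<bar> \<le> \<delta>0" using d by simp
          from expectation_UV[OF this, of l t] cdf_growth[of d] d small
          show "expectation (U l (\<xi>0 + d) t) \<le> - (c * d / 2)" by linarith
        qed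
        ultimately have "e \<le> h (\<xi>0 + d) \<omega>" by (simp add: h_def sum_subtractf e_def N_def)
        then show ?thesis using \<omega> by (auto simp: H_def)
      next
        case 2
        have "(\<Sum>t\<in>T. U l (\<xi>0 - d) t \<omega>) \<le> 0"
          using mono(2)[OF 2] UV[of "\<xi>0 - d"] by (simp add: S_def V_def Vt_def)
        moreover have "(\<Sum>t\<in>T. c * d / 2) \<le> (\<Sum>t\<in>T. expectation (U l (\<xi>0 - d) t))"
        proof (rule sum_mono)
          fix t
          have "\<bar>\<xi>0 - d - \<xi>0\<bar> \<le> \<delta>0" using d by simp
          from expectation_UV[OF this, of l t] cdf_growth[of d] d small
          show "c * d / 2 \<le> expectation (U l (\<xi>0 - d) t)" by linarith
        qed
        ultimately have "h (\<xi>0 - d) \<omega> \<le> - e" by (simp add: h_def sum_subtractf e_def N_def)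
        then show ?thesis using \<omega> by (auto simp: H_def)
      qed
    qed simp
  qed
  have pA: "prob A \<le> N * 2 * (C * \<theta> ^ l)"
  proof -
    have "prob A \<le> N * real (card S) * (C * \<theta> ^ l)"
      unfolding A_def N_def using d T by (intro mismatch_union) (auto simp: S_def)
    also have "card S = 2" using d by (simp add: S_def)
    finally show ?thesis by simp
  qed
  have pH: "prob (H x) \<le> 8 * real l / (N * (c * d)\<^sup>2)" for x
  proof -
    have "prob (H x) \<le> (2 * real l * N * 1) / e\<^sup>2"
      unfolding H_def
    proof (rule chebyshev_second_moment[OF hm _ _ e])
      show "expectation (\<lambda>\<omega>. (h x \<omega>)\<^sup>2) \<le> 2 * real l * N * 1"
        unfolding h_def N_def by (rule centered_U_sum_second_moment[OF T(1) l])
      show "integrable M (\<lambda>\<omega>. (h x \<omega>)\<^sup>2)"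
        unfolding h_def by (intro bm_integrable[of UNIV] bm_power bm_sum bm_diff bm_const U_bm)
    qed
    also have "\<dots> = 8 * real l / (N * (c * d)\<^sup>2)"
      using N by (simp add: e_def power_mult_distrib power_divide power2_eq_square)
    finally show ?thesis .
  qed
  have "prob {\<omega>\<in>space M. d < \<bar>xi \<omega> - \<xi>0\<bar>} \<le> prob (A \<union> (H (\<xi>0 - d) \<union> H (\<xi>0 + d)))"
    using ms by (intro finite_measure_mono sub) auto
  also have "\<dots> \<le> prob A + (prob (H (\<xi>0 - d)) + prob (H (\<xi>0 + d)))"
    using ms by (intro order_trans[OF measure_Un_le] add_left_mono measure_Un_le) auto
  finally have "prob {\<omega>\<in>space M. d < \<bar>xi \<omega> - \<xi>0\<bar>} \<le> N * 2 * (C * \<theta> ^ l) + 2 * (8 * real l / (N * (c * d)\<^sup>2))"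
    using pA pH[of "\<xi>0 - d"] pH[of "\<xi>0 + d"] by linarith
  then show ?thesis by (simp add: N_def)
qed

end

section \<open>Uniform comparison of bilinear forms\<close>

text \<open>Weights depend on the time as well as the lag, so that pairs whose earlier member leaves
  \<open>I\<close> can be switched off by a zero weight.\<close>

definition bil :: "int set \<Rightarrow> int \<Rightarrow> (int \<Rightarrow> int \<Rightarrow> real) \<Rightarrow> (int \<Rightarrow> real) \<Rightarrow> (int \<Rightarrow> real) \<Rightarrow> real" where
  "bil I b \<beta> a d = (\<Sum>t\<in>I. \<Sum>j\<in>{0..b}. \<beta> t j * (a t * d (t - j)))"

lemma bil_cong:
  assumes "\<And>t. t \<in> I \<Longrightarrow> a t = a' t" "\<And>t. t \<in> I \<Longrightarrow> d t = d' t"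
    and "\<And>t j. t \<in> I \<Longrightarrow> t - j \<notin> I \<Longrightarrow> \<beta> t j = 0"
  shows "bil I b \<beta> a d = bil I b \<beta> a' d'"
  unfolding bil_def
proof (intro sum.cong refl)
  fix t j assume "t \<in> I"
  then show "\<beta> t j * (a t * d (t - j)) = \<beta> t j * (a' t * d' (t - j))"
    using assms by (cases "t - j \<in> I") auto
qed

text \<open>A change at one index affects at most \<open>b + 1\<close> products in which it is the
  later time and as many in which it is the earlier one. \<open>\<beta>0\<close> keeps the second
  count inside \<open>I\<close>.\<close>

lemma bil_change_le:
  fixes a a' :: "int \<Rightarrow> real"
  assumes I: "finite I" and b: "0 \<le> b" and \<beta>: "\<And>t j. \<bar>\<beta> t j\<bar> \<le> Ca"
    and \<beta>0: "\<And>t j. t \<in> I \<Longrightarrow> t - j \<notin> I \<Longrightarrow> \<beta> t j = 0"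
    and a: "\<And>t. \<bar>a t\<bar> \<le> 1" and a': "\<And>t. \<bar>a' t\<bar> \<le> 1"
  shows "\<bar>bil I b \<beta> a a - bil I b \<beta> a' a'\<bar> \<le> 2 * Ca * (real_of_int b + 1) * (\<Sum>t\<in>I. \<bar>a t - a' t\<bar>)"
proof -
  define h where "h = (\<lambda>t. \<bar>a t - a' t\<bar>)"
  have Ca: "0 \<le> Ca" using \<beta>[of 0 0] by linarith
  have "\<bar>bil I b \<beta> a a - bil I b \<beta> a' a'\<bar> = \<bar>\<Sum>t\<in>I. \<Sum>j\<in>{0..b}. \<beta> t j * (a t * a (t - j) - a' t * a' (t - j))\<bar>"
    by (simp add: bil_def sum_subtractf[symmetric] right_diff_distrib)
  also have "\<dots> \<le> (\<Sum>t\<in>I. \<Sum>j\<in>{0..b}. Ca * (h t + (if t - j \<in> I then h (t - j) else 0)))"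
  proof (rule order_trans[OF sum_abs], rule sum_mono, rule order_trans[OF sum_abs], rule sum_mono)
    fix t j assume t: "t \<in> I"
    have h0: "0 \<le> h t" for t by (simp add: h_def)
    have "\<bar>a t * a (t - j) - a' t * a' (t - j)\<bar> \<le> h t + h (t - j)"
    proof -
      have "a t * a (t - j) - a' t * a' (t - j) = (a t - a' t) * a (t - j) + a' t * (a (t - j) - a' (t - j))"
        by (simp add: algebra_simps)
      then have "\<bar>a t * a (t - j) - a' t * a' (t - j)\<bar> \<le> \<bar>a t - a' t\<bar> * \<bar>a (t - j)\<bar> + \<bar>a' t\<bar> * \<bar>a (t - j) - a' (t - j)\<bar>"
        using abs_triangle_ineq[of "(a t - a' t) * a (t - j)" "a' t * (a (t - j) - a' (t - j))"] by (simp add: abs_mult)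
      also have "\<dots> \<le> h t * 1 + 1 * h (t - j)" unfolding h_def using a a' by (intro add_mono mult_mono) auto
      finally show ?thesis by simp
    qed
    then have "\<bar>\<beta> t j\<bar> * \<bar>a t * a (t - j) - a' t * a' (t - j)\<bar> \<le> Ca * (h t + h (t - j))"
      using \<beta> Ca by (intro mult_mono) auto
    then show "\<bar>\<beta> t j * (a t * a (t - j) - a' t * a' (t - j))\<bar> \<le> Ca * (h t + (if t - j \<in> I then h (t - j) else 0))"
      using \<beta>0[OF t] Ca h0 by (auto simp: abs_mult)
  qed
  also have "\<dots> = Ca * ((real_of_int b + 1) * (\<Sum>t\<in>I. h t) + (\<Sum>t\<in>I. \<Sum>j\<in>{0..b}. if t - j \<in> I then h (t - j) else 0))"
    using b by (simp add: sum_distrib_left[symmetric] sum.distrib)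
  finally have 1: "\<bar>bil I b \<beta> a a - bil I b \<beta> a' a'\<bar> \<le>
    Ca * ((real_of_int b + 1) * (\<Sum>t\<in>I. h t) + (\<Sum>t\<in>I. \<Sum>j\<in>{0..b}. if t - j \<in> I then h (t - j) else 0))" .
  have "(\<Sum>t\<in>I. \<Sum>j\<in>{0..b}. if t - j \<in> I then h (t - j) else 0) = (\<Sum>j\<in>{0..b}. \<Sum>t\<in>{t\<in>I. t - j \<in> I}. h (t - j))"
    using I by (subst sum.swap) (simp add: sum.inter_filter)
  also have "\<dots> \<le> (\<Sum>j\<in>{0..b}. \<Sum>t\<in>I. h t)"
  proof (rule sum_mono)
    fix j
    have "(\<Sum>t\<in>{t\<in>I. t - j \<in> I}. h (t - j)) = (\<Sum>t\<in>(\<lambda>t. t - j) ` {t\<in>I. t - j \<in> I}. h t)"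
      by (subst sum.reindex) (auto simp: inj_on_def)
    also have "\<dots> \<le> (\<Sum>t\<in>I. h t)" using I by (intro sum_mono2) (auto simp: h_def)
    finally show "(\<Sum>t\<in>{t\<in>I. t - j \<in> I}. h (t - j)) \<le> (\<Sum>t\<in>I. h t)" .
  qed
  also have "\<dots> = (real_of_int b + 1) * (\<Sum>t\<in>I. h t)" using b by simp
  finally have "Ca * ((real_of_int b + 1) * (\<Sum>t\<in>I. h t) + (\<Sum>t\<in>I. \<Sum>j\<in>{0..b}. if t - j \<in> I then h (t - j) else 0)) \<le>
    Ca * ((real_of_int b + 1) * (\<Sum>t\<in>I. h t) + (real_of_int b + 1) * (\<Sum>t\<in>I. h t))"
    using Ca by (intro mult_left_mono add_left_mono)
  also have "\<dots> = 2 * Ca * (real_of_int b + 1) * (\<Sum>t\<in>I. \<bar>a t - a' t\<bar>)" by (simp add: h_def)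
  finally show ?thesis using 1 by linarith
qed

context quantile_process_const
begin

text \<open>Between neighbouring grid points the indicators are monotone, so a random argument costs at most the number of
  indicators that change there; at the grid points themselves a union bound over second moments suffices.\<close>
lemma grid_comparison:
  fixes xi :: "'a \<Rightarrow> real" and I :: "int set" and \<beta> :: "int \<Rightarrow> int \<Rightarrow> real" and b :: int and K l :: nat
    and \<gamma> \<kappa> \<eta> d Ca :: real
  assumes I: "finite I" "I \<noteq> {}" and xi: "xi \<in> borel_measurable M"
    and \<beta>: "\<And>t j. \<bar>\<beta> t j\<bar> \<le> Ca" and \<beta>0: "\<And>t j. t \<in> I \<Longrightarrow> t - j \<notin> I \<Longrightarrow> \<beta> t j = 0"
    and l: "l \<ge> 1" "2 * int l \<le> b" and \<gamma>: "0 < \<gamma>" "real (K + 1) * \<gamma> \<le> \<delta>0" "2 * (C * \<theta> ^ l) \<le> \<gamma>"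
    and \<kappa>: "L * (real (K + 1) * \<gamma>) + 2 * (C * \<theta> ^ l) \<le> \<kappa>" and d: "d \<le> real K * \<gamma>" and \<eta>: "0 < \<eta>"
    and \<eta>1: "2 * Ca * (real_of_int b + 1) * (2 * (L + 1) * real (card I) * \<gamma>) \<le> \<eta> / 2"
    and \<eta>2: "real (card I) * (2 * real l) * Ca * (4 * \<kappa>) \<le> \<eta> / 8"
  defines "\<Psi> \<equiv> 5 * Ca\<^sup>2 * real (card I) * (8 * (real l)\<^sup>2 * real_of_int b * \<kappa> + 96 * (real l)^3 * \<kappa>
        + 24 * real l * (real_of_int b)\<^sup>2 * \<kappa>\<^sup>2 + 4 * real (card I) * (real_of_int b)\<^sup>2 * \<kappa>^4)"
  shows "prob {\<omega>\<in>space M. \<eta> < \<bar>bil I b \<beta> (\<lambda>t. V (xi \<omega>) t \<omega>) (\<lambda>t. V (xi \<omega>) t \<omega>) - bil I b \<beta> (\<lambda>t. U l \<xi>0 t \<omega>) (\<lambda>t. U l \<xi>0 t \<omega>)\<bar>} \<le>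
    prob {\<omega>\<in>space M. d < \<bar>xi \<omega> - \<xi>0\<bar>} + real (card I) * real (2 * K + 2) * (C * \<theta> ^ l) +
    real (2 * K + 1) * (2 * real l / ((L + 1) * real (card I) * \<gamma>) + 2 * (64 * \<Psi> / \<eta>\<^sup>2))"
proof -
  define N where "N = real (card I)"
  have N: "N > 0" using I by (simp add: N_def card_gt_0_iff)
  define g where "g = (\<lambda>i::int. \<xi>0 + of_int i * \<gamma>)"
  define R where "R = {- int K..int K}"
  \<comment> \<open>One point more than \<open>R\<close> on the right, because the upper neighbour
    of every cell is needed.\<close>
  define S where "S = g ` {- int K..int K + 1}"
  have gd: "\<bar>g i - \<xi>0\<bar> \<le> real (K + 1) * \<gamma>" if "i \<in> {- int K..int K + 1}" for i
  proof -
    have "\<bar>real_of_int i\<bar> \<le> real (K + 1)" using that by auto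
    then have "\<bar>real_of_int i\<bar> * \<gamma> \<le> real (K + 1) * \<gamma>" using \<gamma> by (intro mult_right_mono) auto
    then show ?thesis using \<gamma> by (simp add: g_def abs_mult)
  qed
  have gd0: "\<bar>g i - \<xi>0\<bar> \<le> \<delta>0" if "i \<in> {- int K..int K + 1}" for i
    using gd[OF that] \<gamma> by linarith
  have C\<theta>: "0 \<le> C * \<theta> ^ l" using params by simp
  have L0: "0 \<le> L" using params by simp
  have b0: "0 \<le> b" using l by linarith
  define D where "D = (\<lambda>i t \<omega>. U l (g i) t \<omega> - U l \<xi>0 t \<omega>)"
  have Dp: "lproc (int l) (D i)" for i
    unfolding D_def lproc_def by (intro allI bm_diff lprocD[OF U_lproc order_refl])
  have D1: "\<bar>D i t \<omega>\<bar> \<le> 1" for i t \<omega> by (auto simp: D_def U_def Vt_def)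
  have ED: "expectation (\<lambda>\<omega>. \<bar>D i t \<omega>\<bar>) \<le> \<kappa>" if "i \<in> R" for i t
  proof -
    have i: "i \<in> {- int K..int K + 1}" using that by (auto simp: R_def)
    have "expectation (\<lambda>\<omega>. \<bar>D i t \<omega>\<bar>) \<le> L * \<bar>g i - \<xi>0\<bar> + 2 * (C * \<theta> ^ l)"
      unfolding D_def by (rule U_increment[OF gd0[OF i] \<xi>0_close])
    also have "\<dots> \<le> L * (real (K + 1) * \<gamma>) + 2 * (C * \<theta> ^ l)"
      using gd[OF i] L0 by (intro add_right_mono mult_left_mono) auto
    finally show ?thesis using \<kappa> by linarith
  qed
  have ED': "\<bar>expectation (D i t)\<bar> \<le> \<kappa>" if "i \<in> R" for i t
    using ED[OF that, of t] integral_abs_bound[of M "D i t"] by linarith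
  have EU: "\<bar>expectation (U l (g i) t)\<bar> \<le> \<kappa>" if "i \<in> R" for i t
  proof -
    have i: "i \<in> {- int K..int K + 1}" using that by (auto simp: R_def)
    have "L * \<bar>g i - \<xi>0\<bar> \<le> L * (real (K + 1) * \<gamma>)" using gd[OF i] L0 by (intro mult_left_mono) auto
    then show ?thesis using expectation_U[OF gd0[OF i], of l t] \<kappa> C\<theta> by linarith
  qed
  have EU0: "\<bar>expectation (U l \<xi>0 t)\<bar> \<le> \<kappa>" for t
  proof -
    have "0 \<le> L * (real (K + 1) * \<gamma>)" using L0 \<gamma> by simp
    then show ?thesis using expectation_U0[of l t] \<kappa> C\<theta> by linarith
  qed
  have ex: "\<exists>e1 e2. \<bar>e1\<bar> \<le> \<eta> / 8 \<and> \<bar>e2\<bar> \<le> \<eta> / 8 \<and>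
      expectation (\<lambda>\<omega>. (bil I b \<beta> (\<lambda>t. U l (g i) t \<omega>) (\<lambda>t. D i t \<omega>) - e1)\<^sup>2) \<le> \<Psi> \<and>
      expectation (\<lambda>\<omega>. (bil I b \<beta> (\<lambda>t. D i t \<omega>) (\<lambda>t. U l \<xi>0 t \<omega>) - e2)\<^sup>2) \<le> \<Psi>" if i: "i \<in> R" for i
  proof -
    have disj: "(\<forall>t. expectation (\<lambda>\<omega>. \<bar>U l (g i) t \<omega>\<bar>) \<le> \<kappa>) \<or> (\<forall>t. expectation (\<lambda>\<omega>. \<bar>D i t \<omega>\<bar>) \<le> \<kappa>)"
      "(\<forall>t. expectation (\<lambda>\<omega>. \<bar>D i t \<omega>\<bar>) \<le> \<kappa>) \<or> (\<forall>t. expectation (\<lambda>\<omega>. \<bar>U l \<xi>0 t \<omega>\<bar>) \<le> \<kappa>)"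
      using ED[OF i] by auto
    have l1: "1 \<le> int l" using l by simp
    obtain x1 where x1: "\<bar>x1\<bar> \<le> real (card I) * (2 * real l) * Ca * (4 * \<kappa>)"
        "expectation (\<lambda>\<omega>. (bil I b \<beta> (\<lambda>t. U l (g i) t \<omega>) (\<lambda>t. D i t \<omega>) - x1)\<^sup>2) \<le> \<Psi>"
      using bilinear_second_moment[where \<beta>=\<beta> and b=b, OF U_lproc Dp U_bound D1 EU[OF i] ED'[OF i] disj(1) l1 l(2) \<beta> I(1)]
      unfolding bil_def \<Psi>_def by (auto simp only: of_int_of_nat_eq)
    obtain x2 where x2: "\<bar>x2\<bar> \<le> real (card I) * (2 * real l) * Ca * (4 * \<kappa>)"
        "expectation (\<lambda>\<omega>. (bil I b \<beta> (\<lambda>t. D i t \<omega>) (\<lambda>t. U l \<xi>0 t \<omega>) - x2)\<^sup>2) \<le> \<Psi>"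
      using bilinear_second_moment[where \<beta>=\<beta> and b=b, OF Dp U_lproc D1 U_bound ED'[OF i] EU0 disj(2) l1 l(2) \<beta> I(1)]
      unfolding bil_def \<Psi>_def by (auto simp only: of_int_of_nat_eq)
    from x1(1) x2(1) \<eta>2 have "\<bar>x1\<bar> \<le> \<eta> / 8" "\<bar>x2\<bar> \<le> \<eta> / 8" by linarith+
    with x1(2) x2(2) show ?thesis by blast
  qed
  \<comment> \<open>The means in \<open>bilinear_second_moment\<close> are only existential, so one
    pair is selected for each grid point.\<close>
  define e1 where "e1 = (\<lambda>i. SOME e1. \<exists>e2. \<bar>e1\<bar> \<le> \<eta> / 8 \<and> \<bar>e2\<bar> \<le> \<eta> / 8 \<and>
      expectation (\<lambda>\<omega>. (bil I b \<beta> (\<lambda>t. U l (g i) t \<omega>) (\<lambda>t. D i t \<omega>) - e1)\<^sup>2) \<le> \<Psi> \<and>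
      expectation (\<lambda>\<omega>. (bil I b \<beta> (\<lambda>t. D i t \<omega>) (\<lambda>t. U l \<xi>0 t \<omega>) - e2)\<^sup>2) \<le> \<Psi>)"
  have "\<exists>e2. \<forall>i\<in>R. \<bar>e1 i\<bar> \<le> \<eta> / 8 \<and> \<bar>e2 i\<bar> \<le> \<eta> / 8 \<and>
      expectation (\<lambda>\<omega>. (bil I b \<beta> (\<lambda>t. U l (g i) t \<omega>) (\<lambda>t. D i t \<omega>) - e1 i)\<^sup>2) \<le> \<Psi> \<and>
      expectation (\<lambda>\<omega>. (bil I b \<beta> (\<lambda>t. D i t \<omega>) (\<lambda>t. U l \<xi>0 t \<omega>) - e2 i)\<^sup>2) \<le> \<Psi>"
    by (rule bchoice, rule ballI) (unfold e1_def, rule someI_ex[OF ex])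
  then obtain e2 where e12: "\<And>i. i \<in> R \<Longrightarrow> \<bar>e1 i\<bar> \<le> \<eta> / 8" "\<And>i. i \<in> R \<Longrightarrow> \<bar>e2 i\<bar> \<le> \<eta> / 8"
      "\<And>i. i \<in> R \<Longrightarrow> expectation (\<lambda>\<omega>. (bil I b \<beta> (\<lambda>t. U l (g i) t \<omega>) (\<lambda>t. D i t \<omega>) - e1 i)\<^sup>2) \<le> \<Psi>"
      "\<And>i. i \<in> R \<Longrightarrow> expectation (\<lambda>\<omega>. (bil I b \<beta> (\<lambda>t. D i t \<omega>) (\<lambda>t. U l \<xi>0 t \<omega>) - e2 i)\<^sup>2) \<le> \<Psi>" by blast
  define G where "G = (\<lambda>i \<omega>. \<Sum>t\<in>I. (U l (g i) t \<omega> - U l (g (i + 1)) t \<omega>) - expectation (\<lambda>\<omega>. U l (g i) t \<omega> - U l (g (i + 1)) t \<omega>))"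
  define f1 where "f1 = (\<lambda>i \<omega>. bil I b \<beta> (\<lambda>t. U l (g i) t \<omega>) (\<lambda>t. D i t \<omega>) - e1 i)"
  define f2 where "f2 = (\<lambda>i \<omega>. bil I b \<beta> (\<lambda>t. D i t \<omega>) (\<lambda>t. U l \<xi>0 t \<omega>) - e2 i)"
  have bG: "bm UNIV (G i)" "bm UNIV (f1 i)" "bm UNIV (f2 i)" for i
    unfolding G_def f1_def f2_def bil_def D_def by (intro bm_sum bm_diff bm_mult bm_const U_bm)+
  have inc: "expectation (\<lambda>\<omega>. \<bar>U l (g i) t \<omega> - U l (g (i + 1)) t \<omega>\<bar>) \<le> (L + 1) * \<gamma>" if "i \<in> R" for i t
  proof -
    have "i \<in> {- int K..int K + 1}" "i + 1 \<in> {- int K..int K + 1}" using that by (auto simp: R_def)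
    note U_increment[OF gd0[OF this(1)] gd0[OF this(2)], of l t]
    also have "\<bar>g i - g (i + 1)\<bar> = \<gamma>" using \<gamma> by (simp add: g_def algebra_simps)
    finally show ?thesis using \<gamma>(3) by (simp add: distrib_right)
  qed
  define B0 where "B0 = {\<omega>\<in>space M. d < \<bar>xi \<omega> - \<xi>0\<bar>}"
  define A where "A = {\<omega>\<in>space M. \<exists>t\<in>I. \<exists>x\<in>S. V x t \<omega> \<noteq> U l x t \<omega>}"
  define H where "H = (\<lambda>f e. {\<omega>\<in>space M. e \<le> \<bar>f \<omega> :: real\<bar>})"
  \<comment> \<open>The error budget: \<open>\<eta> / 2\<close> for moving from \<open>xi\<close> to
    the grid, and \<open>\<eta> / 8\<close> for each of \<open>f1\<close>, \<open>f2\<close> and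
    their two means.\<close>
  define Q where "Q = (\<lambda>i. H (G i) ((L + 1) * N * \<gamma>) \<union> (H (f1 i) (\<eta> / 8) \<union> H (f2 i) (\<eta> / 8)))"
  note [measurable] = xi bm_measurable[OF U_bm] bm_measurable[OF V_bm']
  have fS: "finite S" by (simp add: S_def)
  have mH: "H f e \<in> events" if "bm UNIV f" for f e
    unfolding H_def using bm_measurable[OF that] by measurable
  have ms: "B0 \<in> events" "A \<in> events" "Q i \<in> events" for i
  proof -
    show "B0 \<in> events" unfolding B0_def by measurable
    show "A \<in> events" unfolding A_def using I fS by measurable
    show "Q i \<in> events" unfolding Q_def by (intro sets.Un mH bG)
  qed
  have cheb: "prob (H f e) \<le> Kf / e\<^sup>2" if "bm UNIV f" "expectation (\<lambda>\<omega>. (f \<omega>)\<^sup>2) \<le> Kf" "e > 0" for f e Kf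
    unfolding H_def using that by (intro chebyshev_second_moment bm_measurable[OF that(1)] bm_integrable[OF bm_power[OF that(1)]])
  have pQ: "prob (Q i) \<le> 2 * real l / ((L + 1) * N * \<gamma>) + 2 * (64 * \<Psi> / \<eta>\<^sup>2)" if i: "i \<in> R" for i
  proof -
    have "prob (H (G i) ((L + 1) * N * \<gamma>)) \<le> (2 * real l * N * ((L + 1) * \<gamma>)) / ((L + 1) * N * \<gamma>)\<^sup>2"
      using L0 N \<gamma> centered_U_increment_second_moment[OF I(1) l(1) inc[OF i]]
      by (intro cheb bG) (auto simp: G_def N_def)
    also have "\<dots> = 2 * real l / ((L + 1) * N * \<gamma>)"
      using L0 N \<gamma> by (simp add: power2_eq_square)
    finally have 1: "prob (H (G i) ((L + 1) * N * \<gamma>)) \<le> 2 * real l / ((L + 1) * N * \<gamma>)" .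
    have "prob (H (f1 i) (\<eta> / 8)) \<le> \<Psi> / (\<eta> / 8)\<^sup>2" "prob (H (f2 i) (\<eta> / 8)) \<le> \<Psi> / (\<eta> / 8)\<^sup>2"
      by (rule cheb[OF bG(2)], use e12(3)[OF i] \<eta> in \<open>simp_all add: f1_def\<close>)
        (rule cheb[OF bG(3)], use e12(4)[OF i] \<eta> in \<open>simp_all add: f2_def\<close>)
    then have 2: "prob (H (f1 i) (\<eta> / 8)) + prob (H (f2 i) (\<eta> / 8)) \<le> 2 * (64 * \<Psi> / \<eta>\<^sup>2)"
      by (simp add: power_divide)
    have "prob (Q i) \<le> prob (H (G i) ((L + 1) * N * \<gamma>)) + (prob (H (f1 i) (\<eta> / 8)) + prob (H (f2 i) (\<eta> / 8)))"
      unfolding Q_def by (intro order_trans[OF measure_Un_le] add_left_mono measure_Un_le sets.Un mH bG)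
    then show ?thesis using 1 2 by linarith
  qed
  have pA: "prob A \<le> N * real (2 * K + 2) * (C * \<theta> ^ l)"
  proof -
    have "prob A \<le> N * real (card S) * (C * \<theta> ^ l)"
      unfolding A_def N_def using gd0 by (intro mismatch_union I fS) (auto simp: S_def)
    also have "\<dots> \<le> N * real (2 * K + 2) * (C * \<theta> ^ l)"
    proof (intro mult_right_mono mult_left_mono C\<theta>)
      have "card S \<le> card {- int K..int K + 1}" unfolding S_def by (intro card_image_le) simp
      then show "real (card S) \<le> real (2 * K + 2)" by simp
    qed (use N in auto)
    finally show ?thesis .
  qed
  have sub: "{\<omega>\<in>space M. \<eta> < \<bar>bil I b \<beta> (\<lambda>t. V (xi \<omega>) t \<omega>) (\<lambda>t. V (xi \<omega>) t \<omega>) - bil I b \<beta> (\<lambda>t. U l \<xi>0 t \<omega>) (\<lambda>t. U l \<xi>0 t \<omega>)\<bar>}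
     \<subseteq> B0 \<union> (A \<union> (\<Union>i\<in>R. Q i))"
  proof (rule subsetI, rule ccontr)
    fix \<omega> assume "\<omega> \<in> {\<omega>\<in>space M. \<eta> < \<bar>bil I b \<beta> (\<lambda>t. V (xi \<omega>) t \<omega>) (\<lambda>t. V (xi \<omega>) t \<omega>) - bil I b \<beta> (\<lambda>t. U l \<xi>0 t \<omega>) (\<lambda>t. U l \<xi>0 t \<omega>)\<bar>}"
    then have \<omega>: "\<omega> \<in> space M" and big: "\<eta> < \<bar>bil I b \<beta> (\<lambda>t. V (xi \<omega>) t \<omega>) (\<lambda>t. V (xi \<omega>) t \<omega>) - bil I b \<beta> (\<lambda>t. U l \<xi>0 t \<omega>) (\<lambda>t. U l \<xi>0 t \<omega>)\<bar>" by auto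
    assume out: "\<omega> \<notin> B0 \<union> (A \<union> (\<Union>i\<in>R. Q i))"
    define z where "z = (xi \<omega> - \<xi>0) / \<gamma>"
    define i where "i = \<lfloor>z\<rfloor>"
    have "\<bar>xi \<omega> - \<xi>0\<bar> \<le> real K * \<gamma>" using out \<omega> d by (auto simp: B0_def)
    then have z: "- real K \<le> z" "z \<le> real K" using \<gamma> by (auto simp: z_def field_simps abs_le_iff)
    then have i: "i \<in> R" unfolding i_def R_def by (auto simp: le_floor_iff floor_le_iff)
    then have gS: "g i \<in> S" "g (i + 1) \<in> S" by (auto simp: S_def R_def)
    have "real_of_int i \<le> z" "z < real_of_int (i + 1)" unfolding i_def by linarith+
    then have "real_of_int i * \<gamma> \<le> xi \<omega> - \<xi>0" "xi \<omega> - \<xi>0 < real_of_int (i + 1) * \<gamma>"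
      using \<gamma> by (auto simp: z_def pos_le_divide_eq pos_divide_less_eq)
    then have gi: "g i \<le> xi \<omega>" "xi \<omega> < g (i + 1)" by (auto simp: g_def)
    have UV: "V x t \<omega> = U l x t \<omega>" if "x \<in> S" "t \<in> I" for x t using out \<omega> that by (auto simp: A_def)
    have Qi: "\<bar>G i \<omega>\<bar> < (L + 1) * N * \<gamma>" "\<bar>f1 i \<omega>\<bar> < \<eta> / 8" "\<bar>f2 i \<omega>\<bar> < \<eta> / 8"
      using out i \<omega> by (auto simp: Q_def H_def not_le)
    have "(\<Sum>t\<in>I. \<bar>V (xi \<omega>) t \<omega> - V (g i) t \<omega>\<bar>) \<le> (\<Sum>t\<in>I. U l (g i) t \<omega> - U l (g (i + 1)) t \<omega>)"
    proof (rule sum_mono)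
      fix t assume t: "t \<in> I"
      show "\<bar>V (xi \<omega>) t \<omega> - V (g i) t \<omega>\<bar> \<le> U l (g i) t \<omega> - U l (g (i + 1)) t \<omega>"
        unfolding UV[OF gS(1) t, symmetric] UV[OF gS(2) t, symmetric] using gi by (auto simp: V_def Vt_def)
    qed
    also have "\<dots> = G i \<omega> + (\<Sum>t\<in>I. expectation (\<lambda>\<omega>. U l (g i) t \<omega> - U l (g (i + 1)) t \<omega>))"
      unfolding G_def by (simp add: sum_subtractf)
    also have "\<dots> \<le> (L + 1) * N * \<gamma> + (\<Sum>t\<in>I. (L + 1) * \<gamma>)"
    proof (intro add_mono sum_mono)
      fix t
      show "expectation (\<lambda>\<omega>. U l (g i) t \<omega> - U l (g (i + 1)) t \<omega>) \<le> (L + 1) * \<gamma>"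
        using inc[OF i, of t] integral_abs_bound[of M "\<lambda>\<omega>. U l (g i) t \<omega> - U l (g (i + 1)) t \<omega>"] by linarith
    qed (use Qi in linarith)
    also have "\<dots> = 2 * (L + 1) * N * \<gamma>" by (simp add: N_def)
    finally have cnt: "(\<Sum>t\<in>I. \<bar>V (xi \<omega>) t \<omega> - V (g i) t \<omega>\<bar>) \<le> 2 * (L + 1) * N * \<gamma>" .
    have "\<bar>bil I b \<beta> (\<lambda>t. V (xi \<omega>) t \<omega>) (\<lambda>t. V (xi \<omega>) t \<omega>) - bil I b \<beta> (\<lambda>t. V (g i) t \<omega>) (\<lambda>t. V (g i) t \<omega>)\<bar> \<le>
      2 * Ca * (real_of_int b + 1) * (\<Sum>t\<in>I. \<bar>V (xi \<omega>) t \<omega> - V (g i) t \<omega>\<bar>)"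
      by (intro bil_change_le I b0 \<beta> \<beta>0 V_bound)
    also have "\<dots> \<le> 2 * Ca * (real_of_int b + 1) * (2 * (L + 1) * N * \<gamma>)"
      using cnt b0 \<beta>[of 0 0] by (intro mult_left_mono) auto
    also have "\<dots> \<le> \<eta> / 2" using \<eta>1 by (simp add: N_def)
    finally have 1: "\<bar>bil I b \<beta> (\<lambda>t. V (xi \<omega>) t \<omega>) (\<lambda>t. V (xi \<omega>) t \<omega>) - bil I b \<beta> (\<lambda>t. V (g i) t \<omega>) (\<lambda>t. V (g i) t \<omega>)\<bar> \<le> \<eta> / 2" .
    have 2: "bil I b \<beta> (\<lambda>t. V (g i) t \<omega>) (\<lambda>t. V (g i) t \<omega>) = bil I b \<beta> (\<lambda>t. U l (g i) t \<omega>) (\<lambda>t. U l (g i) t \<omega>)"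
      using UV gS \<beta>0 by (intro bil_cong) auto
    \<comment> \<open>Polarization, \<open>a a - a' a' = a (a - a') + (a - a') a'\<close>: each
      summand contains one small increment, in the second or in the first slot. That is why
      \<open>bilinear_second_moment\<close> admits smallness of either factor.\<close>
    have "bil I b \<beta> (\<lambda>t. U l (g i) t \<omega>) (\<lambda>t. U l (g i) t \<omega>) - bil I b \<beta> (\<lambda>t. U l \<xi>0 t \<omega>) (\<lambda>t. U l \<xi>0 t \<omega>)
      = (f1 i \<omega> + e1 i) + (f2 i \<omega> + e2 i)"
      unfolding f1_def f2_def bil_def D_def by (simp add: sum.distrib[symmetric] sum_subtractf[symmetric] algebra_simps)
    then show False using 1 2 Qi e12(1,2)[OF i] big by linarith
  qed
  have "prob {\<omega>\<in>space M. \<eta> < \<bar>bil I b \<beta> (\<lambda>t. V (xi \<omega>) t \<omega>) (\<lambda>t. V (xi \<omega>) t \<omega>) - bil I b \<beta> (\<lambda>t. U l \<xi>0 t \<omega>) (\<lambda>t. U l \<xi>0 t \<omega>)\<bar>}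
    \<le> prob (B0 \<union> (A \<union> (\<Union>i\<in>R. Q i)))"
    using ms by (intro finite_measure_mono sub) (auto simp: R_def)
  also have "\<dots> \<le> prob B0 + (prob A + prob (\<Union>i\<in>R. Q i))"
    using ms by (intro order_trans[OF measure_Un_le] add_left_mono measure_Un_le) (auto simp: R_def)
  finally have 1: "prob {\<omega>\<in>space M. \<eta> < \<bar>bil I b \<beta> (\<lambda>t. V (xi \<omega>) t \<omega>) (\<lambda>t. V (xi \<omega>) t \<omega>) - bil I b \<beta> (\<lambda>t. U l \<xi>0 t \<omega>) (\<lambda>t. U l \<xi>0 t \<omega>)\<bar>}
    \<le> prob B0 + (prob A + prob (\<Union>i\<in>R. Q i))" .
  have "prob (\<Union>i\<in>R. Q i) \<le> (\<Sum>i\<in>R. prob (Q i))"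
    using ms by (intro finite_measure_subadditive_finite) (auto simp: R_def)
  also have "\<dots> \<le> (\<Sum>i\<in>R. 2 * real l / ((L + 1) * N * \<gamma>) + 2 * (64 * \<Psi> / \<eta>\<^sup>2))"
    by (intro sum_mono pQ)
  also have "\<dots> = real (2 * K + 1) * (2 * real l / ((L + 1) * N * \<gamma>) + 2 * (64 * \<Psi> / \<eta>\<^sup>2))"
    by (simp add: R_def)
  finally show ?thesis using 1 pA unfolding B0_def N_def by linarith
qed

end

section \<open>Removing the plug-in quantile\<close>

locale spectral_estimation = quantile_process_const M E eps Y \<tau> C \<theta> \<delta>0 L c + lag_window w Lw Cw
  for M :: "'a measure" and E :: "'e measure" and eps :: "int \<Rightarrow> 'a \<Rightarrow> 'e" and Y :: "(nat \<Rightarrow> 'e) \<Rightarrow> real" and \<tau> :: real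
    and C \<theta> \<delta>0 L c :: real and w :: "real \<Rightarrow> real" and Lw Cw :: real +
  fixes lam p C3 :: real and B :: "nat \<Rightarrow> real" and xi :: "nat \<Rightarrow> 'a \<Rightarrow> real"
  assumes w_even: "\<And>x. w (- x) = w x" and w0: "w 0 = 1"
    and w_cubic: "\<And>x. \<bar>1 - w x\<bar> \<le> C3 * \<bar>x\<bar> ^ 3"
    and B_inf: "filterlim B at_top sequentially"
    and B_small: "B \<in> o(\<lambda>n. real n powr (1/4))"
    and B_large: "(\<lambda>n. real n) \<in> o(\<lambda>n. B n ^ 7)"
    and xi_meas: "\<And>n. xi n \<in> borel_measurable M"
    and xi_min: "\<And>n \<omega> x. \<omega> \<in> space M \<Longrightarrow>
        (\<Sum>t\<in>{1 .. int (mn n) - int (ln_len p n)}. rho \<tau> (X t \<omega> - xi n \<omega>))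
        \<le> (\<Sum>t\<in>{1 .. int (mn n) - int (ln_len p n)}. rho \<tau> (X t \<omega> - x))"
begin

text \<open>The exponents are convenient choices: the block length must lie between \<open>n\<^sup>1\<^sup>/\<^sup>4\<close>, which dominates the bandwidth,
  and \<open>n\<^sup>1\<^sup>/\<^sup>2\<close>, so that fourth moments are negligible; the grid of \<open>ngrid n\<close> points with spacing \<open>mesh n\<close>
  must cover the \<open>n\<^sup>-\<^sup>9\<^sup>/\<^sup>2\<^sup>0\<close>-neighbourhood of the quantile.\<close>
definition lag :: "nat \<Rightarrow> nat" where "lag n = nat \<lceil>real n powr (1/1000)\<rceil>"
definition blk :: "nat \<Rightarrow> nat" where "blk n = nat \<lceil>real n powr (3/8)\<rceil>"
definition ngrid :: "nat \<Rightarrow> nat" where "ngrid n = nat \<lceil>real n powr (1/5)\<rceil>"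
definition mesh :: "nat \<Rightarrow> real" where "mesh n = real n powr (-13/20)"
definition bw :: "nat \<Rightarrow> int" where "bw n = \<lfloor>B n\<rfloor>"
definition half2 :: "nat \<Rightarrow> int set" where "half2 n = {int (mn n) + 1..int n}"
text \<open>The two-sided sum over lags is folded onto nonnegative lags, hence the factor 2 inside \<open>wcos\<close>
  except at lag 0.\<close>
definition wt :: "nat \<Rightarrow> int \<Rightarrow> real" where "wt n j = (if j = 0 then w 0 else wcos (B n) lam j)"
text \<open>Requiring \<open>t - j\<close> to stay in the second half of the sample reproduces the
  lower limit of the inner sum in \<open>gtilde\<close>.\<close>

definition wgt :: "nat \<Rightarrow> int \<Rightarrow> int \<Rightarrow> real" where "wgt n t j = (if t - j \<in> half2 n then wt n j else 0)"
text \<open>The standard deviation scale of the quadratic form: multiplying by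
  \<open>sqrt (m / B)\<close> and dividing by \<open>2 pi m\<close> amounts to dividing by
  \<open>2 pi scl n\<close>.\<close>

definition scl :: "nat \<Rightarrow> real" where "scl n = sqrt (real (mn n) * B n)"

lemma wt_bound: "\<bar>wt n j\<bar> \<le> 2 * Cw"
  using wcos_bound[of "B n" lam j] w_bound[of 0] Cw_nonneg by (auto simp: wt_def)

lemma wgt_bound: "\<bar>wgt n t j\<bar> \<le> 2 * Cw"
  using wt_bound[of n j] Cw_nonneg by (auto simp: wgt_def)

lemma wgt_outside: "t \<in> half2 n \<Longrightarrow> t - j \<notin> half2 n \<Longrightarrow> wgt n t j = 0"
  by (simp add: wgt_def)

lemma card_half2: "real (card (half2 n)) = real n - real (mn n)"
  by (simp add: half2_def mn_def of_nat_diff)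

text \<open>Collects the size relations that hold for large \<open>n\<close>, so that each later
  asymptotic estimate becomes an inequality at a single \<open>n\<close>.\<close>

definition regular :: "nat \<Rightarrow> bool" where
  "regular n \<longleftrightarrow> 100 \<le> n \<and> real n powr (1/7) \<le> B n \<and> B n \<le> real n powr (1/4) \<and>
    real n powr (1/1000) \<le> real (lag n) \<and> real (lag n) \<le> 2 * real n powr (1/1000) \<and> 1 \<le> lag n \<and>
    2 * int (lag n) \<le> bw n \<and> 4 \<le> B n \<and>
    real n powr (3/8) \<le> real (blk n) \<and> real (blk n) \<le> 2 * real n powr (3/8) \<and>
    bw n + 2 * int (lag n) \<le> int (blk n) \<and> bw n + 1 \<le> int (mn n) \<and> blk n \<le> n - mn n \<and>
    2 * B n \<le> real (blk n)"

lemma regular_eventually: "eventually regular sequentially"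
proof -
  have 1: "eventually (\<lambda>n. B n \<le> real n powr (1/4)) sequentially"
    using landau_o.smallD[OF B_small zero_less_one] by (auto elim: eventually_mono)
  have B1: "eventually (\<lambda>n. B n \<ge> 4) sequentially" using B_inf by (auto simp: filterlim_at_top)
  \<comment> \<open>Here \<open>B_large\<close> serves only as a polynomial lower bound on the
    bandwidth; its full strength is spent on the bias.\<close>
  have 2: "eventually (\<lambda>n. real n powr (1/7) \<le> B n) sequentially"
    using landau_o.smallD[OF B_large zero_less_one] B1 eventually_gt_at_top[of 0]
  proof eventually_elim
    case (elim n)
    then have "real n \<le> B n ^ 7" by simp
    then have "real n powr (1/7) \<le> (B n ^ 7) powr (1/7)" using elim by (intro powr_mono2) auto
    also have "B n ^ 7 = B n powr 7" using elim by simp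
    also have "(B n powr 7) powr (1/7) = B n"
      using elim by (simp only: powr_powr) simp
    finally show ?case .
  qed
  have e: "eventually (\<lambda>n. 2 * (real n powr (1/1000) + 1) \<le> real n powr (1/7) - 1) sequentially"
    "eventually (\<lambda>n. 1 \<le> real n powr (1/1000)) sequentially"
    "eventually (\<lambda>n. 1 \<le> real n powr (3/8)) sequentially"
    "eventually (\<lambda>n. real n powr (1/4) + 2 * (real n powr (1/1000) + 1) \<le> real n powr (3/8)) sequentially"
    "eventually (\<lambda>n. real n powr (1/4) + 1 \<le> real n / 3) sequentially"
    "eventually (\<lambda>n. 2 * real n powr (3/8) \<le> real n / 3) sequentially"
    "eventually (\<lambda>n. 2 * real n powr (1/4) \<le> real n powr (3/8)) sequentially"
    by real_asymp+
  show ?thesis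
    using 1 2 B1 e eventually_ge_at_top[of 100]
  proof eventually_elim
    case (elim n)
    have l: "real n powr (1/1000) \<le> real (lag n)" "real (lag n) \<le> real n powr (1/1000) + 1"
      using elim by (auto simp: lag_def)
    have bl: "real n powr (3/8) \<le> real (blk n)" "real (blk n) \<le> real n powr (3/8) + 1"
      using elim by (auto simp: blk_def)
    have bw: "real_of_int (bw n) \<le> B n" "B n - 1 \<le> real_of_int (bw n)" unfolding bw_def by linarith+
    have m: "real n / 3 \<le> real (mn n)" "real n / 3 \<le> real (n - mn n)" using elim by (auto simp: mn_def)
    have "real_of_int (2 * int (lag n)) \<le> real_of_int (bw n)" using l bw elim by simp
    then have "2 * int (lag n) \<le> bw n" by linarith
    moreover have "real_of_int (bw n + 2 * int (lag n)) \<le> real_of_int (int (blk n))" using l bw bl elim by simp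
    then have "bw n + 2 * int (lag n) \<le> int (blk n)" by linarith
    moreover have "real_of_int (bw n + 1) \<le> real_of_int (int (mn n))" using bw m elim by simp
    then have "bw n + 1 \<le> int (mn n)" by linarith
    moreover have "real (blk n) \<le> real (n - mn n)" using bl m elim by linarith
    then have "blk n \<le> n - mn n" by linarith
    ultimately show ?case unfolding regular_def using l bl elim by auto
  qed
qed

lemma regularD:
  assumes "regular n"
  shows "1 \<le> lag n" "2 * int (lag n) \<le> bw n" "real_of_int (bw n) \<le> B n" "real_of_int (bw n) + 1 \<le> 2 * B n"
    and "real n powr (1/7) \<le> B n" "B n \<le> real n powr (1/4)" "real (lag n) \<le> 2 * real n powr (1/1000)"
    and "real n / 3 \<le> real (mn n)" "real (mn n) \<le> real n" "real (card (half2 n)) \<le> 2 * real (mn n)"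
    and "real n / 3 \<le> real (card (half2 n))" "real (card (half2 n)) \<le> real n" "4 \<le> B n" "100 \<le> n" "0 < real (mn n)"
    and "half2 n \<noteq> {}" "0 < scl n"
proof -
  note r = assms[unfolded regular_def]
  show m: "real n / 3 \<le> real (mn n)" "real (mn n) \<le> real n" "real (card (half2 n)) \<le> 2 * real (mn n)"
    "real n / 3 \<le> real (card (half2 n))" "real (card (half2 n)) \<le> real n"
    unfolding card_half2 using r by (auto simp: mn_def)
  show "1 \<le> lag n" "2 * int (lag n) \<le> bw n" 
    "real n powr (1/7) \<le> B n" "B n \<le> real n powr (1/4)" "real (lag n) \<le> 2 * real n powr (1/1000)" "4 \<le> B n" "100 \<le> n"
    using r by auto
  show "real_of_int (bw n) \<le> B n" by (simp add: bw_def)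
  then show "real_of_int (bw n) + 1 \<le> 2 * B n" using r by linarith
  show "0 < real (mn n)" using m r by linarith
  then show "0 < scl n" using r by (simp add: scl_def)
  show "half2 n \<noteq> {}" using m r by auto
qed

lemma powr_small: "e > 0 \<Longrightarrow> d > 0 \<Longrightarrow> eventually (\<lambda>n. K * real n powr (- e) \<le> d) sequentially"
proof -
  assume "e > 0" "d > 0"
  have "(\<lambda>n. real n powr (- e)) \<longlonglongrightarrow> 0" using \<open>e > 0\<close> by real_asymp
  from order_tendstoD(2)[OF tendsto_mult_right_zero[OF this, of K] \<open>d > 0\<close>]
  show ?thesis by eventually_elim simp
qed

lemma powr_null: "e > 0 \<Longrightarrow> (\<lambda>n. K * real n powr (- e)) \<longlonglongrightarrow> 0"
proof -
  assume "e > 0"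
  then have "(\<lambda>n. real n powr (- e)) \<longlonglongrightarrow> 0" by real_asymp
  then show ?thesis by (rule tendsto_mult_right_zero)
qed

text \<open>\<open>\<theta> ^ lag n\<close> is at most the exponential of a negative multiple of
  \<open>n^(1/1000)\<close>. The cube is generous enough for every union bound and every sum over
  times and lags in what follows.\<close>

lemma theta_null: "(\<lambda>n. K * (real n ^ 3 * \<theta> ^ lag n)) \<longlonglongrightarrow> 0"
proof (rule tendsto_mult_right_zero, rule Lim_null_comparison)
  define k where "k = - ln \<theta>"
  have k: "k > 0" using params by (simp add: k_def)
  show "eventually (\<lambda>n. norm (real n ^ 3 * \<theta> ^ lag n) \<le> real n ^ 3 * exp (- k * real n powr (1/1000))) sequentially"
    using regular_eventually
  proof eventually_elim
    case (elim n)
    have "\<theta> ^ lag n = exp (- k * real (lag n))"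
      using params by (simp add: k_def powr_realpow[symmetric] powr_def mult.commute)
    also have "\<dots> \<le> exp (- k * real n powr (1/1000))"
      using elim k by (simp add: regular_def)
    finally have "\<theta> ^ lag n \<le> exp (- k * real n powr (1/1000))" .
    then show ?case using params by (simp add: mult_left_mono)
  qed
  show "(\<lambda>n. real n ^ 3 * exp (- k * real n powr (1/1000))) \<longlonglongrightarrow> 0" using k by real_asymp
qed

text \<open>\<open>m B\<close> is at least a third of \<open>n^(8/7)\<close>; the factor 2 absorbs
  the third.\<close>

lemma scl_lower: "regular n \<Longrightarrow> real n powr (4/7) \<le> 2 * scl n"
proof -
  assume r: "regular n"
  note d = regularD[OF r]
  have "(real n powr (4/7))\<^sup>2 = real n * real n powr (1/7)"
    using d by (simp add: power2_eq_square powr_add[symmetric] powr_mult_base)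
  also have "\<dots> \<le> (3 * real (mn n)) * B n" using d by (intro mult_mono) auto
  also have "\<dots> \<le> (2 * scl n)\<^sup>2" using d by (simp add: scl_def power_mult_distrib)
  finally show ?thesis by (rule power2_le_imp_le) (use d in simp)
qed

lemma scl_sq: "regular n \<Longrightarrow> (scl n)\<^sup>2 = real (mn n) * B n"
  using regularD[of n] by (simp add: scl_def)

text \<open>In \<open>quantile_localization\<close> with \<open>d = n^(-9/20)\<close> the Chebyshev
  term has exponent \<open>1/1000 - 1 + 9/10\<close>, which is negative because 9/20 stays below
  1/2.\<close>

lemma quantile_tail_null: "(\<lambda>n. prob {\<omega>\<in>space M. real n powr (-9/20) < \<bar>xi n \<omega> - \<xi>0\<bar>}) \<longlonglongrightarrow> 0"
proof -
  define T where "T = (\<lambda>n. {1 .. int (mn n) - int (ln_len p n)})"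
  \<comment> \<open>The \<open>ln_len p n\<close> observations left out of the quantile sample are
    negligible, so that at least \<open>n / 4\<close> remain.\<close>
  have lnp: "eventually (\<lambda>n. ln (real n) powr p \<le> real n / 20) sequentially"
  proof -
    have "(\<lambda>n. ln (real n) powr p / real n) \<longlonglongrightarrow> 0" by real_asymp
    then have "eventually (\<lambda>n. ln (real n) powr p / real n < 1 / 20) sequentially"
      by (rule order_tendstoD) simp
    then show ?thesis using eventually_gt_at_top[of 0] by eventually_elim (simp add: field_simps)
  qed
  have ev1: "eventually (\<lambda>n. real n powr (-9/20) \<le> \<delta>0) sequentially"
    using powr_small[of "9/20" \<delta>0 1] params by simp
  have ev2: "eventually (\<lambda>n. 2 * (C * \<theta> ^ lag n) \<le> c * real n powr (-9/20)) sequentially"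
  proof -
    have "eventually (\<lambda>n. (2 * C) * (real n ^ 3 * \<theta> ^ lag n) < c) sequentially"
      using order_tendstoD(2)[OF theta_null, of c] params by simp
    then show ?thesis using eventually_gt_at_top[of 0]
    proof eventually_elim
      case (elim n)
      have "2 * (C * \<theta> ^ lag n) * 1 \<le> 2 * (C * \<theta> ^ lag n) * (real n ^ 3 * real n powr (-9/20))"
      proof (intro mult_left_mono)
        have "1 = real n powr 0" using elim by simp
        also have "\<dots> \<le> real n powr (3 + (-9/20))" using elim by (intro powr_mono) auto
        also have "\<dots> = real n ^ 3 * real n powr (-9/20)" using elim by (simp only: powr_add) simp
        finally show "1 \<le> real n ^ 3 * real n powr (-9/20)" .
      qed (use params in auto)
      also have "\<dots> = ((2 * C) * (real n ^ 3 * \<theta> ^ lag n)) * real n powr (-9/20)" by simp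
      also have "\<dots> \<le> c * real n powr (-9/20)" using elim by (intro mult_right_mono) auto
      finally show ?case by simp
    qed
  qed
  show ?thesis
  proof (rule Lim_null_comparison)
    show "(\<lambda>n. (2 * C) * (real n ^ 3 * \<theta> ^ lag n) + (128 / c\<^sup>2) * real n powr (- (99/1000))) \<longlonglongrightarrow> 0"
      using tendsto_add[OF theta_null[of "2 * C"] powr_null[of "99/1000" "128 / c\<^sup>2"]] by simp
    show "eventually (\<lambda>n. norm (prob {\<omega>\<in>space M. real n powr (-9/20) < \<bar>xi n \<omega> - \<xi>0\<bar>}) \<le>
        (2 * C) * (real n ^ 3 * \<theta> ^ lag n) + (128 / c\<^sup>2) * real n powr (- (99/1000))) sequentially"
      using lnp ev1 ev2 regular_eventually
    proof eventually_elim
      case (elim n)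
      note d = regularD[OF elim(4)]
      have x: "1 \<le> real n" "0 < real n" using d by auto
      have lnn: "real (ln_len p n) \<le> real n / 20" using elim(1) unfolding ln_len_def by linarith
      have "real (card (T n)) = real (nat (int (mn n) - int (ln_len p n)))" by (simp add: T_def)
      then have cT: "real n / 4 \<le> real (card (T n))" "real (card (T n)) \<le> real n"
        using lnn d by linarith+
      then have ne: "T n \<noteq> {}" using x by auto
      have "prob {\<omega>\<in>space M. real n powr (-9/20) < \<bar>xi n \<omega> - \<xi>0\<bar>} \<le>
        real (card (T n)) * 2 * (C * \<theta> ^ lag n) + 16 * real (lag n) / (real (card (T n)) * (c * real n powr (-9/20))\<^sup>2)"
      proof (rule quantile_localization)
        show "finite (T n)" by (simp add: T_def)
        show "(\<Sum>t\<in>T n. rho \<tau> (X t \<omega> - xi n \<omega>)) \<le> (\<Sum>t\<in>T n. rho \<tau> (X t \<omega> - x))" if "\<omega> \<in> space M" for \<omega> x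
          unfolding T_def by (rule xi_min[OF that])
      qed (use ne xi_meas elim d x in auto)
      also have "\<dots> \<le> (2 * C) * (real n ^ 3 * \<theta> ^ lag n) + (128 / c\<^sup>2) * real n powr (- (99/1000))"
      proof (rule add_mono)
        have "real n * 1 \<le> real n * (real n)\<^sup>2" using x by (intro mult_left_mono one_le_power) auto
        then have "real (card (T n)) \<le> real n ^ 3" using cT by (simp add: power2_eq_square power3_eq_cube)
        then have "real (card (T n)) * (2 * (C * \<theta> ^ lag n)) \<le> real n ^ 3 * (2 * (C * \<theta> ^ lag n))"
          using params by (intro mult_right_mono) auto
        then show "real (card (T n)) * 2 * (C * \<theta> ^ lag n) \<le> (2 * C) * (real n ^ 3 * \<theta> ^ lag n)" by (simp add: mult_ac)
        have "16 * real (lag n) / (real (card (T n)) * (c * real n powr (-9/20))\<^sup>2) \<le>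
          16 * (2 * real n powr (1/1000)) / ((real n / 4) * (c * real n powr (-9/20))\<^sup>2)"
          using d cT x params by (intro frac_le mult_left_mono mult_right_mono mult_pos_pos) auto
        also have "\<dots> = (128 / c\<^sup>2) * (real n powr (1/1000) / (real n powr 1 * (real n powr (-9/20))\<^sup>2))"
          using x params by (simp add: power_mult_distrib)
        also have "real n powr 1 * (real n powr (-9/20))\<^sup>2 = real n powr (1/10)"
          using x by (simp only: power2_eq_square powr_add[symmetric]) simp
        also have "real n powr (1/1000) / real n powr (1/10) = real n powr (- (99/1000))"
          using x by (simp only: powr_diff[symmetric]) simp
        finally show "16 * real (lag n) / (real (card (T n)) * (c * real n powr (-9/20))\<^sup>2) \<le> (128 / c\<^sup>2) * real n powr (- (99/1000))" .
      qed
      finally show ?case by simp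
    qed
  qed
qed


text \<open>The second moment bound \<open>\<Psi>\<close> of \<open>grid_comparison\<close> for the
  weights of the estimator.\<close>

definition grid_err :: "nat \<Rightarrow> real \<Rightarrow> real" where
  "grid_err n \<kappa> = 5 * (2 * Cw)\<^sup>2 * real (card (half2 n)) * (8 * (real (lag n))\<^sup>2 * real_of_int (bw n) * \<kappa> + 96 * (real (lag n))^3 * \<kappa>
        + 24 * real (lag n) * (real_of_int (bw n))\<^sup>2 * \<kappa>\<^sup>2 + 4 * real (card (half2 n)) * (real_of_int (bw n))\<^sup>2 * \<kappa>^4)"

text \<open>Relative to \<open>m B\<close> the four summands have exponents -448/1000, -447/1000,
  -649/1000 and -550/1000; the second, from the small lags, dominates. The constant is
  \<open>40 (32 + 768 + 48 + 4)\<close>.\<close>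

lemma grid_err_bound:
  assumes r: "regular n" and k: "1 \<le> k"
  shows "grid_err n (k * real n powr (-9/20)) \<le> (scl n)\<^sup>2 * (34080 * Cw\<^sup>2 * k ^ 4 * real n powr (- (447/1000)))"
proof -
  note d = regularD[OF r]
  define x where "x = real n"
  define \<kappa> where "\<kappa> = k * x powr (-9/20)"
  define l where "l = real (lag n)"
  define b where "b = real_of_int (bw n)"
  define N where "N = real (card (half2 n))"
  define m where "m = real (mn n)"
  have x: "1 \<le> x" "0 < x" using d by (auto simp: x_def)
  have l: "0 \<le> l" "l \<le> 2 * x powr (1/1000)" using d by (auto simp: l_def x_def)
  have b: "0 \<le> b" "b \<le> B n" "1 \<le> B n" "B n \<le> x powr (1/4)" using d by (auto simp: b_def x_def)
  have N: "0 \<le> N" "N \<le> 2 * m" "N \<le> x" using d by (auto simp: N_def m_def x_def)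
  have \<kappa>: "0 \<le> \<kappa>" using k by (simp add: \<kappa>_def)
  have kp: "k \<le> k ^ 4" "k\<^sup>2 \<le> k ^ 4" using k power_increasing[of 1 4 k] power_increasing[of 2 4 k] by auto
  have b2: "b\<^sup>2 \<le> B n * x powr (1/4)"
    unfolding power2_eq_square using b by (intro mult_mono) auto
  have l2: "l\<^sup>2 \<le> 4 * x powr (2/1000)"
  proof -
    have "l\<^sup>2 \<le> (2 * x powr (1/1000))\<^sup>2" using l by (intro power_mono) auto
    also have "\<dots> = 4 * x powr (2/1000)" using x by (simp add: power2_eq_square powr_add[symmetric])
    finally show ?thesis .
  qed
  have l3: "l ^ 3 \<le> 8 * x powr (3/1000)"
  proof -
    have "l ^ 3 \<le> (2 * x powr (1/1000)) ^ 3" using l by (intro power_mono) auto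
    also have "\<dots> = 8 * x powr (3/1000)" using x by (simp add: power3_eq_cube powr_add[symmetric])
    finally show ?thesis .
  qed
  define y where "y = x powr (- (447/1000))"
  have t1: "8 * l\<^sup>2 * b * \<kappa> \<le> B n * (32 * k ^ 4 * y)"
  proof -
    have "8 * l\<^sup>2 * b * \<kappa> \<le> 8 * (4 * x powr (2/1000)) * B n * \<kappa>"
      using l2 b \<kappa> by (intro mult_right_mono mult_mono) auto
    also have "\<dots> = B n * (32 * k * (x powr (2/1000) * x powr (-9/20)))" by (simp add: \<kappa>_def)
    also have "x powr (2/1000) * x powr (-9/20) = x powr (- (448/1000))" by (simp add: powr_add[symmetric])
    also have "B n * (32 * k * x powr (- (448/1000))) \<le> B n * (32 * k ^ 4 * y)"
      unfolding y_def using b kp x by (intro mult_left_mono mult_mono powr_mono) auto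
    finally show ?thesis .
  qed
  have t2: "96 * l ^ 3 * \<kappa> \<le> B n * (768 * k ^ 4 * y)"
  proof -
    have "96 * l ^ 3 * \<kappa> \<le> 96 * (8 * x powr (3/1000)) * \<kappa>"
      using l3 \<kappa> by (intro mult_right_mono mult_left_mono) auto
    also have "\<dots> = 768 * k * (x powr (3/1000) * x powr (-9/20))" by (simp add: \<kappa>_def)
    also have "x powr (3/1000) * x powr (-9/20) = y" by (simp add: y_def powr_add[symmetric])
    also have "768 * k * y \<le> 1 * (768 * k ^ 4 * y)"
      using kp by (simp add: y_def mult_right_mono)
    also have "\<dots> \<le> B n * (768 * k ^ 4 * y)"
      using b k by (intro mult_right_mono) (auto simp: y_def)
    finally show ?thesis .
  qed
  have t3: "24 * l * b\<^sup>2 * \<kappa>\<^sup>2 \<le> B n * (48 * k ^ 4 * y)"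
  proof -
    have "24 * l * b\<^sup>2 * \<kappa>\<^sup>2 \<le> 24 * (2 * x powr (1/1000)) * (B n * x powr (1/4)) * \<kappa>\<^sup>2"
      using l b2 b by (intro mult_right_mono mult_mono) auto
    also have "\<dots> = B n * (48 * k\<^sup>2 * (x powr (1/1000) * x powr (1/4) * (x powr (-9/20))\<^sup>2))" by (simp add: \<kappa>_def power_mult_distrib)
    also have "x powr (1/1000) * x powr (1/4) * (x powr (-9/20))\<^sup>2 = x powr (- (649/1000))" by (simp add: power2_eq_square powr_add[symmetric])
    also have "B n * (48 * k\<^sup>2 * x powr (- (649/1000))) \<le> B n * (48 * k ^ 4 * y)"
      unfolding y_def using b kp x by (intro mult_left_mono mult_mono powr_mono) auto
    finally show ?thesis .
  qed
  have t4: "4 * N * b\<^sup>2 * \<kappa> ^ 4 \<le> B n * (4 * k ^ 4 * y)"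
  proof -
    have "4 * N * b\<^sup>2 * \<kappa> ^ 4 \<le> 4 * x * (B n * x powr (1/4)) * \<kappa> ^ 4"
      using N b2 b \<kappa> x by (intro mult_right_mono mult_mono) auto
    also have "\<dots> = B n * (4 * k ^ 4 * (x powr 1 * x powr (1/4) * (x powr (-9/20)) ^ 4))" using x by (simp add: \<kappa>_def power_mult_distrib)
    also have "x powr 1 * x powr (1/4) * (x powr (-9/20)) ^ 4 = x powr (- (550/1000))"
      by (simp only: power4_eq_xxxx powr_add[symmetric]) simp
    also have "B n * (4 * k ^ 4 * x powr (- (550/1000))) \<le> B n * (4 * k ^ 4 * y)"
      unfolding y_def using b k x by (intro mult_left_mono mult_mono powr_mono) auto
    finally show ?thesis .
  qed
  have "grid_err n \<kappa> = 5 * (2 * Cw)\<^sup>2 * N * (8 * l\<^sup>2 * b * \<kappa> + 96 * l ^ 3 * \<kappa> + 24 * l * b\<^sup>2 * \<kappa>\<^sup>2 + 4 * N * b\<^sup>2 * \<kappa> ^ 4)"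
    by (simp add: grid_err_def N_def l_def b_def)
  also have "\<dots> \<le> 5 * (2 * Cw)\<^sup>2 * N * (B n * (32 * k ^ 4 * y) + B n * (768 * k ^ 4 * y) + B n * (48 * k ^ 4 * y) + B n * (4 * k ^ 4 * y))"
    using N by (intro mult_left_mono add_mono t1 t2 t3 t4) simp
  also have "\<dots> \<le> 5 * (2 * Cw)\<^sup>2 * (2 * m) * (B n * (32 * k ^ 4 * y) + B n * (768 * k ^ 4 * y) + B n * (48 * k ^ 4 * y) + B n * (4 * k ^ 4 * y))"
    using N b k by (intro mult_right_mono mult_left_mono add_nonneg_nonneg mult_nonneg_nonneg) (simp_all add: y_def)
  also have "\<dots> = (m * B n) * (34080 * Cw\<^sup>2 * k ^ 4 * y)" by (simp add: power_mult_distrib algebra_simps)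
  also have "m * B n = (scl n)\<^sup>2" using scl_sq[OF r] by (simp add: m_def)
  finally show ?thesis unfolding \<kappa>_def y_def x_def .
qed

lemma theta_small: "k > 0 \<Longrightarrow> e \<le> 3 \<Longrightarrow> eventually (\<lambda>n. 2 * (C * \<theta> ^ lag n) \<le> k * real n powr (- e)) sequentially"
proof -
  assume k: "k > 0" and e: "e \<le> 3"
  have "eventually (\<lambda>n. (2 * C) * (real n ^ 3 * \<theta> ^ lag n) < k) sequentially"
    by (rule order_tendstoD(2)[OF theta_null k])
  then show ?thesis using eventually_gt_at_top[of 0]
  proof eventually_elim
    case (elim n)
    have "2 * (C * \<theta> ^ lag n) * 1 \<le> 2 * (C * \<theta> ^ lag n) * (real n ^ 3 * real n powr (- e))"
    proof (intro mult_left_mono)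
      have "1 = real n powr 0" using elim by simp
      also have "\<dots> \<le> real n powr (3 + (- e))" using elim e by (intro powr_mono) auto
      also have "\<dots> = real n ^ 3 * real n powr (- e)" using elim by (simp only: powr_add) simp
      finally show "1 \<le> real n ^ 3 * real n powr (- e)" .
    qed (use params in auto)
    also have "\<dots> = ((2 * C) * (real n ^ 3 * \<theta> ^ lag n)) * real n powr (- e)" by simp
    also have "\<dots> \<le> k * real n powr (- e)" using elim by (intro mult_right_mono) auto
    finally show ?case by simp
  qed
qed

text \<open>The four summands of \<open>h\<close> correspond to a badly located quantile, mismatch
  with the l-dependent copy, too many indicators changing inside a cell, and a large bilinear form
  at a grid point. In the last two the number of cells, of order \<open>n^(1/5)\<close>, multiplies
  bounds with exponents -349/1000 and -447/1000.\<close>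

lemma plugin_negligible:
  assumes \<epsilon>: "\<epsilon> > 0"
  shows "(\<lambda>n. prob {\<omega>\<in>space M. \<epsilon> * scl n < \<bar>bil (half2 n) (bw n) (wgt n) (\<lambda>t. V (xi n \<omega>) t \<omega>) (\<lambda>t. V (xi n \<omega>) t \<omega>)
      - bil (half2 n) (bw n) (wgt n) (\<lambda>t. U (lag n) \<xi>0 t \<omega>) (\<lambda>t. U (lag n) \<xi>0 t \<omega>)\<bar>}) \<longlonglongrightarrow> 0"
    (is "?f \<longlonglongrightarrow> 0")
proof -
  \<comment> \<open>Grid points lie within \<open>3 n^(-9/20)\<close> of the quantile, hence
    \<open>3 L\<close>; the added 1 pays for the mismatch error.\<close>
  define k where "k = 3 * L + 1"
  have k: "1 \<le> k" using params by (simp add: k_def)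
  define \<kappa> where "\<kappa> = (\<lambda>n. k * real n powr (-9/20))"
  define h where "h = (\<lambda>n. prob {\<omega>\<in>space M. real n powr (-9/20) < \<bar>xi n \<omega> - \<xi>0\<bar>} + (6 * C) * (real n ^ 3 * \<theta> ^ lag n)
     + 60 * real n powr (- (149/1000)) + (640 * 34080 * Cw\<^sup>2 * k ^ 4 / \<epsilon>\<^sup>2) * real n powr (- (247/1000)))"
  have ng: "eventually (\<lambda>n. real n powr (1/5) \<le> real (ngrid n) \<and> real (ngrid n) + 1 \<le> 3 * real n powr (1/5)) sequentially"
  proof -
    have "eventually (\<lambda>n. 1 \<le> real n powr (1/5)) sequentially" by real_asymp
    then show ?thesis
    proof eventually_elim
      case (elim n)
      have "real n powr (1/5) \<le> real (ngrid n)" "real (ngrid n) \<le> real n powr (1/5) + 1"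
        using elim unfolding ngrid_def by linarith+
      then show ?case using elim by linarith
    qed
  qed
  have e1: "eventually (\<lambda>n. 3 * real n powr (- (9/20)) \<le> \<delta>0) sequentially"
    using powr_small[of "9/20" \<delta>0 3] params by simp
  have e2: "eventually (\<lambda>n. 2 * (C * \<theta> ^ lag n) \<le> 1 * real n powr (- (13/20))) sequentially"
    by (rule theta_small) auto
  have e3: "eventually (\<lambda>n. (64 * Cw * (L + 1)) * real n powr (- (1/40)) \<le> \<epsilon>) sequentially"
    using powr_small[of "1/40"] \<epsilon> by simp
  have e4: "eventually (\<lambda>n. (512 * Cw * k) * real n powr (- (1/50)) \<le> \<epsilon>) sequentially"
    using powr_small[of "1/50"] \<epsilon> by simp
  show ?thesis
  proof (rule Lim_null_comparison[where g=h])
    show "h \<longlonglongrightarrow> 0"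
      unfolding h_def
      using tendsto_add[OF tendsto_add[OF tendsto_add[OF quantile_tail_null theta_null[of "6 * C"]]
        powr_null[of "149/1000" 60]] powr_null[of "247/1000" "640 * 34080 * Cw\<^sup>2 * k ^ 4 / \<epsilon>\<^sup>2"]] by simp
    show "eventually (\<lambda>n. norm (?f n) \<le> h n) sequentially"
      using regular_eventually ng e1 e2 e3 e4
    proof eventually_elim
      case (elim n)
      note d = regularD[OF elim(1)]
      define x where "x = real n"
      have x: "1 \<le> x" "0 < x" using d by (auto simp: x_def)
      define N where "N = real (card (half2 n))"
      have N: "0 < N" "x / 3 \<le> N" "N \<le> x" "N \<le> 2 * real (mn n)" using d by (auto simp: N_def x_def)
      have mesh: "mesh n = x powr (-13/20)" by (simp add: mesh_def x_def)
      have g1: "real (ngrid n + 1) * mesh n \<le> 3 * x powr (-9/20)"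
      proof -
        have "real (ngrid n + 1) * mesh n \<le> (3 * x powr (1/5)) * x powr (-13/20)"
          unfolding mesh using elim(2) by (intro mult_right_mono) (auto simp: x_def)
        also have "\<dots> = 3 * x powr (-9/20)" by (simp add: powr_add[symmetric])
        finally show ?thesis .
      qed
      have g2: "x powr (-9/20) \<le> real (ngrid n) * mesh n"
      proof -
        have "x powr (-9/20) = x powr (1/5) * x powr (-13/20)" by (simp add: powr_add[symmetric])
        also have "\<dots> \<le> real (ngrid n) * mesh n"
          unfolding mesh using elim(2) by (intro mult_right_mono) (auto simp: x_def)
        finally show ?thesis .
      qed
      have \<kappa>n: "L * (real (ngrid n + 1) * mesh n) + 2 * (C * \<theta> ^ lag n) \<le> \<kappa> n"
      proof -
        have "L * (real (ngrid n + 1) * mesh n) \<le> L * (3 * x powr (-9/20))"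
          using g1 params by (intro mult_left_mono) auto
        moreover have "2 * (C * \<theta> ^ lag n) \<le> x powr (-9/20)"
        proof -
          have "2 * (C * \<theta> ^ lag n) \<le> x powr (- (13/20))" using elim(4) by (simp add: x_def)
          also have "\<dots> \<le> x powr (-9/20)" using x by (intro powr_mono) auto
          finally show ?thesis .
        qed
        ultimately show ?thesis by (simp add: \<kappa>_def k_def x_def algebra_simps)
      qed
      have c1: "2 * (2 * Cw) * (real_of_int (bw n) + 1) * (2 * (L + 1) * N * mesh n) \<le> \<epsilon> * scl n / 2"
      proof -
        have "2 * (2 * Cw) * (real_of_int (bw n) + 1) * (2 * (L + 1) * N * mesh n) \<le>
           2 * (2 * Cw) * (2 * B n) * (2 * (L + 1) * (2 * real (mn n)) * mesh n)"
          using d N Cw_nonneg params by (intro mult_mono mult_left_mono mult_right_mono) (auto simp: mesh_def)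
        also have "\<dots> = 32 * Cw * (L + 1) * (scl n * scl n) * mesh n"
          using scl_sq[OF elim(1)] by (simp add: power2_eq_square)
        also have "\<dots> = scl n * (32 * Cw * (L + 1) * (scl n * x powr (-13/20)))" by (simp add: mesh)
        \<comment> \<open>\<open>scl n\<close> can only be bounded by \<open>n^(5/8)\<close>, since
          \<open>B\<close> may be close to \<open>n^(1/4)\<close>. Therefore the mesh exponent 13/20
          has to exceed 5/8.\<close>
        also have "scl n * x powr (-13/20) \<le> x powr (5/8) * x powr (-13/20)"
        proof (intro mult_right_mono)
          have "(scl n)\<^sup>2 \<le> x * x powr (1/4)"
            unfolding scl_sq[OF elim(1)] using d x by (intro mult_mono) (auto simp: x_def)
          also have "\<dots> = (x powr (5/8))\<^sup>2" using x by (simp add: power2_eq_square powr_add[symmetric] powr_mult_base)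
          finally show "scl n \<le> x powr (5/8)" by (rule power2_le_imp_le) simp
        qed simp
        also have "x powr (5/8) * x powr (-13/20) = x powr (- (1/40))" by (simp add: powr_add[symmetric])
        finally have "2 * (2 * Cw) * (real_of_int (bw n) + 1) * (2 * (L + 1) * N * mesh n) \<le> scl n * (32 * Cw * (L + 1) * x powr (- (1/40)))"
          using d Cw_nonneg params by (simp add: mult_left_mono)
        also have "\<dots> \<le> scl n * (\<epsilon> / 2)"
          using elim(5) d by (intro mult_left_mono) (auto simp: x_def)
        finally show ?thesis by (simp add: mult.commute)
      qed
      have c2: "N * (2 * real (lag n)) * (2 * Cw) * (4 * \<kappa> n) \<le> \<epsilon> * scl n / 8"
      proof -
        have "N * (2 * real (lag n)) * (2 * Cw) * (4 * \<kappa> n) \<le> x * (2 * (2 * x powr (1/1000))) * (2 * Cw) * (4 * \<kappa> n)"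
          using N d Cw_nonneg k x by (intro mult_mono mult_right_mono) (auto simp: \<kappa>_def x_def)
        also have "\<dots> = 32 * Cw * k * (x powr 1 * x powr (1/1000) * x powr (-9/20))"
          using x by (simp add: \<kappa>_def x_def)
        also have "x powr 1 * x powr (1/1000) * x powr (-9/20) = x powr (551/1000)" by (simp only: powr_add[symmetric]) simp
        \<comment> \<open>The margin between 551/1000 and \<open>4/7 - 1/50\<close> is less than
          1/2000, so a tiny lag exponent is essential to this comparison.\<close>
        also have "\<dots> \<le> x powr (4/7 + (- (1/50)))" using x by (intro powr_mono) auto
        also have "\<dots> = x powr (4/7) * x powr (- (1/50))" by (rule powr_add)
        also have "\<dots> \<le> (2 * scl n) * x powr (- (1/50))" using scl_lower[OF elim(1)] by (intro mult_right_mono) (auto simp: x_def)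
        finally have "N * (2 * real (lag n)) * (2 * Cw) * (4 * \<kappa> n) \<le> 32 * Cw * k * ((2 * scl n) * x powr (- (1/50)))"
          using Cw_nonneg k by (simp add: mult_left_mono)
        also have "\<dots> = scl n * ((512 * Cw * k) * x powr (- (1/50))) / 8" by simp
        also have "\<dots> \<le> scl n * \<epsilon> / 8" using elim(6) d by (intro divide_right_mono mult_left_mono) (auto simp: x_def)
        finally show ?thesis by (simp add: mult.commute)
      qed
      have main: "?f n \<le> prob {\<omega>\<in>space M. x powr (-9/20) < \<bar>xi n \<omega> - \<xi>0\<bar>} + N * real (2 * ngrid n + 2) * (C * \<theta> ^ lag n) +
        real (2 * ngrid n + 1) * (2 * real (lag n) / ((L + 1) * N * mesh n) + 2 * (64 * grid_err n (\<kappa> n) / (\<epsilon> * scl n)\<^sup>2))"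
        unfolding grid_err_def N_def
      proof (rule grid_comparison)
        show "0 < mesh n" using x by (simp add: mesh)
        show "real (ngrid n + 1) * mesh n \<le> \<delta>0" using g1 elim(3) by (simp add: x_def)
        show "2 * (C * \<theta> ^ lag n) \<le> mesh n" using elim(4) by (simp add: mesh_def)
        show "0 < \<epsilon> * scl n" using \<epsilon> d by simp
      qed (use d c1 c2 \<kappa>n g2 wgt_bound wgt_outside xi_meas in \<open>auto simp: N_def half2_def\<close>)
      have "N * real (2 * ngrid n + 2) * (C * \<theta> ^ lag n) \<le> (6 * C) * (real n ^ 3 * \<theta> ^ lag n)"
      proof -
        have "real (2 * ngrid n + 2) \<le> 6 * x powr (1/5)" using elim(2) by (simp add: x_def)
        also have "\<dots> \<le> 6 * x powr 2" using x by (intro mult_left_mono powr_mono) auto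
        finally have "N * real (2 * ngrid n + 2) \<le> x * (6 * x ^ 2)" using N x by (intro mult_mono) auto
        then have "N * real (2 * ngrid n + 2) * (C * \<theta> ^ lag n) \<le> x * (6 * x ^ 2) * (C * \<theta> ^ lag n)"
          using params by (intro mult_right_mono) auto
        then show ?thesis by (simp add: x_def power2_eq_square power3_eq_cube mult_ac)
      qed
      moreover have "real (2 * ngrid n + 1) * (2 * real (lag n) / ((L + 1) * N * mesh n)) \<le> 60 * real n powr (- (149/1000))"
      proof -
        have "2 * real (lag n) / ((L + 1) * N * mesh n) \<le> 2 * (2 * x powr (1/1000)) / (1 * (x / 3) * mesh n)"
          using d N params x by (intro frac_le mult_mono mult_left_mono mult_pos_pos) (auto simp: x_def mesh_def)
        also have "\<dots> = 12 * (x powr (1/1000) / (x powr 1 * x powr (-13/20)))" using x by (simp add: mesh)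
        also have "x powr (1/1000) / (x powr 1 * x powr (-13/20)) = x powr (- (349/1000))"
          by (simp only: powr_add[symmetric] powr_diff[symmetric]) simp
        finally have "2 * real (lag n) / ((L + 1) * N * mesh n) \<le> 12 * x powr (- (349/1000))" .
        moreover have "real (2 * ngrid n + 1) \<le> 5 * x powr (1/5)" 
        proof -
          have "1 \<le> x powr (1/5)" using x by (simp add: ge_one_powr_ge_zero)
          moreover have "real (ngrid n) \<le> x powr (1/5) + 1" using x by (simp add: ngrid_def x_def)
          ultimately show ?thesis by simp
        qed
        ultimately have "real (2 * ngrid n + 1) * (2 * real (lag n) / ((L + 1) * N * mesh n)) \<le> (5 * x powr (1/5)) * (12 * x powr (- (349/1000)))"
          using params N by (intro mult_mono) (auto simp: mesh_def)
        also have "\<dots> = 60 * (x powr (1/5) * x powr (- (349/1000)))" by simp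
        also have "x powr (1/5) * x powr (- (349/1000)) = x powr (- (149/1000))" by (simp add: powr_add[symmetric])
        finally show ?thesis by (simp add: x_def)
      qed
      moreover have "real (2 * ngrid n + 1) * (2 * (64 * grid_err n (\<kappa> n) / (\<epsilon> * scl n)\<^sup>2)) \<le>
          (640 * 34080 * Cw\<^sup>2 * k ^ 4 / \<epsilon>\<^sup>2) * real n powr (- (247/1000))"
      proof -
        have "2 * (64 * grid_err n (\<kappa> n) / (\<epsilon> * scl n)\<^sup>2) \<le> 2 * (64 * ((scl n)\<^sup>2 * (34080 * Cw\<^sup>2 * k ^ 4 * x powr (- (447/1000)))) / (\<epsilon> * scl n)\<^sup>2)"
          using grid_err_bound[OF elim(1) k] by (intro mult_left_mono divide_right_mono) (auto simp: \<kappa>_def x_def)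
        also have "\<dots> = (128 * 34080 * Cw\<^sup>2 * k ^ 4 / \<epsilon>\<^sup>2) * x powr (- (447/1000))"
          using d by (simp add: power_mult_distrib)
        finally have 1: "2 * (64 * grid_err n (\<kappa> n) / (\<epsilon> * scl n)\<^sup>2) \<le> (128 * 34080 * Cw\<^sup>2 * k ^ 4 / \<epsilon>\<^sup>2) * x powr (- (447/1000))" .
        have "real (2 * ngrid n + 1) \<le> 5 * x powr (1/5)" 
        proof -
          have "1 \<le> x powr (1/5)" using x by (simp add: ge_one_powr_ge_zero)
          moreover have "real (ngrid n) \<le> x powr (1/5) + 1" using x by (simp add: ngrid_def x_def)
          ultimately show ?thesis by simp
        qed
        then have "real (2 * ngrid n + 1) * (2 * (64 * grid_err n (\<kappa> n) / (\<epsilon> * scl n)\<^sup>2)) \<le>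
           (5 * x powr (1/5)) * ((128 * 34080 * Cw\<^sup>2 * k ^ 4 / \<epsilon>\<^sup>2) * x powr (- (447/1000)))"
          by (intro order_trans[OF mult_left_mono[OF 1]] mult_right_mono) auto
        also have "\<dots> = (640 * 34080 * Cw\<^sup>2 * k ^ 4 / \<epsilon>\<^sup>2) * (x powr (1/5) * x powr (- (447/1000)))" by simp
        also have "x powr (1/5) * x powr (- (447/1000)) = x powr (- (247/1000))" by (simp add: powr_add[symmetric])
        finally show ?thesis by (simp add: x_def)
      qed
      ultimately show ?case using main unfolding h_def x_def distrib_left by simp
    qed
  qed
qed

end

section \<open>Splitting into small and large lags\<close>

text \<open>Used with \<open>s = sqrt \<theta>\<close>: half of the geometric decay pays for the
  cubic factor from the flatness of the window, the other half keeps the sum over lags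
  finite.\<close>

lemma cube_geometric_bounded:
  fixes s :: real assumes "0 < s" "s < 1"
  shows "\<exists>K>0. \<forall>k::nat. (real k + 1) ^ 3 * s ^ k \<le> K"
proof -
  define a where "a = - ln s"
  have a: "a > 0" using assms by (simp add: a_def)
  have "(\<lambda>k::nat. (real k + 1) ^ 3 * exp (- a * real k)) \<longlonglongrightarrow> 0" using a by real_asymp
  moreover have "exp (- a * real k) = s ^ k" for k using assms by (simp add: a_def exp_of_nat_mult[symmetric] mult.commute)
      (simp add: exp_of_nat_mult)
  ultimately have "(\<lambda>k::nat. (real k + 1) ^ 3 * s ^ k) \<longlonglongrightarrow> 0" by simp
  then have "Bseq (\<lambda>k::nat. (real k + 1) ^ 3 * s ^ k)" by (intro convergent_imp_Bseq convergentI)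
  then obtain K where K: "K > 0" "\<And>k::nat. norm ((real k + 1) ^ 3 * s ^ k) \<le> K" by (elim BseqE) blast
  have "(real k + 1) ^ 3 * s ^ k \<le> K" for k :: nat
    using K(2)[of k] by (rule order_trans[rotated]) simp
  then show ?thesis using K(1) by blast
qed

context spectral_estimation
begin

text \<open>The first \<open>gap n\<close> indices of each block are dropped, so that the products over the rest of
  the block depend only on innovations inside the block.\<close>
definition gap :: "nat \<Rightarrow> int" where "gap n = bw n + int (lag n)"
definition nblk :: "nat \<Rightarrow> nat" where "nblk n = (n - mn n) div blk n"
definition core :: "nat \<Rightarrow> nat \<Rightarrow> int set" where
  "core n i = {int (mn n) + int i * int (blk n) + gap n + 1..int (mn n) + (int i + 1) * int (blk n)}"
definition Wl :: "nat \<Rightarrow> int \<Rightarrow> 'a \<Rightarrow> real" where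
  "Wl n t \<omega> = (\<Sum>j\<in>{2 * int (lag n)..bw n}. wt n j * Z (lag n) (t - j) \<omega>)"
definition Tb :: "nat \<Rightarrow> nat \<Rightarrow> 'a \<Rightarrow> real" where
  "Tb n i \<omega> = (\<Sum>t\<in>core n i. Z (lag n) t \<omega> * Wl n t \<omega>)"
definition small :: "nat \<Rightarrow> 'a \<Rightarrow> real" where
  "small n \<omega> = (\<Sum>t\<in>half2 n. \<Sum>j\<in>{0..<2 * int (lag n)}. wgt n t j * (Z (lag n) t \<omega> * Z (lag n) (t - j) \<omega>))"
definition small_mean :: "nat \<Rightarrow> real" where
  "small_mean n = (\<Sum>t\<in>half2 n. \<Sum>j\<in>{0..<2 * int (lag n)}. wgt n t j * expectation (\<lambda>\<omega>. Z (lag n) t \<omega> * Z (lag n) (t - j) \<omega>))"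
definition large :: "nat \<Rightarrow> 'a \<Rightarrow> real" where
  "large n \<omega> = (\<Sum>t\<in>half2 n. Z (lag n) t \<omega> * (\<Sum>j\<in>{2 * int (lag n)..bw n}. wgt n t j * Z (lag n) (t - j) \<omega>))"

lemma bil_Z_split:
  assumes "regular n"
  shows "bil (half2 n) (bw n) (wgt n) (\<lambda>t. Z (lag n) t \<omega>) (\<lambda>t. Z (lag n) t \<omega>) = small n \<omega> + large n \<omega>"
proof -
  have split: "(\<Sum>j\<in>{0..bw n}. g j) = (\<Sum>j\<in>{0..<2*int (lag n)}. g j) + (\<Sum>j\<in>{2*int (lag n)..bw n}. g j)" for g :: "int \<Rightarrow> real"
    using regularD(1,2)[OF assms] by (subst sum.union_disjoint[symmetric]) (auto intro!: sum.cong)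
  show ?thesis
    unfolding bil_def split sum.distrib small_def large_def by (simp add: sum_distrib_left mult_ac)
qed

text \<open>\<open>U - Z\<close> is a deterministic mean of order \<open>\<theta> ^ lag n\<close>,
  so the estimate holds for every \<open>\<omega>\<close>.\<close>

lemma bil_UZ_close:
  "\<epsilon> > 0 \<Longrightarrow> eventually (\<lambda>n. \<forall>\<omega>. \<bar>bil (half2 n) (bw n) (wgt n) (\<lambda>t. U (lag n) \<xi>0 t \<omega>) (\<lambda>t. U (lag n) \<xi>0 t \<omega>) -
     bil (half2 n) (bw n) (wgt n) (\<lambda>t. Z (lag n) t \<omega>) (\<lambda>t. Z (lag n) t \<omega>)\<bar> \<le> \<epsilon> * scl n) sequentially"
proof -
  assume \<epsilon>: "\<epsilon> > 0"
  have "eventually (\<lambda>n. (16 * Cw * C) * (real n ^ 3 * \<theta> ^ lag n) < \<epsilon>) sequentially"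
    by (rule order_tendstoD(2)[OF theta_null \<epsilon>])
  then show ?thesis using regular_eventually
  proof eventually_elim
    case (elim n)
    note d = regularD[OF elim(2)]
    show ?case
    proof
      fix \<omega>
      have "\<bar>bil (half2 n) (bw n) (wgt n) (\<lambda>t. U (lag n) \<xi>0 t \<omega>) (\<lambda>t. U (lag n) \<xi>0 t \<omega>) -
         bil (half2 n) (bw n) (wgt n) (\<lambda>t. Z (lag n) t \<omega>) (\<lambda>t. Z (lag n) t \<omega>)\<bar> \<le>
        2 * (2 * Cw) * (real_of_int (bw n) + 1) * (\<Sum>t\<in>half2 n. \<bar>U (lag n) \<xi>0 t \<omega> - Z (lag n) t \<omega>\<bar>)"
        using d by (intro bil_change_le wgt_bound wgt_outside U_bound Z_bound) (auto simp: half2_def)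
      also have "\<dots> \<le> 2 * (2 * Cw) * (2 * B n) * (\<Sum>t\<in>half2 n. C * \<theta> ^ lag n)"
      proof (rule mult_mono)
        show "(\<Sum>t\<in>half2 n. \<bar>U (lag n) \<xi>0 t \<omega> - Z (lag n) t \<omega>\<bar>) \<le> (\<Sum>t\<in>half2 n. C * \<theta> ^ lag n)"
          using expectation_U0[of "lag n"] by (intro sum_mono) (simp add: Z_def)
        show "2 * (2 * Cw) * (real_of_int (bw n) + 1) \<le> 2 * (2 * Cw) * (2 * B n)"
          using d Cw_nonneg by (intro mult_left_mono) auto
        show "0 \<le> 2 * (2 * Cw) * (2 * B n)" using d Cw_nonneg by simp
        show "0 \<le> (\<Sum>t\<in>half2 n. \<bar>U (lag n) \<xi>0 t \<omega> - Z (lag n) t \<omega>\<bar>)" by (intro sum_nonneg) simp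
      qed
      also have "\<dots> = 8 * Cw * C * (B n * real (card (half2 n))) * \<theta> ^ lag n" by simp
      also have "\<dots> \<le> 8 * Cw * C * (2 * scl n * real n ^ 3) * \<theta> ^ lag n"
      proof (intro mult_right_mono mult_left_mono)
        have "B n * real (card (half2 n)) \<le> B n * (2 * real (mn n))" using d by (intro mult_left_mono) auto
        also have "\<dots> = 2 * scl n * scl n" using scl_sq[OF elim(2)] by (simp add: power2_eq_square)
        also have "\<dots> \<le> 2 * scl n * real n ^ 3"
        proof (intro mult_left_mono)
          have "(scl n)\<^sup>2 \<le> real n * real n" unfolding scl_sq[OF elim(2)]
          proof (intro mult_mono)
            have "B n \<le> real n powr (1/4)" using d by simp
            also have "\<dots> \<le> real n powr 1" using d by (intro powr_mono) auto
            finally show "B n \<le> real n" by simp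
          qed (use d in auto)
          then have "(scl n)\<^sup>2 \<le> (real n)\<^sup>2" by (simp only: power2_eq_square)
          then have "scl n \<le> real n" by (rule power2_le_imp_le) simp
          also have "real n * 1 \<le> real n * (real n)\<^sup>2" using d by (intro mult_left_mono one_le_power) auto
          finally show "scl n \<le> real n ^ 3" by (simp add: power3_eq_cube power2_eq_square)
        qed (use d in auto)
        finally show "B n * real (card (half2 n)) \<le> 2 * scl n * real n ^ 3" .
      qed (use Cw_nonneg params in auto)
      also have "\<dots> = ((16 * Cw * C) * (real n ^ 3 * \<theta> ^ lag n)) * scl n" by simp
      also have "\<dots> \<le> \<epsilon> * scl n" using elim d by (intro mult_right_mono) auto
      finally show "\<bar>bil (half2 n) (bw n) (wgt n) (\<lambda>t. U (lag n) \<xi>0 t \<omega>) (\<lambda>t. U (lag n) \<xi>0 t \<omega>) -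
         bil (half2 n) (bw n) (wgt n) (\<lambda>t. Z (lag n) t \<omega>) (\<lambda>t. Z (lag n) t \<omega>)\<bar> \<le> \<epsilon> * scl n" .
    qed
  qed
qed

lemma Z_power_moment: "expectation (\<lambda>\<omega>. (Z l t \<omega>)\<^sup>2) \<le> 1" "expectation (\<lambda>\<omega>. (Z l t \<omega> * Z l s \<omega>)\<^sup>2) \<le> 1"
proof -
  have "(Z l t \<omega>)\<^sup>2 \<le> 1" for t \<omega> using Z_bound[of l t \<omega>] by (simp add: abs_square_le_1)
  note this[of t] this[of s]
  moreover from this have "(Z l t \<omega> * Z l s \<omega>)\<^sup>2 \<le> 1" for \<omega>
    unfolding power_mult_distrib by (intro mult_le_one) auto
  ultimately show "expectation (\<lambda>\<omega>. (Z l t \<omega>)\<^sup>2) \<le> 1" "expectation (\<lambda>\<omega>. (Z l t \<omega> * Z l s \<omega>)\<^sup>2) \<le> 1"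
    by (auto intro!: integral_le_const bm_integrable[of UNIV] bm_power bm_mult Z_bm)
qed

text \<open>The variance is of order \<open>m lag^3\<close> against
  \<open>(\<epsilon> scl n)^2\<close>, of order \<open>m B\<close>. Since \<open>B\<close> is at
  least \<open>n^(1/7)\<close>, the ratio is at most a constant times
  \<open>n^(3/1000 - 1/7)\<close>.\<close>

lemma small_negligible:
  assumes \<epsilon>: "\<epsilon> > 0"
  shows "(\<lambda>n. prob {\<omega>\<in>space M. \<epsilon> * scl n \<le> \<bar>small n \<omega> - small_mean n\<bar>}) \<longlonglongrightarrow> 0"
proof (rule Lim_null_comparison)
  show "(\<lambda>n. (1536 * Cw\<^sup>2 / \<epsilon>\<^sup>2) * real n powr (- (139/1000))) \<longlonglongrightarrow> 0" by (rule powr_null) simp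
  show "eventually (\<lambda>n. norm (prob {\<omega>\<in>space M. \<epsilon> * scl n \<le> \<bar>small n \<omega> - small_mean n\<bar>}) \<le>
      (1536 * Cw\<^sup>2 / \<epsilon>\<^sup>2) * real n powr (- (139/1000))) sequentially"
    using regular_eventually
  proof eventually_elim
    case (elim n)
    note d = regularD[OF elim]
    define l where "l = real (lag n)"
    define K where "K = 2 * real_of_int (2 * int (lag n) + int (lag n)) * real (card (half2 n)) * ((real_of_int (2 * int (lag n)))\<^sup>2 * (2 * Cw)\<^sup>2 * 1)"
    have b: "bm UNIV (\<lambda>\<omega>. small n \<omega> - small_mean n)"
      unfolding small_def by (intro bm_diff bm_sum bm_mult bm_const Z_bm)
    have "expectation (\<lambda>\<omega>. (small n \<omega> - small_mean n)\<^sup>2) \<le> K"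
      unfolding small_def small_mean_def K_def
      by (rule small_lags_second_moment[where \<beta>="wgt n", OF Z_lproc Z_lproc Z_power_moment(2) _ _ wgt_bound])
         (use d in \<open>auto simp: half2_def\<close>)
    then have "prob {\<omega>\<in>space M. \<epsilon> * scl n \<le> \<bar>small n \<omega> - small_mean n\<bar>} \<le> K / (\<epsilon> * scl n)\<^sup>2"
      using \<epsilon> d by (intro chebyshev_second_moment bm_measurable[OF b] bm_integrable[OF bm_power[OF b]]) auto
    also have "K = 96 * Cw\<^sup>2 * l ^ 3 * real (card (half2 n))"
      by (simp add: K_def l_def power_mult_distrib power2_eq_square power3_eq_cube)
    also have "96 * Cw\<^sup>2 * l ^ 3 * real (card (half2 n)) / (\<epsilon> * scl n)\<^sup>2 \<le> 96 * Cw\<^sup>2 * (8 * real n powr (3/1000)) * (2 * real (mn n)) / (\<epsilon> * scl n)\<^sup>2"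
    proof (intro divide_right_mono mult_mono mult_left_mono)
      have "l ^ 3 \<le> (2 * real n powr (1/1000)) ^ 3" using d by (intro power_mono) (auto simp: l_def)
      also have "\<dots> = 8 * real n powr (3/1000)" using d by (simp add: power3_eq_cube powr_add[symmetric])
      finally show "l ^ 3 \<le> 8 * real n powr (3/1000)" .
    qed (use d in \<open>auto simp: l_def\<close>)
    also have "\<dots> = (1536 * Cw\<^sup>2 / \<epsilon>\<^sup>2) * (real n powr (3/1000) / B n)"
      using d scl_sq[OF elim] by (simp add: power_mult_distrib)
    also have "\<dots> \<le> (1536 * Cw\<^sup>2 / \<epsilon>\<^sup>2) * real n powr (- (139/1000))"
    proof (intro mult_left_mono)
      have "real n powr (3/1000) / B n \<le> real n powr (3/1000) / real n powr (1/7)"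
        using d by (intro divide_left_mono mult_pos_pos) auto
      also have "\<dots> = real n powr (3/1000 - 1/7)" by (simp only: powr_diff)
      also have "\<dots> \<le> real n powr (- (139/1000))" using d by (intro powr_mono) auto
      finally show "real n powr (3/1000) / B n \<le> real n powr (- (139/1000))" .
    qed simp
    finally show ?case by simp
  qed
qed

lemma core_subset:
  assumes "regular n" "i < nblk n"
  shows "core n i \<subseteq> half2 n" 
    and "core n i = {(int (mn n) + int i * int (blk n) + gap n) + 1..(int (mn n) + int i * int (blk n) + gap n) + (int (blk n) - gap n)}"
proof -
  have "nblk n * blk n \<le> n - mn n" unfolding nblk_def by simp
  moreover have "(i + 1) * blk n \<le> nblk n * blk n" using assms(2) by (intro mult_right_mono) auto
  ultimately have "(i + 1) * blk n \<le> n - mn n" by linarith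
  moreover have "mn n \<le> n" by (simp add: mn_def)
  ultimately have "(i + 1) * blk n + mn n \<le> n" by linarith
  then have "int ((i + 1) * blk n + mn n) \<le> int n" by (simp only: of_nat_le_iff)
  then have "int (mn n) + (int i + 1) * int (blk n) \<le> int n" by (simp add: algebra_simps)
  then show "core n i \<subseteq> half2 n"
    using regularD(1,2)[OF assms(1)] by (auto simp: core_def half2_def gap_def intro: order_trans)
  show "core n i = {(int (mn n) + int i * int (blk n) + gap n) + 1..(int (mn n) + int i * int (blk n) + gap n) + (int (blk n) - gap n)}"
    by (simp add: core_def algebra_simps)
qed

text \<open>Dropping \<open>gap n\<close> indices, also in the first block, keeps
  \<open>t - j\<close> inside the second half. The truncation in \<open>wgt\<close> is inactive, so
  all blocks have the same weights and hence the same variance.\<close>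

lemma core_weights:
  assumes "regular n" "i < nblk n" "t \<in> core n i"
  shows "(\<Sum>j\<in>{2 * int (lag n)..bw n}. wgt n t j * Z (lag n) (t - j) \<omega>) = Wl n t \<omega>"
  unfolding Wl_def
proof (intro sum.cong refl)
  fix j assume j: "j \<in> {2 * int (lag n)..bw n}"
  define z where "z = int i * int (blk n)"
  have z: "0 \<le> z" by (simp add: z_def)
  have "int (mn n) + z + gap n + 1 \<le> t" "t \<le> int n"
    using assms(3) core_subset(1)[OF assms(1,2)] by (auto simp: core_def half2_def z_def)
  then have "t - j \<in> half2 n"
    using j z by (auto simp: half2_def gap_def)
  then show "wgt n t j * Z (lag n) (t - j) \<omega> = wt n j * Z (lag n) (t - j) \<omega>" by (simp add: wgt_def)
qed

lemma core_disjoint: "i < j \<Longrightarrow> regular n \<Longrightarrow> core n i \<inter> core n j = {}"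
proof -
  assume ij: "i < j" and r: "regular n"
  have "(int i + 1) * int (blk n) \<le> int j * int (blk n)" using ij by (intro mult_right_mono) auto
  then show ?thesis using regularD(1,2)[OF r] by (auto simp: core_def gap_def)
qed

definition rest :: "nat \<Rightarrow> int set" where "rest n = half2 n - (\<Union>i<nblk n. core n i)"

lemma card_core: "regular n \<Longrightarrow> i < nblk n \<Longrightarrow> real (card (core n i)) = real (blk n) - real_of_int (gap n)"
proof -
  assume r: "regular n" and i: "i < nblk n"
  have "gap n \<le> int (blk n)" using r by (auto simp: regular_def gap_def)
  then show ?thesis unfolding core_subset(2)[OF r i] by simp
qed

text \<open>The leftover consists of an incomplete last block, at most \<open>2 n^(3/8)\<close>
  indices, and the gaps: at most \<open>n^(5/8)\<close> blocks with gaps of at most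
  \<open>2 n^(1/4)\<close>.\<close>

lemma card_rest:
  assumes r: "regular n"
  shows "real (card (rest n)) = real (card (half2 n)) - real (nblk n) * (real (blk n) - real_of_int (gap n))"
    and "real (card (rest n)) \<le> 2 * real n powr (3/8) + 2 * real n powr (7/8)"
proof -
  note d = regularD[OF r]
  have cd: "card (\<Union>i<nblk n. core n i) = (\<Sum>i<nblk n. card (core n i))"
  proof (rule card_UN_disjoint)
    show "\<forall>i\<in>{..<nblk n}. \<forall>j\<in>{..<nblk n}. i \<noteq> j \<longrightarrow> core n i \<inter> core n j = {}"
      using core_disjoint[OF _ r] by (metis inf_commute linorder_neqE_nat)
  qed (auto simp: core_def)
  have sub: "(\<Union>i<nblk n. core n i) \<subseteq> half2 n" using core_subset(1)[OF r] by auto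
  have fin: "finite (\<Union>i<nblk n. core n i)" "finite (half2 n)" by (auto simp: core_def half2_def)
  have "card (rest n) = card (half2 n) - (\<Sum>i<nblk n. card (core n i))"
    unfolding rest_def using card_Diff_subset[OF fin(1) sub] cd by simp
  moreover have "(\<Sum>i<nblk n. card (core n i)) \<le> card (half2 n)" using card_mono[OF fin(2) sub] cd by simp
  ultimately have "real (card (rest n)) = real (card (half2 n)) - (\<Sum>i<nblk n. real (card (core n i)))" by simp
  also have "(\<Sum>i<nblk n. real (card (core n i))) = real (nblk n) * (real (blk n) - real_of_int (gap n))"
    using card_core[OF r] by simp
  finally show 1: "real (card (rest n)) = real (card (half2 n)) - real (nblk n) * (real (blk n) - real_of_int (gap n))" .
  have P: "0 < blk n" using r by (auto simp: regular_def)
  have "(n - mn n) - nblk n * blk n < blk n" "nblk n * blk n \<le> n - mn n"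
    unfolding nblk_def using P by (auto simp: minus_div_mult_eq_mod)
  then have "real (n - mn n) - real (nblk n) * real (blk n) \<le> real (blk n)" "real (nblk n) * real (blk n) \<le> real (n - mn n)"
    by (simp_all flip: of_nat_mult of_nat_diff)
  then have a: "real (card (half2 n)) - real (nblk n) * real (blk n) \<le> real (blk n)" "real (nblk n) * real (blk n) \<le> real n"
    unfolding card_half2 by (auto simp: mn_def of_nat_diff)
  have "real (nblk n) * real_of_int (gap n) \<le> 2 * real n powr (7/8)"
  proof -
    have "real n powr (3/8) * real (nblk n) \<le> real (blk n) * real (nblk n)" using r by (intro mult_right_mono) (auto simp: regular_def)
    also have "\<dots> \<le> real n" using a by (simp add: mult.commute)
    also have "real n = real n powr (3/8) * real n powr (5/8)" using d by (simp add: powr_add[symmetric])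
    finally have "real (nblk n) \<le> real n powr (5/8)" using d by simp
    moreover have "real_of_int (gap n) \<le> 2 * real n powr (1/4)" using d by (simp add: gap_def)
    ultimately have "real (nblk n) * real_of_int (gap n) \<le> real n powr (5/8) * (2 * real n powr (1/4))"
      using d by (intro mult_mono) (auto simp: gap_def)
    also have "\<dots> = 2 * real n powr (7/8)" by (simp add: powr_add[symmetric])
    finally show ?thesis .
  qed
  moreover have "real (blk n) \<le> 2 * real n powr (3/8)" using r by (auto simp: regular_def)
  ultimately show "real (card (rest n)) \<le> 2 * real n powr (3/8) + 2 * real n powr (7/8)"
    unfolding 1 right_diff_distrib using a by linarith
qed

lemma large_blocks:
  assumes r: "regular n"
  shows "large n \<omega> - (\<Sum>i<nblk n. Tb n i \<omega>) =
    (\<Sum>t\<in>rest n. Z (lag n) t \<omega> * (\<Sum>j\<in>{2 * int (lag n)..bw n}. wgt n t j * Z (lag n) (t - j) \<omega>))"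
proof -
  define f where "f = (\<lambda>t. Z (lag n) t \<omega> * (\<Sum>j\<in>{2 * int (lag n)..bw n}. wgt n t j * Z (lag n) (t - j) \<omega>))"
  have "(\<Sum>i<nblk n. Tb n i \<omega>) = (\<Sum>i<nblk n. \<Sum>t\<in>core n i. f t)"
    unfolding Tb_def f_def using core_weights[OF r] by (intro sum.cong refl) auto
  also have "\<dots> = (\<Sum>t\<in>(\<Union>i<nblk n. core n i). f t)"
  proof (rule sum.UNION_disjoint[symmetric])
    show "\<forall>i\<in>{..<nblk n}. \<forall>j\<in>{..<nblk n}. i \<noteq> j \<longrightarrow> core n i \<inter> core n j = {}"
      using core_disjoint[OF _ r] by (metis inf_commute linorder_neqE_nat)
  qed (auto simp: core_def)
  finally have "(\<Sum>i<nblk n. Tb n i \<omega>) = (\<Sum>t\<in>(\<Union>i<nblk n. core n i). f t)" .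
  moreover have "(\<Sum>t\<in>half2 n. f t) = (\<Sum>t\<in>half2 n - (\<Union>i<nblk n. core n i). f t) + (\<Sum>t\<in>(\<Union>i<nblk n. core n i). f t)"
    by (rule sum.subset_diff) (use core_subset(1)[OF r] in \<open>auto simp: half2_def\<close>)
  ultimately show ?thesis by (simp add: large_def rest_def f_def)
qed

text \<open>\<open>large_lags_second_moment\<close> is linear in the number of times involved, so
  the factor \<open>B\<close> cancels against \<open>scl n\<close> squared and the exponent
  \<open>2/1000 + 7/8 - 1\<close> remains.\<close>

lemma rest_negligible:
  assumes \<epsilon>: "\<epsilon> > 0"
  shows "(\<lambda>n. prob {\<omega>\<in>space M. \<epsilon> * scl n \<le> \<bar>large n \<omega> - (\<Sum>i<nblk n. Tb n i \<omega>)\<bar>}) \<longlonglongrightarrow> 0"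
proof (rule Lim_null_comparison)
  show "(\<lambda>n. (1536 * Cw\<^sup>2 / \<epsilon>\<^sup>2) * real n powr (- (123/1000))) \<longlonglongrightarrow> 0" by (rule powr_null) simp
  show "eventually (\<lambda>n. norm (prob {\<omega>\<in>space M. \<epsilon> * scl n \<le> \<bar>large n \<omega> - (\<Sum>i<nblk n. Tb n i \<omega>)\<bar>}) \<le>
      (1536 * Cw\<^sup>2 / \<epsilon>\<^sup>2) * real n powr (- (123/1000))) sequentially"
    using regular_eventually
  proof eventually_elim
    case (elim n)
    note d = regularD[OF elim]
    define l where "l = real (lag n)"
    define K where "K = 2 * real_of_int (int (lag n)) * real (card (rest n)) * (1 * (2 * real_of_int (int (lag n)) * (real_of_int (bw n) + 1) * ((2 * Cw)\<^sup>2 * 1)))"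
    define f where "f = (\<lambda>\<omega>. large n \<omega> - (\<Sum>i<nblk n. Tb n i \<omega>))"
    have b: "bm UNIV f"
      unfolding f_def large_blocks[OF elim] by (intro bm_sum bm_mult bm_const Z_bm)
    have "expectation (\<lambda>\<omega>. (f \<omega>)\<^sup>2) \<le> K"
      unfolding f_def large_blocks[OF elim] K_def
      by (rule large_lags_second_moment[where \<beta>="wgt n", OF Z_lproc Z_lproc expectation_Z expectation_Z Z_power_moment(1) Z_power_moment(1) _ order_refl _ wgt_bound])
         (use d in \<open>auto simp: half2_def rest_def\<close>)
    then have "prob {\<omega>\<in>space M. \<epsilon> * scl n \<le> \<bar>f \<omega>\<bar>} \<le> K / (\<epsilon> * scl n)\<^sup>2"
      using \<epsilon> d by (intro chebyshev_second_moment bm_measurable[OF b] bm_integrable[OF bm_power[OF b]]) auto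
    also have "K = 16 * Cw\<^sup>2 * l\<^sup>2 * (real_of_int (bw n) + 1) * real (card (rest n))"
      by (simp add: K_def l_def power_mult_distrib power2_eq_square)
    also have "16 * Cw\<^sup>2 * l\<^sup>2 * (real_of_int (bw n) + 1) * real (card (rest n)) / (\<epsilon> * scl n)\<^sup>2 \<le>
        16 * Cw\<^sup>2 * (4 * real n powr (2/1000)) * (2 * B n) * (4 * real n powr (7/8)) / (\<epsilon> * scl n)\<^sup>2"
    proof (intro divide_right_mono mult_mono mult_left_mono)
      have "l\<^sup>2 \<le> (2 * real n powr (1/1000))\<^sup>2" using d by (intro power_mono) (auto simp: l_def)
      also have "\<dots> = 4 * real n powr (2/1000)" using d by (simp add: power2_eq_square powr_add[symmetric])
      finally show "l\<^sup>2 \<le> 4 * real n powr (2/1000)" .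
      have "real n powr (3/8) \<le> real n powr (7/8)" using d by (intro powr_mono) auto
      then show "real (card (rest n)) \<le> 4 * real n powr (7/8)" using card_rest(2)[OF elim] by linarith
    qed (use d in auto)
    also have "\<dots> = (512 * Cw\<^sup>2 / \<epsilon>\<^sup>2) * (real n powr (2/1000) * real n powr (7/8) / real (mn n))"
      using d scl_sq[OF elim] by (simp add: power_mult_distrib)
    also have "\<dots> \<le> (512 * Cw\<^sup>2 / \<epsilon>\<^sup>2) * (3 * real n powr (- (123/1000)))"
    proof (intro mult_left_mono)
      have "real n powr (2/1000) * real n powr (7/8) / real (mn n) \<le> real n powr (2/1000) * real n powr (7/8) / (real n / 3)"
        using d by (intro divide_left_mono mult_pos_pos) auto
      also have "\<dots> = 3 * (real n powr (2/1000) * real n powr (7/8) / real n powr 1)" using d by simp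
      also have "real n powr (2/1000) * real n powr (7/8) / real n powr 1 = real n powr (- (123/1000))"
        by (simp only: powr_add[symmetric] powr_diff[symmetric]) simp
      finally show "real n powr (2/1000) * real n powr (7/8) / real (mn n) \<le> 3 * real n powr (- (123/1000))" .
    qed simp
    finally show ?case by (simp add: f_def)
  qed
qed

end

section \<open>Bias\<close>

context spectral_estimation
begin

definition Rsum :: real where "Rsum = infsum (\<lambda>u. r u * cos (real_of_int u * lam)) UNIV"

text \<open>Unfolds the one-sided sum back to symmetric lags, with the triangular factor counting
  the times at which both members of a pair lie in the second half.\<close>

lemma small_mean_eq:
  assumes reg: "regular n"
  shows "small_mean n = (\<Sum>u\<in>{-(2 * int (lag n))<..<2 * int (lag n)}.
    w (real_of_int u / B n) * cos (real_of_int u * lam) * (real (card (half2 n)) - \<bar>real_of_int u\<bar>) * cov (lag n) u)"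
proof -
  note d = regularD[OF reg]
  define k where "k = 2 * int (lag n)"
  define N where "N = real (card (half2 n))"
  define g where "g = (\<lambda>u. w (real_of_int u / B n) * cos (real_of_int u * lam) * (N - \<bar>real_of_int u\<bar>) * cov (lag n) u)"
  have cs: "cov (lag n) (- u) = cov (lag n) u" for u
    using cov_stationary[of "lag n" 0 u] cov_stationary[of "lag n" u 0] by (simp add: mult.commute)
  have gs: "g (- u) = g u" for u by (simp add: g_def cs w_even)
  have k: "1 \<le> k" "k \<le> bw n" using d by (auto simp: k_def)
  have "small_mean n = (\<Sum>j\<in>{0..<k}. \<Sum>t\<in>half2 n. wgt n t j * cov (lag n) j)"
    unfolding small_mean_def k_def cov_stationary by (subst sum.swap) simp
  also have "\<dots> = (\<Sum>j\<in>{0..<k}. wt n j * (N - real_of_int j) * cov (lag n) j)"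
  proof (intro sum.cong refl)
    fix j assume j: "j \<in> {0..<k}"
    have "(\<Sum>t\<in>half2 n. wgt n t j * cov (lag n) j) = (\<Sum>t\<in>{t\<in>half2 n. t - j \<in> half2 n}. wt n j * cov (lag n) j)"
      by (subst sum.inter_filter) (auto simp: wgt_def half2_def intro!: sum.cong)
    also have "{t\<in>half2 n. t - j \<in> half2 n} = {int (mn n) + 1 + j..int n}" using j by (auto simp: half2_def)
    also have "(\<Sum>t\<in>\<dots>. wt n j * cov (lag n) j) = real (nat (int n - int (mn n) - j)) * (wt n j * cov (lag n) j)"
      by (simp add: algebra_simps)
    also have "real (nat (int n - int (mn n) - j)) = N - real_of_int j"
    proof -
      have "bw n + 1 \<le> int (mn n)" using reg by (simp add: regular_def)
      then have "j \<le> int (mn n)" using j k by auto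
      moreover have "2 * int (mn n) \<le> int n" by (simp add: mn_def)
      ultimately show ?thesis unfolding N_def card_half2 by simp
    qed
    finally show "(\<Sum>t\<in>half2 n. wgt n t j * cov (lag n) j) = wt n j * (N - real_of_int j) * cov (lag n) j" by simp
  qed
  also have "\<dots> = wt n 0 * N * cov (lag n) 0 + (\<Sum>j\<in>{1..<k}. wt n j * (N - real_of_int j) * cov (lag n) j)"
  proof -
    have "{0..<k} = insert 0 {1..<k}" using k by auto
    then show ?thesis by simp
  qed
  also have "(\<Sum>j\<in>{1..<k}. wt n j * (N - real_of_int j) * cov (lag n) j) = (\<Sum>j\<in>{1..<k}. g j + g j)"
    by (intro sum.cong refl) (auto simp: wt_def wcos_def g_def)
  also have "\<dots> = (\<Sum>j\<in>{1..<k}. g j) + (\<Sum>j\<in>{1..<k}. g j)" by (rule sum.distrib)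
  finally have 1: "small_mean n = wt n 0 * N * cov (lag n) 0 + ((\<Sum>j\<in>{1..<k}. g j) + (\<Sum>j\<in>{1..<k}. g j))" .
  have neg: "(\<Sum>j\<in>{1..<k}. g j) = (\<Sum>j\<in>{-k<..-1}. g j)"
    by (rule sum.reindex_bij_witness[of _ uminus uminus]) (auto simp: gs)
  have "small_mean n = g 0 + ((\<Sum>j\<in>{-k<..-1}. g j) + (\<Sum>j\<in>{1..<k}. g j))"
    unfolding 1 neg by (simp add: g_def wt_def)
  also have "\<dots> = (\<Sum>u\<in>{-k<..<k}. g u)"
  proof -
    have "{-k<..<k} = insert 0 ({-k<..-1} \<union> {1..<k})" using k by auto
    moreover have "(\<Sum>u\<in>{-k<..-1} \<union> {1..<k}. g u) = (\<Sum>j\<in>{-k<..-1}. g j) + (\<Sum>j\<in>{1..<k}. g j)"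
      by (rule sum.union_disjoint) auto
    ultimately show ?thesis by simp
  qed
  finally show ?thesis by (simp add: g_def k_def N_def)
qed

lemma C3_ge1: "1 \<le> C3"
  using w_cubic[of 1] w_outside[of 1] by simp

text \<open>Lag by lag there are three errors: truncated against true covariance, the window and the
  triangular factor against 1, and the covariances beyond lag \<open>2 lag n\<close>. The second
  grows like the cube of the lag, which \<open>K\<close> absorbs at the price of replacing
  \<open>\<theta>\<close> by its square root.\<close>

lemma bias_bound:
  assumes K: "\<And>k::nat. (real k + 1) ^ 3 * (sqrt \<theta>) ^ k \<le> K" and reg: "regular n"
  defines "S \<equiv> infsum (\<lambda>u::int. sqrt \<theta> ^ nat \<bar>u\<bar>) UNIV"
  shows "\<bar>small_mean n - real (mn n) * Rsum\<bar> \<le> 4 * real (lag n) * (Cw * real (card (half2 n)) * ((2 * C + C\<^sup>2) * \<theta> ^ lag n)) +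
    (C * K * (C3 * real (card (half2 n)) / B n ^ 3 + (Cw + 1)) + real (mn n) * C * \<theta> ^ lag n) * S"
proof -
  note d = regularD[OF reg]
  define s where "s = sqrt \<theta>"
  have s: "0 < s" "s < 1" "s * s = \<theta>" using params by (auto simp: s_def)
  define N where "N = real (card (half2 n))"
  define m where "m = real (mn n)"
  define k where "k = 2 * int (lag n)"
  \<comment> \<open>For odd \<open>n\<close> the second half has one index more than
    \<open>mn n\<close>.\<close>
  have Nm: "0 \<le> N - m" "N - m \<le> 1" "0 \<le> m"
    unfolding N_def m_def card_half2 by (auto simp: mn_def)
  have K0: "0 \<le> K" using K[of 0] by simp
  have C3: "0 \<le> C3" using C3_ge1 by simp
  have sp: "\<theta> ^ j * (real j + 1) ^ 3 \<le> K * s ^ j" for j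
  proof -
    have "\<theta> ^ j * (real j + 1) ^ 3 = ((real j + 1) ^ 3 * s ^ j) * s ^ j"
      by (simp add: s(3)[symmetric] power_mult_distrib)
    also have "\<dots> \<le> K * s ^ j" using K[of j] s by (intro mult_right_mono) (auto simp: s_def)
    finally show ?thesis .
  qed
  define e where "e = (\<lambda>u. if u \<in> {-k<..<k} then w (real_of_int u / B n) * cos (real_of_int u * lam) * (N - \<bar>real_of_int u\<bar>) * cov (lag n) u else 0)"
  define f where "f = (\<lambda>u. m * (r u * cos (real_of_int u * lam)))"
  define k1 where "k1 = Cw * N * ((2 * C + C\<^sup>2) * \<theta> ^ lag n)"
  define k2 where "k2 = C * K * (C3 * N / B n ^ 3 + (Cw + 1)) + m * C * \<theta> ^ lag n"
  have k2: "0 \<le> k2" using params K0 C3 Nm Cw_nonneg d by (simp add: k2_def N_def)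
  have sS: "(\<lambda>u::int. Q * s ^ nat \<bar>u\<bar>) summable_on UNIV" for Q using s by (intro geometric_int_summable) auto
  have i1: "(\<lambda>u. if u \<in> {-k<..<k} then k1 else 0) summable_on UNIV" "infsum (\<lambda>u. if u \<in> {-k<..<k} then k1 else 0) UNIV = (\<Sum>u\<in>{-k<..<k}. k1)"
  proof -
    have "((\<lambda>u. if u \<in> {-k<..<k} then k1 else 0) has_sum (\<Sum>u\<in>{-k<..<k}. k1)) UNIV"
    proof (subst has_sum_cong_neutral[where T="{-k<..<k}" and g="\<lambda>_. k1"])
      show "((\<lambda>_. k1) has_sum (\<Sum>u\<in>{-k<..<k}. k1)) {-k<..<k}" by (rule has_sum_finite) simp
    qed auto
    then show "(\<lambda>u. if u \<in> {-k<..<k} then k1 else 0) summable_on UNIV" "infsum (\<lambda>u. if u \<in> {-k<..<k} then k1 else 0) UNIV = (\<Sum>u\<in>{-k<..<k}. k1)"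
      by (auto simp: summable_on_def infsumI)
  qed
  have ie: "e summable_on UNIV" "infsum e UNIV = small_mean n"
  proof -
    have "(e has_sum (\<Sum>u\<in>{-k<..<k}. e u)) UNIV"
    proof (subst has_sum_cong_neutral[where T="{-k<..<k}" and g=e])
      show "(e has_sum (\<Sum>u\<in>{-k<..<k}. e u)) {-k<..<k}" by (rule has_sum_finite) simp
    qed (auto simp: e_def)
    moreover have "(\<Sum>u\<in>{-k<..<k}. e u) = small_mean n"
      unfolding small_mean_eq[OF reg] k_def[symmetric] by (intro sum.cong) (auto simp: e_def N_def)
    ultimately show "e summable_on UNIV" "infsum e UNIV = small_mean n"
      by (auto simp: summable_on_def infsumI)
  qed
  have rsum: "(\<lambda>u. r u * cos (real_of_int u * lam)) summable_on UNIV"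
  proof (rule abs_summable_summable[OF summable_on_comparison_test])
    show "(\<lambda>u::int. C * \<theta> ^ nat \<bar>u\<bar>) summable_on UNIV" using params by (intro geometric_int_summable) auto
    show "norm (r u * cos (real_of_int u * lam)) \<le> C * \<theta> ^ nat \<bar>u\<bar>" for u
      using mult_mono[OF r_bound[of u] abs_cos_le_one[of "real_of_int u * lam"]] params by (simp add: abs_mult)
  qed simp
  have if': "f summable_on UNIV" "infsum f UNIV = m * Rsum"
    unfolding f_def Rsum_def using rsum by (auto intro: summable_on_cmult_right simp: infsum_cmult_right)
  have pt: "\<bar>e u - f u\<bar> \<le> (if u \<in> {-k<..<k} then k1 else 0) + k2 * s ^ nat \<bar>u\<bar>" for u
  proof (cases "u \<in> {-k<..<k}")
    case True
    define x where "x = w (real_of_int u / B n)"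
    define a where "a = \<bar>real_of_int u\<bar>"
    define j where "j = nat \<bar>u\<bar>"
    have aj: "a = real j" by (simp add: a_def j_def)
    have "\<bar>u\<bar> \<le> k" using True by auto
    moreover have "bw n + 1 \<le> int (mn n)" "k \<le> bw n" using reg d by (auto simp: regular_def k_def)
    ultimately have "\<bar>u\<bar> \<le> int (mn n)" by linarith
    then have "a \<le> m" unfolding a_def m_def by linarith
    then have a: "0 \<le> N - a" "N - a \<le> N" using Nm by (auto simp: a_def)
    have x: "\<bar>x\<bar> \<le> Cw" by (simp add: x_def w_bound)
    have x1: "\<bar>x - 1\<bar> \<le> C3 * (a ^ 3 / B n ^ 3)"
      using w_cubic[of "real_of_int u / B n"] d by (simp add: x_def a_def abs_minus_commute power_divide abs_divide)
    have "e u - f u = cos (real_of_int u * lam) * (x * (N - a) * (cov (lag n) u - r u) + r u * (x * (N - a) - m))"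
      using True by (simp add: e_def f_def x_def a_def algebra_simps)
    then have "\<bar>e u - f u\<bar> = \<bar>cos (real_of_int u * lam)\<bar> * \<bar>x * (N - a) * (cov (lag n) u - r u) + r u * (x * (N - a) - m)\<bar>"
      by (simp add: abs_mult)
    also have "\<dots> \<le> 1 * (\<bar>x\<bar> * (N - a) * \<bar>cov (lag n) u - r u\<bar> + \<bar>r u\<bar> * \<bar>x * (N - a) - m\<bar>)"
      using a by (intro mult_mono order_trans[OF abs_triangle_ineq]) (auto simp: abs_mult)
    also have "\<dots> \<le> 1 * (Cw * N * ((2 * C + C\<^sup>2) * \<theta> ^ lag n) + C * \<theta> ^ j * (C3 * N / B n ^ 3 * a ^ 3 + Cw * a + 1))"
    proof (intro mult_left_mono add_mono mult_mono x a cov_r)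
      show "\<bar>r u\<bar> \<le> C * \<theta> ^ j" using r_bound[of u] by (simp add: j_def)
      have "x * (N - a) - m = (x - 1) * N - x * a + (N - m)" by (simp add: algebra_simps)
      then have "\<bar>x * (N - a) - m\<bar> \<le> \<bar>(x - 1) * N\<bar> + \<bar>x * a\<bar> + \<bar>N - m\<bar>" by linarith
      moreover have "\<bar>(x - 1) * N\<bar> \<le> C3 * (a ^ 3 / B n ^ 3) * N" unfolding abs_mult using x1 a by (intro mult_mono) auto
      moreover have "\<bar>x * a\<bar> \<le> Cw * a" unfolding abs_mult using x by (intro mult_mono) (auto simp: a_def)
      moreover have "\<bar>N - m\<bar> \<le> 1" using Nm by simp
      moreover have "C3 * (a ^ 3 / B n ^ 3) * N = C3 * N / B n ^ 3 * a ^ 3" by simp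
      ultimately show "\<bar>x * (N - a) - m\<bar> \<le> C3 * N / B n ^ 3 * a ^ 3 + Cw * a + 1" by linarith
    qed (use a params Cw_nonneg in auto)
    also have "C * \<theta> ^ j * (C3 * N / B n ^ 3 * a ^ 3 + Cw * a + 1) \<le> C * (\<theta> ^ j * (real j + 1) ^ 3) * (C3 * N / B n ^ 3 + (Cw + 1))"
    proof -
      have p: "a ^ 3 \<le> (real j + 1) ^ 3" "a \<le> (real j + 1) ^ 3" "1 \<le> (real j + 1) ^ 3"
        unfolding aj using power_increasing[of 1 3 "real j + 1"] by (auto intro!: power_mono)
      have "C3 * N / B n ^ 3 * a ^ 3 + Cw * a + 1 \<le> C3 * N / B n ^ 3 * (real j + 1) ^ 3 + Cw * (real j + 1) ^ 3 + (real j + 1) ^ 3"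
        using p C3 Cw_nonneg d by (intro add_mono mult_left_mono) (auto simp: N_def)
      also have "\<dots> = (real j + 1) ^ 3 * (C3 * N / B n ^ 3 + (Cw + 1))" by (simp add: algebra_simps)
      finally have "C * \<theta> ^ j * (C3 * N / B n ^ 3 * a ^ 3 + Cw * a + 1) \<le> C * \<theta> ^ j * ((real j + 1) ^ 3 * (C3 * N / B n ^ 3 + (Cw + 1)))"
        using params by (intro mult_left_mono) auto
      then show ?thesis by (simp add: mult.assoc)
    qed
    also have "C * (\<theta> ^ j * (real j + 1) ^ 3) * (C3 * N / B n ^ 3 + (Cw + 1)) \<le> C * (K * s ^ j) * (C3 * N / B n ^ 3 + (Cw + 1))"
      using sp[of j] params C3 Cw_nonneg d by (intro mult_right_mono mult_left_mono) (auto simp: N_def)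
    also have "\<dots> \<le> k2 * s ^ j"
      using params Nm s by (simp add: k2_def algebra_simps)
    finally show ?thesis using True by (simp add: k1_def j_def)
  next
    case False
    define j where "j = nat \<bar>u\<bar>"
    have kj: "2 * lag n \<le> j" using False by (auto simp: k_def j_def)
    have "\<bar>e u - f u\<bar> = m * (\<bar>r u\<bar> * \<bar>cos (real_of_int u * lam)\<bar>)" using False Nm by (auto simp: e_def f_def abs_mult)
    also have "\<dots> \<le> m * ((C * \<theta> ^ j) * 1)"
      using r_bound[of u] params Nm by (intro mult_left_mono mult_mono) (auto simp: j_def)
    \<comment> \<open>As \<open>j\<close> is at least \<open>2 lag n\<close>, one of the two factors
      already gives \<open>\<theta> ^ lag n\<close> and the other remains for summation.\<close>
    also have "\<theta> ^ j = s ^ j * s ^ j" by (simp add: s(3)[symmetric] power_mult_distrib)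
    also have "m * ((C * (s ^ j * s ^ j)) * 1) \<le> m * ((C * (s ^ (2 * lag n) * s ^ j)) * 1)"
      using kj s params Nm by (intro mult_left_mono mult_right_mono power_decreasing) auto
    also have "s ^ (2 * lag n) = \<theta> ^ lag n" by (simp add: power_mult power2_eq_square s(3))
    also have "m * ((C * (\<theta> ^ lag n * s ^ j)) * 1) \<le> k2 * s ^ j"
      using params C3 Cw_nonneg d K0 s by (simp add: k2_def N_def distrib_right)
    finally have "\<bar>e u - f u\<bar> \<le> k2 * s ^ nat \<bar>u\<bar>" by (simp add: j_def)
    then show ?thesis unfolding if_not_P[OF False] by simp
  qed
  have sd: "(\<lambda>u. \<bar>e u - f u\<bar>) summable_on UNIV"
    by (rule summable_on_comparison_test[OF summable_on_add[OF i1(1) sS[of k2]]]) (use pt in auto)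
  have "\<bar>small_mean n - m * Rsum\<bar> = \<bar>infsum (\<lambda>u. e u - f u) UNIV\<bar>"
    using infsum_add[OF ie(1), of "\<lambda>u. - f u"] ie(2) if' by (simp add: infsum_uminus summable_on_uminus)
  also have "\<dots> \<le> infsum (\<lambda>u. \<bar>e u - f u\<bar>) UNIV"
    using norm_infsum_bound[of "\<lambda>u. e u - f u" UNIV] sd by simp
  also have "\<dots> \<le> infsum (\<lambda>u. (if u \<in> {-k<..<k} then k1 else 0) + k2 * s ^ nat \<bar>u\<bar>) UNIV"
    by (intro infsum_mono sd summable_on_add i1 sS pt)
  also have "\<dots> = (\<Sum>u\<in>{-k<..<k}. k1) + k2 * S"
    unfolding i1(2)[symmetric] S_def s_def[symmetric] infsum_cmult_right'[symmetric] by (intro infsum_add i1 sS)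
  also have "(\<Sum>u\<in>{-k<..<k}. k1) \<le> 4 * real (lag n) * k1"
  proof -
    have "real (card {-k<..<k}) \<le> 4 * real (lag n)" using d by (simp add: k_def)
    moreover have "0 \<le> k1" using Cw_nonneg params by (simp add: k1_def N_def)
    ultimately show ?thesis by (simp add: mult_right_mono)
  qed
  finally show ?thesis by (simp add: k1_def k2_def N_def m_def)
qed

text \<open>The critical term is \<open>m / B^3\<close>; divided by \<open>sqrt (m B)\<close> it is
  the square root of \<open>m / B^7\<close>, so the condition \<open>n = o(B^7)\<close> is used in
  full. The remaining terms are bounded or carry \<open>\<theta> ^ lag n\<close>.\<close>

lemma bias_negligible:
  assumes \<epsilon>: "\<epsilon> > 0"
  shows "eventually (\<lambda>n. \<bar>small_mean n - real (mn n) * Rsum\<bar> \<le> \<epsilon> * scl n) sequentially"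
proof -
  obtain K where K: "K > 0" "\<And>k::nat. (real k + 1) ^ 3 * (sqrt \<theta>) ^ k \<le> K"
    using cube_geometric_bounded[of "sqrt \<theta>"] params by auto
  define S where "S = infsum (\<lambda>u::int. sqrt \<theta> ^ nat \<bar>u\<bar>) UNIV"
  have S: "0 \<le> S" unfolding S_def using params by (intro infsum_nonneg) auto
  define k3 where "k3 = C * K * C3 * S"
  have k3: "0 \<le> k3" unfolding k3_def using params K S C3_ge1 by simp
  \<comment> \<open>The square anticipates that the estimate is proved for \<open>N^2\<close> and
    then passed through a square root; \<open>k3 + 1\<close> avoids a division by zero.\<close>
  define \<delta> where "\<delta> = (\<epsilon> / (8 * (k3 + 1)))\<^sup>2"
  have \<delta>: "\<delta> > 0" using \<epsilon> k3 by (simp add: \<delta>_def)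
  have e1: "eventually (\<lambda>n. (4 * Cw * (2 * C + C\<^sup>2)) * (real n ^ 3 * \<theta> ^ lag n) < \<epsilon> / 4) sequentially"
    by (rule order_tendstoD(2)[OF theta_null]) (use \<epsilon> in simp)
  have e2: "eventually (\<lambda>n. (S * C) * (real n ^ 3 * \<theta> ^ lag n) < \<epsilon> / 4) sequentially"
    by (rule order_tendstoD(2)[OF theta_null]) (use \<epsilon> in simp)
  have e3: "eventually (\<lambda>n. (2 * (C * K * (Cw + 1) * S)) * real n powr (- (4/7)) \<le> \<epsilon> / 4) sequentially"
    by (rule powr_small) (use \<epsilon> in auto)
  have e4: "eventually (\<lambda>n. norm (real n) \<le> \<delta> * norm (B n ^ 7)) sequentially"
    by (rule landau_o.smallD[OF B_large \<delta>])
  have e5: "eventually (\<lambda>n. 2 * real n powr (- (4/7)) \<le> 1) sequentially"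
    by (rule powr_small) auto
  show ?thesis using e1 e2 e3 e4 e5 regular_eventually
  proof eventually_elim
    case (elim n)
    note d = regularD[OF elim(6)]
    define N where "N = real (card (half2 n))"
    have inv: "real n powr (4/7) * real n powr (- (4/7)) = 1" using d by (simp add: powr_add[symmetric])
    have scl1: "1 \<le> scl n"
    proof -
      have "real n powr (4/7) * (2 * real n powr (- (4/7))) \<le> real n powr (4/7) * 1"
        using elim(5) by (intro mult_left_mono) auto
      then have "2 \<le> real n powr (4/7)" using inv by simp
      then show ?thesis using scl_lower[OF elim(6)] by linarith
    qed
    have n1: "real (lag n) * N \<le> real n ^ 3"
    proof -
      have "2 * int (lag n) \<le> bw n" "bw n + 1 \<le> int (mn n)" using elim(6) by (auto simp: regular_def)
      then have "int (lag n) \<le> int (mn n)" by linarith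
      then have "real (lag n) \<le> real n" using d by simp
      then have "real (lag n) * N \<le> real n * real n" using d by (intro mult_mono) (auto simp: N_def)
      also have "real n * real n = real n * real n * 1" by simp
      also have "\<dots> \<le> real n * real n * real n" using d by (intro mult_left_mono) auto
      finally show ?thesis by (simp add: power3_eq_cube)
    qed
    have n2: "real (mn n) \<le> real n ^ 3"
    proof -
      have "real n * 1 \<le> real n * (real n)\<^sup>2" using d by (intro mult_left_mono one_le_power) auto
      then have "real n \<le> real n ^ 3" by (simp add: power2_eq_square power3_eq_cube)
      then show ?thesis using d by linarith
    qed
    have a1: "4 * real (lag n) * (Cw * N * ((2 * C + C\<^sup>2) * \<theta> ^ lag n)) \<le> \<epsilon> / 4 * scl n"
    proof -
      have "4 * real (lag n) * (Cw * N * ((2 * C + C\<^sup>2) * \<theta> ^ lag n)) = (4 * Cw * (2 * C + C\<^sup>2)) * ((real (lag n) * N) * \<theta> ^ lag n)" by simp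
      also have "\<dots> \<le> (4 * Cw * (2 * C + C\<^sup>2)) * (real n ^ 3 * \<theta> ^ lag n)"
        using n1 Cw_nonneg params by (intro mult_left_mono mult_right_mono) auto
      also have "\<dots> \<le> \<epsilon> / 4 * 1" using elim(1) by simp
      also have "\<dots> \<le> \<epsilon> / 4 * scl n" using scl1 \<epsilon> by (intro mult_left_mono) auto
      finally show ?thesis .
    qed
    have a2: "real (mn n) * C * \<theta> ^ lag n * S \<le> \<epsilon> / 4 * scl n"
    proof -
      have "real (mn n) * C * \<theta> ^ lag n * S = (S * C) * (real (mn n) * \<theta> ^ lag n)" by simp
      also have "\<dots> \<le> (S * C) * (real n ^ 3 * \<theta> ^ lag n)"
        using n2 S params by (intro mult_left_mono mult_right_mono) auto
      also have "\<dots> \<le> \<epsilon> / 4 * 1" using elim(2) by simp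
      also have "\<dots> \<le> \<epsilon> / 4 * scl n" using scl1 \<epsilon> by (intro mult_left_mono) auto
      finally show ?thesis .
    qed
    have a3: "C * K * (Cw + 1) * S \<le> \<epsilon> / 4 * scl n"
    proof -
      define k4 where "k4 = C * K * (Cw + 1) * S"
      have "0 \<le> k4" using params K S Cw_nonneg by (simp add: k4_def)
      have "k4 = k4 * real n powr (- (4/7)) * real n powr (4/7)" using inv by (simp add: mult.assoc mult.commute)
      also have "\<dots> \<le> k4 * real n powr (- (4/7)) * (2 * scl n)"
        using scl_lower[OF elim(6)] \<open>0 \<le> k4\<close> by (intro mult_left_mono) auto
      also have "\<dots> = ((2 * k4) * real n powr (- (4/7))) * scl n" by simp
      also have "\<dots> \<le> \<epsilon> / 4 * scl n" using elim(3) scl1 by (intro mult_right_mono) (auto simp: k4_def)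
      finally show ?thesis by (simp add: k4_def)
    qed
    have a4: "C * K * (C3 * N / B n ^ 3) * S \<le> \<epsilon> / 4 * scl n"
    proof -
      have B0: "0 < B n" using d by simp
      have "N\<^sup>2 \<le> (2 * real (mn n))\<^sup>2" using d by (intro power_mono) (auto simp: N_def)
      also have "\<dots> = 4 * real (mn n) * real (mn n)" by (simp add: power2_eq_square)
      also have "\<dots> \<le> 4 * real (mn n) * (\<delta> * B n ^ 7)"
        using elim(4) d B0 by (intro mult_left_mono) auto
      also have "\<dots> = (2 * (\<epsilon> / (8 * (k3 + 1))) * scl n * B n ^ 3)\<^sup>2"
        using scl_sq[OF elim(6)] by (simp add: \<delta>_def power_mult_distrib power_divide eval_nat_numeral)
      finally have "N \<le> 2 * (\<epsilon> / (8 * (k3 + 1))) * scl n * B n ^ 3"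
        by (rule power2_le_imp_le) (use \<epsilon> k3 d B0 in auto)
      then have "N / B n ^ 3 \<le> 2 * (\<epsilon> / (8 * (k3 + 1))) * scl n" using B0 by (simp add: pos_divide_le_eq)
      then have "k3 * (N / B n ^ 3) \<le> (k3 + 1) * (2 * (\<epsilon> / (8 * (k3 + 1))) * scl n)"
        using k3 B0 d by (intro mult_mono) (auto simp: N_def)
      also have "\<dots> = \<epsilon> / 4 * scl n" using k3 by (simp add: field_simps)
      finally show ?thesis by (simp add: k3_def mult_ac)
    qed
    have "\<bar>small_mean n - real (mn n) * Rsum\<bar> \<le> 4 * real (lag n) * (Cw * N * ((2 * C + C\<^sup>2) * \<theta> ^ lag n)) +
      (C * K * (C3 * N / B n ^ 3 + (Cw + 1)) + real (mn n) * C * \<theta> ^ lag n) * S"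
      unfolding S_def N_def by (rule bias_bound[OF K(2) elim(6)])
    also have "\<dots> = 4 * real (lag n) * (Cw * N * ((2 * C + C\<^sup>2) * \<theta> ^ lag n)) + C * K * (C3 * N / B n ^ 3) * S + C * K * (Cw + 1) * S
       + real (mn n) * C * \<theta> ^ lag n * S" by (simp add: algebra_simps)
    also have "\<dots> \<le> \<epsilon> * scl n" using a1 a2 a3 a4 by linarith
    finally show ?case .
  qed
qed

end

section \<open>Central limit theorem for the blocks\<close>

context spectral_estimation
begin

definition blen :: "nat \<Rightarrow> int" where "blen n = int (blk n) - gap n"
definition bvar :: "nat \<Rightarrow> real" where "bvar n = block_var (cov (lag n)) (wt n) (int (lag n)) {2 * int (lag n)..bw n} (blen n)"
definition bfour :: "nat \<Rightarrow> real" where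
  "bfour n = 3 * (real_of_int (gap n))\<^sup>2 * (real (nat (blen n)) + 2 * real_of_int (gap n))\<^sup>2 *
    (2 * real (lag n) * real_of_int (bw n + 1 + 2 * int (lag n)) * (2 * Cw)\<^sup>2)\<^sup>2"
definition I0 :: real where "I0 = integral {0..1} (\<lambda>x. (w x)\<^sup>2)"

lemma blen_ge: "regular n \<Longrightarrow> int (lag n) \<le> blen n"
  by (auto simp: regular_def blen_def gap_def)

text \<open>The last claim uses \<open>gap n = bw n + lag n\<close>: the oldest innovation of the
  core still lies in the block, so different blocks use disjoint innovations.\<close>

lemma Tb_moments:
  assumes r: "regular n" and i: "i < nblk n"
  shows "expectation (Tb n i) = 0" "expectation (\<lambda>\<omega>. (Tb n i \<omega>)\<^sup>2) = bvar n" "expectation (\<lambda>\<omega>. (Tb n i \<omega>) ^ 4) \<le> bfour n"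
    and "bm {int (mn n) + int i * int (blk n) + 1..int (mn n) + (int i + 1) * int (blk n)} (Tb n i)"
proof -
  note d = regularD[OF r]
  define a where "a = int (mn n) + int i * int (blk n) + gap n"
  have core: "core n i = {a + 1..a + blen n}" using core_subset(2)[OF r i] by (simp add: a_def blen_def)
  have l: "int (lag n) \<ge> 1" "2 * int (lag n) \<le> bw n" "int (lag n) \<le> blen n" using d blen_ge[OF r] by auto
  have sub: "core n i \<subseteq> {a + 1..<a + 1 + int (nat (blen n))}" using l by (auto simp: core)
  have T: "Tb n i = (\<lambda>\<omega>. \<Sum>t\<in>core n i. Z (lag n) t \<omega> * (\<Sum>j\<in>{2 * int (lag n)..bw n}. wt n j * Z (lag n) (t - j) \<omega>))"
    by (rule ext) (simp add: Tb_def Wl_def)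
  note bf = block_fourth_moment[where \<alpha>="wt n", OF Z_lproc expectation_Z Z_bound wt_bound l(1,2) sub]
  show "expectation (Tb n i) = 0" unfolding T by (rule bf(2))
  show "expectation (\<lambda>\<omega>. (Tb n i \<omega>) ^ 4) \<le> bfour n" unfolding T bfour_def using bf(1) by (simp add: gap_def)
  show "expectation (\<lambda>\<omega>. (Tb n i \<omega>)\<^sup>2) = bvar n"
    unfolding T core bvar_def
    by (rule block_second_moment[OF Z_lproc expectation_Z cov_stationary l(1,3)])
  show "bm {int (mn n) + int i * int (blk n) + 1..int (mn n) + (int i + 1) * int (blk n)} (Tb n i)"
    unfolding T
  proof (rule bf(3))
    have "a + 1 + int (nat (blen n)) = int (mn n) + (int i + 1) * int (blk n) + 1"
      using l by (simp add: a_def blen_def algebra_simps)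
    then show "{a + 1 - bw n - int (lag n)..<a + 1 + int (nat (blen n))} \<subseteq> {int (mn n) + int i * int (blk n) + 1..int (mn n) + (int i + 1) * int (blk n)}"
      by (auto simp: a_def gap_def)
  qed
qed

text \<open>Lags in a block start at \<open>2 * lag n\<close>, which is positive, so the exceptional
  weight at lag 0 does not occur.\<close>

lemma block_var_wt:
  assumes "regular n"
  shows "bvar n = block_var (cov (lag n)) (wcos (B n) lam) (int (lag n)) {2 * int (lag n)..\<lfloor>B n\<rfloor>} (blen n)"
proof -
  have "autocorr (wt n) {2 * int (lag n)..bw n} d = autocorr (wcos (B n) lam) {2 * int (lag n)..bw n} d" for d
    unfolding autocorr_def using regularD(1)[OF assms] by (intro sum.cong) (auto simp: wt_def)
  then show ?thesis by (simp add: bvar_def block_var_def bw_def)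
qed

lemma bvar_limit: "(\<lambda>n. bvar n / (real_of_int (blen n) * B n)) \<longlonglongrightarrow> 2 * (1 + hfun (2 * lam)) * I0 * Rsum\<^sup>2"
proof (rule Lim_transform_eventually)
  show "(\<lambda>n. block_var (cov (lag n)) (wcos (B n) lam) (int (lag n)) {2 * int (lag n)..\<lfloor>B n\<rfloor>} (blen n) / (real_of_int (blen n) * B n)) \<longlonglongrightarrow>
    2 * (1 + hfun (2 * lam)) * I0 * Rsum\<^sup>2"
    unfolding I0_def Rsum_def
  proof (rule block_var_limit[where l="\<lambda>n. int (lag n)" and c="\<lambda>n. cov (lag n)" and K=blen and B=B, OF B_inf])
    show "(\<lambda>n. real_of_int (int (lag n)) / B n) \<longlonglongrightarrow> 0"
    proof (rule Lim_null_comparison)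
      show "eventually (\<lambda>n. norm (real_of_int (int (lag n)) / B n) \<le> 2 * real n powr (- (1/8))) sequentially"
        using regular_eventually
      proof eventually_elim
        case (elim n)
        note d = regularD[OF elim]
        have "real (lag n) / B n \<le> 2 * real n powr (1/1000) / real n powr (1/7)"
          using d by (intro frac_le) auto
        also have "\<dots> = 2 * (real n powr (1/1000 - 1/7))" unfolding powr_diff by simp
        also have "\<dots> \<le> 2 * real n powr (- (1/8))" using d by (intro mult_left_mono powr_mono) auto
        finally show ?case using d by simp
      qed
      show "(\<lambda>n. 2 * real n powr (- (1/8))) \<longlonglongrightarrow> 0" by (rule powr_null) simp
    qed
    show "filterlim (\<lambda>n. int (lag n)) at_top sequentially"
    proof -
      have "filterlim (\<lambda>n. real n powr (1/1000)) at_top sequentially" by real_asymp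
      then have "filterlim (\<lambda>n. real (lag n)) at_top sequentially"
        by (rule filterlim_at_top_mono) (use regular_eventually in \<open>auto elim: eventually_mono simp: regular_def\<close>)
      then show ?thesis
        by (simp add: filterlim_sequentially_iff_filterlim_real[symmetric] filterlim_int_sequentially filterlim_compose[OF filterlim_int_sequentially])
    qed
    show "0 \<le> int (lag n)" for n by simp
    show "eventually (\<lambda>n. int (lag n) \<le> blen n) sequentially"
      using regular_eventually by (rule eventually_mono) (rule blen_ge)
    show "(\<lambda>n. cov (lag n) u) \<longlonglongrightarrow> r u" for u
    proof (rule LIM_zero_cancel, rule Lim_null_comparison)
      show "eventually (\<lambda>n. norm (cov (lag n) u - r u) \<le> (2 * C + C\<^sup>2) * (real n ^ 3 * \<theta> ^ lag n)) sequentially"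
        using eventually_ge_at_top[of 1]
      proof eventually_elim
        case (elim n)
        have "1 * \<theta> ^ lag n \<le> real n ^ 3 * \<theta> ^ lag n" using elim params by (intro mult_right_mono one_le_power) auto
        then have "(2 * C + C\<^sup>2) * \<theta> ^ lag n \<le> (2 * C + C\<^sup>2) * (real n ^ 3 * \<theta> ^ lag n)"
          using params by (intro mult_left_mono) auto
        then show ?case using cov_r[of "lag n" u] by simp
      qed
      show "(\<lambda>n. (2 * C + C\<^sup>2) * (real n ^ 3 * \<theta> ^ lag n)) \<longlonglongrightarrow> 0" by (rule theta_null)
    qed
    show "\<bar>cov (lag n) u\<bar> \<le> (3 * C + C\<^sup>2) * \<theta> ^ nat \<bar>u\<bar>" for n u by (rule cov_bound)
  qed (use params r_sym in auto)
  show "eventually (\<lambda>n. block_var (cov (lag n)) (wcos (B n) lam) (int (lag n)) {2 * int (lag n)..\<lfloor>B n\<rfloor>} (blen n) / (real_of_int (blen n) * B n)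
     = bvar n / (real_of_int (blen n) * B n)) sequentially"
    using regular_eventually by eventually_elim (simp add: block_var_wt)
qed

lemma block_count_limit: "(\<lambda>n. real (nblk n) * real_of_int (blen n) / real (mn n)) \<longlonglongrightarrow> 1"
proof (rule LIM_zero_cancel, rule Lim_null_comparison)
  show "eventually (\<lambda>n. norm (real (nblk n) * real_of_int (blen n) / real (mn n) - 1) \<le> 15 * real n powr (- (1/8))) sequentially"
    using regular_eventually
  proof eventually_elim
    case (elim n)
    note d = regularD[OF elim]
    have e: "real (nblk n) * real_of_int (blen n) = real (card (half2 n)) - real (card (rest n))"
      using card_rest(1)[OF elim] by (simp add: blen_def)
    have "\<bar>real (card (half2 n)) - real (mn n)\<bar> \<le> 1" unfolding card_half2 by (auto simp: mn_def)
    moreover have "real (card (rest n)) \<le> 4 * real n powr (7/8)"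
    proof -
      have "real n powr (3/8) \<le> real n powr (7/8)" using d by (intro powr_mono) auto
      then show ?thesis using card_rest(2)[OF elim] by linarith
    qed
    moreover have "1 \<le> real n powr (7/8)" using d by (intro ge_one_powr_ge_zero) auto
    ultimately have "\<bar>real (nblk n) * real_of_int (blen n) - real (mn n)\<bar> \<le> 5 * real n powr (7/8)"
      unfolding e by linarith
    then have "\<bar>real (nblk n) * real_of_int (blen n) - real (mn n)\<bar> / real (mn n) \<le> 5 * real n powr (7/8) / (real n / 3)"
      using d by (intro frac_le) auto
    also have "\<dots> = 15 * (real n powr (7/8) / real n powr 1)" using d by simp
    also have "real n powr (7/8) / real n powr 1 = real n powr (- (1/8))" by (simp only: powr_diff[symmetric]) simp
    finally have 1: "\<bar>real (nblk n) * real_of_int (blen n) - real (mn n)\<bar> / real (mn n) \<le> 15 * real n powr (- (1/8))" .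
    have "real (nblk n) * real_of_int (blen n) / real (mn n) - 1 = (real (nblk n) * real_of_int (blen n) - real (mn n)) / real (mn n)"
      using d(15) by (simp add: diff_divide_distrib)
    then show ?case using 1 by (simp only: real_norm_def abs_divide abs_of_nat)
  qed
  show "(\<lambda>n. 15 * real n powr (- (1/8))) \<longlonglongrightarrow> 0" by (rule powr_null) simp
qed

lemma scaled_variance_limit:
  "(\<lambda>n. real (nblk n) * (bvar n / (2 * pi * scl n)\<^sup>2)) \<longlonglongrightarrow> (1 + hfun (2 * lam)) * (Rsum / (2 * pi))\<^sup>2 * (2 * I0)"
proof (rule Lim_transform_eventually)
  have "(\<lambda>n. (bvar n / (real_of_int (blen n) * B n)) * (real (nblk n) * real_of_int (blen n) / real (mn n)) / (2 * pi)\<^sup>2)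
     \<longlonglongrightarrow> (2 * (1 + hfun (2 * lam)) * I0 * Rsum\<^sup>2) * 1 / (2 * pi)\<^sup>2"
    by (intro tendsto_divide tendsto_mult bvar_limit block_count_limit tendsto_const) simp
  moreover have "(2 * (1 + hfun (2 * lam)) * I0 * Rsum\<^sup>2) * 1 / (2 * pi)\<^sup>2 = (1 + hfun (2 * lam)) * (Rsum / (2 * pi))\<^sup>2 * (2 * I0)"
    unfolding power_divide by (simp add: field_simps)
  ultimately show "(\<lambda>n. (bvar n / (real_of_int (blen n) * B n)) * (real (nblk n) * real_of_int (blen n) / real (mn n)) / (2 * pi)\<^sup>2)
     \<longlonglongrightarrow> (1 + hfun (2 * lam)) * (Rsum / (2 * pi))\<^sup>2 * (2 * I0)"
    by (simp only:)
  show "eventually (\<lambda>n. (bvar n / (real_of_int (blen n) * B n)) * (real (nblk n) * real_of_int (blen n) / real (mn n)) / (2 * pi)\<^sup>2 =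
     real (nblk n) * (bvar n / (2 * pi * scl n)\<^sup>2)) sequentially"
    using regular_eventually
  proof eventually_elim
    case (elim n)
    note d = regularD[OF elim]
    have "0 < blen n" using blen_ge[OF elim] d by linarith
    then show ?case
      using d scl_sq[OF elim] by (simp add: power_mult_distrib field_simps)
  qed
qed

text \<open>Up to constants the total is \<open>B^2 P lag^2 / m\<close> with block length
  \<open>P\<close>, of exponent \<open>1/2 + 3/8 + 2/1000 - 1\<close>. Blocks must be shorter than
  \<open>n^(1/2)\<close> for this to vanish when \<open>B\<close> is near
  \<open>n^(1/4)\<close>.\<close>

lemma scaled_fourth_limit:
  "(\<lambda>n. real (nblk n) * (bfour n / (2 * pi * scl n) ^ 4)) \<longlonglongrightarrow> 0"
proof (rule Lim_null_comparison)
  show "(\<lambda>n. (62208 * 48 * Cw ^ 4) * real n powr (- (123/1000))) \<longlonglongrightarrow> 0" by (rule powr_null) simp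
  show "eventually (\<lambda>n. norm (real (nblk n) * (bfour n / (2 * pi * scl n) ^ 4)) \<le> (62208 * 48 * Cw ^ 4) * real n powr (- (123/1000))) sequentially"
    using regular_eventually
  proof eventually_elim
    case (elim n)
    note d = regularD[OF elim]
    define P where "P = real (blk n)"
    define l where "l = real (lag n)"
    define b where "b = B n"
    define m where "m = real (mn n)"
    define x where "x = real n"
    have x: "1 \<le> x" "0 < x" "x / 3 \<le> m" "0 < m" "0 < b" "b \<le> x powr (1/4)" "0 \<le> l" "l \<le> 2 * x powr (1/1000)"
      using d by (auto simp: x_def m_def b_def l_def)
    have P: "0 \<le> P" "P \<le> 2 * x powr (3/8)" "2 * b \<le> P"
      using elim by (auto simp: P_def x_def regular_def b_def)
    have gap: "0 \<le> real_of_int (gap n)" "real_of_int (gap n) \<le> 2 * b" using d by (auto simp: gap_def b_def)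
    have bl: "0 < blen n" using blen_ge[OF elim] d by linarith
    have "real_of_int (blen n) = P - real_of_int (gap n)" by (simp add: blen_def P_def)
    then have bl2: "real (nat (blen n)) = P - real_of_int (gap n)" using bl by simp
    have q0: "0 \<le> bfour n" by (simp add: bfour_def)
    have "bfour n \<le> 3 * (2 * b)\<^sup>2 * (3 * P)\<^sup>2 * (2 * l * (3 * b) * (2 * Cw)\<^sup>2)\<^sup>2"
      unfolding bfour_def bl2
    proof (intro mult_mono mult_left_mono power_mono mult_right_mono)
      show "real_of_int (bw n + 1 + 2 * int (lag n)) \<le> 3 * b" using d by (simp add: b_def)
      show "P - real_of_int (gap n) + 2 * real_of_int (gap n) \<le> 3 * P" using gap P by linarith
    qed (use gap P x d Cw_nonneg in \<open>auto simp: l_def\<close>)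
    also have "\<dots> = 62208 * Cw ^ 4 * (b ^ 4 * P\<^sup>2 * l\<^sup>2)" by (simp add: power_mult_distrib eval_nat_numeral mult_ac)
    finally have q: "bfour n \<le> 62208 * Cw ^ 4 * (b ^ 4 * P\<^sup>2 * l\<^sup>2)" .
    have kP: "real (nblk n) * P \<le> 2 * m"
    proof -
      have "nblk n * blk n \<le> n - mn n" unfolding nblk_def by simp
      then have "real (nblk n * blk n) \<le> real (n - mn n)" by (simp only: of_nat_le_iff)
      also have "\<dots> = real (card (half2 n))" unfolding card_half2 by (simp add: mn_def of_nat_diff)
      finally show ?thesis using d by (simp add: P_def m_def)
    qed
    have s4: "(scl n) ^ 4 = m\<^sup>2 * b\<^sup>2"
    proof -
      have "(scl n) ^ 4 = ((scl n)\<^sup>2)\<^sup>2" by simp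
      then show ?thesis unfolding scl_sq[OF elim] by (simp add: power_mult_distrib m_def b_def)
    qed
    have pi1: "1 \<le> (2 * pi) ^ 4" using pi_gt3 by (intro one_le_power) simp
    have "real (nblk n) * (bfour n / (2 * pi * scl n) ^ 4) \<le> real (nblk n) * (bfour n / (scl n) ^ 4)"
    proof (intro mult_left_mono divide_left_mono q0)
      show "(scl n) ^ 4 \<le> (2 * pi * scl n) ^ 4" using pi1 d by (simp add: power_mult_distrib mult_right_mono[of 1, simplified])
      show "0 < (2 * pi * scl n) ^ 4 * scl n ^ 4" using d by simp
    qed simp
    also have "\<dots> \<le> real (nblk n) * (62208 * Cw ^ 4 * (b ^ 4 * P\<^sup>2 * l\<^sup>2) / (scl n) ^ 4)"
      using q d by (intro mult_left_mono divide_right_mono) auto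
    also have "\<dots> = 62208 * Cw ^ 4 * ((real (nblk n) * P) * (b\<^sup>2 * P * l\<^sup>2) / m\<^sup>2)"
      unfolding s4 using x by (simp add: power2_eq_square eval_nat_numeral)
    also have "\<dots> \<le> 62208 * Cw ^ 4 * ((2 * m) * (b\<^sup>2 * P * l\<^sup>2) / m\<^sup>2)"
      using kP P by (intro mult_left_mono divide_right_mono mult_right_mono) auto
    also have "\<dots> = 62208 * Cw ^ 4 * (2 * (b\<^sup>2 * P * l\<^sup>2) / m)" using x by (simp add: power2_eq_square)
    also have "\<dots> \<le> 62208 * Cw ^ 4 * (2 * ((x powr (1/4))\<^sup>2 * (2 * x powr (3/8)) * (2 * x powr (1/1000))\<^sup>2) / (x / 3))"
      using x P by (intro mult_left_mono frac_le mult_mono power_mono) auto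
    also have "\<dots> = 62208 * Cw ^ 4 * (48 * ((x powr (1/4))\<^sup>2 * x powr (3/8) * (x powr (1/1000))\<^sup>2 / x powr 1))"
      using x by (simp add: power_mult_distrib)
    also have "(x powr (1/4))\<^sup>2 * x powr (3/8) * (x powr (1/1000))\<^sup>2 / x powr 1 = x powr (- (123/1000))"
      by (simp only: power2_eq_square powr_add[symmetric] powr_diff[symmetric]) simp
    finally show ?case using q0 d by (simp add: x_def abs_mult)
  qed
qed

lemma block_clt:
  "(\<lambda>n. expectation (\<lambda>\<omega>. iexp (u * ((\<Sum>i<nblk n. Tb n i \<omega>) / (2 * pi * scl n))))) \<longlonglongrightarrow>
    of_real (exp (- (u\<^sup>2 * ((1 + hfun (2 * lam)) * (Rsum / (2 * pi))\<^sup>2 * (2 * I0)) / 2)))"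
proof -
  define kv where "kv = (\<lambda>n. real (nblk n) * (bvar n / (2 * pi * scl n)\<^sup>2))"
  \<comment> \<open>The null sequence \<open>1 / (n + 1)\<close> is added because
    \<open>char_block_sum_approx\<close> needs a strictly positive \<open>d\<close>.\<close>
  define dd where "dd = (\<lambda>n. real (nblk n) * (bfour n / (2 * pi * scl n) ^ 4) + inverse (real (Suc n)))"
  define \<sigma>2 where "\<sigma>2 = (1 + hfun (2 * lam)) * (Rsum / (2 * pi))\<^sup>2 * (2 * I0)"
  have kv: "kv \<longlonglongrightarrow> \<sigma>2" unfolding kv_def \<sigma>2_def by (rule scaled_variance_limit)
  have dd: "dd \<longlonglongrightarrow> 0" unfolding dd_def using tendsto_add[OF scaled_fourth_limit LIMSEQ_inverse_real_of_nat] by simp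
  have "(\<lambda>n. expectation (\<lambda>\<omega>. iexp (u * ((\<Sum>i<nblk n. Tb n i \<omega>) / (2 * pi * scl n)))) - of_real (exp (- (u\<^sup>2 * kv n / 2)))) \<longlonglongrightarrow> 0"
  proof (rule Lim_null_comparison)
    show "eventually (\<lambda>n. norm (expectation (\<lambda>\<omega>. iexp (u * ((\<Sum>i<nblk n. Tb n i \<omega>) / (2 * pi * scl n)))) - of_real (exp (- (u\<^sup>2 * kv n / 2))))
      \<le> \<bar>u\<bar> ^ 3 * sqrt (dd n) * (kv n + 1) / 12 + u ^ 4 * dd n / 8) sequentially"
      using regular_eventually
    proof eventually_elim
      case (elim n)
      note d = regularD[OF elim]
      define T where "T = (\<lambda>i \<omega>. (1 / (2 * pi * scl n)) * Tb n i \<omega>)"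
      define S where "S = (\<lambda>i::nat. {int (mn n) + int i * int (blk n) + 1..int (mn n) + (int i + 1) * int (blk n)})"
      have "norm (expectation (\<lambda>\<omega>. iexp (u * (\<Sum>i<nblk n. T i \<omega>))) - of_real (exp (- (u\<^sup>2 * (nblk n * (bvar n / (2 * pi * scl n)\<^sup>2)) / 2))))
        \<le> \<bar>u\<bar> ^ 3 * sqrt (dd n) * (nblk n * (bvar n / (2 * pi * scl n)\<^sup>2) + 1) / 12 + u ^ 4 * dd n / 8"
      proof (rule char_block_sum_approx[where S=S and q="bfour n / (2 * pi * scl n) ^ 4"])
        fix i assume i: "i < nblk n"
        note Tm = Tb_moments[OF elim i]
        show "bm (S i) (T i)" unfolding S_def T_def by (intro bm_cmult Tm)
        show "expectation (T i) = 0" unfolding T_def using Tm(1) by simp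
        show "expectation (\<lambda>\<omega>. (T i \<omega>)\<^sup>2) = bvar n / (2 * pi * scl n)\<^sup>2"
          unfolding T_def power_mult_distrib[of "1 / _"] power_one_over using Tm(2) by simp
        show "expectation (\<lambda>\<omega>. T i \<omega> ^ 4) \<le> bfour n / (2 * pi * scl n) ^ 4"
          unfolding T_def power_mult_distrib[of "1 / _"] power_one_over using divide_right_mono[OF Tm(3), of "(2 * pi * scl n) ^ 4"] by simp
      next
        fix i j :: nat assume "i < j" "j < nblk n"
        then have "(int i + 1) * int (blk n) \<le> int j * int (blk n)" by (intro mult_right_mono) auto
        then show "S i \<inter> S j = {}" by (auto simp: S_def)
      next
        have "0 \<le> bfour n" by (simp add: bfour_def)
        then show "0 < dd n" unfolding dd_def using d by (intro add_nonneg_pos) auto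
        show "real (nblk n) * (bfour n / (2 * pi * scl n) ^ 4) \<le> dd n" by (simp add: dd_def)
      qed
      then show ?case by (simp add: T_def kv_def sum_divide_distrib)
    qed
    have "(\<lambda>n. \<bar>u\<bar> ^ 3 * sqrt (dd n) * (kv n + 1) / 12 + u ^ 4 * dd n / 8) \<longlonglongrightarrow> \<bar>u\<bar> ^ 3 * sqrt 0 * (\<sigma>2 + 1) / 12 + u ^ 4 * 0 / 8"
      by (intro tendsto_intros kv dd) auto
    then show "(\<lambda>n. \<bar>u\<bar> ^ 3 * sqrt (dd n) * (kv n + 1) / 12 + u ^ 4 * dd n / 8) \<longlonglongrightarrow> 0" by simp
  qed
  moreover have "(\<lambda>n. complex_of_real (exp (- (u\<^sup>2 * kv n / 2)))) \<longlonglongrightarrow> of_real (exp (- (u\<^sup>2 * \<sigma>2 / 2)))"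
    by (intro tendsto_intros kv) simp
  ultimately show ?thesis unfolding \<sigma>2_def[symmetric] by (rule Lim_transform[rotated])
qed

end

section \<open>Convergence of the estimator\<close>

text \<open>The limiting variance may be zero, when the spectral density vanishes at
  \<open>lam\<close>; the limit is then a point mass and is treated separately here and for the
  characteristic function.\<close>

lemma real_distribution_normal_measure:
  assumes "0 \<le> s2" shows "real_distribution (normal_measure 0 s2)"
proof (cases "s2 = 0")
  case True
  then show ?thesis by (auto simp: normal_measure_def real_distribution_def real_distribution_axioms_def prob_space_return)
next
  case False
  then show ?thesis
    using assms by (auto simp: normal_measure_def real_distribution_def real_distribution_axioms_def intro!: prob_space_normal_density)
qed

lemma char_normal_measure:
  assumes "0 \<le> s2" shows "char (normal_measure 0 s2) u = of_real (exp (- (u\<^sup>2 * s2 / 2)))"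
proof (cases "s2 = 0")
  case True
  then show ?thesis by (simp add: normal_measure_def char_def integral_return)
next
  case False
  then have s2: "0 < s2" using assms by simp
  interpret N: prob_space std_normal_distribution by (intro prob_space_normal_density) simp
  have "distributed std_normal_distribution lborel (\<lambda>x. x) (normal_density 0 1)"
    unfolding distributed_def by (auto simp: distr_id2)
  from N.normal_density_affine[OF this, of "sqrt s2" 0]
  have "distr std_normal_distribution lborel (\<lambda>x. sqrt s2 * x) = density lborel (normal_density 0 (sqrt s2))"
    using s2 by (simp add: distributed_def)
  moreover have "distr std_normal_distribution lborel (\<lambda>x. sqrt s2 * x) = distr std_normal_distribution borel (\<lambda>x. sqrt s2 * x)"
    by (intro distr_cong) auto
  ultimately have "normal_measure 0 s2 = distr std_normal_distribution borel (\<lambda>x. sqrt s2 * x)"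
    using s2 by (simp add: normal_measure_def)
  then have "char (normal_measure 0 s2) u = char std_normal_distribution (u * sqrt s2)"
    by (simp add: char_def integral_distr mult_ac)
  then show ?thesis using s2 by (simp add: char_std_normal_distribution power_mult_distrib)
qed

lemma iexp_lipschitz: "cmod (iexp a - iexp b) \<le> \<bar>a - b\<bar>"
proof -
  have "iexp a - iexp b = iexp b * (iexp (a - b) - 1)"
    by (simp add: algebra_simps exp_add[symmetric])
  then have "cmod (iexp a - iexp b) = cmod (iexp (a - b) - 1)" by (simp add: norm_mult)
  also have "\<dots> \<le> \<bar>a - b\<bar>" using iexp_approx1[of "a - b" 0] by simp
  finally show ?thesis .
qed

lemma (in prob_space) iexp_expectation_close:
  fixes f g :: "'a \<Rightarrow> real"
  assumes [measurable]: "f \<in> borel_measurable M" "g \<in> borel_measurable M" and \<epsilon>: "0 \<le> \<epsilon>"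
  shows "norm (expectation (\<lambda>\<omega>. iexp (u * f \<omega>)) - expectation (\<lambda>\<omega>. iexp (u * g \<omega>)))
    \<le> \<bar>u\<bar> * \<epsilon> + 2 * prob {\<omega>\<in>space M. \<epsilon> < \<bar>f \<omega> - g \<omega>\<bar>}"
proof -
  define A where "A = {\<omega>\<in>space M. \<epsilon> < \<bar>f \<omega> - g \<omega>\<bar>}"
  have A[measurable]: "A \<in> sets M" unfolding A_def by measurable
  have iA: "integrable M (indicator A :: 'a \<Rightarrow> real)" by (rule integrable_real_indicator) (auto simp: emeasure_eq_measure)
  have i: "integrable M (\<lambda>\<omega>. iexp (u * h \<omega>))" if [measurable]: "h \<in> borel_measurable M" for h
    by (rule integrable_const_bound[where B=1]) auto
  have "expectation (\<lambda>\<omega>. iexp (u * f \<omega>)) - expectation (\<lambda>\<omega>. iexp (u * g \<omega>)) = expectation (\<lambda>\<omega>. iexp (u * f \<omega>) - iexp (u * g \<omega>))"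
    by (intro Bochner_Integration.integral_diff[symmetric] i assms)
  also have "norm \<dots> \<le> expectation (\<lambda>\<omega>. \<bar>u\<bar> * \<epsilon> + 2 * indicator A \<omega>)"
  proof (rule order_trans[OF integral_norm_bound integral_mono])
    show "integrable M (\<lambda>\<omega>. norm (iexp (u * f \<omega>) - iexp (u * g \<omega>)))"
      by (intro integrable_norm Bochner_Integration.integrable_diff i assms)
    show "integrable M (\<lambda>\<omega>. \<bar>u\<bar> * \<epsilon> + 2 * indicator A \<omega>)" using iA by auto
    fix \<omega> assume \<omega>: "\<omega> \<in> space M"
    show "norm (iexp (u * f \<omega>) - iexp (u * g \<omega>)) \<le> \<bar>u\<bar> * \<epsilon> + 2 * indicator A \<omega>"
    proof (cases "\<omega> \<in> A")
      case True
      have "norm (iexp (u * f \<omega>) - iexp (u * g \<omega>)) \<le> 2"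
        using norm_triangle_ineq4[of "iexp (u * f \<omega>)" "iexp (u * g \<omega>)"] by simp
      moreover have "0 \<le> \<bar>u\<bar> * \<epsilon>" using \<epsilon> by simp
      ultimately show ?thesis using True by simp
    next
      case False
      then have "\<bar>u\<bar> * \<bar>f \<omega> - g \<omega>\<bar> \<le> \<bar>u\<bar> * \<epsilon>" using \<omega> by (intro mult_left_mono) (auto simp: A_def)
      moreover have "norm (iexp (u * f \<omega>) - iexp (u * g \<omega>)) \<le> \<bar>u\<bar> * \<bar>f \<omega> - g \<omega>\<bar>"
        using iexp_lipschitz[of "u * f \<omega>" "u * g \<omega>"] by (simp only: abs_mult[symmetric] right_diff_distrib)
      ultimately show ?thesis using False by simp
    qed
  qed
  also have "\<dots> = \<bar>u\<bar> * \<epsilon> + 2 * prob A"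
    by (subst Bochner_Integration.integral_add) (use iA in \<open>auto simp: prob_space\<close>)
  finally show ?thesis by (simp add: A_def)
qed

lemma (in prob_space) iexp_limit_cong:
  fixes f g :: "nat \<Rightarrow> 'a \<Rightarrow> real"
  assumes f: "\<And>n. f n \<in> borel_measurable M" and g: "\<And>n. g n \<in> borel_measurable M"
    and close: "\<And>\<epsilon>. \<epsilon> > 0 \<Longrightarrow> (\<lambda>n. prob {\<omega>\<in>space M. \<epsilon> < \<bar>f n \<omega> - g n \<omega>\<bar>}) \<longlonglongrightarrow> 0"
    and lim: "(\<lambda>n. expectation (\<lambda>\<omega>. iexp (u * g n \<omega>))) \<longlonglongrightarrow> z"
  shows "(\<lambda>n. expectation (\<lambda>\<omega>. iexp (u * f n \<omega>))) \<longlonglongrightarrow> z"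
proof -
  have "(\<lambda>n. expectation (\<lambda>\<omega>. iexp (u * f n \<omega>)) - expectation (\<lambda>\<omega>. iexp (u * g n \<omega>))) \<longlonglongrightarrow> 0"
  proof (rule tendstoI)
    fix e :: real assume e: "e > 0"
    define \<epsilon> where "\<epsilon> = e / (2 * (\<bar>u\<bar> + 1))"
    have \<epsilon>: "\<epsilon> > 0" using e by (simp add: \<epsilon>_def add_nonneg_pos)
    have ue: "\<bar>u\<bar> * \<epsilon> \<le> e / 2" using e by (simp add: \<epsilon>_def field_simps add_nonneg_pos)
    have "eventually (\<lambda>n. prob {\<omega>\<in>space M. \<epsilon> < \<bar>f n \<omega> - g n \<omega>\<bar>} < e / 4) sequentially"
      by (rule order_tendstoD(2)[OF close[OF \<epsilon>]]) (use e in simp)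
    then show "eventually (\<lambda>n. dist (expectation (\<lambda>\<omega>. iexp (u * f n \<omega>)) - expectation (\<lambda>\<omega>. iexp (u * g n \<omega>))) 0 < e) sequentially"
    proof eventually_elim
      case (elim n)
      have "norm (expectation (\<lambda>\<omega>. iexp (u * f n \<omega>)) - expectation (\<lambda>\<omega>. iexp (u * g n \<omega>)))
        \<le> \<bar>u\<bar> * \<epsilon> + 2 * prob {\<omega>\<in>space M. \<epsilon> < \<bar>f n \<omega> - g n \<omega>\<bar>}"
        using \<epsilon> by (intro iexp_expectation_close f g) simp
      then have "norm (expectation (\<lambda>\<omega>. iexp (u * f n \<omega>)) - expectation (\<lambda>\<omega>. iexp (u * g n \<omega>))) < e"
        using ue elim by linarith
      then show ?case unfolding dist_norm diff_0_right .
    qed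
  qed
  then show ?thesis using lim by (rule Lim_transform[rotated])
qed

context spectral_estimation
begin

lemma gtau_eq: "gtau M X \<tau> lam = Rsum / (2 * pi)"
  by (simp add: gtau_def Rsum_def r_def)

text \<open>Evenness of window and cosine folds lags \<open>j\<close> and \<open>-j\<close>
  together, and the bandwidth cuts the lags at \<open>bw n\<close>, which is below
  \<open>mn n\<close>.\<close>

lemma gtilde_eq:
  assumes reg: "regular n"
  shows "gtilde X \<tau> w B xi n lam \<omega> =
    bil (half2 n) (bw n) (wgt n) (\<lambda>t. V (xi n \<omega>) t \<omega>) (\<lambda>t. V (xi n \<omega>) t \<omega>) / (2 * pi * real (mn n))"
proof -
  note d = regularD[OF reg]
  define m where "m = int (mn n)"
  define v where "v = (\<lambda>t. V (xi n \<omega>) t \<omega>)"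
  define S where "S = (\<lambda>j. \<Sum>t\<in>{j + m + 1..int n}. v t * v (t - j))"
  define G where "G = (\<lambda>j. w (real_of_int j / B n) * cos (real_of_int j * lam) * S \<bar>j\<bar>)"
  have Gs: "G (- j) = G j" for j by (simp add: G_def w_even)
  have bm: "0 \<le> bw n" "bw n \<le> m - 1" using reg d by (auto simp: regular_def m_def)
  have neg: "(\<Sum>j\<in>{1..m - 1}. G j) = (\<Sum>j\<in>{-(m - 1)..-1}. G j)"
    by (rule sum.reindex_bij_witness[of _ uminus uminus]) (auto simp: Gs)
  have "(\<Sum>j\<in>{-(m - 1)..m - 1}. G j) = G 0 + ((\<Sum>j\<in>{-(m - 1)..-1}. G j) + (\<Sum>j\<in>{1..m - 1}. G j))"
  proof -
    have "{-(m - 1)..m - 1} = insert 0 ({-(m - 1)..-1} \<union> {1..m - 1})" using bm by auto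
    moreover have "(\<Sum>u\<in>{-(m - 1)..-1} \<union> {1..m - 1}. G u) = (\<Sum>j\<in>{-(m - 1)..-1}. G j) + (\<Sum>j\<in>{1..m - 1}. G j)"
      by (rule sum.union_disjoint) auto
    ultimately show ?thesis by simp
  qed
  also have "\<dots> = G 0 + (\<Sum>j\<in>{1..m - 1}. G j + G j)"
    unfolding neg[symmetric] sum.distrib ..
  also have "(\<Sum>j\<in>{1..m - 1}. G j + G j) = (\<Sum>j\<in>{1..m - 1}. wt n j * S j)"
    by (intro sum.cong refl) (auto simp: G_def wt_def wcos_def)
  also have "G 0 = wt n 0 * S 0" by (simp add: G_def wt_def)
  also have "wt n 0 * S 0 + (\<Sum>j\<in>{1..m - 1}. wt n j * S j) = (\<Sum>j\<in>{0..m - 1}. wt n j * S j)"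
  proof -
    have "{0..m - 1} = insert 0 {1..m - 1}" using bm by auto
    then show ?thesis by simp
  qed
  \<comment> \<open>An integer lag above \<open>\<lfloor>B n\<rfloor>\<close> exceeds
    \<open>B n\<close>, where the window vanishes.\<close>
  also have "\<dots> = (\<Sum>j\<in>{0..bw n}. wt n j * S j)"
  proof (rule sum.mono_neutral_right)
    show "\<forall>j\<in>{0..m - 1} - {0..bw n}. wt n j * S j = 0"
    proof
      fix j assume "j \<in> {0..m - 1} - {0..bw n}"
      then have j: "bw n < j" by auto
      then have "B n < real_of_int j" unfolding bw_def by linarith
      then have "1 \<le> \<bar>real_of_int j / B n\<bar>" using d by simp
      then have "w (real_of_int j / B n) = 0" by (rule w_outside)
      then show "wt n j * S j = 0" using j bm by (simp add: wt_def wcos_def)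
    qed
  qed (use bm in auto)
  also have "\<dots> = (\<Sum>j\<in>{0..bw n}. \<Sum>t\<in>half2 n. wgt n t j * (v t * v (t - j)))"
  proof (intro sum.cong refl)
    fix j assume j: "j \<in> {0..bw n}"
    have "(\<Sum>t\<in>half2 n. wgt n t j * (v t * v (t - j))) = (\<Sum>t\<in>{t\<in>half2 n. t - j \<in> half2 n}. wt n j * (v t * v (t - j)))"
      by (subst sum.inter_filter) (auto simp: wgt_def half2_def intro!: sum.cong)
    also have "{t\<in>half2 n. t - j \<in> half2 n} = {j + m + 1..int n}" using j by (auto simp: half2_def m_def)
    finally show "wt n j * S j = (\<Sum>t\<in>half2 n. wgt n t j * (v t * v (t - j)))" by (simp add: S_def sum_distrib_left)
  qed
  also have "\<dots> = bil (half2 n) (bw n) (wgt n) v v" unfolding bil_def by (rule sum.swap)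
  finally have "(\<Sum>j\<in>{-(m - 1)..m - 1}. G j) = bil (half2 n) (bw n) (wgt n) v v" .
  moreover have "gtilde X \<tau> w B xi n lam \<omega> = 1 / (2 * pi * real (mn n)) * (\<Sum>j\<in>{-(m - 1)..m - 1}. G j)"
    by (simp add: gtilde_def Let_def G_def S_def v_def V_def m_def)
  ultimately show ?thesis by (simp add: v_def)
qed

lemma scaled_error_eq:
  assumes reg: "regular n"
  shows "sqrt (real (mn n) / B n) * (gtilde X \<tau> w B xi n lam \<omega> - gtau M X \<tau> lam) =
    (bil (half2 n) (bw n) (wgt n) (\<lambda>t. V (xi n \<omega>) t \<omega>) (\<lambda>t. V (xi n \<omega>) t \<omega>) - real (mn n) * Rsum) / (2 * pi * scl n)"
proof -
  note d = regularD[OF reg]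
  define m where "m = real (mn n)"
  define q where "q = bil (half2 n) (bw n) (wgt n) (\<lambda>t. V (xi n \<omega>) t \<omega>) (\<lambda>t. V (xi n \<omega>) t \<omega>)"
  have m: "0 < m" "0 < B n" using d by (auto simp: m_def)
  have "sqrt m * sqrt m = m" using m by simp
  then have "sqrt (m / B n) = m / sqrt (m * B n)" using m by (simp add: real_sqrt_divide real_sqrt_mult field_simps)
  then have "sqrt (m / B n) * (q / (2 * pi * m) - Rsum / (2 * pi)) = m / sqrt (m * B n) * (q / (2 * pi * m) - Rsum / (2 * pi))"
    by simp
  also have "\<dots> = (q - m * Rsum) / (2 * pi * sqrt (m * B n))" using m by (simp add: field_simps)
  finally show ?thesis unfolding gtilde_eq[OF reg] gtau_eq scl_def m_def q_def .
qed

lemma V_xi_measurable: "(\<lambda>\<omega>. V (xi n \<omega>) t \<omega>) \<in> borel_measurable M"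
proof -
  have [measurable]: "X t \<in> borel_measurable M" "xi n \<in> borel_measurable M" by (rule X_measurable, rule xi_meas)
  show ?thesis unfolding V_def Vt_def by measurable
qed

lemma estimator_measurable:
  "(\<lambda>\<omega>. sqrt (real (mn n) / B n) * (gtilde X \<tau> w B xi n lam \<omega> - gtau M X \<tau> lam)) \<in> borel_measurable M"
proof -
  note [measurable] = V_xi_measurable
  show ?thesis unfolding gtilde_def Let_def V_def[symmetric] by measurable
qed

lemma Tb_measurable: "Tb n i \<in> borel_measurable M"
proof -
  have "bm UNIV (\<lambda>\<omega>. Tb n i \<omega>)" unfolding Tb_def Wl_def by (intro bm_sum bm_mult bm_const Z_bm)
  then show ?thesis by (rule bm_measurable)
qed

lemma remainder_negligible:
  assumes \<epsilon>: "\<epsilon> > 0"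
  shows "(\<lambda>n. prob {\<omega>\<in>space M. \<epsilon> * scl n < \<bar>bil (half2 n) (bw n) (wgt n) (\<lambda>t. V (xi n \<omega>) t \<omega>) (\<lambda>t. V (xi n \<omega>) t \<omega>)
    - real (mn n) * Rsum - (\<Sum>i<nblk n. Tb n i \<omega>)\<bar>}) \<longlonglongrightarrow> 0"
proof (rule Lim_null_comparison)
  \<comment> \<open>Five errors share \<open>\<epsilon>\<close>: plug-in, centring, fluctuation of
    the small lags, bias, and the times outside the cores. Centring and bias are deterministic, so
    only three events contribute probability.\<close>
  define e where "e = \<epsilon> / 5"
  have e: "e > 0" using \<epsilon> by (simp add: e_def)
  define bV where "bV = (\<lambda>n \<omega>. bil (half2 n) (bw n) (wgt n) (\<lambda>t. V (xi n \<omega>) t \<omega>) (\<lambda>t. V (xi n \<omega>) t \<omega>))"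
  define bU where "bU = (\<lambda>n \<omega>. bil (half2 n) (bw n) (wgt n) (\<lambda>t. U (lag n) \<xi>0 t \<omega>) (\<lambda>t. U (lag n) \<xi>0 t \<omega>))"
  define bZ where "bZ = (\<lambda>n \<omega>. bil (half2 n) (bw n) (wgt n) (\<lambda>t. Z (lag n) t \<omega>) (\<lambda>t. Z (lag n) t \<omega>))"
  define sT where "sT = (\<lambda>n \<omega>. \<Sum>i<nblk n. Tb n i \<omega>)"
  define A1 where "A1 = (\<lambda>n. {\<omega>\<in>space M. e * scl n < \<bar>bV n \<omega> - bU n \<omega>\<bar>})"
  define A2 where "A2 = (\<lambda>n. {\<omega>\<in>space M. e * scl n \<le> \<bar>small n \<omega> - small_mean n\<bar>})"
  define A3 where "A3 = (\<lambda>n. {\<omega>\<in>space M. e * scl n \<le> \<bar>large n \<omega> - sT n \<omega>\<bar>})"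
  note [measurable] = V_xi_measurable bm_measurable[OF U_bm] bm_measurable[OF Z_bm] Tb_measurable
  have [measurable]: "A1 n \<in> sets M" "A2 n \<in> sets M" "A3 n \<in> sets M" for n
    unfolding A1_def A2_def A3_def bV_def bU_def sT_def bil_def small_def large_def by measurable
  have l: "(\<lambda>n. prob (A1 n)) \<longlonglongrightarrow> 0" "(\<lambda>n. prob (A2 n)) \<longlonglongrightarrow> 0" "(\<lambda>n. prob (A3 n)) \<longlonglongrightarrow> 0"
    unfolding A1_def A2_def A3_def bV_def bU_def sT_def
    by (rule plugin_negligible[OF e], rule small_negligible[OF e], rule rest_negligible[OF e])
  from tendsto_add[OF tendsto_add[OF l(1,2)] l(3)]
  show "(\<lambda>n. prob (A1 n) + prob (A2 n) + prob (A3 n)) \<longlonglongrightarrow> 0" by simp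
  show "eventually (\<lambda>n. norm (prob {\<omega>\<in>space M. \<epsilon> * scl n < \<bar>bil (half2 n) (bw n) (wgt n) (\<lambda>t. V (xi n \<omega>) t \<omega>) (\<lambda>t. V (xi n \<omega>) t \<omega>)
    - real (mn n) * Rsum - (\<Sum>i<nblk n. Tb n i \<omega>)\<bar>}) \<le> prob (A1 n) + prob (A2 n) + prob (A3 n)) sequentially"
    using regular_eventually bil_UZ_close[OF e] bias_negligible[OF e]
  proof eventually_elim
    case (elim n)
    have "{\<omega>\<in>space M. \<epsilon> * scl n < \<bar>bV n \<omega> - real (mn n) * Rsum - sT n \<omega>\<bar>} \<subseteq> A1 n \<union> A2 n \<union> A3 n"
    proof (rule subsetI, rule ccontr)
      fix \<omega> assume \<omega>: "\<omega> \<in> {\<omega>\<in>space M. \<epsilon> * scl n < \<bar>bV n \<omega> - real (mn n) * Rsum - sT n \<omega>\<bar>}" and "\<omega> \<notin> A1 n \<union> A2 n \<union> A3 n"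
      then have "\<bar>bV n \<omega> - bU n \<omega>\<bar> \<le> e * scl n" "\<bar>small n \<omega> - small_mean n\<bar> \<le> e * scl n" "\<bar>large n \<omega> - sT n \<omega>\<bar> \<le> e * scl n"
        by (auto simp: A1_def A2_def A3_def)
      moreover have "\<bar>bU n \<omega> - bZ n \<omega>\<bar> \<le> e * scl n" using elim(2) by (simp add: bU_def bZ_def)
      moreover have "bZ n \<omega> = small n \<omega> + large n \<omega>" unfolding bZ_def by (rule bil_Z_split[OF elim(1)])
      ultimately have "\<bar>bV n \<omega> - real (mn n) * Rsum - sT n \<omega>\<bar> \<le> 5 * (e * scl n)" using elim(3) by linarith
      then show False using \<omega> by (simp add: e_def)
    qed
    then have "prob {\<omega>\<in>space M. \<epsilon> * scl n < \<bar>bV n \<omega> - real (mn n) * Rsum - sT n \<omega>\<bar>} \<le> prob (A1 n \<union> A2 n \<union> A3 n)"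
      by (intro finite_measure_mono) auto
    also have "\<dots> \<le> prob (A1 n \<union> A2 n) + prob (A3 n)" by (intro measure_Un_le) auto
    also have "prob (A1 n \<union> A2 n) \<le> prob (A1 n) + prob (A2 n)" by (intro measure_Un_le) auto
    finally show ?case by (simp add: bV_def sT_def)
  qed
qed

lemma window_integral: "(LBINT x=-1..1. (w x)\<^sup>2) = 2 * I0" and I0_nonneg: "0 \<le> I0"
proof -
  have c: "continuous_on S (\<lambda>x. (w x)\<^sup>2)" for S
    by (intro continuous_on_power continuous_on_subset[OF lipschitz_on_continuous_on[OF w_lipschitz]]) simp
  have i: "(\<lambda>x. (w x)\<^sup>2) integrable_on {a..b}" for a b by (rule integrable_continuous_real[OF c])
  have "(LBINT x=-1..1. (w x)\<^sup>2) = integral {-1..1} (\<lambda>x. (w x)\<^sup>2)"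
    using interval_integral_eq_integral[of "-1" 1 "\<lambda>x. (w x)\<^sup>2"] borel_integrable_atLeastAtMost'[OF c, of "-1" 1]
    by (simp add: one_ereal_def)
  also have "\<dots> = integral {-1..0} (\<lambda>x. (w x)\<^sup>2) + integral {0..1} (\<lambda>x. (w x)\<^sup>2)"
    by (rule Henstock_Kurzweil_Integration.integral_combine[symmetric]) (auto intro: i)
  also have "integral {-1..0} (\<lambda>x. (w x)\<^sup>2) = integral {0..1} (\<lambda>x. (w x)\<^sup>2)"
    using Henstock_Kurzweil_Integration.integral_reflect_real[of 1 0 "\<lambda>x. (w x)\<^sup>2"] by (simp add: w_even)
  finally show "(LBINT x=-1..1. (w x)\<^sup>2) = 2 * I0" by (simp add: I0_def)
  show "0 \<le> I0" unfolding I0_def by (intro Henstock_Kurzweil_Integration.integral_nonneg i) auto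
qed

text \<open>By Levy continuity it suffices to treat the characteristic function at each
  \<open>u\<close>: \<open>block_clt\<close> gives its limit for the scaled block sum and
  \<open>remainder_negligible\<close> transfers the limit to the estimator.\<close>

theorem estimator_clt:
  "weak_conv_m
     (\<lambda>n. distr M borel (\<lambda>\<omega>. sqrt (real (mn n) / B n) * (gtilde X \<tau> w B xi n lam \<omega> - gtau M X \<tau> lam)))
     (normal_measure 0 ((1 + hfun (2 * lam)) * (gtau M X \<tau> lam)\<^sup>2 * (LBINT x=-1..1. (w x)\<^sup>2)))"
proof (rule levy_continuity)
  define s2 where "s2 = (1 + hfun (2 * lam)) * (gtau M X \<tau> lam)\<^sup>2 * (LBINT x=-1..1. (w x)\<^sup>2)"
  define f where "f = (\<lambda>n \<omega>. sqrt (real (mn n) / B n) * (gtilde X \<tau> w B xi n lam \<omega> - gtau M X \<tau> lam))"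
  define g where "g = (\<lambda>n \<omega>. (\<Sum>i<nblk n. Tb n i \<omega>) / (2 * pi * scl n))"
  have s2: "0 \<le> s2" unfolding s2_def window_integral using I0_nonneg by (simp add: hfun_def)
  have f: "f n \<in> borel_measurable M" for n unfolding f_def by (rule estimator_measurable)
  have g: "g n \<in> borel_measurable M" for n
    unfolding g_def by (intro borel_measurable_divide borel_measurable_sum Tb_measurable) auto
  show "real_distribution (distr M borel (\<lambda>\<omega>. sqrt (real (mn n) / B n) * (gtilde X \<tau> w B xi n lam \<omega> - gtau M X \<tau> lam)))" for n
    using estimator_measurable by (rule real_distribution_distr)
  show "real_distribution (normal_measure 0 ((1 + hfun (2 * lam)) * (gtau M X \<tau> lam)\<^sup>2 * (LBINT x=-1..1. (w x)\<^sup>2)))"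
    using real_distribution_normal_measure[OF s2] by (simp add: s2_def)
  have close: "(\<lambda>n. prob {\<omega>\<in>space M. \<epsilon> < \<bar>f n \<omega> - g n \<omega>\<bar>}) \<longlonglongrightarrow> 0" if \<epsilon>: "\<epsilon> > 0" for \<epsilon>
  proof (rule Lim_transform_eventually[OF remainder_negligible[of "\<epsilon> * (2 * pi)"]])
    show "0 < \<epsilon> * (2 * pi)" using \<epsilon> by simp
    show "eventually (\<lambda>n. prob {\<omega>\<in>space M. \<epsilon> * (2 * pi) * scl n < \<bar>bil (half2 n) (bw n) (wgt n) (\<lambda>t. V (xi n \<omega>) t \<omega>) (\<lambda>t. V (xi n \<omega>) t \<omega>)
      - real (mn n) * Rsum - (\<Sum>i<nblk n. Tb n i \<omega>)\<bar>} = prob {\<omega>\<in>space M. \<epsilon> < \<bar>f n \<omega> - g n \<omega>\<bar>}) sequentially"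
      using regular_eventually
    proof eventually_elim
      case (elim n)
      have p: "0 < 2 * pi * scl n" using regularD(17)[OF elim] by simp
      have "(\<epsilon> < \<bar>f n \<omega> - g n \<omega>\<bar>) \<longleftrightarrow> \<epsilon> * (2 * pi) * scl n < \<bar>bil (half2 n) (bw n) (wgt n) (\<lambda>t. V (xi n \<omega>) t \<omega>) (\<lambda>t. V (xi n \<omega>) t \<omega>)
        - real (mn n) * Rsum - (\<Sum>i<nblk n. Tb n i \<omega>)\<bar>" for \<omega>
        unfolding f_def g_def scaled_error_eq[OF elim] diff_divide_distrib[symmetric] abs_divide
        using pos_less_divide_eq[OF p] p by (simp add: mult.assoc)
      then show ?case by simp
    qed
  qed
  fix u
  have lim: "(\<lambda>n. expectation (\<lambda>\<omega>. iexp (u * g n \<omega>))) \<longlonglongrightarrow> of_real (exp (- (u\<^sup>2 * s2 / 2)))"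
    using block_clt[of u] unfolding g_def s2_def window_integral gtau_eq .
  have "(\<lambda>n. expectation (\<lambda>\<omega>. iexp (u * f n \<omega>))) \<longlonglongrightarrow> of_real (exp (- (u\<^sup>2 * s2 / 2)))"
    by (rule iexp_limit_cong[where f=f and g=g]) (use f g close lim in auto)
  moreover have "char (distr M borel (f n)) u = expectation (\<lambda>\<omega>. iexp (u * f n \<omega>))" for n
    unfolding char_def using f by (subst integral_distr) auto
  ultimately have "(\<lambda>n. char (distr M borel (f n)) u) \<longlonglongrightarrow> char (normal_measure 0 s2) u"
    using char_normal_measure[OF s2] by simp
  then show "(\<lambda>n. char (distr M borel (\<lambda>\<omega>. sqrt (real (mn n) / B n) * (gtilde X \<tau> w B xi n lam \<omega> - gtau M X \<tau> lam))) u) \<longlonglongrightarrow>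
    char (normal_measure 0 ((1 + hfun (2 * lam)) * (gtau M X \<tau> lam)\<^sup>2 * (LBINT x=-1..1. (w x)\<^sup>2))) u"
    unfolding f_def s2_def .
qed

end

text \<open>The set where the continuous \<open>w\<close> is nonzero is open, so it lies in the
  interior of its closure and \<open>w\<close> vanishes at the end points as well. The bound
  \<open>3 * L\<close> comes from comparison with \<open>w 2 = 0\<close>.\<close>

lemma lag_window_exists:
  fixes w :: "real \<Rightarrow> real"
  assumes lip: "L-lipschitz_on UNIV w" and supp: "closure {x. w x \<noteq> 0} = {-1..1}"
  shows "lag_window w L (3 * L)"
proof
  show "L-lipschitz_on UNIV w" by (rule lip)
  have L: "0 \<le> L" using lip by (rule lipschitz_on_nonneg)
  have "open {x. w x \<noteq> 0}"
    using lipschitz_on_continuous_on[OF lip] by (intro open_Collect_neq continuous_on_const)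
  moreover have "{x. w x \<noteq> 0} \<subseteq> {-1..1}" using closure_subset[of "{x. w x \<noteq> 0}"] supp by simp
  ultimately have "{x. w x \<noteq> 0} \<subseteq> {-1<..<1}"
    using interior_maximal[of "{x. w x \<noteq> 0}" "{-1..1}"] by simp
  then show out: "\<bar>x\<bar> \<ge> 1 \<Longrightarrow> w x = 0" for x by (auto simp: subset_iff abs_if split: if_splits)
  show "\<bar>w x\<bar> \<le> 3 * L" for x
  proof (cases "\<bar>x\<bar> \<ge> 1")
    case True then show ?thesis using out L by simp
  next
    case False
    have "\<bar>w x - w 2\<bar> \<le> L * \<bar>x - 2\<bar>" using lipschitz_onD[OF lip, of x 2] by (simp add: dist_real_def)
    also have "\<dots> \<le> L * 3" using False L by (intro mult_left_mono) auto
    finally show ?thesis using out[of 2] by simp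
  qed
qed

text \<open>Near 0 the existing limit bounds the quotient; away from 0 a bounded function is
  dominated by a multiple of the cube. This makes the local hypothesis global, as the bias estimate
  at all lags requires.\<close>

lemma (in lag_window) cubic_flatness:
  assumes lim: "((\<lambda>x. (1 - w x) / \<bar>x\<bar> ^ 3) \<longlongrightarrow> c) (at 0)" and w0: "w 0 = 1"
  shows "\<exists>C3. \<forall>x. \<bar>1 - w x\<bar> \<le> C3 * \<bar>x\<bar> ^ 3"
proof -
  have "eventually (\<lambda>x. dist ((1 - w x) / \<bar>x\<bar> ^ 3) c < 1) (at 0)" by (rule tendstoD[OF lim]) simp
  then obtain d where d: "d > 0" "\<And>x. x \<noteq> 0 \<Longrightarrow> \<bar>x\<bar> < d \<Longrightarrow> \<bar>(1 - w x) / \<bar>x\<bar> ^ 3 - c\<bar> < 1"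
    by (auto simp: eventually_at dist_real_def)
  define K where "K = (1 + Cw) / d ^ 3"
  have K: "0 \<le> K" using d Cw_nonneg by (simp add: K_def)
  have "\<bar>1 - w x\<bar> \<le> (\<bar>c\<bar> + 1 + K) * \<bar>x\<bar> ^ 3" for x
  proof (cases "x = 0")
    case True then show ?thesis using w0 by simp
  next
    case x: False
    show ?thesis
    proof (cases "\<bar>x\<bar> < d")
      case True
      have "\<bar>(1 - w x) / \<bar>x\<bar> ^ 3\<bar> \<le> \<bar>c\<bar> + 1 + K" using d(2)[OF x True] K by linarith
      then show ?thesis using x by (simp add: abs_divide pos_divide_le_eq)
    next
      case False
      have "\<bar>1 - w x\<bar> \<le> 1 + Cw" using w_bound[of x] by linarith
      also have "\<dots> = K * d ^ 3" using d by (simp add: K_def)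
      also have "\<dots> \<le> K * \<bar>x\<bar> ^ 3" using False d K by (intro mult_left_mono power_mono) auto
      also have "\<dots> \<le> (\<bar>c\<bar> + 1 + K) * \<bar>x\<bar> ^ 3" by (intro mult_right_mono) auto
      finally show ?thesis .
    qed
  qed
  then show ?thesis by blast
qed

theorem theorem3p7:
  fixes M :: "'a measure" and E :: "'e measure"
    and eps :: "int \<Rightarrow> 'a \<Rightarrow> 'e"
    and Y :: "(nat \<Rightarrow> 'e) \<Rightarrow> real"
    and \<tau> p lam :: real
    and w :: "real \<Rightarrow> real" and B :: "nat \<Rightarrow> real"
    and xi :: "nat \<Rightarrow> 'a \<Rightarrow> real"
  defines "X \<equiv> Xproc eps Y"
  defines "\<xi>0 \<equiv> quant0 M (X 0) \<tau>"
  assumes P: "prob_space M"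
    and eps_meas: "\<And>t. eps t \<in> measurable M E"
    and eps_indep: "prob_space.indep_vars M (\<lambda>_. E) eps UNIV"
    and eps_ident: "\<And>t. distr M E (eps t) = distr M E (eps 0)"
    and Y_meas: "Y \<in> borel_measurable (PiM UNIV (\<lambda>_::nat. E))"
    and X_int: "integrable M (X 0)"
    and tau: "0 < \<tau>" "\<tau> < 1"
    and p: "p > 1"
    \<comment> \<open>(B)\<close>
    and B_lip: "\<exists>\<delta>>0. \<exists>L. L-lipschitz_on (cball \<xi>0 \<delta>) (cdfX M (X 0))"
    and B_dens: "\<exists>f \<delta>. \<delta> > 0 \<and> isCont f \<xi>0 \<and> f \<xi>0 > 0 \<and>
        (\<forall>x\<in>cball \<xi>0 \<delta>. f x \<ge> 0) \<and>
        (\<forall>a b. \<xi>0 - \<delta> \<le> a \<longrightarrow> a \<le> b \<longrightarrow> b \<le> \<xi>0 + \<delta> \<longrightarrow>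
           set_integrable lborel {a..b} f \<and>
           cdfX M (X 0) b - cdfX M (X 0) a = (LINT x:{a..b}|lborel. f x))"
    \<comment> \<open>(D)\<close>
    and D_lip: "\<exists>nstar. \<forall>n>nstar. \<exists>\<delta>>0. \<exists>L.
        L-lipschitz_on (cball \<xi>0 \<delta>) (cdfX M (Xtilde M E eps X (ln_len p n) 0))"
    and D_coup: "\<exists>rr. 0 < rr \<and> rr < 1 \<and>
        (\<lambda>n. coupling_dist (distr M E (eps 0)) Y n) \<in> O(\<lambda>n. rr ^ n)"
    \<comment> \<open>lag window\<close>
    and w_even: "\<And>x. w (- x) = w x"
    and w_lip: "\<exists>L. L-lipschitz_on UNIV w"
    and w_supp: "closure {x. w x \<noteq> 0} = {-1..1}"
    and w0: "w 0 = 1"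
    and w_lim: "\<exists>c. ((\<lambda>x. (1 - w x) / \<bar>x\<bar> ^ 3) \<longlongrightarrow> c) (at 0)"
    \<comment> \<open>bandwidth\<close>
    and B_inf: "filterlim B at_top sequentially"
    and B_small: "B \<in> o(\<lambda>n. real n powr (1/4))"
    and B_large: "(\<lambda>n. real n) \<in> o(\<lambda>n. B n ^ 7)"
    \<comment> \<open>sample quantile from X_1, ..., X_(m_n - l_n)\<close>
    and xi_meas: "\<And>n. xi n \<in> borel_measurable M"
    and xi_min: "\<And>n \<omega> x. \<omega> \<in> space M \<Longrightarrow>
        (\<Sum>t\<in>{1 .. int (mn n) - int (ln_len p n)}. rho \<tau> (X t \<omega> - xi n \<omega>))
        \<le> (\<Sum>t\<in>{1 .. int (mn n) - int (ln_len p n)}. rho \<tau> (X t \<omega> - x))"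
  shows "weak_conv_m
           (\<lambda>n. distr M borel (\<lambda>\<omega>. sqrt (real (mn n) / B n) *
                   (gtilde X \<tau> w B xi n lam \<omega> - gtau M X \<tau> lam)))
           (normal_measure 0 ((1 + hfun (2 * lam)) * (gtau M X \<tau> lam)\<^sup>2 *
                               (LBINT x=-1..1. (w x)\<^sup>2)))"
proof -
  interpret quantile_process M E eps Y \<tau>
    using P eps_meas eps_indep eps_ident Y_meas X_int tau B_lip B_dens D_coup
    unfolding quantile_process_def iid_functional_def iid_functional_axioms_def quantile_process_axioms_def X_def \<xi>0_def
    by blast
  obtain C \<theta> \<delta>0 L c where q: "quantile_process_const M E eps Y \<tau> C \<theta> \<delta>0 L c" using constants_exist by blast
  obtain Lw where "Lw-lipschitz_on UNIV w" using w_lip by blast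
  then have lw: "lag_window w Lw (3 * Lw)" using w_supp by (rule lag_window_exists)
  obtain C3 where C3: "\<And>x. \<bar>1 - w x\<bar> \<le> C3 * \<bar>x\<bar> ^ 3"
    using lag_window.cubic_flatness[OF lw _ w0] w_lim by blast
  have "spectral_estimation M E eps Y \<tau> C \<theta> \<delta>0 L c w Lw (3 * Lw) p C3 B xi"
    unfolding spectral_estimation_def spectral_estimation_axioms_def
    using q lw w_even w0 C3 B_inf B_small B_large xi_meas xi_min[unfolded X_def] by blast
  then show ?thesis unfolding X_def by (rule spectral_estimation.estimator_clt)
qed

end
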